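(* Let $n\ge 2$ be an integer and let $G$ be the constant-coefficient, reparametrization-invariant Sobolev-type Riemannian metric of order $n$ on $\mathcal{I}^n([0,2\pi],\mathbb{R})$ with coefficients $a_0,\dots,a_n\ge 0$, where $a_0,a_2,a_n>0$. Let $\overline{\mathcal{I}^n([0,2\pi],\mathbb{R})}$ be the metric completion of $\mathcal{I}^n([0,2\pi],\mathbb{R})$ with respect to the geodesic distance $\mathrm{dist}_G$. Then the mapping $$\mathcal{F}:\operatorname{Diff}_{H^n}([0,2\pi])\to \overline{\mathcal{I}^n([0,2\pi],\mathbb{R})}\setminus \mathcal{I}^n([0,2\pi],\mathbb{R}),$$ taking a diffeomorphism $\varphi$ to the limit point in $\overline{\mathcal{I}^n([0,2\pi],\mathbb{R})}$ of the vanishing-length sequence of immersions $\left(\frac1m\varphi\right)_{m=1}^\infty$, is (well defined and) a homeomorphism. As a result, the metric completion can be written as the disjoint union $$\overline{\mathcal{I}^n([0,2\pi],\mathbb{R})}=\mathcal{I}^n([0,2\pi],\mathbb{R})\sqcup \operatorname{Diff}_{H^n}([0,2\pi]),$$ where the second part is identified with the set of additional limit points via $\mathcal{F}$. Furthermore, the inverse $\mathcal{F}^{-1}$ is Lipschitz continuous when $\operatorname{Diff}_{H^n}([0,2\pi])$ is endowed with the distance induced by its natural embedding into $\mathcal{I}^n([0,2\pi],\mathbb{R})$, i.e. with the restriction of $\mathrm{dist}_G$ to $\operatorname{Diff}_{H^n}([0,2\pi])\subset\mathcal{I}^n([0,2\pi],\mathbb{R})$.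
   Context: For an integer $n\ge2$, $\mathcal{I}^n([0,2\pi],\mathbb{R})=\{c\in H^n((0,2\pi),\mathbb{R}) : |c'(\theta)|>0 \text{ for all } \theta\in[0,2\pi]\}$, where $H^n$ functions are identified with their $C^1([0,2\pi])$ representatives. It is an open subset of the Hilbert space $H^n((0,2\pi),\mathbb{R})$, hence a Hilbert manifold with tangent space $T_c\mathcal{I}^n\cong H^n((0,2\pi),\mathbb{R})$ at each $c$. For $c\in\mathcal{I}^n$ write $\partial_s h=\frac{1}{|c'|}\partial_\theta h$ and $ds=|c'|\,d\theta$. The constant-coefficient Sobolev-type metric of order $n$ is $$G_c(h,k)=\sum_{i=0}^n a_i\int_0^{2\pi}\partial_s^i h\cdot\partial_s^i k\;ds,\qquad h,k\in T_c\mathcal{I}^n,$$ with constants $a_i\ge0$. The length of a piecewise $C^1$ path $\gamma:[a,b]\to\mathcal{I}^n$ is $\mathrm{len}(\gamma)=\int_a^b\sqrt{G_{\gamma(t)}(\gamma_t(t),\gamma_t(t))}\,dt$, where $\gamma_t=\partial_t\gamma$. The geodesic distance $\mathrm{dist}_G(c_1,c_2)$ is the infimum of $\mathrm{len}(\gamma)$ over all piecewise $C^1$ paths $\gamma$ in $\mathcal{I}^n$ from $c_1$ to $c_2$ (it is $+\infty$ if $c_1,c_2$ lie in different connected components, i.e. if one is increasing and the other decreasing). The metric completion carries the extension of $\mathrm{dist}_G$, and the set of additional limit points $\overline{\mathcal{I}^n}\setminus\mathcal{I}^n$ carries the restricted distance and its topology. $\operatorname{Diff}_{H^n}([0,2\pi])$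 is the group of $H^n$-regular diffeomorphisms of $[0,2\pi]$ onto itself, i.e. bijections $\varphi:[0,2\pi]\to[0,2\pi]$ with $\varphi\in H^n$ and $\varphi'(\theta)\neq0$ for all $\theta$; it is a subset of $\mathcal{I}^n([0,2\pi],\mathbb{R})$ and is equipped with its natural topology, induced by $\|\cdot\|_{H^n}$. *)

theory Defs
  imports "HOL-Analysis.Analysis"
begin

section \<open>Extended metric spaces and their completion\<close>

text \<open>
  The geodesic distance takes the value \<open>\<infinity>\<close> between different components of the space of
  immersions, so distances have values in \<^typ>\<open>ennreal\<close> and the locale \<^locale>\<open>Metric_space\<close>, whose
  distances are real, does not apply.
\<close>

definition emetric_topology :: "'a set \<Rightarrow> ('a \<Rightarrow> 'a \<Rightarrow> ennreal) \<Rightarrow> 'a topology" where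
  "emetric_topology M d =
     topology (\<lambda>U. U \<subseteq> M \<and> (\<forall>x\<in>U. \<exists>e>0. \<forall>y\<in>M. d x y < e \<longrightarrow> y \<in> U))"

lemma openin_emetric_topology:
  "openin (emetric_topology M d) U \<longleftrightarrow>
     U \<subseteq> M \<and> (\<forall>x\<in>U. \<exists>e>0. \<forall>y\<in>M. d x y < e \<longrightarrow> y \<in> U)"
proof -
  have "istopology (\<lambda>U. U \<subseteq> M \<and> (\<forall>x\<in>U. \<exists>e>0. \<forall>y\<in>M. d x y < e \<longrightarrow> y \<in> U))"
    (is "istopology ?P")
    unfolding istopology_def
  proof (intro conjI allI impI)
    fix S T assume S: "?P S" and T: "?P T"
    show "S \<inter> T \<subseteq> M" using S by blast
    show "\<forall>x\<in>S \<inter> T. \<exists>e>0. \<forall>y\<in>M. d x y < e \<longrightarrow> y \<in> S \<inter> T"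
    proof
      fix x assume x: "x \<in> S \<inter> T"
      obtain e where e: "e > 0" "\<forall>y\<in>M. d x y < e \<longrightarrow> y \<in> S" using S x by blast
      obtain e' where e': "e' > 0" "\<forall>y\<in>M. d x y < e' \<longrightarrow> y \<in> T" using T x by blast
      show "\<exists>e>0. \<forall>y\<in>M. d x y < e \<longrightarrow> y \<in> S \<inter> T"
        using e e' by (intro exI[of _ "min e e'"]) auto
    qed
  next
    fix K assume K: "\<forall>S\<in>K. ?P S"
    show "\<Union>K \<subseteq> M" using K by blast
    show "\<forall>x\<in>\<Union>K. \<exists>e>0. \<forall>y\<in>M. d x y < e \<longrightarrow> y \<in> \<Union>K"
    proof
      fix x assume "x \<in> \<Union>K"
      then obtain S where S: "S \<in> K" "x \<in> S" by blast
      with K obtain e where "e > 0" "\<forall>y\<in>M. d x y < e \<longrightarrow> y \<in> S" by blast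
      with S show "\<exists>e>0. \<forall>y\<in>M. d x y < e \<longrightarrow> y \<in> \<Union>K" by blast
    qed
  qed
  then show ?thesis
    unfolding emetric_topology_def by (simp add: topology_inverse')
qed

lemma topspace_emetric_topology: "topspace (emetric_topology M d) = M"
proof -
  have "openin (emetric_topology M d) M"
    unfolding openin_emetric_topology by (auto intro: exI[of _ 1])
  moreover have "topspace (emetric_topology M d) \<subseteq> M"
    using openin_topspace[of "emetric_topology M d"] unfolding openin_emetric_topology by blast
  ultimately show ?thesis
    by (simp add: openin_subset subset_antisym)
qed

definition ecauchy :: "'a set \<Rightarrow> ('a \<Rightarrow> 'a \<Rightarrow> ennreal) \<Rightarrow> (nat \<Rightarrow> 'a) set" where
  "ecauchy M d = {x. (\<forall>i. x i \<in> M) \<and> (\<forall>e>0. \<exists>N. \<forall>i\<ge>N. \<forall>j\<ge>N. d (x i) (x j) < e)}"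

definition ecauchy_rel ::
  "'a set \<Rightarrow> ('a \<Rightarrow> 'a \<Rightarrow> ennreal) \<Rightarrow> ((nat \<Rightarrow> 'a) \<times> (nat \<Rightarrow> 'a)) set" where
  "ecauchy_rel M d =
     {(x, y). x \<in> ecauchy M d \<and> y \<in> ecauchy M d \<and> (\<lambda>i. d (x i) (y i)) \<longlonglongrightarrow> 0}"

definition ecompletion :: "'a set \<Rightarrow> ('a \<Rightarrow> 'a \<Rightarrow> ennreal) \<Rightarrow> (nat \<Rightarrow> 'a) set set" where
  "ecompletion M d = ecauchy M d // ecauchy_rel M d"

definition ecompletion_dist ::
  "('a \<Rightarrow> 'a \<Rightarrow> ennreal) \<Rightarrow> (nat \<Rightarrow> 'a) set \<Rightarrow> (nat \<Rightarrow> 'a) set \<Rightarrow> ennreal" where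
  "ecompletion_dist d X Y = (THE l. \<forall>x\<in>X. \<forall>y\<in>Y. (\<lambda>i. d (x i) (y i)) \<longlonglongrightarrow> l)"

definition ecompletion_embed ::
  "'a set \<Rightarrow> ('a \<Rightarrow> 'a \<Rightarrow> ennreal) \<Rightarrow> 'a \<Rightarrow> (nat \<Rightarrow> 'a) set" where
  "ecompletion_embed M d x = ecauchy_rel M d `` {\<lambda>i. x}"


section \<open>The Sobolev space \<open>H\<^sup>n((0, 2\<pi>), \<real>)\<close>\<close>

definition test_function :: "(real \<Rightarrow> real) \<Rightarrow> bool" where
  "test_function \<phi> \<longleftrightarrow>
     (\<forall>k x. (deriv ^^ k) \<phi> differentiable (at x)) \<and>
     (\<exists>K. compact K \<and> K \<subseteq> {0<..<2*pi} \<and> (\<forall>x. x \<notin> K \<longrightarrow> \<phi> x = 0))"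

definition locally_integrable :: "(real \<Rightarrow> real) \<Rightarrow> bool" where
  "locally_integrable f \<longleftrightarrow>
     (\<forall>K. compact K \<and> K \<subseteq> {0<..<2*pi} \<longrightarrow> integrable (lebesgue_on K) f)"

definition has_weak_deriv :: "nat \<Rightarrow> (real \<Rightarrow> real) \<Rightarrow> (real \<Rightarrow> real) \<Rightarrow> bool" where
  "has_weak_deriv k f g \<longleftrightarrow>
     locally_integrable f \<and> locally_integrable g \<and>
     (\<forall>\<phi>. test_function \<phi> \<longrightarrow>
        (LINT x|lebesgue_on {0<..<2*pi}. f x * (deriv ^^ k) \<phi> x) =
        (-1) ^ k * (LINT x|lebesgue_on {0<..<2*pi}. g x * \<phi> x))"

text \<open>Weak derivatives are unique up to null sets; all uses below are under an integral sign.\<close>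

definition weak_deriv :: "nat \<Rightarrow> (real \<Rightarrow> real) \<Rightarrow> real \<Rightarrow> real" where
  "weak_deriv k f = (SOME g. has_weak_deriv k f g)"

definition L2 :: "(real \<Rightarrow> real) set" where
  "L2 = {f. f \<in> borel_measurable (lebesgue_on {0<..<2*pi}) \<and>
            integrable (lebesgue_on {0<..<2*pi}) (\<lambda>x. (f x)\<^sup>2)}"

text \<open>The classical derivative on \<open>[0, 2\<pi>]\<close>, one-sided at the end points.\<close>

definition cderiv :: "(real \<Rightarrow> real) \<Rightarrow> real \<Rightarrow> real" where
  "cderiv c \<theta> = vector_derivative c (at \<theta> within {0..2*pi})"

text \<open>
  For \<open>n \<ge> 2\<close> every class in \<open>H\<^sup>n\<close> has exactly one representative in \<open>C\<^sup>1([0, 2\<pi>])\<close>. It is stored as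
  a function on all of \<open>\<real>\<close> that is \<open>0\<close> outside \<open>[0, 2\<pi>]\<close>, so that each element of \<open>H\<^sup>n\<close> is exactly
  one HOL function and the pointwise operations are those of the vector space \<open>H\<^sup>n\<close>.
\<close>

definition sobolev :: "nat \<Rightarrow> (real \<Rightarrow> real) set" where
  "sobolev n =
     {f. f \<in> L2 \<and> (\<forall>k\<le>n. \<exists>g\<in>L2. has_weak_deriv k f g) \<and>
         f differentiable_on {0..2*pi} \<and> continuous_on {0..2*pi} (cderiv f) \<and>
         (\<forall>x. x \<notin> {0..2*pi} \<longrightarrow> f x = 0)}"

definition sobolev_norm :: "nat \<Rightarrow> (real \<Rightarrow> real) \<Rightarrow> real" where
  "sobolev_norm n f =
     sqrt (\<Sum>k\<le>n. LINT x|lebesgue_on {0<..<2*pi}. (weak_deriv k f x)\<^sup>2)"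


section \<open>Immersions and the Sobolev metric\<close>

definition immersions :: "nat \<Rightarrow> (real \<Rightarrow> real) set" where
  "immersions n = {c \<in> sobolev n. \<forall>\<theta>\<in>{0..2*pi}. \<bar>cderiv c \<theta>\<bar> > 0}"

definition arc_deriv :: "(real \<Rightarrow> real) \<Rightarrow> (real \<Rightarrow> real) \<Rightarrow> real \<Rightarrow> real" where
  "arc_deriv c h \<theta> = 1 / \<bar>cderiv c \<theta>\<bar> * weak_deriv 1 h \<theta>"

definition sobolev_metric ::
  "nat \<Rightarrow> (nat \<Rightarrow> real) \<Rightarrow> (real \<Rightarrow> real) \<Rightarrow> (real \<Rightarrow> real) \<Rightarrow> (real \<Rightarrow> real) \<Rightarrow> real" where
  "sobolev_metric n a c h k =
     (\<Sum>i\<le>n. a i * (LINT \<theta>|lebesgue_on {0<..<2*pi}.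
        (arc_deriv c ^^ i) h \<theta> * (arc_deriv c ^^ i) k \<theta> * \<bar>cderiv c \<theta>\<bar>))"

text \<open>\<open>C\<^sup>1\<close> paths are taken with respect to the norm of \<open>H\<^sup>n\<close>.\<close>

definition has_path_deriv ::
  "nat \<Rightarrow> (real \<Rightarrow> real \<Rightarrow> real) \<Rightarrow> (real \<Rightarrow> real) \<Rightarrow> real \<Rightarrow> real set \<Rightarrow> bool" where
  "has_path_deriv n \<gamma> v t S \<longleftrightarrow>
     v \<in> sobolev n \<and>
     ((\<lambda>r. sobolev_norm n (\<lambda>\<theta>. (\<gamma> r \<theta> - \<gamma> t \<theta>) / (r - t) - v \<theta>)) \<longlongrightarrow> 0) (at t within S)"

definition C1_path_on :: "nat \<Rightarrow> real set \<Rightarrow> (real \<Rightarrow> real \<Rightarrow> real) \<Rightarrow> bool" where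
  "C1_path_on n S \<gamma> \<longleftrightarrow>
     (\<exists>v. \<forall>t\<in>S. has_path_deriv n \<gamma> (v t) t S \<and>
        ((\<lambda>r. sobolev_norm n (\<lambda>\<theta>. v r \<theta> - v t \<theta>)) \<longlongrightarrow> 0) (at t within S))"

text \<open>
  Each piece is \<open>C\<^sup>1\<close> up to and including its end points, unlike in
  \<^const>\<open>piecewise_C1_differentiable_on\<close>; in particular the path is continuous.
\<close>

definition piecewise_C1_path ::
  "nat \<Rightarrow> real \<Rightarrow> real \<Rightarrow> (real \<Rightarrow> real \<Rightarrow> real) \<Rightarrow> bool" where
  "piecewise_C1_path n a b \<gamma> \<longleftrightarrow>
     a < b \<and> (\<forall>t\<in>{a..b}. \<gamma> t \<in> immersions n) \<and>
     (\<exists>\<tau> N. \<tau> 0 = a \<and> \<tau> N = b \<and>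
        (\<forall>j<N. \<tau> j < \<tau> (Suc j) \<and> C1_path_on n {\<tau> j..\<tau> (Suc j)} \<gamma>))"

text \<open>At the finitely many break points the value of the velocity is irrelevant.\<close>

definition path_velocity ::
  "nat \<Rightarrow> real \<Rightarrow> real \<Rightarrow> (real \<Rightarrow> real \<Rightarrow> real) \<Rightarrow> real \<Rightarrow> real \<Rightarrow> real" where
  "path_velocity n a b \<gamma> t = (THE v. has_path_deriv n \<gamma> v t {a..b})"

definition path_len ::
  "nat \<Rightarrow> (nat \<Rightarrow> real) \<Rightarrow> real \<Rightarrow> real \<Rightarrow> (real \<Rightarrow> real \<Rightarrow> real) \<Rightarrow> ennreal" where
  "path_len n w a b \<gamma> =
     (\<integral>\<^sup>+ t. ennreal (sqrt (sobolev_metric n w (\<gamma> t)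
        (path_velocity n a b \<gamma> t) (path_velocity n a b \<gamma> t))) \<partial>lebesgue_on {a..b})"

definition geodesic_dist ::
  "nat \<Rightarrow> (nat \<Rightarrow> real) \<Rightarrow> (real \<Rightarrow> real) \<Rightarrow> (real \<Rightarrow> real) \<Rightarrow> ennreal" where
  "geodesic_dist n w c1 c2 =
     Inf {path_len n w a b \<gamma> | a b \<gamma>. piecewise_C1_path n a b \<gamma> \<and> \<gamma> a = c1 \<and> \<gamma> b = c2}"


section \<open>The metric completion and its limit points\<close>

type_synonym completion_point = "(nat \<Rightarrow> real \<Rightarrow> real) set"

definition imm_completion :: "nat \<Rightarrow> (nat \<Rightarrow> real) \<Rightarrow> completion_point set" where
  "imm_completion n a = ecompletion (immersions n) (geodesic_dist n a)"

definition imm_embed :: "nat \<Rightarrow> (nat \<Rightarrow> real) \<Rightarrow> (real \<Rightarrow> real) \<Rightarrow> completion_point" where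
  "imm_embed n a = ecompletion_embed (immersions n) (geodesic_dist n a)"

definition completion_dist ::
  "nat \<Rightarrow> (nat \<Rightarrow> real) \<Rightarrow> completion_point \<Rightarrow> completion_point \<Rightarrow> ennreal" where
  "completion_dist n a = ecompletion_dist (geodesic_dist n a)"

definition limit_points :: "nat \<Rightarrow> (nat \<Rightarrow> real) \<Rightarrow> completion_point set" where
  "limit_points n a = imm_completion n a - imm_embed n a ` immersions n"

definition Diff :: "nat \<Rightarrow> (real \<Rightarrow> real) set" where
  "Diff n = {\<phi> \<in> sobolev n. bij_betw \<phi> {0..2*pi} {0..2*pi} \<and>
                             (\<forall>\<theta>\<in>{0..2*pi}. cderiv \<phi> \<theta> \<noteq> 0)}"

definition Diff_topology :: "nat \<Rightarrow> (real \<Rightarrow> real) topology" where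
  "Diff_topology n =
     emetric_topology (Diff n) (\<lambda>\<phi> \<psi>. ennreal (sobolev_norm n (\<lambda>\<theta>. \<phi> \<theta> - \<psi> \<theta>)))"

text \<open>The sequence \<open>\<phi>/m\<close>, \<open>m = 1, 2, \<dots>\<close>, is indexed from \<open>0\<close>, hence the \<^const>\<open>Suc\<close>.\<close>

definition is_shrinking_limit ::
  "nat \<Rightarrow> (nat \<Rightarrow> real) \<Rightarrow> (real \<Rightarrow> real) \<Rightarrow> completion_point \<Rightarrow> bool" where
  "is_shrinking_limit n a \<phi> p \<longleftrightarrow>
     limitin (emetric_topology (imm_completion n a) (completion_dist n a))
       (\<lambda>m. imm_embed n a (\<lambda>\<theta>. 1 / real (Suc m) * \<phi> \<theta>)) p sequentially"

definition shrinking_limit ::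
  "nat \<Rightarrow> (nat \<Rightarrow> real) \<Rightarrow> (real \<Rightarrow> real) \<Rightarrow> completion_point" where
  "shrinking_limit n a \<phi> = (THE p. is_shrinking_limit n a \<phi> p)"

end

theory Submission
  imports Defs
begin

text \<open>
  Write \<open>l\<close> for the length of the image of an immersion and let \<open>\<Psi>(l) = ln (1 + l\<^bsup>3/2\<^esup>)\<close>. The coefficients
  \<open>a\<^sub>0, a\<^sub>2\<close> make \<open>\<Psi> \<circ> l\<close> Lipschitz for the geodesic distance, so along a Cauchy sequence \<open>l\<close> converges.
  If its limit is positive, the metric is uniformly equivalent to the \<open>H\<^sup>n\<close> norm near the tail of the
  sequence, which therefore converges in the space of immersions. If \<open>l \<rightarrow> 0\<close>, normalise: an affine map of the target
  turns an immersion into a diffeomorphism of \<open>[0, 2\<pi>]\<close>. For curves of length at most \<open>2\<pi>\<close> the normalised velocity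
  is controlled by the original one, because it vanishes at both end points (so that its
  first two orders are bounded by the second derivative) and the derivatives of order at least \<open>2\<close> only shrink.
  Hence normalisation is Lipschitz on short curves and yields a limiting diffeomorphism \<open>\<phi>\<close>.
  Conversely, scaling \<open>\<phi>\<close> from \<open>r\<close> to \<open>s\<close> costs \<open>O(\<surd>r + \<surd>s)\<close>, and so do translations of the shrunk curves,
  so the limit of the sequence is that of \<open>\<phi>/m\<close>.
\<close>

section \<open>Extended metric spaces\<close>

text \<open>The coefficient \<open>a 1\<close> may vanish, so first order quantities are recovered
  from orders 0 and 2 by interpolation. The exponent 3/2 originates there: on a curve of length l <=
  1 the bound for the squared arc length derivative contains 72 / l^3, so l changes at most at the
  rate l * l^(-3/2) times the metric speed, and l^(3/2) is Lipschitz; for l >= 1 the rate is l,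
  which calls for a logarithm. Normalisation multiplies both the velocity and the arc length by b =
  2 pi / l >= 1, so a squared derivative of order i scales by b^(3 - 2 i): a gain from order 2 on, a
  loss in orders 0 and 1, which the two boundary zeros repair. Shrinking is cheap because the
  velocity phi along r phi has the constant arc length derivative +-1/r: orders from 2 on vanish, G
  = O(1/r), and r^(-1/2) is integrable at 0. The constants in the comparison of norms depend on a
  curve only through bounds on its length, so a radius can be fixed before the centre, a late member
  of a Cauchy sequence, is chosen.\<close>

lemma homeomorphic_map_emetric_topology:
  assumes bij: "bij_betw f M M'"
    and cont: "\<And>x e. x \<in> M ==> e > 0 ==> \<exists>r>0. \<forall>y\<in>M. d x y < r --> d' (f x) (f y) < e"
    and inv: "\<And>x e. x \<in> M ==> e > 0 ==> \<exists>r>0. \<forall>y\<in>M. d' (f x) (f y) < r --> d x y < e"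
  shows "homeomorphic_map (emetric_topology M d) (emetric_topology M' d') f"
proof (rule bijective_open_imp_homeomorphic_map)
  have im: "f ` M = M'" using bij by (simp add: bij_betw_def)
  show "continuous_map (emetric_topology M d) (emetric_topology M' d') f"
    unfolding continuous_map_def topspace_emetric_topology
  proof (intro conjI allI impI)
    show "f \<in> M \<rightarrow> M'" using im by blast
    fix U assume U: "openin (emetric_topology M' d') U"
    show "openin (emetric_topology M d) {x \<in> M. f x \<in> U}"
      unfolding openin_emetric_topology
    proof (intro conjI ballI)
      fix x assume "x \<in> {x \<in> M. f x \<in> U}"
      then have x: "x \<in> M" "f x \<in> U" by auto
      obtain e where e: "e > 0" "\<forall>y\<in>M'. d' (f x) y < e --> y \<in> U"
        using U x(2) unfolding openin_emetric_topology by blast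
      obtain r where r: "r > 0" "\<forall>y\<in>M. d x y < r --> d' (f x) (f y) < e" using cont[OF x(1) e(1)] by blast
      show "\<exists>r>0. \<forall>y\<in>M. d x y < r --> y \<in> {x \<in> M. f x \<in> U}"
        using r e(2) im by (intro exI[of _ r]) blast
    qed blast
  qed
  show "open_map (emetric_topology M d) (emetric_topology M' d') f"
    unfolding open_map_def
  proof (intro allI impI)
    fix U assume U: "openin (emetric_topology M d) U"
    then have UM: "U \<subseteq> M" by (simp add: openin_emetric_topology)
    show "openin (emetric_topology M' d') (f ` U)"
      unfolding openin_emetric_topology
    proof (intro conjI ballI)
      show "f ` U \<subseteq> M'" using UM im by blast
      fix z assume "z \<in> f ` U"
      then obtain x where x: "x \<in> U" "z = f x" by blast
      obtain e where e: "e > 0" "\<forall>y\<in>M. d x y < e --> y \<in> U"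
        using U x(1) unfolding openin_emetric_topology by blast
      have xM: "x \<in> M" using x(1) UM by blast
      obtain r where r: "r > 0" "\<forall>y\<in>M. d' (f x) (f y) < r --> d x y < e" using inv[OF xM e(1)] by blast
      have "\<forall>y\<in>M'. d' z y < r --> y \<in> f ` U" using r(2) e(2) unfolding im[symmetric] x(2) by blast
      with r(1) show "\<exists>r>0. \<forall>y\<in>M'. d' z y < r --> y \<in> f ` U" by blast
    qed
  qed
qed (use bij in \<open>auto simp: topspace_emetric_topology bij_betw_def\<close>)

text \<open>Pseudometric axioms with values up to infinity. Points of the completion are classes of
  Cauchy sequences, so separation holds there by \<open>completion_dist_zero_iff\<close>; for
  immersions it follows later from local comparison, in \<open>dist_zero_imp_eq\<close>.\<close>

locale extended_metric =
  fixes M :: "'a set" and d :: "'a => 'a => ennreal"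
  assumes zero: "x \<in> M ==> d x x = 0"
    and commute: "x \<in> M ==> y \<in> M ==> d x y = d y x"
    and triangle: "x \<in> M ==> y \<in> M ==> z \<in> M ==> d x z <= d x y + d y z"
begin

lemma openin_ball:
  assumes "x \<in> M" shows "openin (emetric_topology M d) {y \<in> M. d x y < e}"
  unfolding openin_emetric_topology
proof (intro conjI ballI)
  fix y assume y: "y \<in> {y \<in> M. d x y < e}"
  show "\<exists>e'>0. \<forall>z\<in>M. d y z < e' --> z \<in> {y \<in> M. d x y < e}"
  proof (intro exI[of _ "e - d x y"] conjI ballI impI)
    have fin: "d x y < top" using y top_greatest[of e] by (auto simp: less_le_trans)
    show "0 < e - d x y" using y by (simp add: diff_gr0_ennreal)
    fix z assume z: "z \<in> M" "d y z < e - d x y"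
    have "d x z <= d x y + d y z" using triangle assms y z(1) by blast
    also have "... < d x y + (e - d x y)" using z(2) fin by (simp add: ennreal_add_left_cancel_less less_top[symmetric])
    also have "... = e" using y by (simp add: add_diff_inverse_ennreal less_imp_le)
    finally show "z \<in> {y \<in> M. d x y < e}" using z(1) by simp
  qed
qed blast

lemma tendsto_zero_iff: "(f \<longlonglongrightarrow> (0::ennreal)) \<longleftrightarrow> (\<forall>e>0. \<exists>N. \<forall>i\<ge>N. f i < e)"
  unfolding order_tendsto_iff eventually_sequentially by auto

text \<open>Balls are open by the triangle inequality, so convergence in the topology reduces to
  distances tending to 0.\<close>

lemma limitin_iff:
  assumes f: "\<And>k. f k \<in> M"
  shows "limitin (emetric_topology M d) f p sequentially \<longleftrightarrow> p \<in> M \<and> (\<lambda>k. d p (f k)) \<longlonglongrightarrow> 0"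
proof
  assume L: "limitin (emetric_topology M d) f p sequentially"
  then have p: "p \<in> M" using limitin_topspace[OF L] by (simp add: topspace_emetric_topology)
  have "\<forall>\<^sub>F k in sequentially. d p (f k) < e" if e: "e > 0" for e
  proof -
    have "p \<in> {y \<in> M. d p y < e}" using p zero e by simp
    then have "\<forall>\<^sub>F k in sequentially. f k \<in> {y \<in> M. d p y < e}"
      using L openin_ball[OF p, of e] unfolding limitin_def by blast
    then show ?thesis by eventually_elim simp
  qed
  then show "p \<in> M \<and> (\<lambda>k. d p (f k)) \<longlonglongrightarrow> 0" using p by (auto simp: order_tendsto_iff)
next
  assume R: "p \<in> M \<and> (\<lambda>k. d p (f k)) \<longlonglongrightarrow> 0"
  show "limitin (emetric_topology M d) f p sequentially"
    unfolding limitin_def topspace_emetric_topology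
  proof (intro conjI allI impI)
    fix U assume "openin (emetric_topology M d) U \<and> p \<in> U"
    then obtain e where e: "e > 0" "\<forall>y\<in>M. d p y < e --> y \<in> U" unfolding openin_emetric_topology by blast
    have "\<forall>\<^sub>F k in sequentially. d p (f k) < e" using R e(1) by (auto simp: order_tendsto_iff)
    then show "\<forall>\<^sub>F k in sequentially. f k \<in> U" by eventually_elim (use e(2) f in blast)
  qed (use R in blast)
qed

section \<open>Classes of Cauchy sequences and the completion distance\<close>

lemma ecauchyD: "x \<in> ecauchy M d ==> x i \<in> M" "x \<in> ecauchy M d ==> e > 0 ==> \<exists>N. \<forall>i\<ge>N. \<forall>j\<ge>N. d (x i) (x j) < e"
  by (auto simp: ecauchy_def)

lemma ecauchy_const: "x \<in> M ==> (\<lambda>i. x) \<in> ecauchy M d"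
  by (simp add: ecauchy_def zero)

lemma tendsto_squeeze_zero:
  assumes "\<And>k. f k <= g k + h k" "g \<longlonglongrightarrow> (0::ennreal)" "h \<longlonglongrightarrow> 0" shows "f \<longlonglongrightarrow> 0"
  by (rule tendsto_sandwich[OF _ _ tendsto_const])
    (use assms(1) tendsto_add[OF assms(2,3)] in \<open>auto intro: always_eventually\<close>)

lemma equiv_ecauchy_rel: "equiv (ecauchy M d) (ecauchy_rel M d)"
proof (rule equivI)
  show "ecauchy_rel M d \<subseteq> ecauchy M d \<times> ecauchy M d" by (auto simp: ecauchy_rel_def)
  show "refl_on (ecauchy M d) (ecauchy_rel M d)"
    by (auto simp: refl_on_def ecauchy_rel_def ecauchyD(1) zero)
  show "sym (ecauchy_rel M d)"
    by (rule symI) (auto simp: ecauchy_rel_def ecauchyD(1) intro: Lim_transform_eventually simp: commute[OF ecauchyD(1) ecauchyD(1)])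
  show "trans (ecauchy_rel M d)"
  proof (rule transI)
    fix x y z assume "(x, y) \<in> ecauchy_rel M d" "(y, z) \<in> ecauchy_rel M d"
    then have C: "x \<in> ecauchy M d" "y \<in> ecauchy M d" "z \<in> ecauchy M d"
      and l: "(\<lambda>i. d (x i) (y i)) \<longlonglongrightarrow> 0" "(\<lambda>i. d (y i) (z i)) \<longlonglongrightarrow> 0" by (auto simp: ecauchy_rel_def)
    have "(\<lambda>i. d (x i) (z i)) \<longlonglongrightarrow> 0"
      by (rule tendsto_squeeze_zero[OF triangle l]) (use C ecauchyD(1) in blast)+
    with C show "(x, z) \<in> ecauchy_rel M d" by (simp add: ecauchy_rel_def)
  qed
qed

text \<open>Finite and infinite distances are treated alike: the triangle inequality gives
  \<open>f i <= e + f j\<close> for all large i and j, hence limsup <= liminf + e for every e. No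
  difference of two distances is ever formed.\<close>

lemma dist_limit_exists:
  assumes x: "x \<in> ecauchy M d" and y: "y \<in> ecauchy M d"
  shows "\<exists>l. (\<lambda>i. d (x i) (y i)) \<longlonglongrightarrow> l"
proof -
  define f where "f i = d (x i) (y i)" for i
  have osc: "\<exists>N. \<forall>i\<ge>N. \<forall>j\<ge>N. f i <= ennreal e + f j" if e: "e > 0" for e :: real
  proof -
    have e2: "ennreal (e/2) > 0" using e by simp
    obtain N1 where N1: "\<forall>i\<ge>N1. \<forall>j\<ge>N1. d (x i) (x j) < ennreal (e/2)" using ecauchyD(2)[OF x e2] by blast
    obtain N2 where N2: "\<forall>i\<ge>N2. \<forall>j\<ge>N2. d (y i) (y j) < ennreal (e/2)" using ecauchyD(2)[OF y e2] by blast
    have "f i <= ennreal e + f j" if ij: "i >= max N1 N2" "j >= max N1 N2" for i j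
    proof -
      note m = ecauchyD(1)[OF x] ecauchyD(1)[OF y]
      have "f i <= d (x i) (x j) + (d (x j) (y j) + d (y j) (y i))"
        unfolding f_def using triangle[OF m(1)[of i] m(1)[of j] m(2)[of i]] triangle[OF m(1)[of j] m(2)[of j] m(2)[of i]]
        by (meson add_left_mono order_trans)
      also have "... <= ennreal (e/2) + (f j + ennreal (e/2))"
        unfolding f_def using N1 N2 ij by (intro add_mono) (auto simp: less_imp_le)
      also have "... = (ennreal (e/2) + ennreal (e/2)) + f j" by (simp add: algebra_simps)
      also have "... = ennreal e + f j" using e by (simp add: ennreal_plus[symmetric] del: ennreal_plus)
      finally show ?thesis .
    qed
    then show ?thesis by blast
  qed
  have "limsup f <= liminf f"
  proof (rule ennreal_le_epsilon)
    fix e :: real assume e: "e > 0"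
    obtain N where N: "\<forall>i\<ge>N. \<forall>j\<ge>N. f i <= ennreal e + f j" using osc[OF e] by blast
    have "limsup f - ennreal e <= liminf f"
    proof (rule Liminf_bounded)
      show "\<forall>\<^sub>F j in sequentially. limsup f - ennreal e <= f j"
        unfolding eventually_sequentially
      proof (intro exI[of _ N] allI impI)
        fix j assume j: "j >= N"
        have "limsup f <= ennreal e + f j"
          by (rule Limsup_bounded) (use N j in \<open>auto simp: eventually_sequentially\<close>)
        then show "limsup f - ennreal e <= f j" by (simp add: ennreal_minus_le_iff)
      qed
    qed
    then show "limsup f <= liminf f + ennreal e" by (simp add: ennreal_minus_le_iff add.commute)
  qed
  then have "limsup f = liminf f" by (intro antisym Liminf_le_Limsup) auto
  then have "f \<longlonglongrightarrow> liminf f" by (intro Liminf_eq_Limsup) auto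
  moreover have "f = (\<lambda>i. d (x i) (y i))" by (simp add: f_def fun_eq_iff)
  ultimately show ?thesis by blast
qed

definition point :: "(nat => 'a) => (nat => 'a) set" where
  "point x = ecauchy_rel M d `` {x}"

lemma point_completion: "x \<in> ecauchy M d ==> point x \<in> ecompletion M d"
  unfolding point_def ecompletion_def by (rule quotientI)

lemma completion_point:
  assumes "p \<in> ecompletion M d" obtains x where "x \<in> ecauchy M d" "p = point x"
  using assms unfolding point_def ecompletion_def by (rule quotientE)

lemma point_eq_iff:
  "x \<in> ecauchy M d ==> y \<in> ecauchy M d ==> point x = point y \<longleftrightarrow> (\<lambda>i. d (x i) (y i)) \<longlonglongrightarrow> 0"
  unfolding point_def by (simp add: eq_equiv_class_iff[OF equiv_ecauchy_rel]) (simp add: ecauchy_rel_def)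

text \<open>The definite description in \<open>ecompletion_dist\<close> asks for one limit common to
  all representatives. It exists because two pairs of representatives can be compared by the
  triangle inequality in both directions.\<close>

lemma dist_point:
  assumes x: "x \<in> ecauchy M d" and y: "y \<in> ecauchy M d"
  shows "(\<lambda>i. d (x i) (y i)) \<longlonglongrightarrow> ecompletion_dist d (point x) (point y)"
proof -
  obtain l where l: "(\<lambda>i. d (x i) (y i)) \<longlonglongrightarrow> l" using dist_limit_exists[OF x y] by blast
  have "ecompletion_dist d (point x) (point y) = l"
    unfolding ecompletion_dist_def
  proof (rule the_equality)
    show "\<forall>x'\<in>point x. \<forall>y'\<in>point y. (\<lambda>i. d (x' i) (y' i)) \<longlonglongrightarrow> l"
    proof (intro ballI)
      fix x' y' assume "x' \<in> point x" "y' \<in> point y"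
      then have C: "x' \<in> ecauchy M d" "y' \<in> ecauchy M d"
        and z: "(\<lambda>i. d (x i) (x' i)) \<longlonglongrightarrow> 0" "(\<lambda>i. d (y i) (y' i)) \<longlonglongrightarrow> 0" by (auto simp: point_def ecauchy_rel_def)
      obtain l' where l': "(\<lambda>i. d (x' i) (y' i)) \<longlonglongrightarrow> l'" using dist_limit_exists[OF C] by blast
      note m = ecauchyD(1)[OF x] ecauchyD(1)[OF y] ecauchyD(1)[OF C(1)] ecauchyD(1)[OF C(2)]
      have a: "d (x i) (y i) <= d (x i) (x' i) + (d (x' i) (y' i) + d (y i) (y' i))" for i
        using triangle[OF m(1)[of i] m(3)[of i] m(2)[of i]] triangle[OF m(3)[of i] m(4)[of i] m(2)[of i]] commute[OF m(4)[of i] m(2)[of i]]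
        by (metis add_left_mono order_trans)
      have b: "d (x' i) (y' i) <= d (x i) (x' i) + (d (x i) (y i) + d (y i) (y' i))" for i
        using triangle[OF m(3)[of i] m(1)[of i] m(4)[of i]] triangle[OF m(1)[of i] m(2)[of i] m(4)[of i]] commute[OF m(3)[of i] m(1)[of i]]
        by (metis add_left_mono order_trans)
      have "l <= 0 + (l' + 0)"
        by (rule tendsto_le[OF sequentially_bot tendsto_add[OF z(1) tendsto_add[OF l' z(2)]] l]) (intro always_eventually allI a)
      moreover have "l' <= 0 + (l + 0)"
        by (rule tendsto_le[OF sequentially_bot tendsto_add[OF z(1) tendsto_add[OF l z(2)]] l']) (intro always_eventually allI b)
      ultimately have "l = l'" by (simp add: antisym)
      with l' show "(\<lambda>i. d (x' i) (y' i)) \<longlonglongrightarrow> l" by simp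
    qed
    fix k assume k: "\<forall>x'\<in>point x. \<forall>y'\<in>point y. (\<lambda>i. d (x' i) (y' i)) \<longlonglongrightarrow> k"
    have "x \<in> point x" "y \<in> point y" unfolding point_def
      using equiv_class_self[OF equiv_ecauchy_rel] x y by auto
    with k l show "k = l" using LIMSEQ_unique by blast
  qed
  with l show ?thesis by simp
qed

lemma dist_point_eqI:
  "x \<in> ecauchy M d ==> y \<in> ecauchy M d ==> (\<lambda>i. d (x i) (y i)) \<longlonglongrightarrow> l ==> ecompletion_dist d (point x) (point y) = l"
  using dist_point LIMSEQ_unique by blast

lemma completion_dist_zero_iff:
  assumes "p \<in> ecompletion M d" "q \<in> ecompletion M d"
  shows "ecompletion_dist d p q = 0 \<longleftrightarrow> p = q"
proof -
  obtain x y where xy: "x \<in> ecauchy M d" "p = point x" "y \<in> ecauchy M d" "q = point y"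
    using assms completion_point by metis
  show ?thesis
    unfolding xy point_eq_iff[OF xy(1,3)] using dist_point[OF xy(1,3)] dist_point_eqI[OF xy(1,3)] by metis
qed

lemma completion_extended_metric: "extended_metric (ecompletion M d) (ecompletion_dist d)"
proof
  fix p assume "p \<in> ecompletion M d"
  then show "ecompletion_dist d p p = 0" by (simp add: completion_dist_zero_iff)
next
  fix p q assume "p \<in> ecompletion M d" "q \<in> ecompletion M d"
  then obtain x y where xy: "x \<in> ecauchy M d" "p = point x" "y \<in> ecauchy M d" "q = point y"
    using completion_point by metis
  have "(\<lambda>i. d (x i) (y i)) = (\<lambda>i. d (y i) (x i))" using commute[OF ecauchyD(1)[OF xy(1)] ecauchyD(1)[OF xy(3)]] by blast
  then show "ecompletion_dist d p q = ecompletion_dist d q p"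
    unfolding xy using dist_point[OF xy(3,1)] by (intro dist_point_eqI xy(1,3)) simp
next
  fix p q r assume "p \<in> ecompletion M d" "q \<in> ecompletion M d" "r \<in> ecompletion M d"
  then obtain x y z where xy: "x \<in> ecauchy M d" "p = point x" "y \<in> ecauchy M d" "q = point y" "z \<in> ecauchy M d" "r = point z"
    using completion_point by metis
  show "ecompletion_dist d p r <= ecompletion_dist d p q + ecompletion_dist d q r"
    unfolding xy
    by (rule tendsto_le[OF sequentially_bot tendsto_add[OF dist_point[OF xy(1,3)] dist_point[OF xy(3,5)]] dist_point[OF xy(1,5)]])
      (intro always_eventually allI triangle ecauchyD(1) xy(1,3,5))
qed

lemma embed_eq_point: "ecompletion_embed M d x = point (\<lambda>i. x)"
  by (simp add: ecompletion_embed_def point_def)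

text \<open>A Cauchy sequence converges to its own class: the distance of that class from the
  constant sequence \<open>x m\<close> is the limit of \<open>d (x i) (x m)\<close> in i. Uniqueness
  holds because the completion distance separates points. The topological limit of a shrinking
  sequence thereby becomes an explicit class.\<close>

lemma limit_of_embedded_cauchy:
  assumes x: "x \<in> ecauchy M d"
  shows "limitin (emetric_topology (ecompletion M d) (ecompletion_dist d)) (\<lambda>m. ecompletion_embed M d (x m)) p sequentially
    \<longleftrightarrow> p = point x"
proof -
  interpret C: extended_metric "ecompletion M d" "ecompletion_dist d" by (rule completion_extended_metric)
  note c = ecauchy_const[OF ecauchyD(1)[OF x]]
  have em: "ecompletion_embed M d (x m) \<in> ecompletion M d" for m
    unfolding embed_eq_point by (rule point_completion[OF c])
  have lim: "(\<lambda>m. ecompletion_dist d (point x) (ecompletion_embed M d (x m))) \<longlonglongrightarrow> 0"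
    unfolding tendsto_zero_iff
  proof (intro allI impI)
    fix e :: ennreal assume "e > 0"
    then obtain e' where e': "0 < e'" "e' < e" using dense by blast
    obtain N where N: "\<forall>i\<ge>N. \<forall>j\<ge>N. d (x i) (x j) < e'" using ecauchyD(2)[OF x e'(1)] by blast
    have "ecompletion_dist d (point x) (ecompletion_embed M d (x m)) <= e'" if m: "m >= N" for m
      unfolding embed_eq_point
      by (rule tendsto_upperbound[OF dist_point[OF x c]])
        (use N m in \<open>auto simp: eventually_sequentially intro!: exI[of _ N] less_imp_le\<close>)
    with e'(2) show "\<exists>N. \<forall>i\<ge>N. ecompletion_dist d (point x) (ecompletion_embed M d (x i)) < e"
      using le_less_trans by blast
  qed
  show ?thesis
    unfolding C.limitin_iff[OF em]
  proof
    assume p: "p \<in> ecompletion M d \<and> (\<lambda>k. ecompletion_dist d p (ecompletion_embed M d (x k))) \<longlonglongrightarrow> 0"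
    note px = point_completion[OF x]
    have "(\<lambda>k. ecompletion_dist d p (point x)) \<longlonglongrightarrow> 0"
    proof (rule tendsto_squeeze_zero[OF _ conjunct2[OF p] lim])
      show "ecompletion_dist d p (point x) <= ecompletion_dist d p (ecompletion_embed M d (x k)) +
          ecompletion_dist d (point x) (ecompletion_embed M d (x k))" for k
        using C.triangle[OF conjunct1[OF p] em px] C.commute[OF em px] by metis
    qed
    then have "ecompletion_dist d p (point x) = 0" by (simp add: LIMSEQ_const_iff)
    then show "p = point x" using completion_dist_zero_iff p px by blast
  next
    assume "p = point x"
    then show "p \<in> ecompletion M d \<and> (\<lambda>k. ecompletion_dist d p (ecompletion_embed M d (x k))) \<longlonglongrightarrow> 0"
      using lim point_completion[OF x] by simp
  qed
qed

end

section \<open>Square integrable and absolutely continuous functions\<close>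

text \<open>\<open>J\<close> carries continuous representatives and gauge integrals,
  \<open>LI\<close> the Lebesgue integrals of classes; the domains differ by the two end points, a
  null set (\<open>LINT_LI_eq\<close>).\<close>

abbreviation J :: "real set" where "J \<equiv> {0..2*pi}"
abbreviation LI :: "real measure" where "LI \<equiv> lebesgue_on {0<..<2*pi}"

lemma finite_measure_LI: "finite_measure LI"
  by (rule finite_measure_lebesgue_on) simp

lemma integrable_const_LI [simp]: "integrable LI (\<lambda>x. c::real)"
  using finite_measure.integrable_const[OF finite_measure_LI] by blast

lemma integrable_LI_iff:
  fixes f :: "real => real"
  shows "integrable LI f \<longleftrightarrow> set_integrable lebesgue {0<..<2*pi} f"
  unfolding set_integrable_def by (subst integrable_restrict_space) auto

lemma integrable_LI_sub:
  fixes f :: "real => real"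
  assumes "integrable LI f" "0 <= x" "y <= 2*pi"
  shows "f absolutely_integrable_on {x..y}"
proof -
  have "f absolutely_integrable_on {0..2*pi}"
    using assms(1) absolutely_integrable_on_Icc_iff_Ioo[where f=f and a=0 and b="2*pi"] by (simp add: integrable_LI_iff)
  then show ?thesis
    by (rule absolutely_integrable_on_subinterval) (use assms in auto)
qed

lemma LINT_LI_eq:
  fixes f :: "real => real"
  assumes "integrable LI f"
  shows "(LINT x|LI. f x) = integral J f"
proof -
  have "(LINT x|LI. f x) = integral {0<..<2*pi} f"
    using assms by (intro lebesgue_integral_eq_integral) auto
  then show ?thesis by (simp add: integral_open_interval_real)
qed

lemma L2I: "f \<in> borel_measurable LI ==> integrable LI (\<lambda>x. (f x)\<^sup>2) ==> f \<in> L2"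
  by (simp add: L2_def)

lemma L2_measurable: "f \<in> L2 ==> f \<in> borel_measurable LI"
  by (simp add: L2_def)

lemma L2_square: "f \<in> L2 ==> integrable LI (\<lambda>x. (f x)\<^sup>2)"
  by (simp add: L2_def)

lemma L2_mult_integrable:
  assumes "f \<in> L2" "g \<in> L2" shows "integrable LI (\<lambda>x. f x * g x)"
proof (rule Bochner_Integration.integrable_bound)
  show "integrable LI (\<lambda>x. (f x)\<^sup>2 + (g x)\<^sup>2)" using assms by (auto simp: L2_def)
  show "(\<lambda>x. f x * g x) \<in> borel_measurable LI" using assms by (auto simp: L2_def)
  have "\<bar>a * b\<bar> <= a\<^sup>2 + b\<^sup>2" for a b :: real
  proof -
    have "0 <= (\<bar>a\<bar> - \<bar>b\<bar>)\<^sup>2" by simp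
    then have "2 * (\<bar>a\<bar> * \<bar>b\<bar>) <= a\<^sup>2 + b\<^sup>2" by (simp add: power2_diff)
    moreover have "0 <= \<bar>a\<bar> * \<bar>b\<bar>" by simp
    ultimately show ?thesis unfolding abs_mult by linarith
  qed
  then show "AE x in LI. norm (f x * g x) <= norm ((f x)\<^sup>2 + (g x)\<^sup>2)" by auto
qed

lemma L2_const [simp]: "(\<lambda>x. c) \<in> L2"
  by (simp add: L2_def)

lemma L2_integrable: "f \<in> L2 ==> integrable LI f"
  using L2_mult_integrable[of f "\<lambda>x. 1"] by simp

lemma L2_add: "f \<in> L2 ==> g \<in> L2 ==> (\<lambda>x. f x + g x) \<in> L2"
  using L2_mult_integrable[of f g]
  by (auto simp: L2_def power2_sum mult.assoc)

lemma L2_bounded_mult: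
  assumes "g \<in> L2" "f \<in> borel_measurable LI" "AE x in LI. \<bar>f x\<bar> <= B"
  shows "(\<lambda>x. f x * g x) \<in> L2"
proof (rule L2I)
  show "(\<lambda>x. f x * g x) \<in> borel_measurable LI" using assms by (auto simp: L2_def)
  show "integrable LI (\<lambda>x. (f x * g x)\<^sup>2)"
  proof (rule Bochner_Integration.integrable_bound)
    show "integrable LI (\<lambda>x. B\<^sup>2 * (g x)\<^sup>2)" using assms by (auto simp: L2_def)
    show "(\<lambda>x. (f x * g x)\<^sup>2) \<in> borel_measurable LI" using assms by (auto simp: L2_def)
    show "AE x in LI. norm ((f x * g x)\<^sup>2) <= norm (B\<^sup>2 * (g x)\<^sup>2)"
      using assms(3)
    proof eventually_elim
      case (elim x)
      then have "(f x)\<^sup>2 <= B\<^sup>2" by (metis abs_ge_zero power2_abs power_mono)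
      then show ?case by (simp add: power_mult_distrib mult_right_mono)
    qed
  qed
qed

lemma L2_cmult: "f \<in> L2 ==> (\<lambda>x. c * f x) \<in> L2"
  by (auto simp: L2_def power_mult_distrib)

lemma L2_diff: "f \<in> L2 ==> g \<in> L2 ==> (\<lambda>x. f x - g x) \<in> L2"
  using L2_add[of f "\<lambda>x. (-1) * g x"] L2_cmult[of g "-1"] by simp

text \<open>Rests on the completeness of Lebesgue measure, and makes membership in \<open>L2\<close>
  a property of the class of a function.\<close>

lemma borel_measurable_LI_cong_AE:
  assumes "f \<in> borel_measurable (lebesgue_on S)" "S \<in> sets lebesgue" "AE x in lebesgue_on S. f x = g x"
  shows "(g :: real => real) \<in> borel_measurable (lebesgue_on S)"
proof -
  have 1: "(\<lambda>x. if x \<in> S then f x else 0) \<in> borel_measurable lebesgue"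
    using assms by (simp add: borel_measurable_if)
  have "AE x in lebesgue. (if x \<in> S then f x else 0) = (if x \<in> S then g x else 0)"
    using assms(3) by (subst (asm) AE_restrict_space_iff) (use assms(2) in auto)
  from borel_measurable_AE[OF 1 this] show ?thesis using assms(2) by (simp add: borel_measurable_if)
qed

lemma L2_cong_AE:
  assumes "f \<in> L2" "AE x in LI. f x = g x" shows "g \<in> L2"
proof (rule L2I)
  show m: "g \<in> borel_measurable LI"
    using borel_measurable_LI_cong_AE[OF L2_measurable[OF assms(1)] _ assms(2)] by simp
  have "integrable LI (\<lambda>x. (f x)\<^sup>2) \<longleftrightarrow> integrable LI (\<lambda>x. (g x)\<^sup>2)"
    using m assms by (intro integrable_cong_AE) (auto simp: L2_def)
  then show "integrable LI (\<lambda>x. (g x)\<^sup>2)" using L2_square[OF assms(1)] by simp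
qed

lemma continuous_on_measurable_LI:
  assumes "continuous_on J f" shows "f \<in> borel_measurable LI"
  by (rule continuous_imp_measurable_on_sets_lebesgue) (auto intro: continuous_on_subset[OF assms])

lemma continuous_on_bounded_J:
  assumes "continuous_on J (f :: real => real)"
  obtains B where "\<And>x. x \<in> J ==> \<bar>f x\<bar> <= B" "B > 0"
proof -
  have "bounded (f ` J)" using assms by (intro compact_imp_bounded compact_continuous_image) auto
  then obtain B where "B > 0" "\<forall>x\<in>J. \<bar>f x\<bar> <= B" unfolding bounded_pos by auto
  then show ?thesis using that[of B] by auto
qed

lemma L2_continuous_mult:
  assumes "continuous_on J f" "g \<in> L2" shows "(\<lambda>x. f x * g x) \<in> L2"
proof -
  obtain B where "\<And>x. x \<in> J ==> \<bar>f x\<bar> <= B" using continuous_on_bounded_J[OF assms(1)] by blast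
  then show ?thesis
    by (intro L2_bounded_mult[OF assms(2) continuous_on_measurable_LI[OF assms(1)], of B])
      (auto intro!: AE_I2)
qed

lemma L2_mult_continuous:
  assumes "continuous_on J f" "g \<in> L2" shows "(\<lambda>x. g x * f x) \<in> L2"
  using L2_continuous_mult[OF assms] by (simp only: mult.commute)

lemma L2_continuous: "continuous_on J f ==> f \<in> L2"
  using L2_continuous_mult[of f "\<lambda>x. 1"] by simp

lemma L2_sub: "f \<in> L2 ==> 0 <= x ==> y <= 2*pi ==> f absolutely_integrable_on {x..y}"
  by (intro integrable_LI_sub L2_integrable)

lemma L2_integrable_on: "f \<in> L2 ==> 0 <= x ==> y <= 2*pi ==> f integrable_on {x..y}"
  using L2_sub absolutely_integrable_on_def by blast

lemma L2_abs: "f \<in> L2 ==> (\<lambda>x. \<bar>f x\<bar>) \<in> L2"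
  by (auto simp: L2_def)

section \<open>Discriminants and the Cauchy-Schwarz inequality\<close>

lemma quadratic_nonneg_imp:
  fixes A B C :: real
  assumes "0 <= A" and q: "\<And>t. 0 <= A * t\<^sup>2 + 2 * B * t + C" shows "B\<^sup>2 <= A * C"
proof (cases "A = 0")
  case True
  have "B = 0"
  proof (rule ccontr)
    assume "B \<noteq> 0"
    \<comment> \<open>At this t the affine function 2 B t + C takes the value -1.\<close>
    then show False using q[of "-(C+1)/(2*B)"] True by (simp add: field_simps)
  qed
  then show ?thesis using True by simp
next
  case False
  then have "A > 0" using assms(1) by simp
  moreover have "A * (-B/A)\<^sup>2 + 2 * B * (-B/A) + C = C - B\<^sup>2/A"
    using False by (simp add: power2_eq_square field_simps)
  ultimately have "B\<^sup>2/A <= C" using q[of "-B/A"] by simp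
  then show ?thesis using \<open>A > 0\<close> by (simp add: field_simps)
qed

lemma Cauchy_Schwarz_integral:
  fixes u v :: "'a => real"
  assumes u: "integrable M (\<lambda>x. (u x)\<^sup>2)" and v: "integrable M (\<lambda>x. (v x)\<^sup>2)"
    and uv: "integrable M (\<lambda>x. u x * v x)"
  shows "(LINT x|M. u x * v x)\<^sup>2 <= (LINT x|M. (u x)\<^sup>2) * (LINT x|M. (v x)\<^sup>2)"
proof -
  define A where "A = (LINT x|M. (u x)\<^sup>2)"
  define B where "B = (LINT x|M. u x * v x)"
  define C where "C = (LINT x|M. (v x)\<^sup>2)"
  have q: "0 <= A * t\<^sup>2 + 2 * B * t + C" for t
  proof -
    have "0 <= (LINT x|M. (t * u x + v x)\<^sup>2)" by simp
    also have "(\<lambda>x. (t * u x + v x)\<^sup>2) = (\<lambda>x. t\<^sup>2 * (u x)\<^sup>2 + (2 * t) * (u x * v x) + (v x)\<^sup>2)"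
      by (auto simp: power2_eq_square algebra_simps)
    also have "(LINT x|M. t\<^sup>2 * (u x)\<^sup>2 + (2 * t) * (u x * v x) + (v x)\<^sup>2) = A * t\<^sup>2 + 2 * B * t + C"
      using u v uv by (simp add: A_def B_def C_def)
    finally show ?thesis .
  qed
  show "B\<^sup>2 <= A * C" by (rule quadratic_nonneg_imp[OF _ q]) (simp add: A_def)
qed

lemma integral_abs_square_le:
  assumes "f \<in> L2" "0 <= x" "x <= y" "y <= 2*pi"
  shows "(integral {x..y} (\<lambda>t. \<bar>f t\<bar>))\<^sup>2 <= (y - x) * integral {x..y} (\<lambda>t. (f t)\<^sup>2)"
proof -
  let ?M = "lebesgue_on {x..y}"
  have i: "integrable ?M (g :: real => real)" if "integrable LI g" for g
    using integrable_LI_sub[OF that assms(2,4)]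
    by (simp add: integrable_restrict_space set_integrable_def)
  have 1: "integrable ?M (\<lambda>t. (f t)\<^sup>2)" "integrable ?M (\<lambda>t. \<bar>f t\<bar> * 1)"
    using i L2_square[OF assms(1)] L2_integrable[OF L2_abs[OF assms(1)]] by auto
  have 2: "integrable ?M (\<lambda>t. (1::real)\<^sup>2)" using i[of "\<lambda>t. 1"] by simp
  have "(LINT t|?M. \<bar>f t\<bar> * 1)\<^sup>2 <= (LINT t|?M. \<bar>f t\<bar>\<^sup>2) * (LINT t|?M. 1\<^sup>2)"
    by (rule Cauchy_Schwarz_integral) (use 1 2 in auto)
  then show ?thesis
    using 1 2 lebesgue_integral_eq_integral[OF 1(1)] lebesgue_integral_eq_integral[OF 1(2)]
      lebesgue_integral_eq_integral[OF 2] assms by (simp add: mult.commute)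
qed

section \<open>Absolutely continuous functions with square integrable derivative\<close>

text \<open>The fundamental theorem of calculus taken as definition: \<open>f\<close> is the
  continuous representative of an H^1 class with derivative \<open>g\<close>. Product and reciprocal
  rules are proved at this level; \<open>ac_weak\<close> and \<open>weak_ac\<close> translate from
  and to weak derivatives.\<close>

definition ac :: "(real => real) => (real => real) => bool" where
  "ac f g \<longleftrightarrow> g \<in> L2 \<and> (\<forall>x\<in>J. f x - f 0 = integral {0..x} g)"

lemma ac_L2: "ac f g ==> g \<in> L2"
  by (simp add: ac_def)

lemma ac_increment:
  assumes "ac f g" "0 <= x" "x <= y" "y <= 2*pi"
  shows "f y - f x = integral {x..y} g"
proof -
  have "g integrable_on {0..y}" using assms L2_integrable_on[OF ac_L2] by auto
  then have "integral {0..x} g + integral {x..y} g = integral {0..y} g"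
    using assms by (intro Henstock_Kurzweil_Integration.integral_combine) auto
  moreover have "f x - f 0 = integral {0..x} g" "f y - f 0 = integral {0..y} g"
    using assms unfolding ac_def by auto
  ultimately show ?thesis by simp
qed

lemma acI:
  assumes "g \<in> L2" "\<And>x. x \<in> J ==> f x - f 0 = integral {0..x} g"
  shows "ac f g"
  using assms unfolding ac_def by blast

lemma ac_continuous: assumes "ac f g" shows "continuous_on J f"
proof -
  have "continuous_on J (\<lambda>x. f 0 + integral {0..x} g)"
    using L2_integrable_on[OF ac_L2[OF assms], of 0 "2*pi"]
    by (intro continuous_intros indefinite_integral_continuous_1) auto
  moreover have "f 0 + integral {0..x} g = f x" if "x \<in> J" for x
    using assms that unfolding ac_def by (metis add_diff_cancel_left' add_diff_eq diff_add_cancel)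
  ultimately show ?thesis by (rule continuous_on_eq)
qed

lemma ac_self_L2: "ac f g ==> f \<in> L2"
  using ac_continuous L2_continuous by blast

lemma ac_indefinite: "g \<in> L2 ==> ac (\<lambda>x. integral {0..x} g) g"
  by (rule acI) auto

lemma ac_const [simp]: "ac (\<lambda>x. c) (\<lambda>x. 0)"
  by (rule acI) auto

lemma ac_add:
  assumes "ac f f'" "ac g g'" shows "ac (\<lambda>x. f x + g x) (\<lambda>x. f' x + g' x)"
proof (rule acI)
  show "(\<lambda>x. f' x + g' x) \<in> L2" using assms L2_add ac_L2 by blast
  fix x :: real assume x: "x \<in> J"
  have "integral {0..x} (\<lambda>x. f' x + g' x) = integral {0..x} f' + integral {0..x} g'"
    using x assms by (intro Henstock_Kurzweil_Integration.integral_add L2_integrable_on ac_L2) auto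
  then show "f x + g x - (f 0 + g 0) = integral {0..x} (\<lambda>x. f' x + g' x)"
    using ac_increment[OF assms(1), of 0 x] ac_increment[OF assms(2), of 0 x] x by auto
qed

lemma ac_cmult:
  assumes "ac f f'" shows "ac (\<lambda>x. c * f x) (\<lambda>x. c * f' x)"
proof (rule acI)
  show "(\<lambda>x. c * f' x) \<in> L2" using assms L2_cmult ac_L2 by blast
  fix x :: real assume x: "x \<in> J"
  show "c * f x - c * f 0 = integral {0..x} (\<lambda>x. c * f' x)"
    using ac_increment[OF assms, of 0 x] x by (simp add: right_diff_distrib[symmetric])
qed

lemma ac_diff:
  assumes "ac f f'" "ac g g'" shows "ac (\<lambda>x. f x - g x) (\<lambda>x. f' x - g' x)"
  using ac_add[OF assms(1) ac_cmult[OF assms(2), of "-1"]] by simp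

lemma ac_cong_AE:
  assumes "ac f g" "AE x in LI. g x = g' x" "\<And>x. x \<in> J ==> f x = f' x"
  shows "ac f' g'"
proof (rule acI)
  show L: "g' \<in> L2" using L2_cong_AE[OF ac_L2[OF assms(1)] assms(2)] .
  fix x :: real assume x: "x \<in> J"
  have "AE t in lebesgue. t \<in> {0<..<2*pi} --> g t = g' t"
    using assms(2) by (subst (asm) AE_restrict_space_iff) auto
  then obtain N where N: "negligible N" "{t. \<not> (t \<in> {0<..<2*pi} --> g t = g' t)} \<subseteq> N"
    by (auto simp: eventually_ae_filter_negligible)
  have "integral {0..x} g = integral {0..x} g'"
  \<comment> \<open>The measure \<open>LI\<close> does not see 0 and 2 pi, so both are added to the
    exceptional null set.\<close>
  proof (rule integral_spike[of "N \<union> {0,2*pi}"])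
    show "g' t = g t" if "t \<in> {0..x} - (N \<union> {0, 2*pi})" for t
    proof (rule ccontr)
      assume "g' t \<noteq> g t"
      moreover have "t \<in> {0<..<2*pi}" using that x by auto
      ultimately have "t \<in> N" using N(2) by auto
      then show False using that by blast
    qed
  qed (use N in \<open>auto intro!: negligible_Un\<close>)
  then show "f' x - f' 0 = integral {0..x} g'"
    using ac_increment[OF assms(1), of 0 x] x assms(3)[of 0] assms(3)[of x] by auto
qed

lemma ac_increment_abs:
  assumes "ac f g" "0 <= u" "u <= x" "x <= y" "y <= v" "v <= 2*pi"
  shows "\<bar>f y - f x\<bar> <= integral {u..v} (\<lambda>t. \<bar>g t\<bar>)"
proof -
  have L: "g \<in> L2" using assms ac_L2 by auto
  have "\<bar>f y - f x\<bar> = \<bar>integral {x..y} g\<bar>" using ac_increment[OF assms(1), of x y] assms by simp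
  also have "... <= integral {x..y} (\<lambda>t. \<bar>g t\<bar>)"
    using integral_norm_bound_integral[of g "{x..y}" "\<lambda>t. \<bar>g t\<bar>"] assms
      L2_integrable_on[OF L, of x y] L2_integrable_on[OF L2_abs[OF L], of x y] by auto
  also have "... <= integral {u..v} (\<lambda>t. \<bar>g t\<bar>)"
    using assms L2_integrable_on[OF L2_abs[OF L]] by (intro integral_subset_le) auto
  finally show ?thesis .
qed

text \<open>Increments bounded by (v - u) * (R v - R u) with R continuous are o(v - u), so H has
  derivative 0 at every point and not merely almost everywhere, which is what constancy requires.
  Product and reciprocal rules are both checked this way, with R built from an integral of squared
  derivatives.\<close>

lemma const_if_increments_small:
  fixes H R :: "real => real"
  assumes R: "continuous_on J R"
    and le: "\<And>u v. 0 <= u ==> u <= v ==> v <= 2*pi ==> \<bar>H v - H u\<bar> <= (v - u) * (R v - R u)"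
    and x: "x \<in> J"
  shows "H x = H 0"
proof -
  have key2: "\<bar>H y - H x\<bar> <= \<bar>y - x\<bar> * \<bar>R y - R x\<bar>" if "x \<in> J" "y \<in> J" for x y
  proof (cases "x <= y")
    case True
    then have "\<bar>H y - H x\<bar> <= (y - x) * (R y - R x)" using le[of x y] that by simp
    also have "... <= \<bar>(y - x) * (R y - R x)\<bar>" by (rule abs_ge_self)
    finally show ?thesis by (simp only: abs_mult)
  next
    case False
    then have "\<bar>H x - H y\<bar> <= (x - y) * (R x - R y)" using le[of y x] that by simp
    also have "... <= \<bar>(x - y) * (R x - R y)\<bar>" by (rule abs_ge_self)
    finally show ?thesis by (simp only: abs_mult abs_minus_commute)
  qed
  have "(H has_field_derivative 0) (at x within J)" if x: "x \<in> J" for x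
    unfolding has_field_derivative_iff
  proof (rule Lim_null_comparison[where g = "\<lambda>y. \<bar>R y - R x\<bar>"])
    show "\<forall>\<^sub>F y in at x within J. norm ((H y - H x) / (y - x)) <= \<bar>R y - R x\<bar>"
      unfolding eventually_at_topological
      by (rule exI[of _ UNIV]) (use key2 x in \<open>auto simp: field_simps abs_divide\<close>)
    have "(R \<longlongrightarrow> R x) (at x within J)" using R x by (auto simp: continuous_on_def)
    then show "((\<lambda>y. \<bar>R y - R x\<bar>) \<longlongrightarrow> 0) (at x within J)"
      using tendsto_rabs_zero LIM_zero by blast
  qed
  then obtain c where "\<And>x. x \<in> J ==> H x = c"
    using has_field_derivative_zero_constant[of J H] by (auto simp: convex_closed_interval)
  then show ?thesis using x by simp
qed

text \<open>The remainder \<open>fg - \<integral>(f'g + fg')\<close> has increments that are quadratically small in the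
  increments of \<open>\<integral>\<bar>f'\<bar>\<close> and \<open>\<integral>\<bar>g'\<bar>\<close>, hence derivative \<open>0\<close> everywhere.\<close>

lemma ac_mult:
  assumes f: "ac f f'" and g: "ac g g'"
  shows "ac (\<lambda>x. f x * g x) (\<lambda>x. f' x * g x + f x * g' x)"
proof -
  define k where "k = (\<lambda>x. f' x * g x + f x * g' x)"
  have f'2: "f' \<in> L2" and g'2: "g' \<in> L2" using f g ac_L2 by auto
  have k2: "k \<in> L2" unfolding k_def
    by (intro L2_add L2_continuous_mult[OF ac_continuous[OF f] g'2]
      L2_mult_continuous[OF ac_continuous[OF g] f'2])
  define H where "H = (\<lambda>x. f x * g x - integral {0..x} k)"
  have rsq: "integrable LI (\<lambda>t. (f' t)\<^sup>2 + (g' t)\<^sup>2)" using f'2 g'2 by (auto simp: L2_def)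
  have rint: "(\<lambda>t. (f' t)\<^sup>2 + (g' t)\<^sup>2) integrable_on {x..y}" if "0 <= x" "y <= 2*pi" for x y
    using integrable_LI_sub[OF rsq that] absolutely_integrable_on_def by blast
  define R where "R = (\<lambda>x. integral {0..x} (\<lambda>t. (f' t)\<^sup>2 + (g' t)\<^sup>2))"
  have R: "R v - R u = integral {u..v} (\<lambda>t. (f' t)\<^sup>2 + (g' t)\<^sup>2)" if "0 <= u" "u <= v" "v <= 2*pi" for u v
    unfolding R_def using Henstock_Kurzweil_Integration.integral_combine[of 0 u v, OF _ _ rint] that by auto
  have Rc: "continuous_on J R" unfolding R_def
    by (intro indefinite_integral_continuous_1 rint) auto
  have key: "\<bar>H v - H u\<bar> <= (v - u) * (R v - R u)" if uv: "0 <= u" "u <= v" "v <= 2*pi" for u v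
  proof -
    define A where "A = integral {u..v} (\<lambda>t. \<bar>f' t\<bar>)"
    define B where "B = integral {u..v} (\<lambda>t. \<bar>g' t\<bar>)"
    have i: "h integrable_on {u..v}" if "h \<in> L2" for h using L2_integrable_on[OF that] uv by auto
    have a: "(\<lambda>t. f' t * (g v - g t)) \<in> L2" "(\<lambda>t. g' t * (f u - f t)) \<in> L2"
      using ac_continuous[OF f] ac_continuous[OF g] f'2 g'2
      by (auto intro!: continuous_intros L2_mult_continuous)
    \<comment> \<open>This splitting leads to the integrand
      \<open>f' t * (g v - g t) + g' t * (f u - f t)\<close>, where each derivative meets a small
      increment of the other function.\<close>
    have "H v - H u = (f v - f u) * g v + (g v - g u) * f u - integral {u..v} k"
      using ac_increment[OF ac_indefinite[OF k2], of u v] uv unfolding H_def by (simp add: algebra_simps)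
    also have "... = integral {u..v} (\<lambda>t. f' t * g v) + integral {u..v} (\<lambda>t. g' t * f u) - integral {u..v} k"
      using ac_increment[OF f, of u v] ac_increment[OF g, of u v] uv by simp
    also have "... = integral {u..v} (\<lambda>t. f' t * g v + g' t * f u - k t)"
      using i[OF k2] i[OF L2_cmult[OF f'2, of "g v"]] i[OF L2_cmult[OF g'2, of "f u"]]
      by (subst Henstock_Kurzweil_Integration.integral_diff, auto simp: mult.commute intro!: integrable_add)
         (subst Henstock_Kurzweil_Integration.integral_add, auto simp: mult.commute)
    also have "(\<lambda>t. f' t * g v + g' t * f u - k t) = (\<lambda>t. f' t * (g v - g t) + g' t * (f u - f t))"
      by (auto simp: k_def algebra_simps)
    finally have "\<bar>H v - H u\<bar> = norm (integral {u..v} (\<lambda>t. f' t * (g v - g t) + g' t * (f u - f t)))" by simp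
    also have "... <= integral {u..v} (\<lambda>t. B * \<bar>f' t\<bar> + A * \<bar>g' t\<bar>)"
    proof (rule integral_norm_bound_integral)
      show "(\<lambda>t. f' t * (g v - g t) + g' t * (f u - f t)) integrable_on {u..v}"
        using i[OF L2_add[OF a]] .
      show "(\<lambda>t. B * \<bar>f' t\<bar> + A * \<bar>g' t\<bar>) integrable_on {u..v}"
        by (intro i L2_add L2_cmult L2_abs f'2 g'2)
      fix t assume t: "t \<in> {u..v}"
      have "\<bar>g v - g t\<bar> <= B" unfolding B_def using ac_increment_abs[OF g, of u t v v] t uv by auto
      moreover have "\<bar>f u - f t\<bar> <= A"
        unfolding A_def using ac_increment_abs[OF f, of u u t v] t uv by (auto simp: abs_minus_commute)
      ultimately have "\<bar>f' t * (g v - g t)\<bar> <= B * \<bar>f' t\<bar>" "\<bar>g' t * (f u - f t)\<bar> <= A * \<bar>g' t\<bar>"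
        unfolding abs_mult by (metis abs_ge_zero mult.commute mult_right_mono)+
      then show "norm (f' t * (g v - g t) + g' t * (f u - f t)) <= B * \<bar>f' t\<bar> + A * \<bar>g' t\<bar>" by simp
    qed
    also have "... = 2 * A * B"
      using Henstock_Kurzweil_Integration.integral_add[OF i[OF L2_cmult[OF L2_abs[OF f'2], of B]] i[OF L2_cmult[OF L2_abs[OF g'2], of A]]]
      by (simp add: A_def B_def)
    \<comment> \<open>The product is traded for squares because Cauchy-Schwarz on [u, v] then
      supplies the factor v - u.\<close>
    also have "... <= A\<^sup>2 + B\<^sup>2" using sum_squares_bound[of A B] by simp
    also have "... <= (v - u) * integral {u..v} (\<lambda>t. (f' t)\<^sup>2) + (v - u) * integral {u..v} (\<lambda>t. (g' t)\<^sup>2)"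
      unfolding A_def B_def using integral_abs_square_le f'2 g'2 uv by (intro add_mono) auto
    also have "... = (v - u) * (R v - R u)"
    proof -
      have "integral {u..v} (\<lambda>t. (f' t)\<^sup>2 + (g' t)\<^sup>2) = integral {u..v} (\<lambda>t. (f' t)\<^sup>2) + integral {u..v} (\<lambda>t. (g' t)\<^sup>2)"
        using integrable_LI_sub[OF L2_square[OF f'2]] integrable_LI_sub[OF L2_square[OF g'2]] uv
        by (intro Henstock_Kurzweil_Integration.integral_add) (auto simp: absolutely_integrable_on_def)
      then show ?thesis unfolding R[OF uv] by (simp only: distrib_left)
    qed
    finally show ?thesis .
  qed
  note H0 = const_if_increments_small[OF Rc key]
  have "ac (\<lambda>x. f x * g x) k"
  proof (rule acI[OF k2])
    fix x assume "x \<in> J"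
    then show "f x * g x - f 0 * g 0 = integral {0..x} k" using H0[of x] by (simp add: H_def)
  qed
  then show ?thesis by (simp only: k_def)
qed

section \<open>Smooth bump functions\<close>

text \<open>From z/m <= exp (z/m) with m = k + 1 one gets exp (-z) <= (m/z)^m, so the exponential
  beats the power k with one factor q to spare. The spare factor makes the bump functions tend to 0
  at the ends of their support, for every k.\<close>

lemma exp_inverse_le:
  fixes e :: real assumes "e > 0"
  obtains K where "K >= 0" "\<And>q. q > 0 ==> inverse q ^ k * exp (- e * inverse q) <= K * q"
proof
  define m where "m = Suc k"
  define K where "K = (real m / e) ^ m"
  show "K >= 0" unfolding K_def using assms by simp
  fix q :: real assume q: "q > 0"
  define z where "z = e * inverse q"
  have z: "z > 0" unfolding z_def using assms q by simp
  have m: "real m > 0" unfolding m_def by simp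
  have "(z / real m) ^ m <= exp (z / real m) ^ m"
    using z m order_trans[OF _ exp_ge_add_one_self[of "z / real m"], of "z / real m"] by (intro power_mono) auto
  also have "... = exp z" using m by (simp add: exp_of_nat_mult[symmetric])
  finally have "exp (- z) <= inverse ((z / real m) ^ m)"
    using z m by (simp add: exp_minus le_imp_inverse_le)
  also have "... = K * q ^ m"
    unfolding K_def z_def by (simp add: power_divide power_mult_distrib field_simps)
  finally have "inverse q ^ k * exp (- z) <= inverse q ^ k * (K * q ^ m)"
    using q by (intro mult_left_mono) auto
  also have "... = K * q" using q unfolding m_def by (simp add: field_simps)
  finally show "inverse q ^ k * exp (- e * inverse q) <= K * q" unfolding z_def by simp
qed

lemma real_polynomial_function_ident: "real_polynomial_function (\<lambda>x::real. x)"
  by (intro real_polynomial_function.intros(1) bounded_linear_ident)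

lemmas real_polynomial_intros = real_polynomial_function_ident real_polynomial_function_diff
  real_polynomial_function_power real_polynomial_function.intros(2-4)

text \<open>A family closed under differentiation: P absorbs polynomial factors, k the powers of the
  reciprocal, and e stays fixed. With k = 0 and e tending to 0 it converges pointwise on (u, v) to
  P.\<close>

definition bump :: "(real => real) => nat => real => real => real => real => real" where
  "bump P k e u v x =
    (if u < x \<and> x < v
     then P x * inverse ((x - u) * (v - x)) ^ k * exp (- e * inverse ((x - u) * (v - x))) else 0)"

lemma bump_bound:
  assumes "e > 0" "real_polynomial_function P"
  obtains C where "\<And>x. \<bar>bump P k e u v x\<bar> <= C * \<bar>(x - u) * (v - x)\<bar>"
proof -
  obtain K where K: "K >= 0" "\<And>q. q > 0 ==> inverse q ^ k * exp (- e * inverse q) <= K * q"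
    using exp_inverse_le[OF assms(1)] by metis
  have "continuous_on {u..v} P"
    using assms(2) by (simp add: continuous_at_imp_continuous_on continuous_real_polymonial_function)
  then have "bounded (P ` {u..v})" by (intro compact_imp_bounded compact_continuous_image) auto
  then obtain B where B: "B > 0" "\<forall>x\<in>{u..v}. \<bar>P x\<bar> <= B" unfolding bounded_pos by auto
  have "\<bar>bump P k e u v x\<bar> <= (B * K) * \<bar>(x - u) * (v - x)\<bar>" for x
  proof (cases "u < x \<and> x < v")
    case True
    define q where "q = (x - u) * (v - x)"
    have q: "q > 0" using True unfolding q_def by simp
    have "\<bar>bump P k e u v x\<bar> = \<bar>P x\<bar> * (inverse q ^ k * exp (- e * inverse q))"
      using True q by (simp add: bump_def q_def[symmetric] abs_mult)
    also have "... <= B * (K * q)"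
      by (rule mult_mono) (use B True K(2)[OF q] q in auto)
    finally show ?thesis using q unfolding q_def[symmetric] by simp
  next
    case False
    then show ?thesis using B K by (auto simp: bump_def)
  qed
  then show ?thesis using that by blast
qed

lemma bump_tendsto_0:
  assumes "e > 0" "real_polynomial_function P" "x = u \<or> x = v"
  shows "(bump P k e u v \<longlongrightarrow> 0) (at x)"
proof -
  obtain C where C: "\<And>x. \<bar>bump P k e u v x\<bar> <= C * \<bar>(x - u) * (v - x)\<bar>"
    using bump_bound[OF assms(1,2)] by metis
  have "((\<lambda>x. C * \<bar>(x - u) * (v - x)\<bar>) \<longlongrightarrow> C * \<bar>(x - u) * (v - x)\<bar>) (at x)"
    by (intro tendsto_intros)
  then have "((\<lambda>x. C * \<bar>(x - u) * (v - x)\<bar>) \<longlongrightarrow> 0) (at x)" using assms(3) by auto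
  then show ?thesis using C by (auto intro: Lim_null_comparison[rotated])
qed

text \<open>Inside (p, c) the three terms of the product rule are brought to the common denominator
  of order k + 2. At p and c the difference quotient is itself a bump with exponent k + 1 and so
  tends to 0.\<close>

lemma bump_has_derivative:
  assumes e: "r > 0" and ab: "p < c" and P: "real_polynomial_function P"
    and P': "\<And>x. (P has_real_derivative P' x) (at x)"
  shows "(bump P k r p c has_real_derivative
    bump (\<lambda>x. P' x * ((x - p) * (c - x))\<^sup>2 - real k * P x * (p + c - 2 * x) * ((x - p) * (c - x))
      + r * P x * (p + c - 2 * x)) (k + 2) r p c x) (at x)"
    (is "(_ has_real_derivative bump ?R _ _ _ _ _) _")
proof -
  \<comment> \<open>Dividing by one factor of u v moves the other factor into the polynomial and
    raises the exponent by one.\<close>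
  have quot: "A * inverse (u * v) ^ k * E / u = A * v * inverse (u * v) ^ Suc k * E"
    if "u \<noteq> 0" "v \<noteq> 0" for A E u v :: real
    using that by (simp add: field_simps)
  consider "x < p \<or> c < x" | "p < x" "x < c" | "x = p" | "x = c" by linarith
  then show ?thesis
  proof cases
    case 1
    then have "x \<in> {..<p} \<union> {c<..}" by auto
    moreover have "open ({..<p} \<union> {c<..})" by auto
    ultimately have "(bump P k r p c has_real_derivative 0) (at x)"
      by (intro has_field_derivative_transform_within_open[OF DERIV_const[of 0 "at x"], of "{..<p} \<union> {c<..}"])
        (auto simp: bump_def)
    then show ?thesis using 1 by (auto simp: bump_def)
  next
    case 2
    define q where "q = (\<lambda>x. (x - p) * (c - x))"
    have q0: "q x > 0" unfolding q_def using 2 by simp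
    have q': "(q has_real_derivative (p + c - 2 * x)) (at x)"
      unfolding q_def by (auto intro!: derivative_eq_intros)
    define i where "i = inverse (q x)"
    have iq: "q x * i = 1" using q0 by (simp add: i_def)
    have di: "((\<lambda>x. inverse (q x)) has_real_derivative (- (i\<^sup>2 * (p + c - 2 * x)))) (at x)"
      using q' q0 by (auto intro!: derivative_eq_intros simp: i_def power2_eq_square)
    have dik: "((\<lambda>x. inverse (q x) ^ k) has_real_derivative (- (real k * i ^ Suc k * (p + c - 2 * x)))) (at x)"
    proof (cases k)
      case (Suc j)
      then show ?thesis
        using DERIV_power[OF di, of k] by (simp add: i_def[symmetric] power2_eq_square mult_ac)
    qed simp
    have de: "((\<lambda>x. exp (- r * inverse (q x))) has_real_derivative
        (exp (- r * i) * (r * i\<^sup>2 * (p + c - 2 * x)))) (at x)"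
      by (rule derivative_eq_intros DERIV_cmult[OF di] refl | simp add: i_def)+
    have "((\<lambda>x. P x * inverse (q x) ^ k * exp (- r * inverse (q x))) has_real_derivative
       ?R x * i ^ (k + 2) * exp (- r * i)) (at x)"
    proof (rule DERIV_cong[OF DERIV_mult[OF DERIV_mult[OF P'[of x] dik] de]])
      have "?R x * i ^ (k + 2) = P' x * i ^ k * (q x * i)\<^sup>2 - real k * P x * (p + c - 2 * x) * i ^ Suc k * (q x * i)
          + r * P x * (p + c - 2 * x) * i ^ k * i\<^sup>2"
        unfolding q_def by (simp add: algebra_simps power2_eq_square)
      also have "... = P' x * i ^ k - real k * P x * (p + c - 2 * x) * i ^ Suc k
          + r * P x * (p + c - 2 * x) * i ^ k * i\<^sup>2" by (simp add: iq)
      finally have "?R x * i ^ (k + 2) * exp (- r * i) = ... * exp (- r * i)" by (rule arg_cong)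
      then show "(P' x * inverse (q x) ^ k + - (real k * i ^ Suc k * (p + c - 2 * x)) * P x) * exp (- r * inverse (q x)) +
          exp (- r * i) * (r * i\<^sup>2 * (p + c - 2 * x)) * (P x * inverse (q x) ^ k) =
          ?R x * i ^ (k + 2) * exp (- r * i)"
        unfolding i_def[symmetric] by (simp only:) (simp add: algebra_simps)
    qed
    then have d: "((\<lambda>x. P x * inverse (q x) ^ k * exp (- r * inverse (q x))) has_real_derivative
       bump ?R (k + 2) r p c x) (at x)"
      using 2 by (simp add: bump_def i_def q_def)
    show ?thesis
    proof (rule has_field_derivative_transform_within_open[OF d])
      show "open {p<..<c}" "x \<in> {p<..<c}" using 2 by auto
      show "P y * inverse (q y) ^ k * exp (- r * inverse (q y)) = bump P k r p c y"
        if "y \<in> {p<..<c}" for y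
        using that by (simp add: bump_def q_def)
    qed
  next
    case 3
    have "(\<lambda>y. (bump P k r p c y - bump P k r p c x) / (y - x)) = bump (\<lambda>x. P x * (c - x)) (Suc k) r p c"
    proof (rule ext)
      fix y
      show "(bump P k r p c y - bump P k r p c x) / (y - x) = bump (\<lambda>x. P x * (c - x)) (Suc k) r p c y"
        using 3 quot[of "y - p" "c - y" "P y"] by (cases "p < y \<and> y < c") (auto simp: bump_def)
    qed
    moreover have "real_polynomial_function (\<lambda>x. P x * (c - x))"
      using P by (intro real_polynomial_intros)
    ultimately show ?thesis
      using bump_tendsto_0[OF e, of _ x p c "Suc k"] 3 by (simp add: has_field_derivative_iff bump_def)
  next
    case 4
    have "(\<lambda>y. (bump P k r p c y - bump P k r p c x) / (y - x)) = bump (\<lambda>x. P x * (p - x)) (Suc k) r p c"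
    proof (rule ext)
      fix y
      show "(bump P k r p c y - bump P k r p c x) / (y - x) = bump (\<lambda>x. P x * (p - x)) (Suc k) r p c y"
      proof (cases "p < y \<and> y < c")
        case True
        have e: "(y - p) * (c - y) = (y - c) * (p - y)" by (simp add: algebra_simps)
        show ?thesis using True 4 quot[of "y - c" "p - y" "P y"] by (simp add: bump_def e)
      qed (use 4 in \<open>auto simp: bump_def\<close>)
    qed
    moreover have "real_polynomial_function (\<lambda>x. P x * (p - x))"
      using P by (intro real_polynomial_intros)
    ultimately show ?thesis
      using bump_tendsto_0[OF e, of _ x p c "Suc k"] 4 by (simp add: has_field_derivative_iff bump_def)
  qed
qed

definition bumps :: "real => real => real => (real => real) set" where
  "bumps e u v = {bump P k e u v | P k. real_polynomial_function P}"

lemma bumps_derivative: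
  assumes "e > 0" "u < v" "f \<in> bumps e u v"
  obtains g where "g \<in> bumps e u v" "\<And>x. (f has_real_derivative g x) (at x)"
proof -
  obtain P k where f: "f = bump P k e u v" and P: "real_polynomial_function P"
    using assms unfolding bumps_def by auto
  obtain P' where P': "real_polynomial_function P'" "\<And>x. (P has_real_derivative P' x) (at x)"
    using has_real_derivative_polynomial_function[OF P] by blast
  have "real_polynomial_function (\<lambda>x. P' x * ((x - u) * (v - x))\<^sup>2 - real k * P x * (u + v - 2 * x) * ((x - u) * (v - x))
      + e * P x * (u + v - 2 * x))"
    by (intro real_polynomial_intros P P')
  then have "bump (\<lambda>x. P' x * ((x - u) * (v - x))\<^sup>2 - real k * P x * (u + v - 2 * x) * ((x - u) * (v - x))
      + e * P x * (u + v - 2 * x)) (k + 2) e u v \<in> bumps e u v"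
    unfolding bumps_def by blast
  then show ?thesis
    using bump_has_derivative[OF assms(1,2) P P'(2)] that unfolding f by blast
qed

text \<open>Gives smoothness without computing higher derivatives: all of them stay in the
  class.\<close>

lemma smooth_closed_classI:
  assumes "\<And>f. f \<in> S ==> \<exists>g\<in>S. \<forall>x. (f has_real_derivative g x) (at x)" "f \<in> S"
  shows "(deriv ^^ k) f differentiable (at x)"
proof -
  have "(deriv ^^ k) f \<in> S"
  proof (induction k)
    case (Suc k)
    then obtain g where "g \<in> S" "\<forall>x. ((deriv ^^ k) f has_real_derivative g x) (at x)" using assms(1) by blast
    then show ?case by (metis DERIV_imp_deriv ext funpow.simps(2) o_apply)
  qed (use assms in simp)
  then show ?thesis using assms(1) real_differentiable_def by blast
qed

lemma bumps_zero: "f \<in> bumps e u v ==> x \<notin> {u..v} ==> f x = 0"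
  unfolding bumps_def by (auto simp: bump_def)

lemma test_function_bumps:
  assumes "e > 0" "0 < u" "u < v" "v < 2*pi" "f \<in> bumps e u v"
  shows "test_function f"
  unfolding test_function_def
proof (intro conjI allI)
  show "(deriv ^^ k) f differentiable (at x)" for k x
    by (rule smooth_closed_classI[of "bumps e u v", OF _ assms(5)]) (metis bumps_derivative assms(1,3))
  show "\<exists>K. compact K \<and> K \<subseteq> {0<..<2*pi} \<and> (\<forall>x. x \<notin> K --> f x = 0)"
    using assms bumps_zero[OF assms(5)] by (intro exI[of _ "{u..v}"]) auto
qed

lemma test_function_continuous: "test_function f ==> continuous_on S f"
  unfolding test_function_def
  by (metis continuous_at_imp_continuous_on differentiable_imp_continuous_within funpow_0)

lemma test_function_deriv:
  assumes "test_function f"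
  shows "test_function (deriv f)" "(f has_real_derivative deriv f x) (at x)"
proof -
  obtain K where K: "compact K" "K \<subseteq> {0<..<2*pi}" "\<forall>x. x \<notin> K --> f x = 0"
    using assms unfolding test_function_def by blast
  have "f differentiable (at x)" for x using assms unfolding test_function_def by (metis funpow_0)
  then show d: "(f has_real_derivative deriv f x) (at x)" for x
    by (simp add: DERIV_deriv_iff_real_differentiable)
  have "deriv f x = 0" if "x \<notin> K" for x
  proof -
    have "open (- K)" using K(1) by (simp add: compact_imp_closed open_Compl)
    then have "(f has_real_derivative 0) (at x)"
      using has_field_derivative_transform_within_open[OF DERIV_const[of 0], of "- K" x f] that K by auto
    then show ?thesis by (rule DERIV_imp_deriv)
  qed
  moreover have "(deriv ^^ k) (deriv f) differentiable (at x)" for k x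
    using assms unfolding test_function_def by (metis comp_apply funpow_Suc_right)
  ultimately show "test_function (deriv f)" using K unfolding test_function_def by blast
qed

section \<open>The fundamental lemma of the calculus of variations\<close>

text \<open>Polynomials are uniformly dense among the continuous functions, so F is orthogonal to
  all of these. Bounded continuous functions approximate \<open>sgn (F x)\<close> almost everywhere,
  and dominated convergence gives that |F| has integral 0.\<close>

lemma AE_zero_if_orthogonal_polynomials:
  fixes F :: "real => real"
  assumes F: "integrable (lebesgue_on {u..v}) F"
    and o: "\<And>P. real_polynomial_function P ==> (LINT x|lebesgue_on {u..v}. F x * P x) = 0"
  shows "AE x in lebesgue_on {u..v}. F x = 0"
proof -
  let ?M = "lebesgue_on {u..v}"
  have Fm: "F \<in> borel_measurable ?M" using F by auto
  have cm: "g \<in> borel_measurable ?M" if "continuous_on UNIV g" for g :: "real => real"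
    by (rule continuous_imp_measurable_on_sets_lebesgue) (auto intro: continuous_on_subset[OF that])
  have cont: "(LINT x|?M. F x * g x) = 0" if g: "continuous_on UNIV g" "\<And>x. \<bar>g x\<bar> <= 1" for g
  proof -
    have "\<bar>LINT x|?M. F x * g x\<bar> <= e" if "e > 0" for e
    proof -
      define I where "I = (LINT x|?M. \<bar>F x\<bar>)"
      have I: "I >= 0" unfolding I_def by simp
      obtain P where P: "real_polynomial_function P" "\<And>x. x \<in> {u..v} ==> \<bar>g x - P x\<bar> < e / (I + 1)"
        using Stone_Weierstrass_real_polynomial_function[of "{u..v}" g "e / (I + 1)"]
          continuous_on_subset[OF g(1)] I \<open>e > 0\<close> by auto
      have Pc: "continuous_on UNIV P"
        using P(1) by (simp add: continuous_at_imp_continuous_on continuous_real_polymonial_function)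
      have gi: "integrable ?M (\<lambda>x. F x * h x)" if "continuous_on UNIV h" "\<And>x. x \<in> {u..v} ==> \<bar>h x\<bar> <= B" for h B
      proof (rule Bochner_Integration.integrable_bound)
        show "integrable ?M (\<lambda>x. B * F x)" using F by simp
        show "(\<lambda>x. F x * h x) \<in> borel_measurable ?M" using Fm cm[OF that(1)] by simp
        have "\<bar>F x\<bar> * \<bar>h x\<bar> <= \<bar>B\<bar> * \<bar>F x\<bar>" if "x \<in> {u..v}" for x
          using that \<open>\<And>x. x \<in> {u..v} ==> \<bar>h x\<bar> <= B\<close>[OF that]
          by (metis abs_ge_self abs_ge_zero mult.commute mult_left_mono order_trans)
        then show "AE x in ?M. norm (F x * h x) <= norm (B * F x)"
          by (intro AE_I2) (auto simp: abs_mult)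
      qed
      have 1: "integrable ?M (\<lambda>x. F x * g x)" using gi[OF g(1), of 1] g(2) by blast
      have "continuous_on UNIV (\<lambda>x. g x - P x)" using g Pc by (intro continuous_intros)
      then have 2: "integrable ?M (\<lambda>x. F x * (g x - P x))"
        by (rule gi[of _ "e / (I + 1)"]) (use P less_imp_le in blast)
      have 3: "integrable ?M (\<lambda>x. F x * P x)"
        using Bochner_Integration.integrable_diff[OF 1 2] by (simp add: algebra_simps)
      have "(LINT x|?M. F x * g x) = (LINT x|?M. F x * (g x - P x) + F x * P x)" by (simp add: algebra_simps)
      also have "... = (LINT x|?M. F x * (g x - P x))"
        using Bochner_Integration.integral_add[OF 2 3] o[OF P(1)] by simp
      also have "\<bar>...\<bar> <= (LINT x|?M. \<bar>F x\<bar> * (e / (I + 1)))"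
      proof (rule order_trans[OF integral_abs_bound], rule integral_mono_AE)
        show "AE x in ?M. \<bar>F x * (g x - P x)\<bar> <= \<bar>F x\<bar> * (e / (I + 1))"
          by (intro AE_I2) (auto simp: abs_mult simp del: times_divide_eq_right intro!: mult_left_mono less_imp_le[OF P(2)])
      qed (use F 2 in auto)
      also have "... = I * (e / (I + 1))" unfolding I_def by simp
      also have "... <= e" using I \<open>e > 0\<close> by (simp add: field_simps)
      finally show ?thesis .
    qed
    then show ?thesis by (meson abs_le_zero_iff field_le_epsilon add.left_neutral le_numeral_extra(3) dense_ge)
  qed
  have "(\<lambda>x. sgn (F x)) \<in> borel_measurable ?M" using Fm by (simp add: sgn_real_def)
  then have "(\<lambda>x. sgn (F x)) measurable_on {u..v}"
    by (simp add: measurable_on_iff_borel_measurable)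
  then obtain N g where N: "negligible N" and g: "\<And>n. continuous_on UNIV (g n)"
    and lim: "\<And>x. x \<notin> N ==> (\<lambda>n. g n x) \<longlonglongrightarrow> (if x \<in> {u..v} then sgn (F x) else 0)"
    unfolding measurable_on_def by auto
  \<comment> \<open>Truncation to [-1, 1] does not disturb the limit, which lies there, and makes
    |F| a dominating function.\<close>
  define h where "h n x = max (-1) (min 1 (g n x))" for n x
  have h: "continuous_on UNIV (h n)" for n unfolding h_def by (intro continuous_intros g)
  have h1: "\<bar>h n x\<bar> <= 1" for n x unfolding h_def by auto
  have "(\<lambda>n. LINT x|?M. F x * h n x) \<longlonglongrightarrow> (LINT x|?M. \<bar>F x\<bar>)"
  proof (rule integral_dominated_convergence[where w = "\<lambda>x. \<bar>F x\<bar>"])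
    show "(\<lambda>x. \<bar>F x\<bar>) \<in> borel_measurable ?M" using Fm by simp
    show "integrable ?M (\<lambda>x. \<bar>F x\<bar>)" using F by simp
    show "(\<lambda>x. F x * h n x) \<in> borel_measurable ?M" for n using Fm cm[OF h] by simp
    show "AE x in ?M. norm (F x * h n x) <= \<bar>F x\<bar>" for n
      using h1 by (intro AE_I2) (auto simp: abs_mult mult_left_le)
    have "AE x in lebesgue. x \<notin> N" using N by (auto simp: eventually_ae_filter_negligible)
    then have "AE x in ?M. x \<notin> N" by (subst AE_restrict_space_iff) auto
    then show "AE x in ?M. (\<lambda>n. F x * h n x) \<longlonglongrightarrow> \<bar>F x\<bar>"
    proof (rule AE_mp, intro AE_I2 impI)
      fix x assume x: "x \<in> space ?M" "x \<notin> N"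
      then have "(\<lambda>n. g n x) \<longlonglongrightarrow> sgn (F x)" using lim[OF x(2)] by (simp only: space_lebesgue_on if_True)
      then have "(\<lambda>n. h n x) \<longlonglongrightarrow> max (-1) (min 1 (sgn (F x)))"
        unfolding h_def by (intro tendsto_intros)
      also have "max (-1) (min 1 (sgn (F x))) = sgn (F x)" by (auto simp: sgn_real_def)
      finally have "(\<lambda>n. F x * h n x) \<longlonglongrightarrow> F x * sgn (F x)" by (intro tendsto_intros)
      then show "(\<lambda>n. F x * h n x) \<longlonglongrightarrow> \<bar>F x\<bar>" by (simp add: abs_sgn)
    qed
  qed
  then have "(LINT x|?M. \<bar>F x\<bar>) = 0" using cont[OF h h1] by (simp add: LIMSEQ_const_iff)
  then show ?thesis using F by (subst (asm) integral_nonneg_eq_0_iff_AE) auto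
qed

section \<open>Weak derivatives\<close>

lemma lebesgue_on_restrict_integrable:
  fixes f :: "real => real"
  assumes "S \<in> sets lebesgue"
  shows "integrable (lebesgue_on S) f \<longleftrightarrow> set_integrable lebesgue S f"
  unfolding set_integrable_def using assms by (subst integrable_restrict_space) auto

lemma AE_notin_negligible: "negligible N ==> AE x in lebesgue. x \<notin> N"
  by (simp add: negligible_iff_null_sets AE_not_in)

lemma negligible_if_AE_notin: "AE x in lebesgue. x \<notin> N ==> negligible N"
  using eventually_ae_filter_negligible negligible_subset by (metis (mono_tags, lifting) mem_Collect_eq subsetI subset_trans)

lemma locally_integrable_LI:
  assumes "integrable LI f" shows "locally_integrable f"
  unfolding locally_integrable_def
proof (intro allI impI)
  fix K :: "real set" assume K: "compact K \<and> K \<subseteq> {0<..<2*pi}"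
  then have "K \<in> sets lebesgue" by (simp add: compact_imp_closed)
  then show "integrable (lebesgue_on K) f"
    using assms K set_integrable_subset[of lebesgue "{0<..<2*pi}" f K]
    by (simp add: lebesgue_on_restrict_integrable)
qed

lemma locally_integrable_L2: "f \<in> L2 ==> locally_integrable f"
  by (simp add: L2_integrable locally_integrable_LI)

lemma AE_LI_iff: "(AE x in LI. P x) \<longleftrightarrow> (AE x in lebesgue. x \<in> {0<..<2*pi} --> P x)"
  by (subst AE_restrict_space_iff) auto

lemma locally_integrable_cong_AE:
  assumes "locally_integrable f" "AE x in LI. f x = g x"
  shows "locally_integrable g"
  unfolding locally_integrable_def
proof (intro allI impI)
  fix K :: "real set" assume K: "compact K \<and> K \<subseteq> {0<..<2*pi}"
  then have Ks: "K \<in> sets lebesgue" by (simp add: compact_imp_closed)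
  have i: "integrable (lebesgue_on K) f" using assms(1) K unfolding locally_integrable_def by blast
  have "AE x in lebesgue. x \<in> K --> f x = g x"
    using assms(2) unfolding AE_LI_iff by (rule AE_mp) (use K in \<open>auto intro!: AE_I2\<close>)
  then have ae: "AE x in lebesgue_on K. f x = g x" using Ks by (subst AE_restrict_space_iff) auto
  have gm: "g \<in> borel_measurable (lebesgue_on K)"
    using borel_measurable_LI_cong_AE[OF _ Ks ae] i by auto
  have "integrable (lebesgue_on K) f \<longleftrightarrow> integrable (lebesgue_on K) g"
    using gm i ae by (intro integrable_cong_AE) auto
  then show "integrable (lebesgue_on K) g" using i by simp
qed

lemma locally_integrable_diff:
  "locally_integrable f ==> locally_integrable g ==> locally_integrable (\<lambda>x. f x - g x)"
  unfolding locally_integrable_def by auto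

lemma locally_integrable_test_mult:
  assumes "locally_integrable f" "test_function \<phi>"
  shows "integrable LI (\<lambda>x. f x * \<phi> x)"
proof -
  obtain K where K: "compact K" "K \<subseteq> {0<..<2*pi}" "\<forall>x. x \<notin> K --> \<phi> x = 0"
    using assms(2) unfolding test_function_def by blast
  have Ks: "K \<in> sets lebesgue" using K by (simp add: compact_imp_closed)
  have i: "integrable (lebesgue_on K) f" using assms(1) K unfolding locally_integrable_def by blast
  have "bounded (\<phi> ` K)"
    using K test_function_continuous[OF assms(2)] by (intro compact_imp_bounded compact_continuous_image) auto
  then obtain B where B: "\<forall>x\<in>K. \<bar>\<phi> x\<bar> <= B" "B > 0" unfolding bounded_pos by auto
  have "integrable (lebesgue_on K) (\<lambda>x. f x * \<phi> x)"
  proof (rule Bochner_Integration.integrable_bound)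
    show "integrable (lebesgue_on K) (\<lambda>x. B * f x)" using i by simp
    have "\<phi> \<in> borel_measurable (lebesgue_on K)"
      by (rule continuous_imp_measurable_on_sets_lebesgue[OF test_function_continuous[OF assms(2)] Ks])
    then show "(\<lambda>x. f x * \<phi> x) \<in> borel_measurable (lebesgue_on K)" using i by auto
    show "AE x in lebesgue_on K. norm (f x * \<phi> x) <= norm (B * f x)"
      using B by (intro AE_I2) (auto simp: abs_mult mult.commute intro!: mult_right_mono)
  qed
  then have "integrable lebesgue (\<lambda>x. indicator K x *\<^sub>R (f x * \<phi> x))"
    using Ks by (simp add: lebesgue_on_restrict_integrable set_integrable_def)
  also have "(\<lambda>x. indicator K x *\<^sub>R (f x * \<phi> x)) = (\<lambda>x. indicator {0<..<2*pi} x *\<^sub>R (f x * \<phi> x))"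
    using K by (auto simp: fun_eq_iff indicator_def)
  finally show ?thesis by (simp add: lebesgue_on_restrict_integrable set_integrable_def)
qed

text \<open>Letting \<open>\<epsilon> \<rightarrow> 0\<close>, the bump functions tend to a polynomial on the whole of \<open>(\<alpha>, \<beta>)\<close>.\<close>

lemma AE_zero_if_orthogonal_bumps:
  assumes F: "locally_integrable F"
    and o: "\<And>\<epsilon> \<alpha> \<beta> \<phi>. \<epsilon> > 0 ==> 0 < \<alpha> ==> \<alpha> < \<beta> ==> \<beta> < 2*pi ==> \<phi> \<in> bumps \<epsilon> \<alpha> \<beta> ==>
      (LINT x|LI. F x * \<phi> x) = 0"
  shows "AE x in LI. F x = 0"
proof -
  have loc: "AE x in lebesgue. x \<in> {\<alpha>..\<beta>} --> F x = 0" if ab: "0 < \<alpha>" "\<alpha> < \<beta>" "\<beta> < 2*pi" for \<alpha> \<beta>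
  proof -
    let ?M = "lebesgue_on {\<alpha>..\<beta>}"
    have "compact {\<alpha>..\<beta>} \<and> {\<alpha>..\<beta>} \<subseteq> {0<..<2*pi}" using ab by auto
    then have Fi: "integrable ?M F" using F unfolding locally_integrable_def by blast
    have "AE x in ?M. F x = 0"
    proof (rule AE_zero_if_orthogonal_polynomials[OF Fi])
      fix P :: "real => real" assume P: "real_polynomial_function P"
      have Pc: "continuous_on {\<alpha>..\<beta>} P"
        using P by (simp add: continuous_at_imp_continuous_on continuous_real_polymonial_function)
      then have "bounded (P ` {\<alpha>..\<beta>})" by (intro compact_imp_bounded compact_continuous_image) auto
      then obtain B where B: "\<forall>x\<in>{\<alpha>..\<beta>}. \<bar>P x\<bar> <= B" "B > 0" unfolding bounded_pos by auto
      define b where "b m = bump P 0 (1 / real (Suc m)) \<alpha> \<beta>" for m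
      have bm: "b m \<in> bumps (1 / real (Suc m)) \<alpha> \<beta>" for m unfolding b_def bumps_def using P by blast
      have bt: "test_function (b m)" for m
        by (rule test_function_bumps[OF _ ab bm]) simp
      have b1: "\<bar>b m x\<bar> <= B" if "x \<in> {\<alpha>..\<beta>}" for m x
      proof -
        have "\<bar>P x\<bar> * exp (- (1 / real (Suc m)) * inverse ((x - \<alpha>) * (\<beta> - x))) <= B * 1"
          using B that by (intro mult_mono) auto
        then show ?thesis using B(2) by (auto simp: b_def bump_def abs_mult)
      qed
      have "(LINT x|?M. F x * b m x) = 0" for m
      proof -
        have "(LINT x|LI. F x * b m x) = (LINT x|lebesgue. indicator {0<..<2*pi} x *\<^sub>R (F x * b m x))"
          by (subst integral_restrict_space) auto
        also have "(\<lambda>x. indicator {0<..<2*pi} x *\<^sub>R (F x * b m x)) = (\<lambda>x. indicator {\<alpha>..\<beta>} x *\<^sub>R (F x * b m x))"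
          using ab bumps_zero[OF bm] by (fastforce simp: fun_eq_iff indicator_def)
        also have "(LINT x|lebesgue. indicator {\<alpha>..\<beta>} x *\<^sub>R (F x * b m x)) = (LINT x|?M. F x * b m x)"
          by (subst integral_restrict_space) auto
        finally show ?thesis using o[OF _ ab bm] by simp
      qed
      moreover have "(\<lambda>m. LINT x|?M. F x * b m x) \<longlonglongrightarrow> (LINT x|?M. F x * P x)"
      proof (rule integral_dominated_convergence[where w = "\<lambda>x. B * \<bar>F x\<bar>"])
        have Pm: "P \<in> borel_measurable ?M" by (rule continuous_imp_measurable_on_sets_lebesgue[OF Pc]) simp
        show "(\<lambda>x. F x * P x) \<in> borel_measurable ?M" using Fi Pm by auto
        have "b m \<in> borel_measurable ?M" for m
          by (rule continuous_imp_measurable_on_sets_lebesgue[OF test_function_continuous[OF bt]]) simp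
        then show "(\<lambda>x. F x * b m x) \<in> borel_measurable ?M" for m using Fi by auto
        show "integrable ?M (\<lambda>x. B * \<bar>F x\<bar>)" using Fi by simp
        show "AE x in ?M. norm (F x * b m x) <= B * \<bar>F x\<bar>" for m
        proof (rule AE_I2)
          fix x assume "x \<in> space ?M"
          then have "\<bar>b m x\<bar> * \<bar>F x\<bar> <= B * \<bar>F x\<bar>" using b1 by (intro mult_right_mono) auto
          then show "norm (F x * b m x) <= B * \<bar>F x\<bar>" by (simp add: abs_mult mult.commute)
        qed
        have "negligible {\<alpha>, \<beta>}" by simp
        then have "AE x in lebesgue. x \<notin> {\<alpha>, \<beta>}" by (rule AE_notin_negligible)
        then have "AE x in ?M. x \<notin> {\<alpha>, \<beta>}" by (subst AE_restrict_space_iff) auto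
        then show "AE x in ?M. (\<lambda>m. F x * b m x) \<longlonglongrightarrow> F x * P x"
        proof (rule AE_mp, intro AE_I2 impI)
          fix x assume "x \<in> space ?M" "x \<notin> {\<alpha>, \<beta>}"
          then have x: "\<alpha> < x" "x < \<beta>" by auto
          have "(\<lambda>m. P x * exp (- (1 / real (Suc m)) * inverse ((x - \<alpha>) * (\<beta> - x)))) \<longlonglongrightarrow> P x * exp (- 0 * inverse ((x - \<alpha>) * (\<beta> - x)))"
            by (intro tendsto_intros LIMSEQ_Suc[OF lim_1_over_n])
          then have "(\<lambda>m. b m x) \<longlonglongrightarrow> P x" using x by (simp add: b_def bump_def)
          then show "(\<lambda>m. F x * b m x) \<longlonglongrightarrow> F x * P x" by (intro tendsto_intros)
        qed
      qed
      ultimately show "(LINT x|?M. F x * P x) = 0" by (simp add: LIMSEQ_const_iff)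
    qed
    then show ?thesis by (subst (asm) AE_restrict_space_iff) auto
  qed
  \<comment> \<open>Countably many compact intervals exhaust (0, 2 pi); local integrability gives
    integrability on each of them.\<close>
  have "AE x in lebesgue. \<forall>m. x \<in> {1 / real (m + 1) .. 2*pi - 1 / real (m + 1)} --> F x = 0"
    unfolding AE_all_countable
  proof
    fix m
    have "1 / real (m + 1) <= 1" by simp
    then have "1 / real (m + 1) < 2*pi - 1 / real (m + 1)" using pi_gt3 by linarith
    then show "AE x in lebesgue. x \<in> {1 / real (m + 1) .. 2*pi - 1 / real (m + 1)} --> F x = 0"
      by (intro loc) auto
  qed
  then show ?thesis unfolding AE_LI_iff
  proof (rule AE_mp, intro AE_I2 impI)
    fix x assume *: "\<forall>m. x \<in> {1 / real (m + 1) .. 2*pi - 1 / real (m + 1)} --> F x = 0"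
      and x: "x \<in> {0<..<2*pi}"
    obtain m where m: "1 / real (Suc m) < min x (2*pi - x)"
      using x reals_Archimedean[of "min x (2*pi - x)"] by (auto simp: inverse_eq_divide)
    then have "x \<in> {1 / real (m + 1) .. 2*pi - 1 / real (m + 1)}" by auto
    then show "F x = 0" using * by blast
  qed
qed

lemma has_weak_deriv_unique:
  assumes "has_weak_deriv k f g" "has_weak_deriv k f h"
  shows "AE x in LI. g x = h x"
proof -
  have li: "locally_integrable g" "locally_integrable h" using assms unfolding has_weak_deriv_def by auto
  have "AE x in LI. g x - h x = 0"
  proof (rule AE_zero_if_orthogonal_bumps[OF locally_integrable_diff[OF li]])
    fix e u v :: real and p assume "e > 0" "0 < u" "u < v" "v < 2*pi" "p \<in> bumps e u v"
    then have t: "test_function p" by (rule test_function_bumps)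
    have "(LINT x|LI. f x * (deriv ^^ k) p x) = (-1) ^ k * (LINT x|LI. g x * p x)"
      "(LINT x|LI. f x * (deriv ^^ k) p x) = (-1) ^ k * (LINT x|LI. h x * p x)"
      using assms t unfolding has_weak_deriv_def by blast+
    then have "(LINT x|LI. g x * p x) = (LINT x|LI. h x * p x)" by simp
    then show "(LINT x|LI. (g x - h x) * p x) = 0"
      using locally_integrable_test_mult[OF li(1) t] locally_integrable_test_mult[OF li(2) t]
      by (simp add: left_diff_distrib)
  qed
  then show ?thesis by simp
qed

lemma ac_C1:
  assumes "\<And>x. x \<in> J ==> (f has_real_derivative f' x) (at x within J)" "continuous_on J f'"
  shows "ac f f'"
proof (rule acI)
  show "f' \<in> L2" using assms(2) by (rule L2_continuous)
  fix x assume x: "x \<in> J"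
  have "(f' has_integral (f x - f 0)) {0..x}"
  proof (rule fundamental_theorem_of_calculus)
    fix y assume "y \<in> {0..x}"
    then have "(f has_vector_derivative f' y) (at y within J)"
      using assms(1)[of y] x by (simp add: has_real_derivative_iff_has_vector_derivative)
    then show "(f has_vector_derivative f' y) (at y within {0..x})"
      by (rule has_vector_derivative_within_subset) (use x in auto)
  qed (use x in auto)
  then show "f x - f 0 = integral {0..x} f'" by (simp add: integral_unique)
qed

lemma ac_test: assumes "test_function f" shows "ac f (deriv f)"
  using test_function_deriv[OF assms] test_function_continuous
  by (intro ac_C1) (auto intro: has_field_derivative_at_within)

lemma test_function_ends: "test_function f ==> f 0 = 0 \<and> f (2*pi) = 0"
  unfolding test_function_def by auto

text \<open>The product with a test function is absolutely continuous and vanishes at 0 and 2 pi, so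
  integrating the product rule is integration by parts. \<open>f1\<close> is any member of the class
  of \<open>f\<close>.\<close>

lemma ac_weak:
  assumes "ac f g" "AE x in LI. f x = f1 x"
  shows "has_weak_deriv 1 f1 g"
  unfolding has_weak_deriv_def
proof (intro conjI allI impI)
  show "locally_integrable f1"
    using locally_integrable_cong_AE[OF locally_integrable_L2[OF ac_self_L2[OF assms(1)]] assms(2)] .
  show "locally_integrable g" using assms(1) ac_L2 locally_integrable_L2 by blast
  fix h assume t: "test_function h"
  note p = ac_mult[OF assms(1) ac_test[OF t]]
  have i: "integrable LI (\<lambda>x. g x * h x)" "integrable LI (\<lambda>x. f x * deriv h x)"
    using locally_integrable_test_mult[OF _ t, of g] locally_integrable_test_mult[OF _ test_function_deriv(1)[OF t], of f]
      locally_integrable_L2 ac_L2[OF assms(1)] ac_self_L2[OF assms(1)] by auto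
  have "integral J (\<lambda>x. g x * h x + f x * deriv h x) = 0"
    using ac_increment[OF p, of 0 "2*pi"] test_function_ends[OF t] by simp
  then have "(LINT x|LI. g x * h x) + (LINT x|LI. f x * deriv h x) = 0"
    using LINT_LI_eq[OF Bochner_Integration.integrable_add[OF i]] i by simp
  moreover have "(LINT x|LI. f1 x * deriv h x) = (LINT x|LI. f x * deriv h x)"
  proof (rule integral_cong_AE)
    show "AE x in LI. f1 x * deriv h x = f x * deriv h x" using assms(2) by (rule AE_mp) (auto intro!: AE_I2)
    then have "AE x in LI. f x * deriv h x = f1 x * deriv h x" by (rule AE_mp) (auto intro!: AE_I2)
    then show "(\<lambda>x. f1 x * deriv h x) \<in> borel_measurable LI"
      using borel_measurable_LI_cong_AE[of "\<lambda>x. f x * deriv h x" "{0<..<2*pi}"] i(2) by auto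
  qed (use i in auto)
  ultimately show "(LINT x|LI. f1 x * (deriv ^^ 1) h x) = (- 1) ^ 1 * (LINT x|LI. g x * h x)" by simp
qed

text \<open>The derivative of a test function has integral 0, hence the correction of
  \<open>f\<close> by a multiple of \<open>g\<close>. The primitive then vanishes on both sides of
  the two supports and is again a test function.\<close>

lemma bumps_antiderivative_smooth:
  assumes "e > 0" "e' > 0" "0 < p" "p < q" "q < 2*pi" "0 < p'" "p' < q'" "q' < 2*pi"
    and f: "f \<in> bumps e p q" and g: "g \<in> bumps e' p' q'"
    and z: "integral J (\<lambda>x. f x - c * g x) = 0"
  obtains F where "test_function F" "\<And>x. deriv F x = f x - c * g x"
proof
  define h where "h = (\<lambda>x. f x - c * g x)"
  \<comment> \<open>The lower limit -1 lies to the left of the supports and keeps every x >= 0 in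
    the interior of the interval of integration, so that derivatives there are two-sided.\<close>
  define F where "F = (\<lambda>x. integral {-1..x} h)"
  define a where "a = min p p'"
  define b where "b = max q q'"
  have ab: "0 < a" "a < b" "b < 2*pi" unfolding a_def b_def using assms by auto
  have h0: "h x = 0" if "x \<notin> {a..b}" for x
  proof -
    have "x \<notin> {p..q}" "x \<notin> {p'..q'}" using that by (auto simp: a_def b_def)
    then show ?thesis using bumps_zero[OF f, of x] bumps_zero[OF g, of x] by (simp add: h_def)
  qed
  define S where "S = {\<lambda>x. u x - c * v x | u v. u \<in> bumps e p q \<and> v \<in> bumps e' p' q'}"
  have Sd: "\<exists>g\<in>S. \<forall>x. (f has_real_derivative g x) (at x)" if fS: "f \<in> S" for f
  proof -
    obtain u v where uv: "u \<in> bumps e p q" "v \<in> bumps e' p' q'" "f = (\<lambda>x. u x - c * v x)"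
      using fS unfolding S_def by blast
    obtain u' where u': "u' \<in> bumps e p q" "\<And>x. (u has_real_derivative u' x) (at x)"
      using bumps_derivative[OF assms(1,4) uv(1)] by blast
    obtain v' where v': "v' \<in> bumps e' p' q'" "\<And>x. (v has_real_derivative v' x) (at x)"
      using bumps_derivative[OF assms(2,7) uv(2)] by blast
    have "(f has_real_derivative u' x - c * v' x) (at x)" for x
      unfolding uv(3) by (intro DERIV_diff u' DERIV_cmult v')
    moreover have "(\<lambda>x. u' x - c * v' x) \<in> S" using u'(1) v'(1) unfolding S_def by blast
    ultimately show ?thesis by (intro bexI[of _ "\<lambda>x. u' x - c * v' x"]) auto
  qed
  have hS: "h \<in> S" unfolding h_def S_def using f g by blast
  have sm: "(deriv ^^ k) h differentiable (at x)" for k x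
    by (rule smooth_closed_classI[OF Sd hS])
  have hc: "continuous_on T h" for T
    using sm[of 0] by (auto intro!: continuous_at_imp_continuous_on differentiable_imp_continuous_within)
  have F': "(F has_real_derivative h x) (at x)" for x
  proof (cases "x < 0")
    case True
    have "F y = 0" if "y \<in> {..<0}" for y
    proof -
      have "integral {-1..y} h = integral {-1..y} (\<lambda>_. 0)"
        using that ab h0 by (intro Henstock_Kurzweil_Integration.integral_cong) auto
      then show ?thesis unfolding F_def by simp
    qed
    then have "(F has_real_derivative 0) (at x)"
      using True by (intro has_field_derivative_transform_within_open[OF DERIV_const[of 0 "at x"], of "{..<0}"]) auto
    then show ?thesis using h0[of x] True ab by simp
  next
    case False
    have "(F has_real_derivative h x) (at x within {-1..x+1})"
      unfolding F_def using False by (intro integral_has_real_derivative hc) auto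
    then have "(F has_real_derivative h x) (at x within {-1<..<x+1})"
      by (rule DERIV_subset) auto
    moreover have "x \<in> {-1<..<x+1}" "open {-1<..<x+1}" using False by auto
    ultimately show ?thesis using at_within_open[of x "{-1<..<x+1}"] by simp
  qed
  then have d: "deriv F = h" by (auto intro: DERIV_imp_deriv)
  then show "deriv F x = f x - c * g x" for x by (simp add: h_def)
  have int: "h integrable_on {x..y}" for x y by (intro integrable_continuous_real hc)
  have p0: "F x = 0" if "x < a" for x
  proof -
    have "integral {-1..x} h = integral {-1..x} (\<lambda>_. 0)"
      using that h0 by (intro Henstock_Kurzweil_Integration.integral_cong) auto
    then show ?thesis unfolding F_def by simp
  qed
  have Z: "integral {-1..2*pi} h = 0"
  proof -
    have "integral {-1..0} h + integral J h = integral {-1..2*pi} h"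
      by (intro Henstock_Kurzweil_Integration.integral_combine int) auto
    then show ?thesis using p0[of 0] ab z unfolding F_def h_def by simp
  qed
  have p1: "F x = 0" if "x > b" for x
  proof -
    have *: "integral {u..v} h = 0" if "u > b" for u v
    proof -
      have "integral {u..v} h = integral {u..v} (\<lambda>_. 0)"
        using that h0 by (intro Henstock_Kurzweil_Integration.integral_cong) auto
      then show ?thesis by simp
    qed
    show ?thesis
    proof (cases "x <= 2*pi")
      case True
      have "integral {-1..x} h + integral {x..2*pi} h = integral {-1..2*pi} h"
        using True that ab by (intro Henstock_Kurzweil_Integration.integral_combine int) auto
      then show ?thesis using Z *[OF that] unfolding F_def by simp
    next
      case False
      have "integral {-1..2*pi} h + integral {2*pi..x} h = integral {-1..x} h"
        using False by (intro Henstock_Kurzweil_Integration.integral_combine int) (auto intro: order_trans[of _ 0])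
      then show ?thesis using Z *[of "2*pi"] ab unfolding F_def by simp
    qed
  qed
  show "test_function F" unfolding test_function_def
  proof (intro conjI allI)
    show "(deriv ^^ k) F differentiable (at x)" for k x
    proof (cases k)
      case 0
      then show ?thesis using F' real_differentiable_def by auto
    next
      case (Suc j)
      then show ?thesis using sm[of j x] d by (simp add: funpow_Suc_right del: funpow.simps)
    qed
    show "\<exists>K. compact K \<and> K \<subseteq> {0<..<2*pi} \<and> (\<forall>x. x \<notin> K --> F x = 0)"
      using ab p0 p1 by (intro exI[of _ "{a..b}"]) (auto simp: not_le)
  qed
qed

text \<open>The du Bois-Reymond lemma. A bump minus the multiple of the fixed bump \<open>h\<close>
  with the same integral is the derivative of a test function, so F sees a bump only through its
  integral, and \<open>F - k\<close> is orthogonal to all bumps.\<close>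

lemma weak_deriv_zero_imp_const:
  assumes F: "F \<in> L2" and o: "\<And>f. test_function f ==> (LINT x|LI. F x * deriv f x) = 0"
  obtains k where "AE x in LI. F x = k"
proof -
  define h where "h = bump (\<lambda>_. 1) 0 1 1 2"
  have h: "h \<in> bumps 1 1 2" unfolding h_def bumps_def
    by (auto intro!: exI[of _ "\<lambda>_::real. 1::real"] real_polynomial_function.intros)
  have two: "(2::real) < 2*pi" using pi_gt3 by linarith
  have ht: "test_function h" by (rule test_function_bumps[OF _ _ _ two h]) auto
  have ii: "integrable LI (\<lambda>x. F x * f x)" "integrable LI f" if "test_function f" for f
    using locally_integrable_test_mult[OF locally_integrable_L2[OF F] that]
      locally_integrable_test_mult[OF locally_integrable_L2[OF L2_const[of 1]] that] by auto
  define E where "E = (LINT x|LI. h x)"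
  have h0: "h x >= 0" for x unfolding h_def by (simp add: bump_def)
  have E: "E \<noteq> 0"
  proof
    assume "E = 0"
    then have "AE x in LI. h x = 0" unfolding E_def using h0 ii(2)[OF ht]
      by (subst (asm) integral_nonneg_eq_0_iff_AE) auto
    then have "AE x in lebesgue. x \<notin> {1<..<2::real}" unfolding AE_LI_iff
      by (rule AE_mp) (use two in \<open>auto intro!: AE_I2 simp: h_def bump_def\<close>)
    then have "negligible (box 1 (2::real))" by (intro negligible_if_AE_notin) simp
    then show False by (simp only: negligible_interval(2)) simp
  qed
  define k where "k = (LINT x|LI. F x * h x) / E"
  have "AE x in LI. F x - k = 0"
  proof (rule AE_zero_if_orthogonal_bumps)
    show "locally_integrable (\<lambda>x. F x - k)" by (intro locally_integrable_L2 L2_diff F L2_const)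
    fix e u v :: real and f assume a: "e > 0" "0 < u" "u < v" "v < 2*pi" "f \<in> bumps e u v"
    then have t: "test_function f" by (rule test_function_bumps)
    define c where "c = (LINT x|LI. f x) / E"
    have i: "integrable LI (\<lambda>x. f x - c * h x)" using ii(2)[OF t] ii(2)[OF ht] by simp
    have "(LINT x|LI. f x - c * h x) = 0"
      using ii(2)[OF t] ii(2)[OF ht] E by (simp add: c_def E_def)
    then have "integral J (\<lambda>x. f x - c * h x) = 0" using LINT_LI_eq[OF i] by simp
    then obtain H where H: "test_function H" "\<And>x. deriv H x = f x - c * h x"
      using bumps_antiderivative_smooth[OF a(1) zero_less_one a(2-4) zero_less_one _ two a(5) h] by auto
    have "(LINT x|LI. F x * (f x - c * h x)) = 0" using o[OF H(1)] H(2) by simp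
    then have "(LINT x|LI. F x * f x) - c * (LINT x|LI. F x * h x) = 0"
      using ii[OF t] ii[OF ht] by (simp add: right_diff_distrib mult.left_commute)
    moreover have "c * (LINT x|LI. F x * h x) = k * (LINT x|LI. f x)" unfolding c_def k_def by simp
    ultimately show "(LINT x|LI. (F x - k) * f x) = 0" using ii[OF t] by (simp add: left_diff_distrib)
  qed
  then show ?thesis using that by simp
qed

text \<open>Subtracting a primitive of \<open>g\<close> from \<open>f\<close> leaves a function with
  weak derivative 0, that is, a constant almost everywhere.\<close>

lemma weak_ac:
  assumes f: "f \<in> L2" and g: "g \<in> L2" and w: "has_weak_deriv 1 f g"
  obtains f1 where "ac f1 g" "AE x in LI. f x = f1 x"
proof -
  define G where "G = (\<lambda>x. integral {0..x} g)"
  have G: "ac G g" unfolding G_def by (rule ac_indefinite[OF g])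
  have GL: "G \<in> L2" by (rule ac_self_L2[OF G])
  obtain m where k: "AE x in LI. f x - G x = m"
  proof (rule weak_deriv_zero_imp_const[OF L2_diff[OF f GL]])
    fix p assume t: "test_function p"
    note t' = test_function_deriv(1)[OF t]
    have "(LINT x|LI. f x * deriv p x) = (LINT x|LI. G x * deriv p x)"
      using w ac_weak[OF G AE_I2] t unfolding has_weak_deriv_def by simp
    then show "(LINT x|LI. (f x - G x) * deriv p x) = 0"
      using locally_integrable_test_mult[OF locally_integrable_L2[OF f] t']
        locally_integrable_test_mult[OF locally_integrable_L2[OF GL] t'] by (simp add: left_diff_distrib)
  qed
  have "ac (\<lambda>x. m + G x) g" using ac_add[OF ac_const[of m] G] by simp
  moreover have "AE x in LI. f x = m + G x" using k by (rule AE_mp) (auto intro!: AE_I2)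
  ultimately show ?thesis by (rule that)
qed

lemma has_weak_deriv_cong_AE:
  assumes "AE x in LI. f x = g x" "has_weak_deriv k f h" shows "has_weak_deriv k g h"
proof -
  have li: "locally_integrable g" "locally_integrable h" "locally_integrable f"
    using assms locally_integrable_cong_AE unfolding has_weak_deriv_def by auto
  have "(LINT x|LI. g x * (deriv ^^ k) p x) = (LINT x|LI. f x * (deriv ^^ k) p x)" if t: "test_function p" for p
  proof -
    have t': "test_function ((deriv ^^ k) p)"
      by (induction k) (use t test_function_deriv in auto)
    show ?thesis
    proof (rule integral_cong_AE)
      show "AE x in LI. g x * (deriv ^^ k) p x = f x * (deriv ^^ k) p x"
        using assms(1) by (rule AE_mp) (auto intro!: AE_I2)
    qed (use locally_integrable_test_mult[OF li(1) t'] locally_integrable_test_mult[OF li(3) t'] in auto)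
  qed
  then show ?thesis using assms(2) li unfolding has_weak_deriv_def by simp
qed

lemma AE_eq_sym: "AE x in M. f x = g x ==> AE x in M. g x = f x"
  by (simp add: eq_commute)

lemma AE_eq_trans: "AE x in M. f x = g x ==> AE x in M. g x = h x ==> AE x in M. f x = h x"
  by auto

text \<open>An identity of functions, not only almost everywhere: the choice operator in
  \<open>weak_deriv\<close> is applied to the same predicate on both sides. This permits rewriting
  inside iterated derivatives.\<close>

lemma weak_deriv_cong_AE:
  assumes "AE x in LI. f x = g x" shows "weak_deriv k f = weak_deriv k g"
proof -
  have "has_weak_deriv k f = has_weak_deriv k g"
    by (intro ext iffI) (erule has_weak_deriv_cong_AE[OF assms] has_weak_deriv_cong_AE[OF AE_eq_sym[OF assms]])+
  then show ?thesis by (simp add: weak_deriv_def)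
qed

lemma has_weak_deriv_cong_AE_right:
  assumes "has_weak_deriv k f g" "AE x in LI. g x = h x" shows "has_weak_deriv k f h"
proof -
  have li: "locally_integrable f" "locally_integrable g" "locally_integrable h"
    using assms locally_integrable_cong_AE unfolding has_weak_deriv_def by auto
  have "(LINT x|LI. g x * p x) = (LINT x|LI. h x * p x)" if t: "test_function p" for p
  proof (rule integral_cong_AE)
    show "AE x in LI. g x * p x = h x * p x"
      using assms(2) by (rule AE_mp) (auto intro!: AE_I2)
  qed (use locally_integrable_test_mult[OF li(2) t] locally_integrable_test_mult[OF li(3) t] in auto)
  then show ?thesis using assms(1) li unfolding has_weak_deriv_def by simp
qed

lemma weak_deriv_AE: "has_weak_deriv k f g ==> AE x in LI. weak_deriv k f x = g x"
  using has_weak_deriv_unique someI[of "has_weak_deriv k f" g] unfolding weak_deriv_def by blast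

lemma has_weak_deriv_0: "locally_integrable f ==> has_weak_deriv 0 f f"
  unfolding has_weak_deriv_def by simp

lemma has_weak_deriv_Suc:
  assumes "has_weak_deriv k f g" "has_weak_deriv 1 g h" shows "has_weak_deriv (Suc k) f h"
  unfolding has_weak_deriv_def
proof (intro conjI allI impI)
  fix p assume t: "test_function p"
  have "(LINT x|LI. f x * (deriv ^^ Suc k) p x) = (LINT x|LI. f x * (deriv ^^ k) (deriv p) x)"
    by (simp add: funpow_swap1)
  also have "... = (-1) ^ k * (LINT x|LI. g x * deriv p x)"
    using assms(1) test_function_deriv(1)[OF t] unfolding has_weak_deriv_def by blast
  also have "(LINT x|LI. g x * deriv p x) = - (LINT x|LI. h x * p x)"
    using assms(2) t unfolding has_weak_deriv_def by simp
  finally show "(LINT x|LI. f x * (deriv ^^ Suc k) p x) = (-1) ^ Suc k * (LINT x|LI. h x * p x)" by simp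
qed (use assms in \<open>auto simp: has_weak_deriv_def\<close>)

text \<open>Membership in \<open>sobolev\<close> provides weak derivatives of each order separately.
  Together with \<open>has_weak_deriv_Suc\<close> this links consecutive orders by a first order
  derivative, so that iterated \<open>wd\<close> can be used instead
  (\<open>Hk_one_iff\<close>).\<close>

lemma has_weak_deriv_SucD:
  assumes "has_weak_deriv k f g" "has_weak_deriv (Suc k) f h" shows "has_weak_deriv 1 g h"
  unfolding has_weak_deriv_def
proof (intro conjI allI impI)
  fix p assume t: "test_function p"
  have "(-1) ^ k * (LINT x|LI. g x * deriv p x) = (LINT x|LI. f x * (deriv ^^ k) (deriv p) x)"
    using assms(1) test_function_deriv(1)[OF t] unfolding has_weak_deriv_def by simp
  also have "... = (LINT x|LI. f x * (deriv ^^ Suc k) p x)" by (simp add: funpow_swap1)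
  also have "... = (-1) ^ Suc k * (LINT x|LI. h x * p x)"
    using assms(2) t unfolding has_weak_deriv_def by blast
  finally have "(-1) ^ k * ((LINT x|LI. g x * deriv p x) + (LINT x|LI. h x * p x)) = 0"
    by (simp add: distrib_left)
  then have "(LINT x|LI. g x * deriv p x) + (LINT x|LI. h x * p x) = 0" by simp
  then show "(LINT x|LI. g x * (deriv ^^ 1) p x) = (-1) ^ 1 * (LINT x|LI. h x * p x)" by simp
qed (use assms in \<open>auto simp: has_weak_deriv_def\<close>)

section \<open>The space H^1 and its product rule\<close>

definition H1 :: "(real => real) => bool" where
  "H1 f \<longleftrightarrow> f \<in> L2 \<and> (\<exists>g\<in>L2. has_weak_deriv 1 f g)"

abbreviation wd :: "(real => real) => real => real" where "wd \<equiv> weak_deriv 1"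

lemma H1_L2: "H1 f ==> f \<in> L2"
  by (simp add: H1_def)

lemma H1_wd: assumes "H1 f" shows "has_weak_deriv 1 f (wd f)" "wd f \<in> L2"
proof -
  obtain g where g: "g \<in> L2" "has_weak_deriv 1 f g" using assms unfolding H1_def by blast
  have ae: "AE x in LI. g x = wd f x" by (rule AE_eq_sym[OF weak_deriv_AE[OF g(2)]])
  show "wd f \<in> L2" by (rule L2_cong_AE[OF g(1) ae])
  show "has_weak_deriv 1 f (wd f)" by (rule has_weak_deriv_cong_AE_right[OF g(2) ae])
qed

lemma H1_ac:
  assumes "H1 f"
  obtains f1 where "ac f1 (wd f)" "AE x in LI. f x = f1 x"
  using weak_ac[OF H1_L2[OF assms] H1_wd(2,1)[OF assms]] by blast

lemma ac_H1:
  assumes "ac f1 g" "AE x in LI. f x = f1 x"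
  shows "H1 f" "AE x in LI. wd f x = g x"
proof -
  have w: "has_weak_deriv 1 f g" by (rule ac_weak[OF assms(1) AE_eq_sym[OF assms(2)]])
  show "AE x in LI. wd f x = g x" by (rule weak_deriv_AE[OF w])
  have "f \<in> L2" using L2_cong_AE[OF ac_self_L2[OF assms(1)] AE_eq_sym[OF assms(2)]] .
  then show "H1 f" using w ac_L2[OF assms(1)] unfolding H1_def by blast
qed

lemma ac_imp_H1: "ac f g ==> H1 f" "ac f g ==> AE x in LI. wd f x = g x"
  using ac_H1[of f g f] by auto

lemma H1_cong_AE: "H1 f ==> AE x in LI. f x = g x ==> H1 g"
  unfolding H1_def using L2_cong_AE has_weak_deriv_cong_AE by blast

lemma continuous_AE_eq:
  fixes f g :: "real => real"
  assumes "continuous_on J f" "continuous_on J g" "AE x in LI. f x = g x" "x \<in> J"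
  shows "f x = g x"
proof (rule ccontr)
  assume ne: "f x \<noteq> g x"
  have "continuous_on J (\<lambda>x. f x - g x)" using assms by (intro continuous_intros)
  then obtain d where d: "d > 0" "\<And>y. y \<in> J ==> dist y x < d ==> dist (f y - g y) (f x - g x) < \<bar>f x - g x\<bar>"
    using assms(4) ne unfolding continuous_on_iff by (metis right_minus_eq zero_less_abs_iff)
  define a where "a = max 0 (x - d)"
  define b where "b = min (2*pi) (x + d)"
  have ab: "a < b" using assms(4) d(1) pi_gt_zero unfolding a_def b_def by auto
  have "f y \<noteq> g y" if "y \<in> {a<..<b}" for y
  proof -
    have "y \<in> J" "dist y x < d" using that unfolding a_def b_def by (auto simp: dist_real_def abs_if)
    from d(2)[OF this] show ?thesis by (auto simp: dist_real_def)
  qed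
  note ne = this
  have "AE y in lebesgue. y \<notin> {a<..<b}"
    using assms(3)[unfolded AE_LI_iff]
  proof eventually_elim
    case (elim y)
    show ?case
    proof
      assume y: "y \<in> {a<..<b}"
      then have "y \<in> {0<..<2*pi}" by (auto simp: a_def b_def)
      then show False using elim ne[OF y] by blast
    qed
  qed
  then have "negligible (box a b)" by (intro negligible_if_AE_notin) simp
  then show False using ab by (simp only: negligible_interval(2)) simp
qed

lemma H1_continuous_ac:
  assumes "H1 f" "continuous_on J f" shows "ac f (wd f)"
proof -
  obtain f1 where f1: "ac f1 (wd f)" "AE x in LI. f x = f1 x" using H1_ac[OF assms(1)] .
  show ?thesis
    by (rule ac_cong_AE[OF f1(1)]) (use continuous_AE_eq[OF ac_continuous[OF f1(1)] assms(2) AE_eq_sym[OF f1(2)]] in auto)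
qed

lemma H1_lin:
  assumes "H1 f" "H1 g"
  shows "H1 (\<lambda>x. a * f x + b * g x)" "AE x in LI. wd (\<lambda>x. a * f x + b * g x) x = a * wd f x + b * wd g x"
proof -
  obtain f1 where f1: "ac f1 (wd f)" "AE x in LI. f x = f1 x" using H1_ac[OF assms(1)] .
  obtain g1 where g1: "ac g1 (wd g)" "AE x in LI. g x = g1 x" using H1_ac[OF assms(2)] .
  have "AE x in LI. a * f x + b * g x = a * f1 x + b * g1 x" using f1(2) g1(2) by eventually_elim simp
  from ac_H1[OF ac_add[OF ac_cmult[OF f1(1), of a] ac_cmult[OF g1(1), of b]] this]
  show "H1 (\<lambda>x. a * f x + b * g x)" "AE x in LI. wd (\<lambda>x. a * f x + b * g x) x = a * wd f x + b * wd g x" .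
qed

lemma H1_mult:
  assumes "H1 f" "H1 g"
  shows "H1 (\<lambda>x. f x * g x)" "AE x in LI. wd (\<lambda>x. f x * g x) x = wd f x * g x + f x * wd g x"
proof -
  obtain f1 where f1: "ac f1 (wd f)" "AE x in LI. f x = f1 x" using H1_ac[OF assms(1)] .
  obtain g1 where g1: "ac g1 (wd g)" "AE x in LI. g x = g1 x" using H1_ac[OF assms(2)] .
  have "AE x in LI. f x * g x = f1 x * g1 x" using f1(2) g1(2) by eventually_elim simp
  note * = ac_H1[OF ac_mult[OF f1(1) g1(1)] this]
  show "H1 (\<lambda>x. f x * g x)" by (rule *(1))
  show "AE x in LI. wd (\<lambda>x. f x * g x) x = wd f x * g x + f x * wd g x"
    using *(2) f1(2) g1(2) by eventually_elim simp
qed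

lemma H1_const [simp]: "H1 (\<lambda>x. c)" and wd_const: "AE x in LI. wd (\<lambda>x. c) x = 0"
  using ac_imp_H1[OF ac_const[of c]] by auto

section \<open>Arc length derivatives with respect to a weight\<close>

text \<open>The weight \<open>w\<close> stands for the speed of a curve, or for the constant 1; one
  theory then serves both the metric and the H^n norm.\<close>

definition ad :: "(real => real) => (real => real) => real => real" where
  "ad w f x = 1 / w x * wd f x"

text \<open>The recursion peels off the innermost derivative, which suits inductions by the product
  rule; \<open>Hk_iff\<close> gives the equivalent form with powers of \<open>ad w\<close>.\<close>

fun Hk :: "(real => real) => nat => (real => real) => bool" where
  "Hk w 0 f \<longleftrightarrow> f \<in> L2"
| "Hk w (Suc k) f \<longleftrightarrow> H1 f \<and> Hk w k (ad w f)"

lemma ad_cong_AE: "AE x in LI. f x = g x ==> ad w f = ad w g"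
  using weak_deriv_cong_AE[of f g 1] by (simp add: ad_def fun_eq_iff)

lemma Hk_L2: "Hk w k f ==> f \<in> L2"
  by (cases k) (auto simp: H1_L2)

lemma Hk_cong_AE: "Hk w k f ==> AE x in LI. f x = g x ==> Hk w k g"
  using ad_cong_AE[of f g w] by (cases k) (auto intro: L2_cong_AE H1_cong_AE)

lemma Hk_Suc_imp: "Hk w (Suc k) f ==> Hk w k f"
  by (induction k arbitrary: f) (auto simp: H1_L2)

lemma Hk_mono: "Hk w k f ==> j <= k ==> Hk w j f"
proof (induction k)
  case (Suc k)
  then show ?case using Hk_Suc_imp[of w k f] by (cases "j = Suc k") (auto simp del: Hk.simps)
qed simp

lemma Hk_iff: "Hk w n f \<longleftrightarrow> (\<forall>k\<le>n. (ad w ^^ k) f \<in> L2) \<and> (\<forall>k<n. H1 ((ad w ^^ k) f))"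
proof (induction n arbitrary: f)
  case (Suc n)
  have "Hk w (Suc n) f \<longleftrightarrow> H1 f \<and> (\<forall>k\<le>n. (ad w ^^ Suc k) f \<in> L2) \<and> (\<forall>k<n. H1 ((ad w ^^ Suc k) f))"
    unfolding Hk.simps(2) Suc by (simp add: funpow_swap1)
  moreover have "(\<forall>k\<le>Suc n. (ad w ^^ k) f \<in> L2) \<longleftrightarrow> f \<in> L2 \<and> (\<forall>k\<le>n. (ad w ^^ Suc k) f \<in> L2)"
    using All_less_Suc2[of "Suc n" "\<lambda>k. (ad w ^^ k) f \<in> L2"] by (simp only: less_Suc_eq_le funpow_0)
  moreover have "(\<forall>k<Suc n. H1 ((ad w ^^ k) f)) \<longleftrightarrow> H1 f \<and> (\<forall>k<n. H1 ((ad w ^^ Suc k) f))"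
    using All_less_Suc2[of n "\<lambda>k. H1 ((ad w ^^ k) f)"] by (simp only: funpow_0)
  ultimately show ?case using H1_L2 by blast
qed simp

lemma ad_one: "ad (\<lambda>_. 1) = wd"
  by (auto simp: ad_def fun_eq_iff)

lemma Hk_one_weak_deriv:
  assumes "Hk (\<lambda>_. 1) n f" "k <= n"
  shows "has_weak_deriv k f ((wd ^^ k) f)"
  using assms(2)
proof (induction k)
  case 0
  then show ?case using has_weak_deriv_0 locally_integrable_L2 Hk_L2[OF assms(1)] by simp
next
  case (Suc k)
  have "H1 ((wd ^^ k) f)" using assms(1) Suc.prems unfolding Hk_iff ad_one by auto
  from has_weak_deriv_Suc[OF Suc.IH H1_wd(1)[OF this]] Suc.prems show ?case by simp
qed

lemma Hk_one_iff: "Hk (\<lambda>_. 1) n f \<longleftrightarrow> f \<in> L2 \<and> (\<forall>k\<le>n. \<exists>g\<in>L2. has_weak_deriv k f g)"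
proof
  assume h: "Hk (\<lambda>_. 1) n f"
  then have "(wd ^^ k) f \<in> L2" if "k <= n" for k using that unfolding Hk_iff ad_one by blast
  then show "f \<in> L2 \<and> (\<forall>k\<le>n. \<exists>g\<in>L2. has_weak_deriv k f g)"
    using Hk_one_weak_deriv[OF h] Hk_L2[OF h] by (intro conjI allI impI bexI[of _ "(wd ^^ _) f"]) simp_all
next
  assume a: "f \<in> L2 \<and> (\<forall>k\<le>n. \<exists>g\<in>L2. has_weak_deriv k f g)"
  have "has_weak_deriv k f ((wd ^^ k) f) \<and> (wd ^^ k) f \<in> L2 \<and> (k < n --> H1 ((wd ^^ k) f))" if "k <= n" for k
    using that
  proof (induction k)
    case 0
    have "H1 f" if "0 < n"
    proof -
      have "1 <= n" using that by simp
      then show ?thesis using a unfolding H1_def by blast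
    qed
    then show ?case using a has_weak_deriv_0 locally_integrable_L2 by auto
  next
    case (Suc k)
    then have IH: "has_weak_deriv k f ((wd ^^ k) f)" "H1 ((wd ^^ k) f)" by auto
    have s: "has_weak_deriv (Suc k) f ((wd ^^ Suc k) f)"
      using has_weak_deriv_Suc[OF IH(1) H1_wd(1)[OF IH(2)]] by simp
    have l: "(wd ^^ Suc k) f \<in> L2" using H1_wd(2)[OF IH(2)] by simp
    have "H1 ((wd ^^ Suc k) f)" if "Suc k < n"
    proof -
      have "Suc (Suc k) <= n" using that by simp
      then obtain g where "g \<in> L2" "has_weak_deriv (Suc (Suc k)) f g" using a by blast
      then show ?thesis using has_weak_deriv_SucD[OF s] l unfolding H1_def by blast
    qed
    then show ?case using s l by blast
  qed
  note * = this
  show "Hk (\<lambda>_. 1) n f" unfolding Hk_iff ad_one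
  proof (intro conjI allI impI)
    show "(wd ^^ k) f \<in> L2" if "k <= n" for k using *[OF that] by simp
    show "H1 ((wd ^^ k) f)" if "k < n" for k using *[of k] that by simp
  qed
qed

section \<open>Representatives that are continuously differentiable\<close>

lemma sobolev_Hk: "f \<in> sobolev n ==> Hk (\<lambda>_. 1) n f"
  unfolding Hk_one_iff sobolev_def by auto

lemma sobolev_zero: "f \<in> sobolev n ==> x \<notin> J ==> f x = 0"
  unfolding sobolev_def by auto

lemma sobolev_derivative:
  assumes "f \<in> sobolev n" "x \<in> J" shows "(f has_real_derivative cderiv f x) (at x within J)"
proof -
  have "f differentiable (at x within J)" using assms unfolding sobolev_def differentiable_on_def by auto
  then show ?thesis
    unfolding cderiv_def has_real_derivative_iff_has_vector_derivative by (simp add: vector_derivative_works)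
qed

lemma sobolev_cderiv_continuous: "f \<in> sobolev n ==> continuous_on J (cderiv f)"
  unfolding sobolev_def by auto

lemma sobolev_ac: "f \<in> sobolev n ==> ac f (cderiv f)"
  by (intro ac_C1 sobolev_derivative sobolev_cderiv_continuous)

lemma sobolev_wd: "f \<in> sobolev n ==> AE x in LI. wd f x = cderiv f x"
  by (rule ac_imp_H1(2)[OF sobolev_ac])

lemma cderiv_eq:
  assumes "(f has_real_derivative D) (at x within J)" "x \<in> J" shows "cderiv f x = D"
  unfolding cderiv_def
  using vector_derivative_within_cbox[of 0 "2*pi" x f D] assms pi_gt_zero
  by (simp add: has_real_derivative_iff_has_vector_derivative)

lemma ac_continuous_has_derivative:
  assumes "ac f g" "continuous_on J g" "x \<in> J"
  shows "(f has_real_derivative g x) (at x within J)"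
proof -
  have "((\<lambda>x. f 0 + integral {0..x} g) has_real_derivative g x) (at x within J)"
    using DERIV_add[OF DERIV_const integral_has_real_derivative[OF assms(2,3)], of "f 0"] by simp
  then show ?thesis
  proof (rule has_field_derivative_transform_within[of _ _ _ _ 1])
    fix y assume "y \<in> J"
    then have "f y - f 0 = integral {0..y} g" using assms(1) unfolding ac_def by blast
    then show "f 0 + integral {0..y} g = f y" by linarith
  qed (use assms in auto)
qed

lemma sobolevI:
  assumes "Hk (\<lambda>_. 1) n f" "ac f g" "continuous_on J g" "\<And>x. x \<notin> J ==> f x = 0"
  shows "f \<in> sobolev n" "\<And>x. x \<in> J ==> cderiv f x = g x"
proof -
  have d: "(f has_real_derivative g x) (at x within J)" if "x \<in> J" for x
    by (rule ac_continuous_has_derivative[OF assms(2,3) that])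
  then show c: "cderiv f x = g x" if "x \<in> J" for x using cderiv_eq that by blast
  have "continuous_on J (cderiv f)" using assms(3) by (rule continuous_on_eq) (simp add: c)
  moreover have "f differentiable_on J"
    unfolding differentiable_on_def using d real_differentiable_def by blast
  ultimately show "f \<in> sobolev n" using assms(1,4) unfolding sobolev_def Hk_one_iff by auto
qed

text \<open>As n >= 2, the weak derivative lies in H^1 and has a continuous representative
  \<open>g\<close>. Its primitive is the C^1 representative, cut off to 0 outside \<open>J\<close>
  as \<open>sobolev\<close> demands.\<close>

lemma Hk_representative:
  assumes "n >= 2" "Hk (\<lambda>_. 1) n f"
  obtains f1 where "f1 \<in> sobolev n" "AE x in LI. f x = f1 x"
proof -
  obtain k where k: "n = Suc (Suc k)" using assms(1) by (metis add_2_eq_Suc le_Suc_ex)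
  have h: "H1 f" "H1 (wd f)" using assms(2) unfolding k Hk.simps ad_one by auto
  obtain f0 where f0: "ac f0 (wd f)" "AE x in LI. f x = f0 x" using H1_ac[OF h(1)] .
  obtain g where g: "ac g (wd (wd f))" "AE x in LI. wd f x = g x" using H1_ac[OF h(2)] .
  define f1 where "f1 x = (if x \<in> J then f0 x else 0)" for x
  have ae: "AE x in LI. f x = f1 x" using f0(2) unfolding AE_LI_iff by eventually_elim (auto simp: f1_def)
  have "ac f1 g" by (rule ac_cong_AE[OF f0(1) g(2)]) (simp add: f1_def)
  then have "f1 \<in> sobolev n"
    by (rule sobolevI(1)[OF Hk_cong_AE[OF assms(2) ae] _ ac_continuous[OF g(1)]]) (simp only: f1_def if_False)
  then show ?thesis using ae that by blast
qed

section \<open>Weighted Sobolev norms\<close>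

definition weight :: "(real => real) => bool" where
  "weight w \<longleftrightarrow> continuous_on J w \<and> (\<forall>x\<in>J. w x > 0)"

definition wlen :: "(real => real) => real" where "wlen w = (LINT x|LI. w x)"

text \<open>Squared L^2 norm with respect to the arc length measure w d theta; \<open>En\<close> is
  the corresponding squared Sobolev norm with all coefficients 1.\<close>

definition X :: "(real => real) => (real => real) => real" where
  "X w f = (LINT x|LI. (f x)\<^sup>2 * w x)"

definition En :: "(real => real) => nat => (real => real) => real" where
  "En w n f = (\<Sum>i\<le>n. X w ((ad w ^^ i) f))"

lemma weight_bounds:
  assumes "weight w"
  obtains m M where "0 < m" "\<And>x. x \<in> J ==> m <= w x" "\<And>x. x \<in> J ==> w x <= M"
proof -
  have c: "continuous_on J w" and p: "\<And>x. x \<in> J ==> w x > 0" using assms by (auto simp: weight_def)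
  have J: "compact J" "J \<noteq> {}" using pi_ge_zero by auto
  obtain x where x: "x \<in> J" "\<forall>y\<in>J. w x <= w y" using continuous_attains_inf[OF J c] by blast
  obtain z where "z \<in> J" "\<forall>y\<in>J. w y <= w z" using continuous_attains_sup[OF J c] by blast
  then show ?thesis using that[of "w x" "w z"] x p by auto
qed

lemma weight_nonneg: "weight w ==> x \<in> J ==> 0 <= w x"
  unfolding weight_def by (meson less_imp_le)

lemma weight_one: "weight (\<lambda>_. 1)"
  by (simp add: weight_def)

lemma weight_L2: "weight w ==> w \<in> L2"
  by (simp add: weight_def L2_continuous)

lemma AE_LI_I: "(\<And>x. x \<in> J ==> P x) ==> AE x in LI. P x"
  by (rule AE_I2) auto

lemma wlen_eq: "weight w ==> wlen w = integral J w"
  unfolding wlen_def by (rule LINT_LI_eq[OF L2_integrable[OF weight_L2]])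

lemma wlen_pos: assumes "weight w" shows "wlen w > 0"
proof -
  obtain m where m: "0 < m" "\<And>x. x \<in> J ==> m <= w x" using weight_bounds[OF assms] by metis
  have "integral J (\<lambda>_. m) <= integral J w"
    using L2_integrable_on[OF weight_L2[OF assms], of 0 "2*pi"] m by (intro integral_le) auto
  moreover have "integral J (\<lambda>_. m) > 0" using m(1) by simp
  ultimately show ?thesis unfolding wlen_eq[OF assms] by linarith
qed

lemma X_integrable:
  assumes "weight w" "f \<in> L2" "g \<in> L2" shows "integrable LI (\<lambda>x. f x * g x * w x)"
  using L2_mult_integrable[OF assms(2) L2_mult_continuous[OF _ assms(3)]] assms(1)
  by (simp add: weight_def mult.assoc)

lemma X_integrable_sq: "weight w ==> f \<in> L2 ==> integrable LI (\<lambda>x. (f x)\<^sup>2 * w x)"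
  using X_integrable[of w f f] by (simp add: power2_eq_square)

lemma X_nonneg: "weight w ==> 0 <= X w f"
  unfolding X_def by (intro integral_nonneg_AE AE_LI_I) (auto simp: weight_nonneg)

lemma X_mono:
  assumes "weight w" "f \<in> L2" "g \<in> L2" "0 <= B" "AE x in LI. (f x)\<^sup>2 <= B * (g x)\<^sup>2"
  shows "X w f <= B * X w g"
proof -
  have "X w f <= (LINT x|LI. B * ((g x)\<^sup>2 * w x))" unfolding X_def
  proof (rule integral_mono_AE)
    have "AE x in LI. 0 <= w x" using assms(1) by (intro AE_LI_I weight_nonneg)
    with assms(5) show "AE x in LI. (f x)\<^sup>2 * w x <= B * ((g x)\<^sup>2 * w x)"
    proof eventually_elim
      case (elim x)
      then have "(f x)\<^sup>2 * w x <= B * (g x)\<^sup>2 * w x" by (intro mult_right_mono) auto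
      then show ?case by (simp add: mult.assoc)
    qed
  qed (use X_integrable_sq assms in auto)
  then show ?thesis by (simp add: X_def)
qed

lemma X_cong_AE:
  assumes "weight w" "f \<in> L2" "AE x in LI. f x = g x" shows "X w f = X w g"
proof -
  have "g \<in> L2" by (rule L2_cong_AE[OF assms(2,3)])
  then show ?thesis unfolding X_def
    using assms by (intro integral_cong_AE) (auto intro!: borel_measurable_integrable X_integrable_sq elim!: AE_mp)
qed

lemma X_cmult: "X w (\<lambda>x. c * f x) = c\<^sup>2 * X w f"
  by (simp add: X_def power_mult_distrib mult.assoc)

lemma X_one_le:
  assumes "weight w" "f \<in> L2" "AE x in LI. (f x)\<^sup>2 <= B" "0 <= B" shows "X w f <= B * wlen w"
  using X_mono[OF assms(1,2) L2_const[of 1] assms(4)] assms(3) by (simp add: X_def wlen_def)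

lemma En_0: "En w 0 f = X w f"
  by (simp add: En_def)

lemma En_Suc: "En w (Suc k) f = X w f + En w k (ad w f)"
  unfolding En_def by (subst sum.atMost_Suc_shift) (simp add: funpow_swap1)

lemma En_nonneg: "weight w ==> 0 <= En w n f"
  unfolding En_def by (intro sum_nonneg X_nonneg)

lemma En_mono: "weight w ==> j <= k ==> En w j f <= En w k f"
  unfolding En_def by (intro sum_mono2) (auto intro: X_nonneg)

lemma X_le_En: "weight w ==> X w f <= En w k f"
  using En_mono[of w 0 k f] by (simp add: En_0)

lemma En_ad_le: "weight w ==> En w k (ad w f) <= En w (Suc k) f"
  by (simp add: En_Suc X_nonneg)

lemma funpow_ad_cong_AE:
  assumes "AE x in LI. f x = g x" shows "AE x in LI. (ad w ^^ i) f x = (ad w ^^ i) g x"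
proof (cases i)
  case (Suc j)
  then show ?thesis using ad_cong_AE[OF assms, of w] by (simp add: funpow_Suc_right del: funpow.simps)
qed (use assms in simp)

lemma En_cong_AE:
  assumes "weight w" "Hk w n f" "AE x in LI. f x = g x" shows "En w n f = En w n g"
  unfolding En_def using assms(2)
  by (intro sum.cong refl X_cong_AE[OF assms(1)] funpow_ad_cong_AE[OF assms(3)]) (auto simp: Hk_iff)

lemma ad_lin:
  assumes "H1 f" "H1 g"
  shows "AE x in LI. ad w (\<lambda>x. a * f x + b * g x) x = a * ad w f x + b * ad w g x"
  using H1_lin(2)[OF assms, of a b] by eventually_elim (simp add: ad_def algebra_simps add_divide_distrib)

lemma Hk_lin_aux:
  assumes "Hk w k f" "Hk w k g"
  shows "Hk w k (\<lambda>x. a * f x + b * g x) \<and>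
    (\<forall>i\<le>k. AE x in LI. (ad w ^^ i) (\<lambda>x. a * f x + b * g x) x = a * (ad w ^^ i) f x + b * (ad w ^^ i) g x)"
  using assms
proof (induction k arbitrary: f g)
  case 0
  then show ?case by (auto intro!: L2_add L2_cmult)
next
  case (Suc k)
  let ?h = "\<lambda>x. a * f x + b * g x" and ?h' = "\<lambda>x. a * ad w f x + b * ad w g x"
  have h: "H1 f" "H1 g" "Hk w k (ad w f)" "Hk w k (ad w g)" using Suc.prems by auto
  note IH = Suc.IH[OF h(3,4)]
  have ae: "AE x in LI. ad w ?h x = ?h' x" by (rule ad_lin[OF h(1,2)])
  have "Hk w k (ad w ?h)" using IH Hk_cong_AE[OF _ AE_eq_sym[OF ae]] by blast
  moreover have "AE x in LI. (ad w ^^ i) ?h x = a * (ad w ^^ i) f x + b * (ad w ^^ i) g x" if "i <= Suc k" for i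
  proof (cases i)
    case (Suc j)
    have "AE x in LI. (ad w ^^ j) (ad w ?h) x = (ad w ^^ j) ?h' x" by (rule funpow_ad_cong_AE[OF ae])
    moreover have "AE x in LI. (ad w ^^ j) ?h' x = a * (ad w ^^ j) (ad w f) x + b * (ad w ^^ j) (ad w g) x"
      using IH that Suc by auto
    ultimately have "AE x in LI. (ad w ^^ j) (ad w ?h) x = a * (ad w ^^ j) (ad w f) x + b * (ad w ^^ j) (ad w g) x"
      by (rule AE_eq_trans)
    then show ?thesis by (simp add: Suc funpow_Suc_right del: funpow.simps)
  qed simp
  ultimately show ?case using H1_lin(1)[OF h(1,2)] by simp
qed

lemma Hk_lin: "Hk w k f ==> Hk w k g ==> Hk w k (\<lambda>x. a * f x + b * g x)"
  using Hk_lin_aux by blast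

lemma funpow_ad_lin:
  "Hk w k f ==> Hk w k g ==> i <= k ==>
    AE x in LI. (ad w ^^ i) (\<lambda>x. a * f x + b * g x) x = a * (ad w ^^ i) f x + b * (ad w ^^ i) g x"
  using Hk_lin_aux by blast

lemma Hk_zero: "Hk w k (\<lambda>x. 0)"
proof (induction k)
  case (Suc k)
  have "AE x in LI. (0::real) = ad w (\<lambda>x. 0) x" using wd_const[of 0] by eventually_elim (simp add: ad_def)
  then show ?case using Hk_cong_AE[OF Suc.IH] by simp
qed simp

lemma ad_const: "AE x in LI. ad w (\<lambda>x. c) x = 0"
  using wd_const[of c] by eventually_elim (simp add: ad_def)

lemma Hk_const: "Hk w k (\<lambda>x. c)"
proof (cases k)
  case (Suc j)
  then show ?thesis using Hk_cong_AE[OF Hk_zero AE_eq_sym[OF ad_const]] by simp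
qed simp

lemma En_zero: "weight w ==> En w k (\<lambda>x. 0) = 0"
proof (induction k)
  case 0
  then show ?case by (simp add: En_0 X_def)
next
  case (Suc k)
  have "En w k (ad w (\<lambda>x. 0)) = En w k (\<lambda>x. 0)"
    using Suc.prems Hk_zero ad_const[of w 0] by (intro En_cong_AE[symmetric] AE_eq_sym[OF ad_const]) auto
  then show ?case using Suc by (simp add: En_Suc X_def)
qed

lemma En_const: assumes "weight w" shows "En w k (\<lambda>x. c) = c\<^sup>2 * wlen w"
proof (cases k)
  case (Suc j)
  have "En w j (ad w (\<lambda>x. c)) = En w j (\<lambda>x. 0)"
    using assms Hk_zero by (intro En_cong_AE[symmetric] AE_eq_sym[OF ad_const]) auto
  then show ?thesis using assms by (simp add: Suc En_Suc En_zero X_def wlen_def)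
qed (simp add: En_0 X_def wlen_def)

section \<open>The inner product behind the weighted Sobolev norm\<close>

definition ip :: "(real => real) => nat => (real => real) => (real => real) => real" where
  "ip w n f g = (\<Sum>i\<le>n. LINT x|LI. (ad w ^^ i) f x * (ad w ^^ i) g x * w x)"

lemma En_ip: "En w n f = ip w n f f"
  by (simp add: En_def X_def ip_def power2_eq_square)

lemma ip_commute: "ip w n f g = ip w n g f"
  by (simp add: ip_def mult.commute)

lemma ip_lin:
  assumes "weight w" "Hk w n f" "Hk w n g" "Hk w n h"
  shows "ip w n (\<lambda>x. a * f x + b * g x) h = a * ip w n f h + b * ip w n g h"
proof -
  have "(LINT x|LI. (ad w ^^ i) (\<lambda>x. a * f x + b * g x) x * (ad w ^^ i) h x * w x) =
      a * (LINT x|LI. (ad w ^^ i) f x * (ad w ^^ i) h x * w x) + b * (LINT x|LI. (ad w ^^ i) g x * (ad w ^^ i) h x * w x)"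
    if i: "i <= n" for i
  proof -
    have l: "(ad w ^^ i) f \<in> L2" "(ad w ^^ i) g \<in> L2" "(ad w ^^ i) h \<in> L2"
      "(ad w ^^ i) (\<lambda>x. a * f x + b * g x) \<in> L2"
      using assms Hk_lin[OF assms(2,3)] i unfolding Hk_iff by auto
    have "(LINT x|LI. (ad w ^^ i) (\<lambda>x. a * f x + b * g x) x * (ad w ^^ i) h x * w x) =
      (LINT x|LI. a * ((ad w ^^ i) f x * (ad w ^^ i) h x * w x) + b * ((ad w ^^ i) g x * (ad w ^^ i) h x * w x))"
    proof (rule integral_cong_AE)
      show "AE x in LI. (ad w ^^ i) (\<lambda>x. a * f x + b * g x) x * (ad w ^^ i) h x * w x =
          a * ((ad w ^^ i) f x * (ad w ^^ i) h x * w x) + b * ((ad w ^^ i) g x * (ad w ^^ i) h x * w x)"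
        using funpow_ad_lin[OF assms(2,3) i, of a b] by eventually_elim (simp add: algebra_simps)
      show "(\<lambda>x. (ad w ^^ i) (\<lambda>x. a * f x + b * g x) x * (ad w ^^ i) h x * w x) \<in> borel_measurable LI"
        by (rule borel_measurable_integrable[OF X_integrable[OF assms(1) l(4,3)]])
      show "(\<lambda>x. a * ((ad w ^^ i) f x * (ad w ^^ i) h x * w x) + b * ((ad w ^^ i) g x * (ad w ^^ i) h x * w x)) \<in> borel_measurable LI"
        using X_integrable[OF assms(1) l(1,3)] X_integrable[OF assms(1) l(2,3)] by auto
    qed
    then show ?thesis
      using X_integrable[OF assms(1) l(1,3)] X_integrable[OF assms(1) l(2,3)] by simp
  qed
  then show ?thesis by (simp add: ip_def sum.distrib sum_distrib_left)
qed

lemma En_lin: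
  assumes "weight w" "Hk w n f" "Hk w n g"
  shows "En w n (\<lambda>x. a * f x + b * g x) = a\<^sup>2 * En w n f + 2 * a * b * ip w n f g + b\<^sup>2 * En w n g"
proof -
  note l = Hk_lin[OF assms(2,3), of a b]
  show ?thesis unfolding En_ip
    by (simp add: ip_lin[OF assms l] ip_commute[of w n f "\<lambda>x. a * f x + b * g x"]
      ip_commute[of w n g "\<lambda>x. a * f x + b * g x"] ip_lin[OF assms assms(2)] ip_lin[OF assms assms(3)]
      ip_commute[of w n g f] power2_eq_square algebra_simps)
qed

lemma ip_Cauchy_Schwarz:
  assumes "weight w" "Hk w n f" "Hk w n g"
  shows "(ip w n f g)\<^sup>2 <= En w n f * En w n g"
proof (rule quadratic_nonneg_imp[OF En_nonneg[OF assms(1)]])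
  fix t
  show "0 <= En w n f * t\<^sup>2 + 2 * ip w n f g * t + En w n g"
    using En_nonneg[OF assms(1), of n "\<lambda>x. t * f x + 1 * g x"] En_lin[OF assms, of t 1] by (simp add: mult_ac)
qed

lemma ip_abs_le:
  assumes "weight w" "Hk w n f" "Hk w n g"
  shows "\<bar>ip w n f g\<bar> <= sqrt (En w n f) * sqrt (En w n g)"
  using real_sqrt_le_mono[OF ip_Cauchy_Schwarz[OF assms]] by (simp add: real_sqrt_mult)

lemma En_triangle:
  assumes "weight w" "Hk w n f" "Hk w n g"
  shows "sqrt (En w n (\<lambda>x. f x + g x)) <= sqrt (En w n f) + sqrt (En w n g)"
proof (rule real_le_lsqrt)
  have "En w n (\<lambda>x. f x + g x) = En w n f + 2 * ip w n f g + En w n g"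
    using En_lin[OF assms, of 1 1] by simp
  also have "... <= En w n f + 2 * (sqrt (En w n f) * sqrt (En w n g)) + En w n g"
    using ip_abs_le[OF assms] by simp
  also have "... = (sqrt (En w n f) + sqrt (En w n g))\<^sup>2"
    using En_nonneg[OF assms(1)] by (simp add: power2_sum)
  finally show "En w n (\<lambda>x. f x + g x) <= (sqrt (En w n f) + sqrt (En w n g))\<^sup>2" .
qed (use En_nonneg[OF assms(1)] in auto)

lemma En_cmult: "weight w ==> Hk w n f ==> En w n (\<lambda>x. c * f x) = c\<^sup>2 * En w n f"
  using En_lin[of w n f f c 0] by simp

lemma En_add_le:
  assumes "weight w" "Hk w n f" "Hk w n g"
  shows "En w n (\<lambda>x. f x + g x) <= 2 * En w n f + 2 * En w n g"
proof -
  have "0 <= En w n (\<lambda>x. 1 * f x + (-1) * g x)" by (rule En_nonneg[OF assms(1)])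
  then show ?thesis using En_lin[OF assms, of 1 "-1"] En_lin[OF assms, of 1 1] by simp
qed

text \<open>Same scheme as for products: the difference between 1/f and the primitive of its formal
  derivative has increments quadratically small in the integral of |f'|.\<close>

lemma ac_inverse:
  assumes f: "ac f f'" and m: "m > 0" "\<And>x. x \<in> J ==> m <= f x"
  shows "ac (\<lambda>x. inverse (f x)) (\<lambda>x. - (f' x * (inverse (f x))\<^sup>2))"
proof -
  have f2: "f' \<in> L2" by (rule ac_L2[OF f])
  have fc: "continuous_on J f" by (rule ac_continuous[OF f])
  have f0: "f x \<noteq> 0" if "x \<in> J" for x using m(1) m(2)[OF that] by linarith
  have ic: "continuous_on J (\<lambda>x. inverse (f x))" using fc f0 by (intro continuous_intros) auto
  define k where "k = (\<lambda>x. - (f' x * (inverse (f x))\<^sup>2))"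
  have k2: "k \<in> L2" unfolding k_def
    using L2_cmult[OF L2_mult_continuous[OF _ f2, of "\<lambda>x. (inverse (f x))\<^sup>2"], of "-1"] ic
    by (simp add: continuous_on_power)
  define H where "H = (\<lambda>x. inverse (f x) - integral {0..x} k)"
  \<comment> \<open>Two differences of reciprocals, each at most A / m^2, are multiplied by a
    reciprocal of size at most 1 / m.\<close>
  define C where "C = 2 / m ^ 3"
  have C: "C >= 0" unfolding C_def using m by simp
  define R where "R = (\<lambda>x. C * integral {0..x} (\<lambda>t. (f' t)\<^sup>2))"
  have rint: "(\<lambda>t. (f' t)\<^sup>2) integrable_on {x..y}" if "0 <= x" "y <= 2*pi" for x y
    using integrable_LI_sub[OF L2_square[OF f2] that] absolutely_integrable_on_def by blast
  have R: "R v - R u = C * integral {u..v} (\<lambda>t. (f' t)\<^sup>2)" if "0 <= u" "u <= v" "v <= 2*pi" for u v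
    unfolding R_def using Henstock_Kurzweil_Integration.integral_combine[of 0 u v, OF _ _ rint] that
    by (simp add: algebra_simps flip: distrib_left)
  have "H x = H 0" if "x \<in> J" for x
  proof (rule const_if_increments_small[OF _ _ that])
    show "continuous_on J R" unfolding R_def
      by (intro continuous_intros indefinite_integral_continuous_1 rint) auto
    fix u v :: real assume uv: "0 <= u" "u <= v" "v <= 2*pi"
    define A where "A = integral {u..v} (\<lambda>t. \<bar>f' t\<bar>)"
    have A0: "A >= 0" unfolding A_def
      using L2_integrable_on[OF L2_abs[OF f2], of u v] uv by (intro Henstock_Kurzweil_Integration.integral_nonneg) auto
    have i: "h integrable_on {u..v}" if "h \<in> L2" for h using L2_integrable_on[OF that] uv by auto
    have uJ: "u \<in> J" "v \<in> J" using uv by auto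
    define d where "d = inverse (f u) * inverse (f v)"
    have "inverse (f v) - inverse (f u) = (f v - f u) * (- d)"
      using f0[OF uJ(1)] f0[OF uJ(2)] unfolding d_def by (simp add: field_simps)
    also have "... = integral {u..v} (\<lambda>t. f' t * (- d))" using ac_increment[OF f uv] by simp
    finally have "H v - H u = integral {u..v} (\<lambda>t. f' t * (- d)) - integral {u..v} k"
      using ac_increment[OF ac_indefinite[OF k2] uv] unfolding H_def by simp
    also have "... = integral {u..v} (\<lambda>t. f' t * (- d) - k t)"
      using i[OF k2] i[OF L2_mult_continuous[OF continuous_on_const f2, of "- d"]]
      by (subst Henstock_Kurzweil_Integration.integral_diff) auto
    finally have "\<bar>H v - H u\<bar> = norm (integral {u..v} (\<lambda>t. f' t * (- d) - k t))" by simp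
    also have "... <= integral {u..v} (\<lambda>t. C * A * \<bar>f' t\<bar>)"
    proof (rule integral_norm_bound_integral)
      show "(\<lambda>t. f' t * (- d) - k t) integrable_on {u..v}"
        by (intro i L2_diff k2 L2_mult_continuous continuous_on_const f2)
      show "(\<lambda>t. C * A * \<bar>f' t\<bar>) integrable_on {u..v}" by (intro i L2_cmult L2_abs f2)
      fix t assume t: "t \<in> {u..v}"
      then have tJ: "t \<in> J" using uv by auto
      have b: "0 <= inverse (f x)" "inverse (f x) <= inverse m" if "x \<in> J" for x
        using m(2)[OF that] m(1) by (auto intro: le_imp_inverse_le)
      have dif: "\<bar>inverse (f x) - inverse (f y)\<bar> <= (inverse m)\<^sup>2 * A" if "x \<in> {u..v}" "y \<in> {u..v}" for x y
      proof -
        have xy: "x \<in> J" "y \<in> J" using that uv by auto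
        have "\<bar>f x - f y\<bar> <= A"
        proof (cases "x <= y")
          case True
          then show ?thesis using ac_increment_abs[OF f, of u x y v] that uv unfolding A_def by (simp add: abs_minus_commute)
        next
          case False
          then show ?thesis using ac_increment_abs[OF f, of u y x v] that uv unfolding A_def by simp
        qed
        moreover have "inverse (f x) - inverse (f y) = (f y - f x) * (inverse (f x) * inverse (f y))"
          using f0[OF xy(1)] f0[OF xy(2)] by (simp add: field_simps)
        moreover have "inverse (f x) * inverse (f y) <= (inverse m)\<^sup>2"
          unfolding power2_eq_square using b xy m(1) by (intro mult_mono) auto
        ultimately have "\<bar>inverse (f x) - inverse (f y)\<bar> <= A * (inverse m)\<^sup>2"
          using b xy A0 by (auto simp: abs_mult abs_minus_commute intro!: mult_mono)
        then show ?thesis by (simp add: mult.commute)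
      qed
      have "f' t * (- d) - k t = f' t * ((inverse (f t) - inverse (f u)) * inverse (f t) + inverse (f u) * (inverse (f t) - inverse (f v)))"
        unfolding k_def d_def by (simp add: algebra_simps power2_eq_square)
      moreover have "\<bar>(inverse (f t) - inverse (f u)) * inverse (f t) + inverse (f u) * (inverse (f t) - inverse (f v))\<bar>
          <= ((inverse m)\<^sup>2 * A) * inverse m + inverse m * ((inverse m)\<^sup>2 * A)"
        using dif[of t u] dif[of t v] b[OF tJ] b[OF uJ(1)] t uv m(1) A0
        by (intro order_trans[OF abs_triangle_ineq] add_mono) (auto simp: abs_mult intro!: mult_mono)
      moreover have "((inverse m)\<^sup>2 * A) * inverse m + inverse m * ((inverse m)\<^sup>2 * A) = C * A"
        unfolding C_def using m(1) by (simp add: field_simps power2_eq_square power3_eq_cube)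
      ultimately show "norm (f' t * (- d) - k t) <= C * A * \<bar>f' t\<bar>"
        by (simp add: abs_mult) (metis abs_ge_zero mult.commute mult_left_mono)
    qed
    also have "... = C * A\<^sup>2" unfolding A_def by (simp add: power2_eq_square)
    also have "... <= C * ((v - u) * integral {u..v} (\<lambda>t. (f' t)\<^sup>2))"
      unfolding A_def using integral_abs_square_le[OF f2 uv] C by (intro mult_left_mono) auto
    also have "... = (v - u) * (R v - R u)" using R[OF uv] by simp
    finally show "\<bar>H v - H u\<bar> <= (v - u) * (R v - R u)" .
  qed
  note H0 = this
  have "ac (\<lambda>x. inverse (f x)) k"
  proof (rule acI[OF k2])
    fix x assume "x \<in> J"
    then show "inverse (f x) - inverse (f 0) = integral {0..x} k" using H0[of x] by (simp add: H_def)
  qed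
  then show ?thesis by (simp only: k_def)
qed

section \<open>Oscillation and supremum bounds in arc length\<close>

lemma Cauchy_Schwarz_interval:
  assumes "u \<in> L2" "v \<in> L2" "0 <= x" "y <= 2*pi"
  shows "(integral {x..y} (\<lambda>t. u t * v t))\<^sup>2 <= integral {x..y} (\<lambda>t. (u t)\<^sup>2) * integral {x..y} (\<lambda>t. (v t)\<^sup>2)"
proof -
  let ?M = "lebesgue_on {x..y}"
  have i: "integrable ?M (g :: real => real)" if "integrable LI g" for g
    using integrable_LI_sub[OF that assms(3,4)]
    by (simp add: integrable_restrict_space set_integrable_def)
  have 1: "integrable ?M (\<lambda>t. (u t)\<^sup>2)" "integrable ?M (\<lambda>t. (v t)\<^sup>2)" "integrable ?M (\<lambda>t. u t * v t)"
    using i L2_square assms(1,2) L2_mult_integrable[OF assms(1,2)] by auto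
  show ?thesis
    using Cauchy_Schwarz_integral[OF 1] 1[THEN lebesgue_integral_eq_integral] by simp
qed

text \<open>Each of the two factors takes one square root of the weight.\<close>

lemma weighted_Cauchy_Schwarz:
  assumes w: "weight w" and g: "g \<in> L2" and xy: "0 <= x" "x <= y" "y <= 2*pi"
  shows "(integral {x..y} (\<lambda>t. \<bar>g t\<bar> * w t))\<^sup>2 <= integral {x..y} w * X w g"
proof -
  have sw: "continuous_on J (\<lambda>t. sqrt (w t))" using w by (auto simp: weight_def intro!: continuous_intros)
  have w0: "0 <= w t" if "t \<in> {x..y}" for t using weight_nonneg[OF w, of t] that xy by auto
  have "(integral {x..y} (\<lambda>t. (\<bar>g t\<bar> * sqrt (w t)) * sqrt (w t)))\<^sup>2
    <= integral {x..y} (\<lambda>t. (\<bar>g t\<bar> * sqrt (w t))\<^sup>2) * integral {x..y} (\<lambda>t. (sqrt (w t))\<^sup>2)"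
    by (intro Cauchy_Schwarz_interval L2_mult_continuous sw L2_abs g L2_continuous) (use xy in auto)
  also have "integral {x..y} (\<lambda>t. (\<bar>g t\<bar> * sqrt (w t)) * sqrt (w t)) = integral {x..y} (\<lambda>t. \<bar>g t\<bar> * w t)"
    using w0 by (intro Henstock_Kurzweil_Integration.integral_cong) simp
  also have "integral {x..y} (\<lambda>t. (sqrt (w t))\<^sup>2) = integral {x..y} w"
    using w0 by (intro Henstock_Kurzweil_Integration.integral_cong) simp
  also have "integral {x..y} (\<lambda>t. (\<bar>g t\<bar> * sqrt (w t))\<^sup>2) = integral {x..y} (\<lambda>t. (g t)\<^sup>2 * w t)"
    using w0 by (intro Henstock_Kurzweil_Integration.integral_cong) (simp add: power_mult_distrib)
  also have "integral {x..y} (\<lambda>t. (g t)\<^sup>2 * w t) * integral {x..y} w <= X w g * integral {x..y} w"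
  proof (rule mult_right_mono)
    have si: "(\<lambda>t. (g t)\<^sup>2 * w t) integrable_on {a..b}" if "0 <= a" "b <= 2*pi" for a b
      using integrable_LI_sub[OF X_integrable_sq[OF w g] that] absolutely_integrable_on_def by blast
    have "integral {x..y} (\<lambda>t. (g t)\<^sup>2 * w t) <= integral J (\<lambda>t. (g t)\<^sup>2 * w t)"
      using xy si weight_nonneg[OF w] by (intro integral_subset_le) auto
    then show "integral {x..y} (\<lambda>t. (g t)\<^sup>2 * w t) <= X w g"
      unfolding X_def LINT_LI_eq[OF X_integrable_sq[OF w g]] .
    show "0 <= integral {x..y} w"
      using w0 L2_integrable_on[OF weight_L2[OF w], of x y] xy
      by (intro Henstock_Kurzweil_Integration.integral_nonneg) auto
  qed
  finally show ?thesis by (simp add: mult.commute)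
qed

lemma ad_times_weight: "weight w ==> x \<in> J ==> ad w f x * w x = wd f x"
  unfolding weight_def ad_def by (auto dest!: bspec[of J _ x])

lemma ad_L2: assumes "weight w" "H1 f" shows "ad w f \<in> L2"
proof -
  have "continuous_on J (\<lambda>x. 1 / w x)" using assms(1) by (auto simp: weight_def intro!: continuous_intros)
  from L2_continuous_mult[OF this H1_wd(2)[OF assms(2)]] show ?thesis by (simp add: ad_def[abs_def])
qed

lemma osc_interval:
  assumes w: "weight w" and f: "H1 f" and f1: "ac f1 (wd f)"
    and "0 <= a" "a <= x" "x <= y" "y <= b" "b <= 2*pi"
  shows "\<bar>f1 y - f1 x\<bar> <= integral {a..b} (\<lambda>t. \<bar>ad w f t\<bar> * w t)"
proof -
  have "\<bar>f1 y - f1 x\<bar> <= integral {a..b} (\<lambda>t. \<bar>wd f t\<bar>)" by (rule ac_increment_abs[OF f1]) (use assms in auto)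
  also have "... = integral {a..b} (\<lambda>t. \<bar>ad w f t\<bar> * w t)"
  proof (rule Henstock_Kurzweil_Integration.integral_cong)
    fix t assume "t \<in> {a..b}"
    then have t: "t \<in> J" using assms by auto
    have "\<bar>ad w f t * w t\<bar> = \<bar>ad w f t\<bar> * w t" using weight_nonneg[OF w t] by (simp add: abs_mult)
    then show "\<bar>wd f t\<bar> = \<bar>ad w f t\<bar> * w t" using ad_times_weight[OF w t, of f] by simp
  qed
  finally show ?thesis .
qed

lemma osc_le:
  assumes w: "weight w" and f: "H1 f" and f1: "ac f1 (wd f)" and "x \<in> J" "y \<in> J"
  shows "(f1 x - f1 y)\<^sup>2 <= wlen w * X w (ad w f)"
proof -
  have "\<bar>f1 x - f1 y\<bar> <= integral J (\<lambda>t. \<bar>ad w f t\<bar> * w t)"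
    using osc_interval[OF w f f1, of 0 x y "2*pi"] osc_interval[OF w f f1, of 0 y x "2*pi"] assms
    by (cases "x <= y") (auto simp: abs_minus_commute)
  then have "(f1 x - f1 y)\<^sup>2 <= (integral J (\<lambda>t. \<bar>ad w f t\<bar> * w t))\<^sup>2"
    by (metis abs_ge_zero power2_abs power_mono)
  also have "... <= integral J w * X w (ad w f)"
    by (rule weighted_Cauchy_Schwarz[OF w ad_L2[OF w f]]) auto
  finally show ?thesis using wlen_eq[OF w] by simp
qed

text \<open>For every y, f(x)^2 <= 2 f(y)^2 + 2 (f(x) - f(y))^2. The last term is bounded by
  \<open>osc_le\<close>, and averaging over y with respect to arc length gives the claim.\<close>

lemma sup_le:
  assumes w: "weight w" and f: "H1 f" and f1: "ac f1 (wd f)" and ae: "AE x in LI. f x = f1 x" and x: "x \<in> J"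
  shows "(f1 x)\<^sup>2 <= 2 / wlen w * X w f + 2 * wlen w * X w (ad w f)"
proof -
  have L: "f1 \<in> L2" by (rule ac_self_L2[OF f1])
  have "(f1 x)\<^sup>2 * wlen w = (LINT y|LI. (f1 x)\<^sup>2 * w y)" by (simp add: wlen_def)
  also have "... <= (LINT y|LI. 2 * ((f1 y)\<^sup>2 * w y) + (2 * (wlen w * X w (ad w f))) * w y)"
  proof (rule integral_mono_AE)
    show "AE y in LI. (f1 x)\<^sup>2 * w y <= 2 * ((f1 y)\<^sup>2 * w y) + (2 * (wlen w * X w (ad w f))) * w y"
    proof (rule AE_LI_I)
      fix y assume y: "y \<in> J"
      have "0 <= (2 * f1 y - f1 x)\<^sup>2" by simp
      then have "(f1 x)\<^sup>2 <= 2 * (f1 y)\<^sup>2 + 2 * (f1 x - f1 y)\<^sup>2"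
        by (simp add: power2_eq_square algebra_simps)
      also have "... <= 2 * (f1 y)\<^sup>2 + 2 * (wlen w * X w (ad w f))"
        using osc_le[OF w f f1 x y] by simp
      finally have "(f1 x)\<^sup>2 * w y <= (2 * (f1 y)\<^sup>2 + 2 * (wlen w * X w (ad w f))) * w y"
        using weight_nonneg[OF w y] by (intro mult_right_mono)
      then show "(f1 x)\<^sup>2 * w y <= 2 * ((f1 y)\<^sup>2 * w y) + (2 * (wlen w * X w (ad w f))) * w y"
        by (simp add: algebra_simps)
    qed
  qed (use X_integrable_sq[OF w L] L2_integrable[OF weight_L2[OF w]] in auto)
  also have "... = 2 * X w f1 + 2 * (wlen w * X w (ad w f)) * wlen w"
    using X_integrable_sq[OF w L] L2_integrable[OF weight_L2[OF w]] by (simp add: X_def wlen_def)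
  also have "X w f1 = X w f" by (rule X_cong_AE[OF w L AE_eq_sym[OF ae]])
  finally show ?thesis using wlen_pos[OF w] by (simp add: field_simps)
qed

text \<open>The weight enters the constants of the following estimates only through these bounds on
  its total length. This uniformity makes the estimates usable along sequences of curves.\<close>

definition wtb :: "real => real => (real => real) => bool" where
  "wtb lo hi w \<longleftrightarrow> weight w \<and> 0 < lo \<and> lo <= wlen w \<and> wlen w <= hi"

lemma wtb_weight: "wtb lo hi w ==> weight w"
  by (simp add: wtb_def)

lemma sup_le_En:
  assumes w: "wtb lo hi w" and f: "H1 f" and f1: "ac f1 (wd f)" and ae: "AE x in LI. f x = f1 x" and x: "x \<in> J"
  shows "(f1 x)\<^sup>2 <= (2 / lo + 2 * hi) * En w 1 f"
proof -
  have w': "weight w" "0 < lo" "lo <= wlen w" "wlen w <= hi" using w by (auto simp: wtb_def)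
  have n: "0 <= X w f" "0 <= X w (ad w f)" by (auto intro: X_nonneg w')
  have "2 / wlen w * X w f <= 2 / lo * X w f"
    using w' n by (intro mult_right_mono divide_left_mono) auto
  moreover have "2 * wlen w * X w (ad w f) <= 2 * hi * X w (ad w f)"
    using w' n by (intro mult_right_mono) auto
  moreover have "0 <= 2 / lo * X w (ad w f)" "0 <= 2 * hi * X w f"
    using n w' by (auto intro!: mult_nonneg_nonneg)
  ultimately show ?thesis using sup_le[OF w'(1) f f1 ae x] En_Suc[of w 0 f]
    by (simp add: En_0 algebra_simps)
qed

lemma AE_sup_le_En:
  assumes "wtb lo hi w" "H1 f"
  shows "AE x in LI. (f x)\<^sup>2 <= (2 / lo + 2 * hi) * En w 1 f"
proof -
  obtain f1 where f1: "ac f1 (wd f)" "AE x in LI. f x = f1 x" using H1_ac[OF assms(2)] .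
  have "AE x in LI. (f1 x)\<^sup>2 <= (2 / lo + 2 * hi) * En w 1 f"
    by (rule AE_LI_I) (rule sup_le_En[OF assms f1])
  with f1(2) show ?thesis by eventually_elim simp
qed

section \<open>Products and reciprocals of Sobolev functions\<close>

lemma H1_mult_L2: assumes "H1 f" "g \<in> L2" shows "(\<lambda>x. f x * g x) \<in> L2"
proof -
  obtain f1 where f1: "ac f1 (wd f)" "AE x in LI. f x = f1 x" using H1_ac[OF assms(1)] .
  have "(\<lambda>x. f1 x * g x) \<in> L2" by (rule L2_continuous_mult[OF ac_continuous[OF f1(1)] assms(2)])
  then show ?thesis by (rule L2_cong_AE) (use f1(2) in eventually_elim, simp)
qed

lemma X_mult_le:
  assumes w: "wtb lo hi w" and f: "H1 f" and g: "g \<in> L2"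
  shows "X w (\<lambda>x. f x * g x) <= (2 / lo + 2 * hi) * En w 1 f * X w g"
proof (rule X_mono[OF wtb_weight[OF w] H1_mult_L2[OF f g] g])
  have "0 < lo" "0 <= hi" using w wlen_pos[OF wtb_weight[OF w]] by (auto simp: wtb_def)
  then show "0 <= (2 / lo + 2 * hi) * En w 1 f"
    using En_nonneg[OF wtb_weight[OF w], of 1 f] by (intro mult_nonneg_nonneg) auto
  show "AE x in LI. (f x * g x)\<^sup>2 <= (2 / lo + 2 * hi) * En w 1 f * (g x)\<^sup>2"
    using AE_sup_le_En[OF w f] by eventually_elim (simp add: power_mult_distrib mult_right_mono)
qed

lemma ad_mult:
  assumes "H1 f" "H1 g"
  shows "AE x in LI. ad w (\<lambda>x. f x * g x) x = 1 * (f x * ad w g x) + 1 * (g x * ad w f x)"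
  using H1_mult(2)[OF assms] by eventually_elim (simp add: ad_def algebra_simps add_divide_distrib)

text \<open>H^k is a module over H^max(k,1), with a constant that depends on \<open>lo\<close>,
  \<open>hi\<close> and \<open>k\<close> only. Already at k = 0 the first factor is estimated by its
  supremum, which takes one derivative. In the inductive step the product rule leaves f g' and g f',
  where the undifferentiated factor still has order max k 1.\<close>

lemma Hk_mult:
  assumes "0 < lo"
  shows "\<exists>C\<ge>0. \<forall>w f g. wtb lo hi w --> Hk w (max k 1) f --> Hk w k g -->
    Hk w k (\<lambda>x. f x * g x) \<and> En w k (\<lambda>x. f x * g x) <= C * (En w (max k 1) f * En w k g)"
proof (induction k)
  case 0
  define C where "C = \<bar>2 / lo + 2 * hi\<bar>"
  show ?case
  proof (intro exI[of _ C] conjI allI impI)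
    fix w f g assume w: "wtb lo hi w" and f: "Hk w (max 0 1) f" and g: "Hk w 0 g"
    have f': "H1 f" and g': "g \<in> L2" using f g by auto
    show "Hk w 0 (\<lambda>x. f x * g x)" using H1_mult_L2[OF f' g'] by simp
    have nn: "0 <= En w 1 f * X w g"
      using X_nonneg[OF wtb_weight[OF w], of g] En_nonneg[OF wtb_weight[OF w], of 1 f] by simp
    have "X w (\<lambda>x. f x * g x) <= (2 / lo + 2 * hi) * (En w 1 f * X w g)"
      using X_mult_le[OF w f' g'] by (simp add: mult.assoc)
    also have "... <= C * (En w 1 f * X w g)" unfolding C_def using nn by (intro mult_right_mono) auto
    finally show "En w 0 (\<lambda>x. f x * g x) <= C * (En w (max 0 1) f * En w 0 g)" by (simp add: En_0)
  qed (simp add: C_def)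
next
  case (Suc k)
  then obtain C where C: "C >= 0" "\<And>w f g. wtb lo hi w ==> Hk w (max k 1) f ==> Hk w k g ==>
    Hk w k (\<lambda>x. f x * g x) \<and> En w k (\<lambda>x. f x * g x) <= C * (En w (max k 1) f * En w k g)" by blast
  define S where "S = \<bar>2 / lo + 2 * hi\<bar>"
  show ?case
  proof (intro exI[of _ "S + 4 * C"] conjI allI impI)
    show "0 <= S + 4 * C" using C by (simp add: S_def)
    fix w f g assume w: "wtb lo hi w" and f: "Hk w (max (Suc k) 1) f" and g: "Hk w (Suc k) g"
    note w' = wtb_weight[OF w]
    have f: "Hk w (Suc k) f" using f by simp
    have h: "H1 f" "H1 g" "Hk w k (ad w f)" "Hk w k (ad w g)" using f g by auto
    have m: "max k 1 <= Suc k" by simp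
    have fg: "Hk w (max k 1) f" "Hk w (max k 1) g" using f g Hk_mono m by blast+
    note 1 = C(2)[OF w fg(1) h(4)] and 2 = C(2)[OF w fg(2) h(3)]
    let ?s = "\<lambda>x. 1 * (f x * ad w g x) + 1 * (g x * ad w f x)"
    have ae: "AE x in LI. ad w (\<lambda>x. f x * g x) x = ?s x" by (rule ad_mult[OF h(1,2)])
    have s: "Hk w k ?s" by (rule Hk_lin) (use 1 2 in auto)
    show "Hk w (Suc k) (\<lambda>x. f x * g x)"
      using H1_mult(1)[OF h(1,2)] Hk_cong_AE[OF s AE_eq_sym[OF ae]] by simp
    define F where "F = En w (Suc k) f"
    define G where "G = En w (Suc k) g"
    have n: "0 <= F" "0 <= G" unfolding F_def G_def by (auto intro: En_nonneg[OF w'])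
    have le: "En w (max k 1) f <= F" "En w (max k 1) g <= G" "En w k (ad w f) <= F" "En w k (ad w g) <= G"
      "En w 1 f <= F" "X w g <= G"
      unfolding F_def G_def using En_mono[OF w' m] En_ad_le[OF w'] En_mono[OF w', of 1 "Suc k"] X_le_En[OF w'] by auto
    have "En w k (ad w (\<lambda>x. f x * g x)) = En w k ?s" by (rule En_cong_AE[OF w' s AE_eq_sym[OF ae], symmetric])
    also have "... <= 2 * En w k (\<lambda>x. f x * ad w g x) + 2 * En w k (\<lambda>x. g x * ad w f x)"
      using En_add_le[OF w', of k "\<lambda>x. f x * ad w g x" "\<lambda>x. g x * ad w f x"] 1 2 by simp
    also have "En w k (\<lambda>x. f x * ad w g x) <= C * (F * G)"
      using 1 le n C(1) En_nonneg[OF w'] by (elim conjE) (erule order_trans, intro mult_left_mono mult_mono, auto)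
    also have "En w k (\<lambda>x. g x * ad w f x) <= C * (F * G)"
      using 2 le n C(1) En_nonneg[OF w']
      by (elim conjE) (erule order_trans, subst mult.commute[of F], intro mult_left_mono mult_mono, auto)
    finally have a: "En w k (ad w (\<lambda>x. f x * g x)) <= 4 * C * (F * G)" by simp
    have "X w (\<lambda>x. f x * g x) <= (2 / lo + 2 * hi) * (En w 1 f * X w g)"
      using X_mult_le[OF w h(1) H1_L2[OF h(2)]] by (simp add: mult.assoc)
    also have "... <= S * (En w 1 f * X w g)"
      unfolding S_def using En_nonneg[OF w', of 1 f] X_nonneg[OF w', of g] by (intro mult_right_mono) auto
    also have "... <= S * (F * G)"
      using le n X_nonneg[OF w'] by (intro mult_left_mono mult_mono) (auto simp: S_def)
    finally have "X w (\<lambda>x. f x * g x) <= S * (F * G)" .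
    with a have "En w (Suc k) (\<lambda>x. f x * g x) <= (S + 4 * C) * (F * G)" by (simp add: En_Suc algebra_simps)
    then show "En w (Suc k) (\<lambda>x. f x * g x) <= (S + 4 * C) * (En w (max (Suc k) 1) f * En w (Suc k) g)"
      by (simp add: F_def G_def)
  qed
qed

lemma ad_inverse:
  assumes "H1 f" "continuous_on J f" "m > 0" "\<forall>x\<in>J. m <= f x"
  shows "H1 (\<lambda>x. inverse (f x))"
    "AE x in LI. ad w (\<lambda>x. inverse (f x)) x = (-1) * (inverse (f x) * (inverse (f x) * ad w f x)) + 0 * 0"
proof -
  have a: "ac (\<lambda>x. inverse (f x)) (\<lambda>x. - (wd f x * (inverse (f x))\<^sup>2))"
    by (rule ac_inverse[OF H1_continuous_ac[OF assms(1,2)] assms(3)]) (use assms(4) in blast)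
  show "H1 (\<lambda>x. inverse (f x))" by (rule ac_imp_H1(1)[OF a])
  show "AE x in LI. ad w (\<lambda>x. inverse (f x)) x = (-1) * (inverse (f x) * (inverse (f x) * ad w f x)) + 0 * 0"
    using ac_imp_H1(2)[OF a] by eventually_elim (simp add: ad_def power2_eq_square)
qed

text \<open>The derivative of 1/f is -(1/f)(1/f) f', so one more order follows from two products at
  the previous order. The induction starts at order 1, where the lower bound \<open>m\<close>
  controls 1/f pointwise.\<close>

lemma Hk_inverse:
  assumes "0 < lo" "0 < m" "0 <= B"
  shows "\<exists>C\<ge>0. \<forall>w f. wtb lo hi w --> Hk w (Suc k) f --> continuous_on J f --> (\<forall>x\<in>J. m <= f x) -->
    En w (Suc k) f <= B -->
    Hk w (Suc k) (\<lambda>x. inverse (f x)) \<and> En w (Suc k) (\<lambda>x. inverse (f x)) <= C"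
proof (induction k)
  case 0
  show ?case
  proof (intro exI[of _ "(inverse m)\<^sup>2 * \<bar>hi\<bar> + (inverse m)^4 * B"] conjI allI impI)
    fix w f assume w: "wtb lo hi w" and f: "Hk w (Suc 0) f" "continuous_on J f" "\<forall>x\<in>J. m <= f x" "En w (Suc 0) f <= B"
    note w' = wtb_weight[OF w]
    have f1: "H1 f" "ad w f \<in> L2" using f(1) by auto
    note i = ad_inverse[OF f1(1) f(2) assms(2) f(3)]
    have iL: "(\<lambda>x. inverse (f x)) \<in> L2" by (rule H1_L2[OF i(1)])
    have b: "0 <= inverse (f x)" "inverse (f x) <= inverse m" if "x \<in> J" for x
      using f(3) that assms(2) by (auto intro: le_imp_inverse_le order_trans[of 0 m])
    show "Hk w (Suc 0) (\<lambda>x. inverse (f x))" using i(1) ad_L2[OF w' i(1)] by simp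
    have "X w (\<lambda>x. inverse (f x)) <= (inverse m)\<^sup>2 * wlen w"
      by (intro X_one_le[OF w' iL] AE_LI_I power_mono b) auto
    also have "... <= (inverse m)\<^sup>2 * \<bar>hi\<bar>" using w by (intro mult_left_mono) (auto simp: wtb_def)
    finally have 1: "X w (\<lambda>x. inverse (f x)) <= (inverse m)\<^sup>2 * \<bar>hi\<bar>" .
    have "X w (ad w (\<lambda>x. inverse (f x))) <= (inverse m)^4 * X w (ad w f)"
    proof (rule X_mono[OF w' ad_L2[OF w' i(1)] f1(2)])
      have "AE x in LI. 0 <= inverse (f x) \<and> inverse (f x) <= inverse m" by (rule AE_LI_I) (use b in auto)
      with i(2)[of w] show "AE x in LI. (ad w (\<lambda>x. inverse (f x)) x)\<^sup>2 <= (inverse m)^4 * (ad w f x)\<^sup>2"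
      proof eventually_elim
        case (elim x)
        have "(inverse (f x))^4 * (ad w f x)\<^sup>2 <= (inverse m)^4 * (ad w f x)\<^sup>2"
          using elim by (intro mult_right_mono power_mono) auto
        then show ?case using elim by (simp add: power_mult_distrib power2_eq_square power4_eq_xxxx mult_ac)
      qed
    qed simp
    also have "... <= (inverse m)^4 * B"
      using f(4) X_nonneg[OF w', of f] by (intro mult_left_mono) (auto simp: En_Suc En_0)
    finally show "En w (Suc 0) (\<lambda>x. inverse (f x)) <= (inverse m)\<^sup>2 * \<bar>hi\<bar> + (inverse m)^4 * B"
      using 1 by (simp add: En_Suc En_0)
  qed (use assms in auto)
next
  case (Suc k)
  then obtain C where C: "C >= 0" "\<And>w f. wtb lo hi w ==> Hk w (Suc k) f ==> continuous_on J f ==> (\<forall>x\<in>J. m <= f x) ==>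
    En w (Suc k) f <= B ==>
    Hk w (Suc k) (\<lambda>x. inverse (f x)) \<and> En w (Suc k) (\<lambda>x. inverse (f x)) <= C" by blast
  obtain P where P: "P >= 0" "\<And>w f g. wtb lo hi w ==> Hk w (Suc k) f ==> Hk w (Suc k) g ==>
    Hk w (Suc k) (\<lambda>x. f x * g x) \<and> En w (Suc k) (\<lambda>x. f x * g x) <= P * (En w (Suc k) f * En w (Suc k) g)"
    using Hk_mult[OF assms(1), of hi "Suc k"] by auto
  show ?case
  proof (intro exI[of _ "C + P * (C * (P * (C * B)))"] conjI allI impI)
    show "0 <= C + P * (C * (P * (C * B)))" using C P assms(3) by simp
    fix w f assume w: "wtb lo hi w" and f: "Hk w (Suc (Suc k)) f" "continuous_on J f" "\<forall>x\<in>J. m <= f x"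
      "En w (Suc (Suc k)) f <= B"
    note w' = wtb_weight[OF w]
    have f1: "H1 f" "Hk w (Suc k) (ad w f)" using f(1) by auto
    note i = ad_inverse[OF f1(1) f(2) assms(2) f(3)]
    have fB: "En w (Suc k) f <= B" using f(4) En_mono[OF w', of "Suc k" "Suc (Suc k)" f] by simp
    have aB: "En w (Suc k) (ad w f) <= B" using f(4) En_ad_le[OF w', of "Suc k" f] by linarith
    note q = C(2)[OF w Hk_Suc_imp[OF f(1)] f(2,3) fB]
    note p1 = P(2)[OF w conjunct1[OF q] f1(2)]
    note p2 = P(2)[OF w conjunct1[OF q] conjunct1[OF p1]]
    let ?s = "\<lambda>x. (-1) * (inverse (f x) * (inverse (f x) * ad w f x)) + 0 * 0"
    have s: "Hk w (Suc k) ?s" by (rule Hk_lin[OF conjunct1[OF p2] Hk_zero])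
    show "Hk w (Suc (Suc k)) (\<lambda>x. inverse (f x))"
      using i(1) Hk_cong_AE[OF s AE_eq_sym[OF i(2)]] by simp
    have "En w (Suc k) (ad w (\<lambda>x. inverse (f x))) = En w (Suc k) ?s"
      by (rule En_cong_AE[OF w' s AE_eq_sym[OF i(2)], symmetric])
    also have "... = En w (Suc k) (\<lambda>x. inverse (f x) * (inverse (f x) * ad w f x))"
      using En_cmult[OF w' conjunct1[OF p2], of "-1"] by simp
    also have "... <= P * (C * (P * (C * B)))"
    proof -
      have "En w (Suc k) (\<lambda>x. inverse (f x) * ad w f x) <= P * (C * B)"
        using p1 q aB P(1) C(1) En_nonneg[OF w'] by (elim conjE) (erule order_trans, intro mult_left_mono mult_mono, auto)
      then show ?thesis
        using p2 q P(1) C(1) En_nonneg[OF w'] by (elim conjE) (erule order_trans, intro mult_left_mono mult_mono, auto)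
    qed
    finally have 1: "En w (Suc k) (ad w (\<lambda>x. inverse (f x))) <= P * (C * (P * (C * B)))" .
    have "X w (\<lambda>x. inverse (f x)) <= C" using q X_le_En[OF w', of "\<lambda>x. inverse (f x)" "Suc k"] by linarith
    with 1 show "En w (Suc (Suc k)) (\<lambda>x. inverse (f x)) <= C + P * (C * (P * (C * B)))"
      by (simp only: En_Suc[of _ "Suc k"])
  qed
qed

section \<open>Interpolation and change of the weight\<close>

text \<open>\<open>ad w h\<close> is w0/w times \<open>ad w0 h\<close>, so each order costs one
  product with the quotient. The quotient only multiplies derivatives of h, hence order K of the
  quotient serves order K + 1 of h; this matches a speed, which is one order less regular than its
  curve.\<close>

lemma Hk_change_weight:
  assumes "0 < lo" "0 <= B" "0 <= S" "1 <= K"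
  shows "k <= Suc K ==> \<exists>C\<ge>0. \<forall>w0 w h. wtb lo hi w0 --> weight w --> Hk w0 K (\<lambda>x. w0 x / w x) -->
    En w0 K (\<lambda>x. w0 x / w x) <= B --> (\<forall>x\<in>J. w x <= S * w0 x) --> Hk w0 k h -->
    Hk w k h \<and> En w k h <= C * En w0 k h"
proof (induction k)
  have X: "X w h <= S * X w0 h" if "weight w0" "weight w" "\<forall>x\<in>J. w x <= S * w0 x" "h \<in> L2" for w0 w h
  proof -
    have "X w h <= (LINT x|LI. S * ((h x)\<^sup>2 * w0 x))" unfolding X_def
    proof (rule integral_mono_AE)
      show "AE x in LI. (h x)\<^sup>2 * w x <= S * ((h x)\<^sup>2 * w0 x)"
      proof (rule AE_LI_I)
        fix x assume "x \<in> J"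
        then have "(h x)\<^sup>2 * w x <= (h x)\<^sup>2 * (S * w0 x)" using that(3) by (intro mult_left_mono) auto
        then show "(h x)\<^sup>2 * w x <= S * ((h x)\<^sup>2 * w0 x)" by (simp add: mult_ac)
      qed
    qed (use X_integrable_sq that in auto)
    then show ?thesis by (simp add: X_def)
  qed
  {
    case 0
    show ?case using X assms(3) by (intro exI[of _ S]) (auto simp: En_0 wtb_def)
  next
    case (Suc k)
    then obtain C where C: "C >= 0" "\<And>w0 w h. wtb lo hi w0 ==> weight w ==> Hk w0 K (\<lambda>x. w0 x / w x) ==>
      En w0 K (\<lambda>x. w0 x / w x) <= B ==> (\<forall>x\<in>J. w x <= S * w0 x) ==> Hk w0 k h ==>
      Hk w k h \<and> En w k h <= C * En w0 k h" by auto
    have kK: "k <= K" "max k 1 <= K" using Suc.prems assms(4) by auto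
    obtain P where P: "P >= 0" "\<And>w f g. wtb lo hi w ==> Hk w (max k 1) f ==> Hk w k g ==>
      Hk w k (\<lambda>x. f x * g x) \<and> En w k (\<lambda>x. f x * g x) <= P * (En w (max k 1) f * En w k g)"
      using Hk_mult[OF assms(1), of hi k] by auto
    show ?case
    proof (intro exI[of _ "S + C * (P * B)"] conjI allI impI)
      show "0 <= S + C * (P * B)" using C(1) P(1) assms by simp
      fix w0 w h assume w0: "wtb lo hi w0" and w: "weight w" and q: "Hk w0 K (\<lambda>x. w0 x / w x)"
        "En w0 K (\<lambda>x. w0 x / w x) <= B" and S: "\<forall>x\<in>J. w x <= S * w0 x" and h: "Hk w0 (Suc k) h"
      note w0' = wtb_weight[OF w0]
      have h1: "H1 h" "Hk w0 k (ad w0 h)" using h by auto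
      have eq: "AE x in LI. w0 x / w x * ad w0 h x = ad w h x"
      proof (rule AE_LI_I)
        fix x assume "x \<in> J"
        then have "w0 x > 0" using w0' by (auto simp: weight_def)
        then show "w0 x / w x * ad w0 h x = ad w h x" by (simp add: ad_def)
      qed
      have p: "Hk w0 k (\<lambda>x. w0 x / w x * ad w0 h x) \<and> En w0 k (\<lambda>x. w0 x / w x * ad w0 h x)
          <= P * (En w0 (max k 1) (\<lambda>x. w0 x / w x) * En w0 k (ad w0 h))"
        by (rule P(2)[OF w0 Hk_mono[OF q(1) kK(2)] h1(2)])
      have a: "Hk w0 k (ad w h)" using Hk_cong_AE[OF _ eq] p by blast
      \<comment> \<open>The induction hypothesis is applied to \<open>ad w h\<close>, already known
        to have order k for the weight \<open>w0\<close>.\<close>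
      note c = C(2)[OF w0 w q S a]
      show "Hk w (Suc k) h" using h1(1) c by simp
      have "En w0 k (ad w h) = En w0 k (\<lambda>x. w0 x / w x * ad w0 h x)"
        using En_cong_AE[OF w0' _ eq] p by simp
      also have "... <= P * (B * En w0 k (ad w0 h))"
        using p q(2) P(1) En_mono[OF w0' kK(2), of "\<lambda>x. w0 x / w x"] En_nonneg[OF w0', of k "ad w0 h"]
        by (elim conjE) (erule order_trans, intro mult_left_mono mult_right_mono, auto)
      also have "... <= P * (B * En w0 (Suc k) h)"
        using P(1) assms(2) En_ad_le[OF w0', of k h] by (intro mult_left_mono) auto
      finally have "C * En w0 k (ad w h) <= C * (P * (B * En w0 (Suc k) h))" using C(1) by (intro mult_left_mono)
      then have 1: "En w k (ad w h) <= C * (P * B) * En w0 (Suc k) h" using c by (simp add: mult.assoc)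
      have "X w h <= S * X w0 h" by (rule X[OF w0' w S H1_L2[OF h1(1)]])
      also have "... <= S * En w0 (Suc k) h" using X_le_En[OF w0', of h "Suc k"] assms(3) by (intro mult_left_mono)
      finally show "En w (Suc k) h <= (S + C * (P * B)) * En w0 (Suc k) h"
        using 1 by (simp add: En_Suc distrib_right)
    qed
  }
qed

text \<open>In the arc length coordinate \<open>U\<close> on an arc of length \<open>\<delta>\<close>, integrating \<open>g = f'\<close> against the weight
  \<open>U(\<delta> - U)\<close>, which vanishes at both ends and has integral \<open>\<delta>\<^sup>3/6\<close>, bounds a mean of \<open>g\<close> by \<open>f\<close>.\<close>

lemma derivative_sup_le_arc:
  assumes w: "weight w" and f: "H1 f" "H1 (ad w f)"
    and g1: "ac g1 (wd (ad w f))" "AE x in LI. ad w f x = g1 x"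
    and ab: "0 <= \<alpha>" "\<alpha> < \<beta>" "\<beta> <= 2*pi" and d: "\<delta> = integral {\<alpha>..\<beta>} w" "\<delta> > 0" and x: "x \<in> {\<alpha>..\<beta>}"
  shows "(g1 x)\<^sup>2 <= 72 / \<delta>^3 * X w f + 2 * \<delta> * X w (ad w (ad w f))"
proof -
  obtain f1 where f1: "ac f1 (wd f)" "AE x in LI. f x = f1 x" using H1_ac[OF f(1)] .
  have wL: "w \<in> L2" by (rule weight_L2[OF w])
  have wc: "continuous_on J w" using w by (simp add: weight_def)
  have w0: "0 <= w t" if "t \<in> {\<alpha>..\<beta>}" for t using weight_nonneg[OF w, of t] that ab by auto
  have "AE x in LI. wd f x = g1 x * w x"
  proof -
    have "AE x in LI. ad w f x * w x = wd f x" by (rule AE_LI_I) (rule ad_times_weight[OF w])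
    with g1(2) show ?thesis by eventually_elim simp
  qed
  then have f1': "ac f1 (\<lambda>x. g1 x * w x)" by (rule ac_cong_AE[OF f1(1)]) simp
  define U where "U = (\<lambda>x. integral {0..x} w - integral {0..\<alpha>} w)"
  have U: "ac U w"
    using ac_diff[OF ac_indefinite[OF wL] ac_const[of "integral {0..\<alpha>} w"]] by (simp add: U_def)
  have Ua: "U \<alpha> = 0" by (simp add: U_def)
  have Ub: "U \<beta> = \<delta>" using ac_increment[OF U, of \<alpha> \<beta>] ab d Ua by simp
  have Ur: "0 <= U t" "U t <= \<delta>" if "t \<in> {\<alpha>..\<beta>}" for t
  proof -
    have i: "w integrable_on {y..z}" if "0 <= y" "z <= 2*pi" for y z using L2_integrable_on[OF wL that] .
    have "U t - U \<alpha> = integral {\<alpha>..t} w" "U \<beta> - U t = integral {t..\<beta>} w"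
      using ac_increment[OF U, of \<alpha> t] ac_increment[OF U, of t \<beta>] that ab by auto
    moreover have "0 <= integral {\<alpha>..t} w" "0 <= integral {t..\<beta>} w"
      using w0 that ab by (auto intro!: Henstock_Kurzweil_Integration.integral_nonneg i)
    ultimately show "0 <= U t" "U t <= \<delta>" using Ua Ub by auto
  qed
  define Q where "Q = (\<lambda>x. \<delta> * U x - U x * U x)"
  define Q' where "Q' = (\<lambda>x. \<delta> * w x - (w x * U x + U x * w x))"
  have Q: "ac Q Q'" unfolding Q_def Q'_def by (intro ac_diff ac_cmult ac_mult U)
  have Qab: "Q \<alpha> = 0" "Q \<beta> = 0" by (auto simp: Q_def Ua Ub)
  have Q0: "0 <= Q t" if "t \<in> {\<alpha>..\<beta>}" for t
    using mult_right_mono[OF Ur(2)[OF that] Ur(1)[OF that]] by (simp add: Q_def)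
  have Q'b: "\<bar>Q' t\<bar> <= \<delta> * w t" if "t \<in> {\<alpha>..\<beta>}" for t
  proof -
    have "Q' t = (\<delta> - 2 * U t) * w t" by (simp add: Q'_def algebra_simps)
    moreover have "\<bar>\<delta> - 2 * U t\<bar> <= \<delta>" using Ur[OF that] by auto
    ultimately show ?thesis using w0[OF that] by (simp add: abs_mult mult_right_mono)
  qed
  have i: "h integrable_on {\<alpha>..\<beta>}" if "h \<in> L2" for h using L2_integrable_on[OF that] ab by auto
  note cont = ac_continuous[OF Q] ac_continuous[OF f1'] ac_continuous[OF g1(1)] ac_continuous[OF U] wc
  have Qw: "(\<lambda>t. Q t * w t) \<in> L2" by (intro L2_continuous continuous_intros cont)
  have mean: "integral {\<alpha>..\<beta>} (\<lambda>t. Q t * w t) = \<delta>^3 / 6"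
  proof -
    \<comment> \<open>The polynomial delta U^2 / 2 - U^3 / 3 is the primitive, in the coordinate U,
      of the averaging weight Q.\<close>
    have "ac (\<lambda>x. \<delta> / 2 * (U x * U x) - 1/3 * (U x * (U x * U x)))
       (\<lambda>x. \<delta> / 2 * (w x * U x + U x * w x) - 1/3 * (w x * (U x * U x) + U x * (w x * U x + U x * w x)))"
      by (intro ac_diff ac_cmult ac_mult U)
    from ac_increment[OF this, of \<alpha> \<beta>] have "\<delta> / 2 * (\<delta> * \<delta>) - 1/3 * (\<delta> * (\<delta> * \<delta>)) =
      integral {\<alpha>..\<beta>} (\<lambda>x. \<delta> / 2 * (w x * U x + U x * w x) - 1/3 * (w x * (U x * U x) + U x * (w x * U x + U x * w x)))"
      using ab by (simp add: Ua Ub)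
    also have "(\<lambda>x. \<delta> / 2 * (w x * U x + U x * w x) - 1/3 * (w x * (U x * U x) + U x * (w x * U x + U x * w x))) = (\<lambda>t. Q t * w t)"
      by (auto simp: Q_def algebra_simps)
    finally show ?thesis by (simp add: power3_eq_cube)
  qed
  define E where "E = integral {\<alpha>..\<beta>} (\<lambda>t. \<bar>ad w (ad w f) t\<bar> * w t)"
  define F where "F = integral {\<alpha>..\<beta>} (\<lambda>t. \<bar>f1 t\<bar> * w t)"
  have parts: "integral {\<alpha>..\<beta>} (\<lambda>t. Q t * (g1 t * w t)) = - integral {\<alpha>..\<beta>} (\<lambda>t. Q' t * f1 t)"
  proof -
    have "integral {\<alpha>..\<beta>} (\<lambda>x. Q' x * f1 x + Q x * (g1 x * w x)) = 0"
      using ac_increment[OF ac_mult[OF Q f1'], of \<alpha> \<beta>] ab Qab by simp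
    moreover have "(\<lambda>x. Q' x * f1 x) \<in> L2" by (intro L2_mult_continuous cont ac_L2[OF Q])
    moreover have "(\<lambda>x. Q x * (g1 x * w x)) \<in> L2" by (intro L2_continuous continuous_intros cont)
    ultimately show ?thesis using Henstock_Kurzweil_Integration.integral_add[OF i i] by fastforce
  qed
  have b1: "\<bar>integral {\<alpha>..\<beta>} (\<lambda>t. Q' t * f1 t)\<bar> <= \<delta> * F"
  proof -
    have "norm (integral {\<alpha>..\<beta>} (\<lambda>t. Q' t * f1 t)) <= integral {\<alpha>..\<beta>} (\<lambda>t. \<delta> * (\<bar>f1 t\<bar> * w t))"
    proof (rule integral_norm_bound_integral)
      show "(\<lambda>t. Q' t * f1 t) integrable_on {\<alpha>..\<beta>}" by (intro i L2_mult_continuous cont ac_L2[OF Q])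
      show "(\<lambda>t. \<delta> * (\<bar>f1 t\<bar> * w t)) integrable_on {\<alpha>..\<beta>}" by (intro i L2_continuous continuous_intros cont)
      fix t assume t: "t \<in> {\<alpha>..\<beta>}"
      have "\<bar>Q' t\<bar> * \<bar>f1 t\<bar> <= (\<delta> * w t) * \<bar>f1 t\<bar>" using Q'b[OF t] by (intro mult_right_mono) auto
      then show "norm (Q' t * f1 t) <= \<delta> * (\<bar>f1 t\<bar> * w t)" by (simp add: abs_mult mult_ac)
    qed
    then show ?thesis unfolding F_def by simp
  qed
  have b2: "\<bar>integral {\<alpha>..\<beta>} (\<lambda>t. Q t * w t * (g1 x - g1 t))\<bar> <= \<delta>^3 / 6 * E"
  proof -
    have "norm (integral {\<alpha>..\<beta>} (\<lambda>t. Q t * w t * (g1 x - g1 t))) <= integral {\<alpha>..\<beta>} (\<lambda>t. E * (Q t * w t))"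
    proof (rule integral_norm_bound_integral)
      show "(\<lambda>t. Q t * w t * (g1 x - g1 t)) integrable_on {\<alpha>..\<beta>}" by (intro i L2_continuous continuous_intros cont)
      show "(\<lambda>t. E * (Q t * w t)) integrable_on {\<alpha>..\<beta>}" by (intro i L2_continuous continuous_intros cont)
      fix t assume t: "t \<in> {\<alpha>..\<beta>}"
      have "\<bar>g1 x - g1 t\<bar> <= E"
        unfolding E_def using osc_interval[OF w f(2) g1(1), of \<alpha> x t \<beta>] osc_interval[OF w f(2) g1(1), of \<alpha> t x \<beta>] t x ab
        by (cases "x <= t") (auto simp: abs_minus_commute)
      then have "(Q t * w t) * \<bar>g1 x - g1 t\<bar> <= (Q t * w t) * E" using Q0[OF t] w0[OF t] by (intro mult_left_mono) auto
      then show "norm (Q t * w t * (g1 x - g1 t)) <= E * (Q t * w t)" using Q0[OF t] w0[OF t] by (simp add: abs_mult mult_ac)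
    qed
    also have "... = \<delta>^3 / 6 * E" using mean by simp
    finally show ?thesis by simp
  qed
  \<comment> \<open>\<open>g1 x\<close> is split into its weighted mean, which integration by parts
    moves onto \<open>f1\<close>, and its deviation from that mean, which is bounded by E.\<close>
  have "g1 x * (\<delta>^3 / 6) = integral {\<alpha>..\<beta>} (\<lambda>t. g1 x * (Q t * w t))" using mean by simp
  also have "(\<lambda>t. g1 x * (Q t * w t)) = (\<lambda>t. Q t * w t * (g1 x - g1 t) + Q t * (g1 t * w t))" by (auto simp: algebra_simps)
  also have "integral {\<alpha>..\<beta>} ... = integral {\<alpha>..\<beta>} (\<lambda>t. Q t * w t * (g1 x - g1 t)) + integral {\<alpha>..\<beta>} (\<lambda>t. Q t * (g1 t * w t))"
    by (rule Henstock_Kurzweil_Integration.integral_add) (intro i L2_continuous continuous_intros cont)+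
  finally have "\<bar>g1 x * (\<delta>^3 / 6)\<bar> <= \<delta>^3 / 6 * E + \<delta> * F" using b1 b2 parts by linarith
  moreover have "(E + 6 / \<delta>\<^sup>2 * F) * (\<delta>^3 / 6) = \<delta>^3 / 6 * E + \<delta> * F"
    using d(2) by (simp add: field_simps power2_eq_square power3_eq_cube)
  moreover have "\<bar>g1 x * (\<delta>^3 / 6)\<bar> = \<bar>g1 x\<bar> * (\<delta>^3 / 6)" using d(2) by (simp add: abs_mult)
  ultimately have "\<bar>g1 x\<bar> * (\<delta>^3 / 6) <= (E + 6 / \<delta>\<^sup>2 * F) * (\<delta>^3 / 6)" by simp
  then have "\<bar>g1 x\<bar> <= E + 6 / \<delta>\<^sup>2 * F" using d(2) by (simp add: mult_le_cancel_right)
  then have "(g1 x)\<^sup>2 <= (E + 6 / \<delta>\<^sup>2 * F)\<^sup>2" by (metis abs_ge_zero power2_abs power_mono)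
  also have "... <= 2 * E\<^sup>2 + 2 * (6 / \<delta>\<^sup>2 * F)\<^sup>2"
    using sum_squares_bound[of E "6 / \<delta>\<^sup>2 * F"] by (simp add: power2_sum)
  also have "E\<^sup>2 <= \<delta> * X w (ad w (ad w f))"
    unfolding E_def d(1) using weighted_Cauchy_Schwarz[OF w ad_L2[OF w f(2)], of \<alpha> \<beta>] ab by simp
  also have "(6 / \<delta>\<^sup>2 * F)\<^sup>2 = 36 / \<delta>^4 * F\<^sup>2" by (simp add: power_mult_distrib power_divide flip: power_mult)
  also have "F\<^sup>2 <= \<delta> * X w f"
    using weighted_Cauchy_Schwarz[OF w ac_self_L2[OF f1(1)], of \<alpha> \<beta>] ab
      X_cong_AE[OF w H1_L2[OF f(1)] f1(2)] unfolding F_def d(1) by simp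
  finally show ?thesis using d(2) by (simp add: field_simps power2_eq_square power3_eq_cube power4_eq_xxxx)
qed

text \<open>The intermediate value theorem for the arc length function W yields an arc of length r
  containing x: one that starts at x or, near the right end, one that ends at 2 pi. The free
  parameter r trades the term of order 0 against the term of order 2.\<close>

lemma derivative_sup_le:
  assumes w: "weight w" and f: "H1 f" "H1 (ad w f)"
    and g1: "ac g1 (wd (ad w f))" "AE x in LI. ad w f x = g1 x"
    and d: "0 < r" "r <= wlen w" and x: "x \<in> J"
  shows "(g1 x)\<^sup>2 <= 72 / r^3 * X w f + 2 * r * X w (ad w (ad w f))"
proof -
  define W where "W = (\<lambda>x. integral {0..x} w)"
  have W: "ac W w" unfolding W_def by (rule ac_indefinite[OF weight_L2[OF w]])
  have Wc: "continuous_on {a..b} W" if "0 <= a" "b <= 2*pi" for a b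
    by (rule continuous_on_subset[OF ac_continuous[OF W]]) (use that in auto)
  have W0: "W 0 = 0" "W (2*pi) = wlen w" unfolding W_def wlen_eq[OF w] by auto
  have mono: "W a <= W b" if "0 <= a" "a <= b" "b <= 2*pi" for a b
  proof -
    have "0 <= integral {a..b} w"
      using that L2_integrable_on[OF weight_L2[OF w]] weight_nonneg[OF w]
      by (intro Henstock_Kurzweil_Integration.integral_nonneg) auto
    then show ?thesis using ac_increment[OF W that] by simp
  qed
  have "\<exists>u v. 0 <= u \<and> u <= x \<and> x <= v \<and> v <= 2*pi \<and> W v - W u = r"
  proof (cases "W x + r <= wlen w")
    case True
    obtain v where "x <= v" "v <= 2*pi" "W v = W x + r"
      using IVT'[of W x "W x + r" "2*pi"] True d x W0 Wc[of x "2*pi"] by auto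
    then show ?thesis using x by (intro exI[of _ x] exI[of _ v]) auto
  next
    case False
    obtain u where "0 <= u" "u <= x" "W u = wlen w - r"
      using IVT'[of W 0 "wlen w - r" x] False d x W0 Wc[of 0 x] by auto
    then show ?thesis using x W0 by (intro exI[of _ u] exI[of _ "2*pi"]) auto
  qed
  then obtain u v where ab: "0 <= u" "u <= x" "x <= v" "v <= 2*pi" "W v - W u = r" by blast
  have "u \<noteq> v" using ab d by auto
  then have lt: "u < v" using ab by auto
  have "r = integral {u..v} w" using ac_increment[OF W, of u v] ab by simp
  from derivative_sup_le_arc[OF w f g1 ab(1) lt ab(4) this d(1)] show ?thesis using ab by auto
qed

section \<open>Interpolation between derivatives\<close>

lemma X_ad_le:
  assumes w: "weight w" and f: "H1 f" "H1 (ad w f)" and d: "0 < r" "r <= wlen w"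
  shows "X w (ad w f) <= (72 / r^3 * X w f + 2 * r * X w (ad w (ad w f))) * wlen w"
proof -
  obtain g1 where g1: "ac g1 (wd (ad w f))" "AE x in LI. ad w f x = g1 x" using H1_ac[OF f(2)] .
  have "AE x in LI. (g1 x)\<^sup>2 <= 72 / r^3 * X w f + 2 * r * X w (ad w (ad w f))"
    by (rule AE_LI_I) (rule derivative_sup_le[OF w f g1 d])
  with g1(2) have "AE x in LI. (ad w f x)\<^sup>2 <= 72 / r^3 * X w f + 2 * r * X w (ad w (ad w f))"
    by eventually_elim simp
  then show ?thesis
    using d X_nonneg[OF w] by (intro X_one_le[OF w H1_L2[OF f(2)]]) auto
qed

lemma interpolation_epsilon_base:
  assumes "0 < lo" "0 < e"
  shows "\<exists>C\<ge>0. \<forall>w f. wtb lo hi w --> H1 f --> H1 (ad w f) --> X w (ad w f) <= e * X w (ad w (ad w f)) + C * X w f"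
proof -
  define h where "h = max hi lo"
  have h: "h > 0" using assms by (simp add: h_def)
  \<comment> \<open>Small enough for 2 r h <= e, and no longer than any admissible curve.\<close>
  define r where "r = min lo (e / (2 * h))"
  have d: "r > 0" "r <= lo" using assms h by (auto simp: r_def)
  have "r <= e / (2 * h)" by (simp add: r_def)
  then have dh: "2 * r * h <= e" using h by (simp add: field_simps)
  show ?thesis
  proof (intro exI[of _ "72 / r^3 * h"] conjI allI impI)
    show "0 <= 72 / r^3 * h" using d h by simp
    fix w f assume w: "wtb lo hi w" and f: "H1 f" "H1 (ad w f)"
    have w': "weight w" "wlen w <= h" "r <= wlen w" using w d by (auto simp: wtb_def h_def)
    have n: "0 <= X w f" "0 <= X w (ad w (ad w f))" by (auto intro: X_nonneg w')
    have "X w (ad w f) <= (72 / r^3 * X w f + 2 * r * X w (ad w (ad w f))) * wlen w"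
      by (rule X_ad_le[OF w'(1) f d(1) w'(3)])
    also have "... <= (72 / r^3 * X w f + 2 * r * X w (ad w (ad w f))) * h"
      using n d w' by (intro mult_left_mono) auto
    also have "... = 72 / r^3 * h * X w f + 2 * r * h * X w (ad w (ad w f))" by (simp add: algebra_simps)
    also have "2 * r * h * X w (ad w (ad w f)) <= e * X w (ad w (ad w f))" using dh n by (intro mult_right_mono)
    finally show "X w (ad w f) <= e * X w (ad w (ad w f)) + 72 / r^3 * h * X w f" by simp
  qed
qed

text \<open>The base inequality, applied to the derivative of order k, bounds the next one but
  returns a lower order term. The induction hypothesis estimates that term by a small multiple of
  the left side, which is absorbed, and a multiple of f.\<close>

lemma interpolation_epsilon:
  assumes "0 < lo"
  shows "0 < r ==> \<exists>C\<ge>0. \<forall>w f. wtb lo hi w --> Hk w (Suc k) f -->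
    X w ((ad w ^^ k) f) <= r * X w ((ad w ^^ Suc k) f) + C * X w f"
proof (induction k arbitrary: r)
  case 0
  show ?case
  proof (intro exI[of _ 1] conjI allI impI)
    fix w f assume "wtb lo hi w"
    then show "X w ((ad w ^^ 0) f) <= r * X w ((ad w ^^ Suc 0) f) + 1 * X w f"
      using X_nonneg[of w "ad w f"] 0 by (simp add: wtb_def)
  qed simp
next
  case (Suc k)
  obtain C1 where C1: "C1 >= 0" "\<And>w f. wtb lo hi w ==> H1 f ==> H1 (ad w f) ==>
      X w (ad w f) <= r / 2 * X w (ad w (ad w f)) + C1 * X w f"
    using interpolation_epsilon_base[OF assms, of "r / 2" hi] Suc.prems by auto
  \<comment> \<open>With \<open>C1 * e <= 1/2\<close> the returning term is at most half of the left
    side.\<close>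
  define e where "e = 1 / (2 * (C1 + 1))"
  have e: "e > 0" "C1 * e <= 1/2" using C1(1) by (auto simp: e_def field_simps)
  obtain C2 where C2: "C2 >= 0" "\<And>w f. wtb lo hi w ==> Hk w (Suc k) f ==>
      X w ((ad w ^^ k) f) <= e * X w ((ad w ^^ Suc k) f) + C2 * X w f"
    using Suc.IH[OF e(1)] by blast
  show ?case
  proof (intro exI[of _ "2 * (C1 * C2)"] conjI allI impI)
    show "0 <= 2 * (C1 * C2)" using C1 C2 by simp
    fix w f assume w: "wtb lo hi w" and f: "Hk w (Suc (Suc k)) f"
    define a where "a = X w ((ad w ^^ Suc k) f)"
    have "H1 ((ad w ^^ k) f)" "H1 ((ad w ^^ Suc k) f)" using f unfolding Hk_iff by auto
    then have "a <= r / 2 * X w ((ad w ^^ Suc (Suc k)) f) + C1 * X w ((ad w ^^ k) f)"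
      using C1(2)[OF w, of "(ad w ^^ k) f"] by (simp add: a_def)
    also have "C1 * X w ((ad w ^^ k) f) <= C1 * (e * a + C2 * X w f)"
      using C2(2)[OF w Hk_Suc_imp[OF f]] C1(1) by (intro mult_left_mono) (auto simp: a_def)
    also have "... = (C1 * e) * a + C1 * C2 * X w f" by (simp add: algebra_simps)
    also have "(C1 * e) * a <= 1/2 * a" using e(2) X_nonneg[OF wtb_weight[OF w]] by (intro mult_right_mono) (auto simp: a_def)
    finally have "a <= r * X w ((ad w ^^ Suc (Suc k)) f) + 2 * (C1 * C2) * X w f" by (simp add: field_simps)
    then show "X w ((ad w ^^ Suc k) f) <= r * X w ((ad w ^^ Suc (Suc k)) f) + 2 * (C1 * C2) * X w f"
      by (simp only: a_def)
  qed
qed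

text \<open>Leaves only orders 0 and n, matching the coefficients \<open>a 0\<close> and
  \<open>a n\<close> that are positive; this is how the metric dominates the full Sobolev norm in
  \<open>En_le_Gm\<close>.\<close>

lemma interpolation:
  assumes "0 < lo"
  shows "\<exists>C\<ge>0. \<forall>w f. wtb lo hi w --> Hk w n f --> En w n f <= C * (X w f + X w ((ad w ^^ n) f))"
proof (induction n)
  case 0
  show ?case
    by (intro exI[of _ 1]) (auto simp: En_0 intro: X_nonneg[OF wtb_weight])
next
  case (Suc n)
  obtain C where C: "C >= 0" "\<And>w f. wtb lo hi w ==> Hk w n f ==> En w n f <= C * (X w f + X w ((ad w ^^ n) f))"
    using Suc.IH by blast
  obtain D where D: "D >= 0" "\<And>w f. wtb lo hi w ==> Hk w (Suc n) f ==>
    X w ((ad w ^^ n) f) <= 1 * X w ((ad w ^^ Suc n) f) + D * X w f"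
    using interpolation_epsilon[OF assms zero_less_one, of hi n] by blast
  show ?case
  proof (intro exI[of _ "C * (2 + D) + 1"] conjI allI impI)
    show "0 <= C * (2 + D) + 1" using C D by simp
    fix w f assume w: "wtb lo hi w" and f: "Hk w (Suc n) f"
    define x where "x = X w f"
    define y where "y = X w ((ad w ^^ Suc n) f)"
    have n: "0 <= x" "0 <= y" unfolding x_def y_def by (auto intro: X_nonneg[OF wtb_weight[OF w]])
    have "En w n f <= C * (x + (y + D * x))"
      using C(2)[OF w Hk_Suc_imp[OF f]] D(2)[OF w f] C(1) unfolding x_def y_def
      by (elim order_trans) (intro mult_left_mono, auto)
    also have "... <= C * ((2 + D) * (x + y))" using n C(1) D(1) by (intro mult_left_mono) (auto simp: algebra_simps)
    finally have "En w n f <= C * (2 + D) * (x + y)" by (simp only: mult.assoc)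
    moreover have "En w (Suc n) f = En w n f + y" by (simp add: En_def y_def)
    ultimately have "En w (Suc n) f <= C * (2 + D) * (x + y) + (x + y)" using n by simp
    then show "En w (Suc n) f <= (C * (2 + D) + 1) * (X w f + X w ((ad w ^^ Suc n) f))"
      by (simp only: x_def y_def) (simp add: algebra_simps)
  qed
qed

section \<open>Immersions\<close>

text \<open>The passage from \<open>w0\<close> to \<open>w\<close> needs the quotient w0/w, which
  \<open>Hk_inverse\<close> obtains from w/w0. The way back uses w/w0 itself, but measured with the
  weight \<open>w\<close>; its bound is transferred by a change of weight at order K (constant
  \<open>C3\<close>).\<close>

lemma equivalent_weights:
  assumes "0 < lo" "0 < m" "0 <= B" "1 <= K"
  shows "\<exists>C>0. \<forall>w0 w. wtb lo hi w0 --> weight w --> (\<forall>x\<in>J. m * w0 x <= w x \<and> w x <= M * w0 x) -->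
    Hk w0 K (\<lambda>x. w x / w0 x) --> En w0 K (\<lambda>x. w x / w0 x) <= B -->
    (\<forall>h. (Hk w0 (Suc K) h \<longleftrightarrow> Hk w (Suc K) h) \<and>
      (Hk w0 (Suc K) h --> En w (Suc K) h <= C * En w0 (Suc K) h \<and> En w0 (Suc K) h <= C * En w (Suc K) h))"
proof -
  obtain k where K: "K = Suc k" using assms(4) by (cases K) auto
  define M' where "M' = max M 1"
  have M': "M' >= 1" "M <= M'" by (auto simp: M'_def)
  obtain C1 where C1: "C1 >= 0" "\<And>w f. wtb lo hi w ==> Hk w K f ==> continuous_on J f ==> (\<forall>x\<in>J. m <= f x) ==>
    En w K f <= B ==> Hk w K (\<lambda>x. inverse (f x)) \<and> En w K (\<lambda>x. inverse (f x)) <= C1"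
    using Hk_inverse[OF assms(1-3), of hi k] unfolding K by blast
  obtain C2 where C2: "C2 >= 0" "\<And>w0 w h. wtb lo hi w0 ==> weight w ==> Hk w0 K (\<lambda>x. w0 x / w x) ==>
    En w0 K (\<lambda>x. w0 x / w x) <= C1 ==> (\<forall>x\<in>J. w x <= M' * w0 x) ==> Hk w0 (Suc K) h ==>
    Hk w (Suc K) h \<and> En w (Suc K) h <= C2 * En w0 (Suc K) h"
    using Hk_change_weight[OF assms(1) C1(1) _ assms(4) le_refl, of M' hi] M' by auto
  obtain C3 where C3: "C3 >= 0" "\<And>w0 w h. wtb lo hi w0 ==> weight w ==> Hk w0 K (\<lambda>x. w0 x / w x) ==>
    En w0 K (\<lambda>x. w0 x / w x) <= C1 ==> (\<forall>x\<in>J. w x <= M' * w0 x) ==> Hk w0 K h ==>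
    Hk w K h \<and> En w K h <= C3 * En w0 K h"
    using Hk_change_weight[OF assms(1) C1(1) _ assms(4), of M' K hi] M' by auto
  have mlo: "0 < m * lo" "0 <= C3 * B" "0 <= inverse m" using assms C3(1) by auto
  obtain C4 where C4: "C4 >= 0" "\<And>w0 w h. wtb (m * lo) (M' * hi) w0 ==> weight w ==> Hk w0 K (\<lambda>x. w0 x / w x) ==>
    En w0 K (\<lambda>x. w0 x / w x) <= C3 * B ==> (\<forall>x\<in>J. w x <= inverse m * w0 x) ==> Hk w0 (Suc K) h ==>
    Hk w (Suc K) h \<and> En w (Suc K) h <= C4 * En w0 (Suc K) h"
    using Hk_change_weight[OF mlo assms(4) le_refl, of "M' * hi"] by auto
  show ?thesis
  proof (intro exI[of _ "C2 + C4 + 1"] conjI allI impI)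
    show "0 < C2 + C4 + 1" using C2 C4 by simp
  next
    fix w0 w assume w0: "wtb lo hi w0" and w: "weight w" and r: "\<forall>x\<in>J. m * w0 x <= w x \<and> w x <= M * w0 x"
      and q: "Hk w0 K (\<lambda>x. w x / w0 x)" "En w0 K (\<lambda>x. w x / w0 x) <= B"
    note w0' = wtb_weight[OF w0]
    have p0: "0 < w0 x" if "x \<in> J" for x using w0' that by (auto simp: weight_def)
    have r': "\<forall>x\<in>J. w x <= M' * w0 x"
    proof
      fix x assume x: "x \<in> J"
      have "w x <= M * w0 x" using r x by blast
      also have "... <= M' * w0 x" using M' p0[OF x] by (intro mult_right_mono) auto
      finally show "w x <= M' * w0 x" .
    qed
    have qc: "continuous_on J (\<lambda>x. w x / w0 x)"
    proof (intro continuous_on_divide ballI)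
      show "w0 x \<noteq> 0" if "x \<in> J" for x using p0[OF that] by simp
    qed (use w w0' in \<open>auto simp: weight_def\<close>)
    have qm: "\<forall>x\<in>J. m <= w x / w0 x" using r p0 by (auto simp: field_simps)
    have q2: "Hk w0 K (\<lambda>x. w0 x / w x) \<and> En w0 K (\<lambda>x. w0 x / w x) <= C1"
      using C1(2)[OF w0 q(1) qc qm q(2)] by (simp add: inverse_eq_divide)
    have q3: "Hk w K (\<lambda>x. w x / w0 x) \<and> En w K (\<lambda>x. w x / w0 x) <= C3 * B"
      using C3(2)[OF w0 w conjunct1[OF q2] conjunct2[OF q2] r' q(1)] q(2) C3(1)
      by (meson mult_left_mono order_trans)
    have ww: "wtb (m * lo) (M' * hi) w"
    proof -
      have i: "integrable LI w" "integrable LI w0" using w w0' weight_L2 L2_integrable by auto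
      have "m * lo <= m * wlen w0" using w0 assms(2) by (auto simp: wtb_def)
      also have "... = (LINT x|LI. m * w0 x)" by (simp add: wlen_def)
      also have "... <= wlen w" unfolding wlen_def using i r by (intro integral_mono_AE AE_LI_I) auto
      finally have 1: "m * lo <= wlen w" .
      have "wlen w <= (LINT x|LI. M' * w0 x)" unfolding wlen_def using i r' by (intro integral_mono_AE AE_LI_I) auto
      also have "... = M' * wlen w0" by (simp add: wlen_def)
      also have "... <= M' * hi" using w0 M' by (auto simp: wtb_def)
      finally show ?thesis using 1 w mlo by (simp add: wtb_def)
    qed
    have r2: "\<forall>x\<in>J. w0 x <= inverse m * w x" using r assms(2) by (auto simp: field_simps)
    fix h
    note f1 = C2(2)[OF w0 w conjunct1[OF q2] conjunct2[OF q2] r', of h]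
    note f2 = C4(2)[OF ww w0' conjunct1[OF q3] conjunct2[OF q3] r2, of h]
    show iff: "Hk w0 (Suc K) h \<longleftrightarrow> Hk w (Suc K) h" using f1 f2 by blast
    assume h: "Hk w0 (Suc K) h"
    then have h': "Hk w (Suc K) h" using iff by blast
    have n: "0 <= En w0 (Suc K) h" "0 <= En w (Suc K) h" using En_nonneg w w0' by auto
    have "En w (Suc K) h <= C2 * En w0 (Suc K) h" using f1 h by blast
    also have "... <= (C2 + C4 + 1) * En w0 (Suc K) h" using n C4(1) by (intro mult_right_mono) auto
    finally show "En w (Suc K) h <= (C2 + C4 + 1) * En w0 (Suc K) h" .
    have "En w0 (Suc K) h <= C4 * En w (Suc K) h" using f2 h' by blast
    also have "... <= (C2 + C4 + 1) * En w (Suc K) h" using n C2(1) by (intro mult_right_mono) auto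
    finally show "En w0 (Suc K) h <= (C2 + C4 + 1) * En w (Suc K) h" .
  qed
qed

section \<open>Linear structure, orientation and length\<close>

lemma sobolev_lin:
  assumes n: "n >= 2" and f: "f \<in> sobolev n" and g: "g \<in> sobolev n"
  shows "(\<lambda>x. a * f x + b * g x) \<in> sobolev n"
    "x \<in> J ==> cderiv (\<lambda>x. a * f x + b * g x) x = a * cderiv f x + b * cderiv g x"
proof -
  have h: "Hk (\<lambda>_. 1) n (\<lambda>x. a * f x + b * g x)" by (intro Hk_lin sobolev_Hk[OF f] sobolev_Hk[OF g])
  have ac: "ac (\<lambda>x. a * f x + b * g x) (\<lambda>x. a * cderiv f x + b * cderiv g x)"
    by (intro ac_add ac_cmult sobolev_ac[OF f] sobolev_ac[OF g])
  have c: "continuous_on J (\<lambda>x. a * cderiv f x + b * cderiv g x)"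
    by (intro continuous_intros sobolev_cderiv_continuous[OF f] sobolev_cderiv_continuous[OF g])
  have z: "a * f x + b * g x = 0" if "x \<notin> J" for x using sobolev_zero[OF f that] sobolev_zero[OF g that] by simp
  note s = sobolevI[OF h ac c z]
  show "(\<lambda>x. a * f x + b * g x) \<in> sobolev n" using s(1) .
  show "x \<in> J ==> cderiv (\<lambda>x. a * f x + b * g x) x = a * cderiv f x + b * cderiv g x" using s(2) .
qed

text \<open>The constant 1 as an element of \<open>sobolev\<close>, whose members vanish outside
  \<open>J\<close>; adding a multiple of it translates a curve.\<close>

definition oneJ :: "real => real" where "oneJ x = (if x \<in> J then 1 else 0)"

lemma oneJ_AE: "AE x in LI. oneJ x = 1"
  by (rule AE_LI_I) (simp add: oneJ_def)

lemma oneJ_sobolev: "oneJ \<in> sobolev n" and cderiv_oneJ: "x \<in> J ==> cderiv oneJ x = 0"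
proof -
  have h: "Hk (\<lambda>_. 1) n oneJ" by (rule Hk_cong_AE[OF Hk_const AE_eq_sym[OF oneJ_AE]])
  have ac: "ac oneJ (\<lambda>x. 0)" by (rule ac_cong_AE[OF ac_const[of 1]]) (auto simp: oneJ_def)
  note s = sobolevI[OF h ac continuous_on_const, unfolded oneJ_def, folded oneJ_def]
  show "oneJ \<in> sobolev n" by (rule sobolevI(1)[OF h ac continuous_on_const]) (simp only: oneJ_def if_False)
  show "x \<in> J ==> cderiv oneJ x = 0" by (rule sobolevI(2)[OF h ac continuous_on_const]) (simp_all only: oneJ_def if_False)
qed

text \<open>Connects the H^n norm, written with separate weak derivatives of each order, to
  \<open>En\<close> with weight 1, written with iterated ones.\<close>

lemma sobolev_norm_eq:
  assumes "Hk (\<lambda>_. 1) n f" shows "sobolev_norm n f = sqrt (En (\<lambda>_. 1) n f)"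
proof -
  have "(LINT x|LI. (weak_deriv k f x)\<^sup>2) = X (\<lambda>_. 1) ((ad (\<lambda>_. 1) ^^ k) f)" if k: "k <= n" for k
  proof -
    have ae: "AE x in LI. weak_deriv k f x = (wd ^^ k) f x"
      by (rule weak_deriv_AE[OF Hk_one_weak_deriv[OF assms k]])
    have "(wd ^^ k) f \<in> L2" using assms k unfolding Hk_iff ad_one by blast
    from X_cong_AE[OF weight_one this AE_eq_sym[OF ae]] show ?thesis unfolding ad_one by (simp add: X_def)
  qed
  then show ?thesis by (simp add: sobolev_norm_def En_def)
qed

definition speed :: "(real => real) => real => real" where "speed c x = \<bar>cderiv c x\<bar>"

definition clen :: "(real => real) => real" where "clen c = wlen (speed c)"

text \<open>Equal to 1 for increasing and -1 for decreasing immersions; read off the end points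
  because point values vary continuously along paths.\<close>

definition orient :: "(real => real) => real" where "orient c = sgn (c (2*pi) - c 0)"

lemma arc_deriv_ad: "arc_deriv c = ad (speed c)"
  by (auto simp: fun_eq_iff arc_deriv_def ad_def speed_def)

lemma immersion_sobolev: "c \<in> immersions n ==> c \<in> sobolev n"
  by (simp add: immersions_def)

lemma immersion_weight: "c \<in> immersions n ==> weight (speed c)"
  by (auto simp: immersions_def weight_def speed_def[abs_def] intro!: continuous_intros sobolev_cderiv_continuous)

lemma immersionI: "c \<in> sobolev n ==> (\<And>x. x \<in> J ==> cderiv c x \<noteq> 0) ==> c \<in> immersions n"
  by (auto simp: immersions_def)

lemma immersion_orient:
  assumes c: "c \<in> immersions n"
  shows "orient c = 1 \<or> orient c = -1" "x \<in> J ==> cderiv c x = orient c * speed c x"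
    "c (2*pi) - c 0 = orient c * clen c" "clen c > 0"
proof -
  note s = immersion_sobolev[OF c]
  show l: "clen c > 0" unfolding clen_def by (rule wlen_pos[OF immersion_weight[OF c]])
  have conn: "connected (cderiv c ` J)"
    by (intro connected_continuous_image sobolev_cderiv_continuous[OF s]) auto
  have nz: "0 \<notin> cderiv c ` J" using c by (auto simp: immersions_def)
  have "(\<forall>x\<in>J. cderiv c x > 0) \<or> (\<forall>x\<in>J. cderiv c x < 0)"
  proof (rule ccontr)
    assume "\<not> ?thesis"
    then obtain x y where "x \<in> J" "y \<in> J" "cderiv c x <= 0" "cderiv c y >= 0" by (auto simp: not_less)
    then have "0 \<in> cderiv c ` J"
      using conn connectedD_interval[of "cderiv c ` J" "cderiv c x" "cderiv c y" 0] by blast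
    then show False using nz by simp
  qed
  then obtain b where b: "b = 1 \<or> b = (-1::real)" "\<And>x. x \<in> J ==> cderiv c x = b * speed c x"
  proof
    assume h: "\<forall>x\<in>J. cderiv c x > 0"
    have "cderiv c x = 1 * speed c x" if "x \<in> J" for x using bspec[OF h that] by (simp add: speed_def)
    then show thesis using that[of 1] by blast
  next
    assume h: "\<forall>x\<in>J. cderiv c x < 0"
    have "cderiv c x = -1 * speed c x" if "x \<in> J" for x using bspec[OF h that] by (simp add: speed_def)
    then show thesis using that[of "-1"] by blast
  qed
  have "c (2*pi) - c 0 = integral J (cderiv c)" using ac_increment[OF sobolev_ac[OF s], of 0 "2*pi"] by simp
  also have "... = integral J (\<lambda>x. b * speed c x)" by (rule Henstock_Kurzweil_Integration.integral_cong) (rule b(2))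
  also have "... = b * clen c" unfolding clen_def wlen_eq[OF immersion_weight[OF c]] by simp
  finally have e: "c (2*pi) - c 0 = b * clen c" .
  then have o: "orient c = b" using b(1) l by (auto simp: orient_def sgn_mult)
  show "orient c = 1 \<or> orient c = -1" using o b by simp
  show "x \<in> J ==> cderiv c x = orient c * speed c x" using o b by simp
  show "c (2*pi) - c 0 = orient c * clen c" using e o by simp
qed

lemma clen_eq: "c \<in> immersions n ==> clen c = \<bar>c (2*pi) - c 0\<bar>"
  using immersion_orient(1,3,4)[of c n] by (auto simp: abs_mult)

text \<open>The unit tangent of a curve in the line is a constant sign. This is special to curves in
  the line and is what makes shrinking cheap.\<close>

lemma immersion_ad_self:
  assumes "c \<in> immersions n" shows "AE x in LI. ad (speed c) c x = orient c"
proof -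
  have "AE x in LI. cderiv c x = orient c * speed c x \<and> speed c x \<noteq> 0"
  proof (rule AE_LI_I)
    fix x assume x: "x \<in> J"
    have "speed c x > 0" using immersion_weight[OF assms] x unfolding weight_def by blast
    then show "cderiv c x = orient c * speed c x \<and> speed c x \<noteq> 0"
      using immersion_orient(2)[OF assms x] by simp
  qed
  with sobolev_wd[OF immersion_sobolev[OF assms]] show ?thesis
    by eventually_elim (simp add: ad_def)
qed

text \<open>The reference weight is 1, so the quotient of the weights is the speed itself, which has
  order n - 1 as a signed first derivative of \<open>c\<close>.\<close>

lemma immersion_norm_equivalence:
  assumes n: "n >= 2" and c: "c \<in> immersions n"
  obtains C where "C > 0" "\<And>h. Hk (\<lambda>_. 1) n h \<longleftrightarrow> Hk (speed c) n h"
    "\<And>h. Hk (\<lambda>_. 1) n h ==> En (speed c) n h <= C * En (\<lambda>_. 1) n h"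
    "\<And>h. Hk (\<lambda>_. 1) n h ==> En (\<lambda>_. 1) n h <= C * En (speed c) n h"
proof -
  obtain K where K: "n = Suc K" "1 <= K" using n by (cases n) auto
  note w = immersion_weight[OF c]
  obtain m M where m: "0 < m" "\<And>x. x \<in> J ==> m <= speed c x" "\<And>x. x \<in> J ==> speed c x <= M"
    using weight_bounds[OF w] by metis
  have w1: "wtb (2*pi) (2*pi) (\<lambda>_. 1)"
    using wlen_eq[OF weight_one] by (simp add: wtb_def weight_one)
  have "Hk (\<lambda>_. 1) K (wd c)" using sobolev_Hk[OF immersion_sobolev[OF c]] unfolding K(1) by (simp add: ad_one)
  then have "Hk (\<lambda>_. 1) K (\<lambda>x. orient c * wd c x + 0 * wd c x)" by (intro Hk_lin)
  moreover have "AE x in LI. orient c * wd c x + 0 * wd c x = speed c x"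
  proof -
    have "AE x in LI. orient c * cderiv c x = speed c x"
      by (rule AE_LI_I) (use immersion_orient(1,2)[OF c] in auto)
    with sobolev_wd[OF immersion_sobolev[OF c]] show ?thesis by eventually_elim simp
  qed
  ultimately have q: "Hk (\<lambda>_. 1) K (\<lambda>x. speed c x / 1)" using Hk_cong_AE by simp
  obtain C where C: "C > 0" "\<forall>w0 w. wtb (2*pi) (2*pi) w0 --> weight w --> (\<forall>x\<in>J. m * w0 x <= w x \<and> w x <= M * w0 x) -->
    Hk w0 K (\<lambda>x. w x / w0 x) --> En w0 K (\<lambda>x. w x / w0 x) <= En (\<lambda>_. 1) K (\<lambda>x. speed c x / 1) -->
    (\<forall>h. (Hk w0 (Suc K) h \<longleftrightarrow> Hk w (Suc K) h) \<and>
      (Hk w0 (Suc K) h --> En w (Suc K) h <= C * En w0 (Suc K) h \<and> En w0 (Suc K) h <= C * En w (Suc K) h))"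
    using equivalent_weights[OF _ m(1) En_nonneg[OF weight_one, of K "\<lambda>x. speed c x / 1"] K(2), where lo = "2*pi" and hi = "2*pi" and M = M] by auto
  from C(2)[rule_format, OF w1 w _ q order_refl] show ?thesis
    using that[of C] C(1) m unfolding K(1)[symmetric] by auto
qed

text \<open>n >= 2 puts \<open>ad w f\<close> into H^1, where the supremum is controlled. The
  continuous function cderiv f / w represents it, so the bound holds at every point.\<close>

lemma H1_ad_sup:
  assumes w: "wtb lo hi w" and n: "n >= 2" and f: "f \<in> sobolev n" "Hk w n f" and x: "x \<in> J"
  shows "(cderiv f x / w x)\<^sup>2 <= (2 / lo + 2 * hi) * En w n f"
proof -
  note w' = wtb_weight[OF w]
  obtain k where k: "n = Suc (Suc k)" using n by (metis add_2_eq_Suc le_Suc_ex)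
  have h: "H1 (ad w f)" using f(2) k by simp
  define v where "v = (\<lambda>x. cderiv f x / w x)"
  have vc: "continuous_on J v" unfolding v_def
    using w' by (auto simp: weight_def intro!: continuous_intros sobolev_cderiv_continuous[OF f(1)] dest: less_imp_neq)
  have ae: "AE x in LI. ad w f x = v x"
    using sobolev_wd[OF f(1)] by eventually_elim (simp add: ad_def v_def)
  have hv: "H1 v" by (rule H1_cong_AE[OF h ae])
  have wdv: "wd v = wd (ad w f)" by (rule weak_deriv_cong_AE[OF AE_eq_sym[OF ae]])
  have "ac v (wd (ad w f))" using H1_continuous_ac[OF hv vc] wdv by simp
  from sup_le_En[OF w h this ae x] have "(v x)\<^sup>2 <= (2 / lo + 2 * hi) * En w 1 (ad w f)" .
  also have "... <= (2 / lo + 2 * hi) * En w n f"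
  proof (rule mult_left_mono)
    have "En w 1 (ad w f) <= En w (Suc k) (ad w f)" by (rule En_mono[OF w']) simp
    also have "... <= En w n f" unfolding k by (rule En_ad_le[OF w'])
    finally show "En w 1 (ad w f) <= En w n f" .
    show "0 <= 2 / lo + 2 * hi" using w wlen_pos[OF w'] by (auto simp: wtb_def)
  qed
  finally show ?thesis by (simp add: v_def)
qed

text \<open>The radius and the constant depend on \<open>c0\<close> only through the bounds on its
  length. In the ball the two speeds differ by at most a factor 2, and their quotient is 1 plus or
  minus an arc length derivative of the displacement, hence bounded in order n - 1, as
  \<open>equivalent_weights\<close> asks.\<close>

lemma immersion_local_equivalence:
  assumes n: "n >= 2" and lo: "0 < lo"
  shows "\<exists>r>0. \<exists>C>0. \<forall>c0\<in>immersions n. lo <= clen c0 --> clen c0 <= hi -->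
    (\<forall>c\<in>sobolev n. En (speed c0) n (\<lambda>x. c x - c0 x) <= r -->
      c \<in> immersions n \<and>
      (\<forall>h. Hk (\<lambda>_. 1) n h --> En (speed c) n h <= C * En (speed c0) n h \<and> En (speed c0) n h <= C * En (speed c) n h))"
proof -
  obtain K where K: "n = Suc K" "1 <= K" using n by (cases n) auto
  define h' where "h' = max hi 1"
  have h': "h' >= 1" "hi <= h'" by (auto simp: h'_def)
  define S where "S = 2 / lo + 2 * h'"
  have S: "S > 0" unfolding S_def using lo h' by (intro add_pos_pos) auto
  \<comment> \<open>Makes S * r equal to the square of 1/2, hence |u'| <= w0 / 2 pointwise.\<close>
  define r where "r = 1 / (4 * S)"
  have r: "r > 0" "S * r = 1/4" using S by (auto simp: r_def)
  obtain C where C: "C > 0" "\<forall>w0 w. wtb lo h' w0 --> weight w --> (\<forall>x\<in>J. 1/2 * w0 x <= w x \<and> w x <= 2 * w0 x) -->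
    Hk w0 K (\<lambda>x. w x / w0 x) --> En w0 K (\<lambda>x. w x / w0 x) <= 2 * h' + 2 * r -->
    (\<forall>h. (Hk w0 (Suc K) h \<longleftrightarrow> Hk w (Suc K) h) \<and>
      (Hk w0 (Suc K) h --> En w (Suc K) h <= C * En w0 (Suc K) h \<and> En w0 (Suc K) h <= C * En w (Suc K) h))"
    using equivalent_weights[OF lo _ _ K(2), of "1/2" "2 * h' + 2 * r" h' 2] h' r by auto
  have main: "c \<in> immersions n \<and>
      (\<forall>h. Hk (\<lambda>_. 1) n h --> En (speed c) n h <= C * En (speed c0) n h \<and> En (speed c0) n h <= C * En (speed c) n h)"
    if c0: "c0 \<in> immersions n" and l: "lo <= clen c0" "clen c0 <= hi" and c: "c \<in> sobolev n"
      and rr: "En (speed c0) n (\<lambda>x. c x - c0 x) <= r" for c c0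
  proof -
    define u where "u = (\<lambda>x. c x - c0 x)"
    define w0 where "w0 = speed c0"
    define e where "e = orient c0"
    have w0: "weight w0" unfolding w0_def by (rule immersion_weight[OF c0])
    have wt: "wtb lo h' w0" using w0 l h' lo by (auto simp: wtb_def w0_def clen_def)
    have e: "e = 1 \<or> e = -1" "\<And>x. x \<in> J ==> cderiv c0 x = e * w0 x"
      using immersion_orient(1,2)[OF c0] by (auto simp: e_def w0_def)
    have p0: "0 < w0 x" if "x \<in> J" for x using w0 that by (auto simp: weight_def)
    have u: "u \<in> sobolev n" and ud: "\<And>x. x \<in> J ==> cderiv u x = cderiv c x - cderiv c0 x"
      using sobolev_lin[OF n c immersion_sobolev[OF c0], where a = 1 and b = "-1"] by (simp_all add: u_def)
    have Hiff: "Hk (\<lambda>_. 1) n h \<longleftrightarrow> Hk w0 n h" for h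
      unfolding w0_def using immersion_norm_equivalence[OF n c0] by metis
    have uH: "Hk w0 n u" using sobolev_Hk[OF u] Hiff by blast
    have small: "\<bar>cderiv u x\<bar> <= 1/2 * w0 x" if x: "x \<in> J" for x
    proof -
      have "(cderiv u x / w0 x)\<^sup>2 <= S * En w0 n u" unfolding S_def by (rule H1_ad_sup[OF wt n u uH x])
      also have "... <= S * r" using rr S by (intro mult_left_mono) (auto simp: u_def w0_def)
      also have "... = (1/2)\<^sup>2" using r by (simp add: power2_eq_square)
      finally have "\<bar>cderiv u x / w0 x\<bar> <= \<bar>1/2\<bar>" by (simp only: abs_le_square_iff)
      then show ?thesis using p0[OF x] by (simp add: abs_divide field_simps)
    qed
    have cd: "e * cderiv c x = w0 x + e * cderiv u x" "speed c x = w0 x + e * cderiv u x"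
      "1/2 * w0 x <= speed c x" "speed c x <= 2 * w0 x" if x: "x \<in> J" for x
      using e(1) e(2)[OF x] ud[OF x] small[OF x] p0[OF x] by (auto simp: speed_def abs_if split: if_splits)
    have ci: "c \<in> immersions n"
    proof (rule immersionI[OF c])
      show "cderiv c x \<noteq> 0" if "x \<in> J" for x using cd(3)[OF that] p0[OF that] by (auto simp: speed_def)
    qed
    \<comment> \<open>Since orientations agree, the speed of c is \<open>w0 + e * cderiv u\<close>;
      dividing by \<open>w0\<close> turns the last term into an arc length derivative.\<close>
    let ?s = "\<lambda>x. 1 * 1 + e * ad w0 u x"
    have ae: "AE x in LI. speed c x / w0 x = ?s x"
    proof -
      have "AE x in LI. speed c x = w0 x + e * cderiv u x \<and> 0 < w0 x" by (rule AE_LI_I) (use cd p0 in auto)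
      with sobolev_wd[OF u] show ?thesis by eventually_elim (simp add: ad_def field_simps)
    qed
    have aH: "Hk w0 K (ad w0 u)" using uH K(1) by simp
    have sH: "Hk w0 K ?s" by (rule Hk_lin[OF Hk_const aH])
    have q: "Hk w0 K (\<lambda>x. speed c x / w0 x)" by (rule Hk_cong_AE[OF sH AE_eq_sym[OF ae]])
    have a2: "En w0 K (ad w0 u) <= r"
      using En_ad_le[OF w0, of K u] rr unfolding K(1)[symmetric] by (simp add: u_def w0_def)
    have "En w0 K (\<lambda>x. speed c x / w0 x) = En w0 K ?s" by (rule En_cong_AE[OF w0 sH AE_eq_sym[OF ae], symmetric])
    also have "... <= 2 * En w0 K (\<lambda>x. 1) + 2 * En w0 K (\<lambda>x. e * ad w0 u x)"
      using En_add_le[OF w0 Hk_const, of K "\<lambda>x. e * ad w0 u x" 1] Hk_lin[OF aH aH, of e 0] by simp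
    also have "En w0 K (\<lambda>x. 1) <= h'" using En_const[OF w0, of K 1] wt by (simp add: wtb_def)
    also have "En w0 K (\<lambda>x. e * ad w0 u x) <= r" using En_cmult[OF w0 aH, of e] e(1) a2 by auto
    finally have qB: "En w0 K (\<lambda>x. speed c x / w0 x) <= 2 * h' + 2 * r" by simp
    have "\<forall>x\<in>J. 1/2 * w0 x <= speed c x \<and> speed c x <= 2 * w0 x" using cd by blast
    from C(2)[rule_format, OF wt immersion_weight[OF ci] this[rule_format] q qB]
    show ?thesis using ci Hiff unfolding K(1)[symmetric] w0_def by auto
  qed
  show ?thesis
    by (rule exI[of _ r], rule conjI[OF r(1)], rule exI[of _ C], rule conjI[OF C(1)]) (use main in blast)
qed

section \<open>The metric as a quadratic form depending on the speed\<close>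

definition Gm :: "nat => (nat => real) => (real => real) => (real => real) => real" where
  "Gm n a w h = (\<Sum>i\<le>n. a i * X w ((ad w ^^ i) h))"

lemma sobolev_metric_eq: "sobolev_metric n a c h h = Gm n a (speed c) h"
  by (simp add: sobolev_metric_def Gm_def arc_deriv_ad X_def speed_def power2_eq_square)

lemma Gm_nonneg:
  assumes "\<And>i. i <= n ==> a i >= 0" "weight w" shows "0 <= Gm n a w h"
  unfolding Gm_def using assms by (intro sum_nonneg mult_nonneg_nonneg X_nonneg) auto

lemma Gm_term_le:
  assumes "\<And>i. i <= n ==> a i >= 0" "weight w" "i <= n"
  shows "a i * X w ((ad w ^^ i) h) <= Gm n a w h"
  unfolding Gm_def using assms
  by (intro member_le_sum[where f = "\<lambda>i. a i * X w ((ad w ^^ i) h)"]) (auto intro!: mult_nonneg_nonneg X_nonneg)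

lemma Gm_le_En:
  assumes "\<And>i. i <= n ==> a i >= 0" "weight w"
  shows "Gm n a w h <= (\<Sum>i\<le>n. a i) * En w n h"
proof -
  have "Gm n a w h <= (\<Sum>i\<le>n. (\<Sum>i\<le>n. a i) * X w ((ad w ^^ i) h))" unfolding Gm_def
  proof (rule sum_mono)
    fix i assume i: "i \<in> {..n}"
    then have "a i <= (\<Sum>i\<le>n. a i)" using assms(1) by (intro member_le_sum) auto
    then show "a i * X w ((ad w ^^ i) h) <= (\<Sum>i\<le>n. a i) * X w ((ad w ^^ i) h)"
      using X_nonneg[OF assms(2)] by (intro mult_right_mono)
  qed
  also have "... = (\<Sum>i\<le>n. a i) * En w n h" by (simp add: En_def sum_distrib_left)
  finally show ?thesis .
qed

lemma En_le_Gm: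
  assumes "\<And>i. i <= n ==> a i >= 0" "a 0 > 0" "a n > 0" "0 < lo"
  shows "\<exists>C>0. \<forall>w h. wtb lo hi w --> Hk w n h --> En w n h <= C * Gm n a w h"
proof -
  obtain C where C: "C >= 0" "\<And>w h. wtb lo hi w ==> Hk w n h ==> En w n h <= C * (X w h + X w ((ad w ^^ n) h))"
    using interpolation[OF assms(4), of hi n] by blast
  define D where "D = C * (1 / a 0 + 1 / a n) + 1"
  show ?thesis
  proof (intro exI[of _ D] conjI allI impI)
    show "D > 0" unfolding D_def using C(1) assms by (intro add_nonneg_pos mult_nonneg_nonneg) auto
    fix w h assume w: "wtb lo hi w" and h: "Hk w n h"
    note w' = wtb_weight[OF w]
    have G: "0 <= Gm n a w h" by (rule Gm_nonneg[OF assms(1) w'])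
    have "a 0 * X w ((ad w ^^ 0) h) <= Gm n a w h" "a n * X w ((ad w ^^ n) h) <= Gm n a w h"
      by (rule Gm_term_le, use assms w' in auto)+
    then have "X w h <= 1 / a 0 * Gm n a w h" "X w ((ad w ^^ n) h) <= 1 / a n * Gm n a w h"
      using assms(2,3) by (auto simp: field_simps)
    then have "X w h + X w ((ad w ^^ n) h) <= (1 / a 0 + 1 / a n) * Gm n a w h" by (simp add: distrib_right)
    then have "C * (X w h + X w ((ad w ^^ n) h)) <= C * ((1 / a 0 + 1 / a n) * Gm n a w h)"
      using C(1) by (rule mult_left_mono)
    then have "En w n h <= C * ((1 / a 0 + 1 / a n) * Gm n a w h)" using C(2)[OF w h] by linarith
    also have "... <= D * Gm n a w h" unfolding D_def using G by (simp add: algebra_simps)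
    finally show "En w n h <= D * Gm n a w h" .
  qed
qed

section \<open>Completeness of the Sobolev space\<close>

abbreviation (input) unit_weight :: "real => real" where "unit_weight \<equiv> \<lambda>_. 1"

lemma LINT_mult_le:
  assumes "u \<in> L2" "v \<in> L2"
  shows "\<bar>LINT x|LI. u x * v x\<bar> <= sqrt (X unit_weight u) * sqrt (X unit_weight v)"
  using real_sqrt_le_mono[OF Cauchy_Schwarz_integral[OF L2_square[OF assms(1)] L2_square[OF assms(2)] L2_mult_integrable[OF assms]]]
  by (simp add: X_def real_sqrt_mult)

text \<open>On a finite measure space an L^2 Cauchy sequence is Cauchy in L^1, so a subsequence
  converges almost everywhere. Fatou's lemma turns the Cauchy bounds into bounds for the distance to
  the pointwise limit.\<close>

lemma L2_complete:
  fixes f :: "nat => real => real"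
  assumes f: "\<And>k. f k \<in> L2"
    and C: "\<And>e. e > 0 ==> \<exists>N. \<forall>i\<ge>N. \<forall>j\<ge>N. X unit_weight (\<lambda>x. f i x - f j x) < e"
  obtains g where "g \<in> L2" "(\<lambda>k. X unit_weight (\<lambda>x. f k x - g x)) \<longlonglongrightarrow> 0"
proof -
  have l1: "(LINT x|LI. \<bar>u x\<bar>) <= sqrt (X unit_weight u) * sqrt (2*pi)" if "u \<in> L2" for u
  proof -
    have "(LINT x|LI. \<bar>u x\<bar> * 1) <= sqrt (X unit_weight (\<lambda>x. \<bar>u x\<bar>)) * sqrt (X unit_weight (\<lambda>x. 1))"
      using LINT_mult_le[OF L2_abs[OF that] L2_const[of 1]] by linarith
    moreover have "X unit_weight (\<lambda>x. 1) = 2*pi" using wlen_eq[OF weight_one] by (simp add: X_def wlen_def)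
    ultimately show ?thesis by (simp add: X_def)
  qed
  have "\<exists>N. \<forall>i\<ge>N. \<forall>j\<ge>N. (LINT x|LI. norm (f i x - f j x)) < e" if "e > 0" for e
  proof -
    define e' where "e' = (e / sqrt (2*pi))\<^sup>2"
    have e': "e' > 0" using that by (simp add: e'_def)
    obtain N where N: "\<And>i j. i >= N ==> j >= N ==> X unit_weight (\<lambda>x. f i x - f j x) < e'" using C[OF e'] by blast
    have "(LINT x|LI. norm (f i x - f j x)) < e" if ij: "i >= N" "j >= N" for i j
    proof -
      have "sqrt (X unit_weight (\<lambda>x. f i x - f j x)) < sqrt e'" using N[OF ij] by simp
      also have "sqrt e' = e / sqrt (2*pi)" using \<open>e > 0\<close> by (simp add: e'_def real_sqrt_abs)
      finally have "sqrt (X unit_weight (\<lambda>x. f i x - f j x)) * sqrt (2*pi) < e" by (simp add: pos_less_divide_eq)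
      then show ?thesis using l1[OF L2_diff[OF f f], of i j] by simp
    qed
    then show ?thesis by blast
  qed
  then obtain r where r: "strict_mono r" "AE x in LI. Cauchy (\<lambda>i. f (r i) x)"
    by (rule cauchy_L1_AE_cauchy_subseq[OF L2_integrable[OF f]]) blast
  define g where "g x = lim (\<lambda>i. f (r i) x)" for x
  have gm: "g \<in> borel_measurable LI"
    unfolding g_def[abs_def] by (rule borel_measurable_lim_metric) (rule L2_measurable[OF f])
  have gl: "AE x in LI. (\<lambda>i. f (r i) x) \<longlonglongrightarrow> g x"
    using r(2) by eventually_elim (simp add: g_def Cauchy_convergent_iff convergent_LIMSEQ_iff)
  have est: "integrable LI (\<lambda>x. (g x - f k x)\<^sup>2) \<and> (LINT x|LI. (g x - f k x)\<^sup>2) <= e"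
    if e: "e > 0" and N: "\<And>i. i >= k ==> X unit_weight (\<lambda>x. f i x - f k x) < e" for k e
  proof -
    have "(\<integral>\<^sup>+x. ennreal ((g x - f k x)\<^sup>2) \<partial>LI) = (\<integral>\<^sup>+x. liminf (\<lambda>i. ennreal ((f (r i) x - f k x)\<^sup>2)) \<partial>LI)"
    proof (rule nn_integral_cong_AE)
      show "AE x in LI. ennreal ((g x - f k x)\<^sup>2) = liminf (\<lambda>i. ennreal ((f (r i) x - f k x)\<^sup>2))"
        using gl
      proof eventually_elim
        case (elim x)
        then have "(\<lambda>i. ennreal ((f (r i) x - f k x)\<^sup>2)) \<longlonglongrightarrow> ennreal ((g x - f k x)\<^sup>2)"
          by (intro tendsto_intros)
        then show ?case by (intro lim_imp_Liminf[symmetric]) auto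
      qed
    qed
    also have "... <= liminf (\<lambda>i. \<integral>\<^sup>+x. ennreal ((f (r i) x - f k x)\<^sup>2) \<partial>LI)"
      using L2_measurable[OF f] by (intro nn_integral_liminf) auto
    also have "... <= limsup (\<lambda>i. \<integral>\<^sup>+x. ennreal ((f (r i) x - f k x)\<^sup>2) \<partial>LI)"
      by (rule Liminf_le_Limsup) simp
    also have "... <= ennreal e"
    proof (rule Limsup_bounded)
      show "\<forall>\<^sub>F i in sequentially. (\<integral>\<^sup>+x. ennreal ((f (r i) x - f k x)\<^sup>2) \<partial>LI) <= ennreal e"
      proof (rule eventually_sequentiallyI[of k])
        fix i assume "i >= k"
        then have "r i >= k" using seq_suble[OF r(1), of i] by simp
        then have "X unit_weight (\<lambda>x. f (r i) x - f k x) <= e" using N by (simp add: less_imp_le)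
        moreover have "(\<integral>\<^sup>+x. ennreal ((f (r i) x - f k x)\<^sup>2) \<partial>LI) = ennreal (X unit_weight (\<lambda>x. f (r i) x - f k x))"
          unfolding X_def using L2_square[OF L2_diff[OF f f], of "r i" k]
          by (simp add: nn_integral_eq_integral)
        ultimately show "(\<integral>\<^sup>+x. ennreal ((f (r i) x - f k x)\<^sup>2) \<partial>LI) <= ennreal e" by (simp add: ennreal_leI)
      qed
    qed
    finally have le: "(\<integral>\<^sup>+x. ennreal ((g x - f k x)\<^sup>2) \<partial>LI) <= ennreal e" .
    have i: "integrable LI (\<lambda>x. (g x - f k x)\<^sup>2)"
      using gm L2_measurable[OF f] le by (intro integrableI_bounded) (auto intro: le_less_trans)
    then have "ennreal (LINT x|LI. (g x - f k x)\<^sup>2) <= ennreal e"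
      using le by (subst nn_integral_eq_integral[symmetric]) auto
    then show ?thesis using i e by (simp add: ennreal_le_iff)
  qed
  obtain N where N: "\<forall>i\<ge>N. \<forall>j\<ge>N. X unit_weight (\<lambda>x. f i x - f j x) < 1" using C[of 1] by auto
  have "integrable LI (\<lambda>x. (g x - f N x)\<^sup>2)" using est[of 1 N] N by simp
  then have "(\<lambda>x. g x - f N x) \<in> L2" using gm L2_measurable[OF f] by (intro L2I) auto
  from L2_add[OF this f[of N]] have gL: "g \<in> L2" by simp
  have "(\<lambda>k. X unit_weight (\<lambda>x. f k x - g x)) \<longlonglongrightarrow> 0"
  proof (rule LIMSEQ_I)
    fix e :: real assume e: "e > 0"
    obtain N where N: "\<forall>i\<ge>N. \<forall>j\<ge>N. X unit_weight (\<lambda>x. f i x - f j x) < e/2" using C[of "e/2"] e by auto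
    have "norm (X unit_weight (\<lambda>x. f k x - g x) - 0) < e" if "k >= N" for k
    proof -
      have "(LINT x|LI. (g x - f k x)\<^sup>2) <= e/2" using est[of "e/2" k] N that e by auto
      then show ?thesis using e X_nonneg[OF weight_one] by (simp add: X_def power2_commute)
    qed
    then show "\<exists>N. \<forall>k\<ge>N. norm (X unit_weight (\<lambda>x. f k x - g x) - 0) < e" by blast
  qed
  with gL show ?thesis by (rule that)
qed

lemma LINT_mult_tendsto:
  assumes "\<And>k. u k \<in> L2" "g \<in> L2" "v \<in> L2" "(\<lambda>k. X unit_weight (\<lambda>x. u k x - g x)) \<longlonglongrightarrow> 0"
  shows "(\<lambda>k. LINT x|LI. u k x * v x) \<longlonglongrightarrow> (LINT x|LI. g x * v x)"
proof -
  have "(\<lambda>k. (LINT x|LI. u k x * v x) - (LINT x|LI. g x * v x)) \<longlonglongrightarrow> 0"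
  proof (rule Lim_null_comparison)
    show "\<forall>\<^sub>F k in sequentially. norm ((LINT x|LI. u k x * v x) - (LINT x|LI. g x * v x))
      <= sqrt (X unit_weight (\<lambda>x. u k x - g x)) * sqrt (X unit_weight v)"
    proof (rule always_eventually, rule allI)
      fix k
      have "(LINT x|LI. (u k x - g x) * v x) = (LINT x|LI. u k x * v x) - (LINT x|LI. g x * v x)"
        using L2_mult_integrable[OF assms(1,3)] L2_mult_integrable[OF assms(2,3)]
        by (simp add: left_diff_distrib)
      then show "norm ((LINT x|LI. u k x * v x) - (LINT x|LI. g x * v x))
        <= sqrt (X unit_weight (\<lambda>x. u k x - g x)) * sqrt (X unit_weight v)"
        using LINT_mult_le[OF L2_diff[OF assms(1,2)] assms(3), of k] by simp
    qed
    have "(\<lambda>k. sqrt (X unit_weight (\<lambda>x. u k x - g x)) * sqrt (X unit_weight v)) \<longlonglongrightarrow> sqrt 0 * sqrt (X unit_weight v)"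
      by (intro tendsto_intros assms(4))
    then show "(\<lambda>k. sqrt (X unit_weight (\<lambda>x. u k x - g x)) * sqrt (X unit_weight v)) \<longlonglongrightarrow> 0" by simp
  qed
  then show ?thesis by (rule LIM_zero_cancel)
qed

lemma test_function_funpow: "test_function f ==> test_function ((deriv ^^ i) f)"
  by (induction i) (auto intro: test_function_deriv)

lemma funpow_ad_diff:
  assumes "Hk w n f" "Hk w n g" "i <= n"
  shows "AE x in LI. (ad w ^^ i) (\<lambda>x. f x - g x) x = (ad w ^^ i) f x - (ad w ^^ i) g x"
  using funpow_ad_lin[OF assms, of 1 "-1"] by simp

lemma Hk_diff: "Hk w n f ==> Hk w n g ==> Hk w n (\<lambda>x. f x - g x)"
  using Hk_lin[of w n f g 1 "-1"] by simp

lemma X_funpow_diff: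
  assumes "weight w" "Hk w n f" "Hk w n g" "i <= n"
  shows "X w ((ad w ^^ i) (\<lambda>x. f x - g x)) = X w (\<lambda>x. (ad w ^^ i) f x - (ad w ^^ i) g x)"
  using X_cong_AE[OF assms(1) _ funpow_ad_diff[OF assms(2-4)]] Hk_diff[OF assms(2,3)] assms(4)
  unfolding Hk_iff by blast

text \<open>Every derivative converges in L^2 to some \<open>g i\<close>. Testing against smooth
  functions identifies \<open>g i\<close> as a weak derivative of \<open>g 0\<close>, whose C^1
  representative is the limit.\<close>

lemma sobolev_complete:
  assumes n: "n >= 2" and f: "\<And>k. f k \<in> sobolev n"
    and C: "\<And>e. e > 0 ==> \<exists>N. \<forall>i\<ge>N. \<forall>j\<ge>N. En unit_weight n (\<lambda>x. f i x - f j x) < e"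
  obtains F where "F \<in> sobolev n" "(\<lambda>k. En unit_weight n (\<lambda>x. f k x - F x)) \<longlonglongrightarrow> 0"
proof -
  note H = sobolev_Hk[OF f]
  have D: "(ad unit_weight ^^ i) (f k) \<in> L2" if "i <= n" for i k using H that unfolding Hk_iff by blast
  have "\<exists>g\<in>L2. (\<lambda>k. X unit_weight (\<lambda>x. (ad unit_weight ^^ i) (f k) x - g x)) \<longlonglongrightarrow> 0" if i: "i <= n" for i
  proof -
    have "\<exists>N. \<forall>j\<ge>N. \<forall>k\<ge>N. X unit_weight (\<lambda>x. (ad unit_weight ^^ i) (f j) x - (ad unit_weight ^^ i) (f k) x) < e"
      if "e > 0" for e
    proof -
      have "X unit_weight (\<lambda>x. (ad unit_weight ^^ i) (f j) x - (ad unit_weight ^^ i) (f k) x)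
        <= En unit_weight n (\<lambda>x. f j x - f k x)" for j k
        unfolding X_funpow_diff[OF weight_one H H i, symmetric] En_def using i
        by (intro member_le_sum[where f = "\<lambda>i. X unit_weight ((ad unit_weight ^^ i) (\<lambda>x. f j x - f k x))"])
          (auto intro: X_nonneg[OF weight_one])
      then show ?thesis using C[OF that] by (meson le_less_trans)
    qed
    from L2_complete[OF D[OF i] this] show ?thesis by blast
  qed
  then have "\<forall>i. \<exists>g. i <= n -->
    g \<in> L2 \<and> (\<lambda>k. X unit_weight (\<lambda>x. (ad unit_weight ^^ i) (f k) x - g x)) \<longlonglongrightarrow> 0" by blast
  from choice[OF this] obtain g where *: "\<forall>i. i <= n -->
    g i \<in> L2 \<and> (\<lambda>k. X unit_weight (\<lambda>x. (ad unit_weight ^^ i) (f k) x - g i x)) \<longlonglongrightarrow> 0" ..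
  have g: "g i \<in> L2" "(\<lambda>k. X unit_weight (\<lambda>x. (ad unit_weight ^^ i) (f k) x - g i x)) \<longlonglongrightarrow> 0"
    if "i <= n" for i using * that by blast+
  have wk: "has_weak_deriv i (g 0) (g i)" if i: "i <= n" for i
    unfolding has_weak_deriv_def
  proof (intro conjI allI impI)
    show "locally_integrable (g 0)" "locally_integrable (g i)" using g(1) i locally_integrable_L2 by auto
    fix h assume t: "test_function h"
    have p: "h \<in> L2" "(deriv ^^ i) h \<in> L2"
      by (intro L2_continuous test_function_continuous test_function_funpow t)+
    have A: "(\<lambda>k. LINT x|LI. f k x * (deriv ^^ i) h x) \<longlonglongrightarrow> (LINT x|LI. g 0 x * (deriv ^^ i) h x)"
      using LINT_mult_tendsto[OF D[of 0] g(1)[of 0] p(2) g(2)[of 0]] by simp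
    have B: "(\<lambda>k. (-1) ^ i * (LINT x|LI. (ad unit_weight ^^ i) (f k) x * h x)) \<longlonglongrightarrow> (-1) ^ i * (LINT x|LI. g i x * h x)"
      by (intro tendsto_intros LINT_mult_tendsto[OF D[OF i] g(1)[OF i] p(1) g(2)[OF i]])
    have E: "(LINT x|LI. f k x * (deriv ^^ i) h x) = (-1) ^ i * (LINT x|LI. (ad unit_weight ^^ i) (f k) x * h x)" for k
      using Hk_one_weak_deriv[OF H i] t unfolding has_weak_deriv_def ad_one by blast
    show "(LINT x|LI. g 0 x * (deriv ^^ i) h x) = (-1) ^ i * (LINT x|LI. g i x * h x)"
      by (rule LIMSEQ_unique[OF A[unfolded E] B])
  qed
  have "Hk unit_weight n (g 0)" unfolding Hk_one_iff using g(1) wk by blast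
  then obtain F where F: "F \<in> sobolev n" "AE x in LI. g 0 x = F x" using Hk_representative[OF n] by blast
  note HF = sobolev_Hk[OF F(1)]
  have ae: "AE x in LI. (ad unit_weight ^^ i) F x = g i x" if "i <= n" for i
    using has_weak_deriv_unique[OF Hk_one_weak_deriv[OF HF that] has_weak_deriv_cong_AE[OF F(2) wk[OF that]]]
    unfolding ad_one .
  have "(\<lambda>k. En unit_weight n (\<lambda>x. f k x - F x)) \<longlonglongrightarrow> (\<Sum>i\<le>n. 0)"
    unfolding En_def
  proof (rule tendsto_sum)
    fix i assume "i \<in> {..n}"
    then have i: "i <= n" by simp
    have "X unit_weight ((ad unit_weight ^^ i) (\<lambda>x. f k x - F x)) = X unit_weight (\<lambda>x. (ad unit_weight ^^ i) (f k) x - g i x)" for k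
    proof -
      have "AE x in LI. (ad unit_weight ^^ i) (f k) x - (ad unit_weight ^^ i) F x = (ad unit_weight ^^ i) (f k) x - g i x"
        using ae[OF i] by eventually_elim simp
      moreover have "(ad unit_weight ^^ i) F \<in> L2" using HF i unfolding Hk_iff by blast
      ultimately show ?thesis unfolding X_funpow_diff[OF weight_one H HF i]
        by (intro X_cong_AE[OF weight_one L2_diff[OF D[OF i]]])
    qed
    then show "(\<lambda>k. X unit_weight ((ad unit_weight ^^ i) (\<lambda>x. f k x - F x))) \<longlonglongrightarrow> 0" using g(2)[OF i] by simp
  qed
  then show ?thesis using that[OF F(1)] by simp
qed

section \<open>Paths and their lengths\<close>

lemma sobolev_norm_nonneg: "0 <= sobolev_norm n f"
  by (simp add: sobolev_norm_def sum_nonneg)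

lemma sobolev_norm_triangle:
  assumes "Hk unit_weight n f" "Hk unit_weight n g"
  shows "sobolev_norm n (\<lambda>x. f x + g x) <= sobolev_norm n f + sobolev_norm n g"
  using En_triangle[OF weight_one assms] Hk_lin[OF assms, of 1 1] assms by (simp add: sobolev_norm_eq)

lemma Hk_cmult: "Hk w n f ==> Hk w n (\<lambda>x. c * f x)"
  using Hk_lin[of w n f f c 0] by simp

lemma sobolev_norm_cmult:
  assumes "Hk unit_weight n f" shows "sobolev_norm n (\<lambda>x. c * f x) = \<bar>c\<bar> * sobolev_norm n f"
  using assms Hk_cmult[OF assms, of c] by (simp add: sobolev_norm_eq En_cmult[OF weight_one] real_sqrt_mult)

lemma sobolev_norm_minus_commute:
  assumes "Hk unit_weight n f" "Hk unit_weight n g"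
  shows "sobolev_norm n (\<lambda>x. f x - g x) = sobolev_norm n (\<lambda>x. g x - f x)"
  using sobolev_norm_cmult[OF Hk_diff[OF assms], of "-1"] by simp

lemma sobolev_eqI:
  assumes "f \<in> sobolev n" "g \<in> sobolev n" "AE x in LI. f x = g x" shows "f = g"
proof
  fix x
  show "f x = g x"
  proof (cases "x \<in> J")
    case True
    then show ?thesis
      using continuous_AE_eq[OF ac_continuous[OF sobolev_ac[OF assms(1)]] ac_continuous[OF sobolev_ac[OF assms(2)]] assms(3)] by blast
  qed (use sobolev_zero[OF assms(1)] sobolev_zero[OF assms(2)] in auto)
qed

lemma X_zero_imp_AE:
  assumes "weight w" "f \<in> L2" "X w f = 0" shows "AE x in LI. f x = 0"
proof -
  have "AE x in LI. 0 <= (f x)\<^sup>2 * w x" by (rule AE_LI_I) (simp add: weight_nonneg[OF assms(1)])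
  from integral_nonneg_eq_0_iff_AE[OF X_integrable_sq[OF assms(1,2)] this] assms(3)
  have "AE x in LI. (f x)\<^sup>2 * w x = 0" by (simp add: X_def)
  moreover have "AE x in LI. 0 < w x" by (rule AE_LI_I) (use assms(1) in \<open>auto simp: weight_def\<close>)
  ultimately show ?thesis by eventually_elim auto
qed

lemma En_zero_imp_AE:
  assumes "weight w" "Hk w n f" "En w n f = 0" shows "AE x in LI. f x = 0"
  using X_zero_imp_AE[OF assms(1) Hk_L2[OF assms(2)]] X_le_En[OF assms(1), of f n] X_nonneg[OF assms(1), of f] assms(3)
  by simp

lemma sobolev_norm_zero_imp_eq:
  assumes "f \<in> sobolev n" "g \<in> sobolev n" "sobolev_norm n (\<lambda>x. f x - g x) = 0" shows "f = g"
proof (rule sobolev_eqI[OF assms(1,2)])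
  have h: "Hk unit_weight n (\<lambda>x. f x - g x)" by (intro Hk_diff sobolev_Hk[OF assms(1)] sobolev_Hk[OF assms(2)])
  have "AE x in LI. f x - g x = 0"
    using En_zero_imp_AE[OF weight_one h] assms(3) by (simp add: sobolev_norm_eq[OF h])
  then show "AE x in LI. f x = g x" by simp
qed

lemma Gm_cmult:
  assumes "weight w" "Hk w n h" shows "Gm n a w (\<lambda>x. c * h x) = c\<^sup>2 * Gm n a w h"
proof -
  have "X w ((ad w ^^ i) (\<lambda>x. c * h x)) = c\<^sup>2 * X w ((ad w ^^ i) h)" if "i <= n" for i
  proof -
    have "AE x in LI. (ad w ^^ i) (\<lambda>x. c * h x) x = c * (ad w ^^ i) h x"
      using funpow_ad_lin[OF assms(2,2) that, of c 0] by simp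
    moreover have "(ad w ^^ i) (\<lambda>x. c * h x) \<in> L2" using Hk_cmult[OF assms(2)] that unfolding Hk_iff by blast
    ultimately show ?thesis using X_cong_AE[OF assms(1)] X_cmult[of w c "(ad w ^^ i) h"] by metis
  qed
  then show ?thesis by (simp add: Gm_def sum_distrib_left mult.left_commute)
qed

lemma has_path_deriv_iff:
  "has_path_deriv n c v t S \<longleftrightarrow> v \<in> sobolev n \<and>
    (\<forall>e>0. \<exists>d>0. \<forall>r\<in>S. 0 < dist r t \<and> dist r t < d -->
      sobolev_norm n (\<lambda>x. (c r x - c t x) / (r - t) - v x) < e)"
  unfolding has_path_deriv_def Lim_within by (simp add: sobolev_norm_nonneg)

lemma quotient_Hk:
  assumes "f \<in> sobolev n" "g \<in> sobolev n"
  shows "Hk unit_weight n (\<lambda>x. (f x - g x) / c)"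
  using Hk_cmult[OF Hk_diff[OF sobolev_Hk[OF assms(1)] sobolev_Hk[OF assms(2)]], of "1 / c"] by simp

lemma has_path_deriv_unique:
  assumes v: "has_path_deriv n c v t S" and u: "has_path_deriv n c u t S"
    and g: "\<And>r. r \<in> S ==> c r \<in> sobolev n" and t: "t \<in> S" "at t within S \<noteq> bot"
  shows "v = u"
proof (rule sobolev_norm_zero_imp_eq)
  show vs: "v \<in> sobolev n" and us: "u \<in> sobolev n" using u v by (auto simp: has_path_deriv_def)
  let ?q = "\<lambda>r y. (c r y - c t y) / (r - t)"
  have "((\<lambda>r. sobolev_norm n (\<lambda>y. ?q r y - v y) + sobolev_norm n (\<lambda>y. ?q r y - u y)) \<longlongrightarrow> 0 + 0) (at t within S)"
    using u v unfolding has_path_deriv_def by (intro tendsto_add) auto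
  moreover have "\<forall>\<^sub>F r in at t within S. sobolev_norm n (\<lambda>y. v y - u y)
      <= sobolev_norm n (\<lambda>y. ?q r y - v y) + sobolev_norm n (\<lambda>y. ?q r y - u y)"
    unfolding eventually_at_filter
  proof (rule always_eventually, intro allI impI)
    fix r assume r: "r \<in> S"
    have h: "Hk unit_weight n (?q r)" by (rule quotient_Hk[OF g[OF r] g[OF t(1)]])
    have 1: "Hk unit_weight n (\<lambda>y. v y - ?q r y)" "Hk unit_weight n (\<lambda>y. ?q r y - u y)"
      by (intro Hk_diff h sobolev_Hk[OF vs] sobolev_Hk[OF us])+
    have "sobolev_norm n (\<lambda>y. v y - u y) = sobolev_norm n (\<lambda>y. (v y - ?q r y) + (?q r y - u y))" by simp
    also have "... <= sobolev_norm n (\<lambda>y. v y - ?q r y) + sobolev_norm n (\<lambda>y. ?q r y - u y)"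
      by (rule sobolev_norm_triangle[OF 1])
    also have "sobolev_norm n (\<lambda>y. v y - ?q r y) = sobolev_norm n (\<lambda>y. ?q r y - v y)"
      by (rule sobolev_norm_minus_commute[OF sobolev_Hk[OF vs] h])
    finally show "sobolev_norm n (\<lambda>y. v y - u y)
      <= sobolev_norm n (\<lambda>y. ?q r y - v y) + sobolev_norm n (\<lambda>y. ?q r y - u y)" .
  qed
  ultimately have "sobolev_norm n (\<lambda>y. v y - u y) <= 0"
    using tendsto_lowerbound[of _ 0 "at t within S"] t(2) by simp
  then show "sobolev_norm n (\<lambda>x. v x - u x) = 0" using sobolev_norm_nonneg[of n] by (simp add: antisym)
qed

text \<open>Paths in H^n are differentiated through such functionals, namely point evaluations and
  inner products, so that one-variable calculus applies. Boundedness is asked only on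
  \<open>sobolev\<close>, because a point value is controlled by the norm only for the continuous
  representative.\<close>

definition bounded_functional :: "nat => ((real => real) => real) => bool" where
  "bounded_functional n L \<longleftrightarrow>
    (\<forall>f g a b. Hk unit_weight n f --> Hk unit_weight n g --> L (\<lambda>x. a * f x + b * g x) = a * L f + b * L g) \<and>
    (\<exists>K. \<forall>f. f \<in> sobolev n --> \<bar>L f\<bar> <= K * sobolev_norm n f)"

lemma bounded_functional_derivative:
  assumes n: "n >= 2" and L: "bounded_functional n T" and v: "has_path_deriv n c v t S"
    and g: "\<And>r. r \<in> S ==> c r \<in> sobolev n" and t: "t \<in> S"
  shows "((\<lambda>r. T (c r)) has_real_derivative T v) (at t within S)"
proof -
  obtain K where K: "\<And>f. f \<in> sobolev n ==> \<bar>T f\<bar> <= K * sobolev_norm n f"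
    using L unfolding bounded_functional_def by blast
  have lin: "T (\<lambda>x. a * f x + b * g x) = a * T f + b * T g" if "f \<in> sobolev n" "g \<in> sobolev n" for a b f g
    using L sobolev_Hk that unfolding bounded_functional_def by blast
  have vs: "v \<in> sobolev n" and vl: "((\<lambda>r. sobolev_norm n (\<lambda>y. (c r y - c t y) / (r - t) - v y)) \<longlongrightarrow> 0) (at t within S)"
    using v by (auto simp: has_path_deriv_def)
  have "((\<lambda>r. (T (c r) - T (c t)) / (r - t) - T v) \<longlongrightarrow> 0) (at t within S)"
  proof (rule Lim_null_comparison)
    show "((\<lambda>r. K * sobolev_norm n (\<lambda>y. (c r y - c t y) / (r - t) - v y)) \<longlongrightarrow> 0) (at t within S)"
      using tendsto_mult_right_zero[OF vl] .
    show "\<forall>\<^sub>F r in at t within S. norm ((T (c r) - T (c t)) / (r - t) - T v)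
      <= K * sobolev_norm n (\<lambda>y. (c r y - c t y) / (r - t) - v y)"
      unfolding eventually_at_filter
    proof (rule always_eventually, intro allI impI)
      fix r assume r: "r \<in> S"
      define q where "q = (\<lambda>y. 1 / (r - t) * c r y + (- 1 / (r - t)) * c t y)"
      have q: "q \<in> sobolev n" unfolding q_def by (rule sobolev_lin(1)[OF n g[OF r] g[OF t]])
      have d: "(\<lambda>y. 1 * q y + (-1) * v y) \<in> sobolev n" by (rule sobolev_lin(1)[OF n q vs])
      have e: "(\<lambda>y. (c r y - c t y) / (r - t) - v y) = (\<lambda>y. 1 * q y + (-1) * v y)"
        by (simp add: q_def diff_divide_distrib)
      have "T (\<lambda>y. 1 * q y + (-1) * v y) = T q - T v" using lin[OF q vs, of 1 "-1"] by simp
      also have "T q = (T (c r) - T (c t)) / (r - t)"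
        unfolding q_def lin[OF g[OF r] g[OF t]] by (simp add: diff_divide_distrib)
      finally show "norm ((T (c r) - T (c t)) / (r - t) - T v)
        <= K * sobolev_norm n (\<lambda>y. (c r y - c t y) / (r - t) - v y)"
        unfolding e using K[OF d] by simp
    qed
  qed
  then show ?thesis unfolding has_field_derivative_iff by (rule LIM_zero_cancel)
qed

text \<open>The integral of an arbitrary function is by definition the supremum over the simple
  functions below it, so measurable minorants decide upper bounds.\<close>

lemma nn_integral_le_if_minorants:
  assumes "\<And>g. g \<in> borel_measurable M ==> (\<And>x. g x <= f x) ==> (\<integral>\<^sup>+x. g x \<partial>M) <= K"
  shows "(\<integral>\<^sup>+x. f x \<partial>M) <= K"
  unfolding nn_integral_def
proof (rule SUP_least)
  fix g assume "g \<in> {g. simple_function M g \<and> g <= f}"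
  then have g: "simple_function M g" "g <= f" by auto
  have "integral\<^sup>S M g = (\<integral>\<^sup>+x. g x \<partial>M)" by (rule nn_integral_eq_simple_integral[OF g(1), symmetric])
  also have "... <= K" using g by (intro assms borel_measurable_simple_function) (auto simp: le_fun_def)
  finally show "integral\<^sup>S M g <= K" .
qed

text \<open>The speed of a path is not known to be measurable; the following facts hold without that.\<close>

lemma nn_integral_cmult_le:
  assumes "C > 0"
  shows "(\<integral>\<^sup>+x. ennreal C * f x \<partial>M) <= ennreal C * (\<integral>\<^sup>+x. f x \<partial>M)"
proof (rule nn_integral_le_if_minorants)
  fix g assume g: "g \<in> borel_measurable M" "\<And>x. g x <= ennreal C * f x"
  have c1: "ennreal C * ennreal (1 / C) = 1" using assms by (simp flip: ennreal_mult)
  have "(\<integral>\<^sup>+x. g x \<partial>M) = (\<integral>\<^sup>+x. ennreal C * (ennreal (1 / C) * g x) \<partial>M)"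
    by (simp add: mult.assoc[symmetric] c1)
  also have "... = ennreal C * (\<integral>\<^sup>+x. ennreal (1 / C) * g x \<partial>M)" using g(1) by (intro nn_integral_cmult) auto
  also have "(\<integral>\<^sup>+x. ennreal (1 / C) * g x \<partial>M) <= (\<integral>\<^sup>+x. f x \<partial>M)"
  proof (rule nn_integral_mono)
    fix x
    have "ennreal (1 / C) * g x <= ennreal (1 / C) * (ennreal C * f x)" using g(2) by (intro mult_left_mono) auto
    also have "... = f x" by (simp add: mult.assoc[symmetric] mult.commute[of "ennreal (1 / C)"] c1)
    finally show "ennreal (1 / C) * g x <= f x" .
  qed
  finally show "(\<integral>\<^sup>+x. g x \<partial>M) <= ennreal C * (\<integral>\<^sup>+x. f x \<partial>M)" by (simp add: mult_left_mono)
qed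

section \<open>Pieces of a path and comparison of lengths\<close>

definition velocity_speed :: "nat => (nat => real) => real => real => (real => real => real) => real => real" where
  "velocity_speed n w a b c t = sqrt (Gm n w (speed (c t)) (path_velocity n a b c t))"

lemma path_len_eq: "path_len n w a b c = (\<integral>\<^sup>+t. ennreal (velocity_speed n w a b c t) \<partial>lebesgue_on {a..b})"
  by (simp add: path_len_def velocity_speed_def sobolev_metric_eq)

lemma path_len_indicator:
  "path_len n w a b c = (\<integral>\<^sup>+t. ennreal (velocity_speed n w a b c t) * indicator {a..b} t \<partial>lebesgue)"
  unfolding path_len_eq by (rule nn_integral_restrict_space) simp

lemma chain_mono:
  fixes t :: "nat => real"
  assumes "\<forall>j<N. t j < t (Suc j)" "i <= j" "j <= N" shows "t i <= t j"
  using assms(2,3)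
proof (induction j)
  case (Suc j)
  then show ?case using assms(1)[rule_format, of j] by (cases "i = Suc j") auto
qed simp

lemma chain_piece:
  fixes u :: "nat => real"
  assumes "\<forall>j<N. u j < u (Suc j)" "u 0 < t" "t < u N" "t \<notin> u ` {..N}"
  shows "\<exists>j<N. u j < t \<and> t < u (Suc j)"
  using assms
proof (induction N)
  case (Suc N)
  have "t \<noteq> u N" using Suc.prems(4) by auto
  then consider "t < u N" | "u N < t" by linarith
  then show ?case
  proof cases
    case 1
    have "\<exists>j<N. u j < t \<and> t < u (Suc j)" using Suc.prems 1 by (intro Suc.IH) auto
    then show ?thesis using less_SucI by blast
  qed (use Suc.prems in blast)
qed simp

lemma chain_continuous:
  fixes t :: "nat => real" and F :: "real => real"
  assumes "\<forall>j<N. t j < t (Suc j)" "\<And>j. j < N ==> continuous_on {t j..t (Suc j)} F"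
  shows "continuous_on {t 0..t N} F"
  using assms
proof (induction N)
  case (Suc N)
  have "{t 0..t (Suc N)} = {t 0..t N} \<union> {t N..t (Suc N)}"
    using chain_mono[OF Suc.prems(1), of 0 N] Suc.prems(1) by (auto simp: ivl_disj_un)
  moreover have "continuous_on ({t 0..t N} \<union> {t N..t (Suc N)}) F"
    using Suc by (intro continuous_on_closed_Un) auto
  ultimately show ?case by simp
qed simp

lemma at_within_Icc_interior: "a < t ==> t < b ==> at t within {a..b} = at (t::real)"
  by (rule at_within_interior) (simp add: interior_atLeastAtMost_real)

text \<open>Hides the subdivision: off a finite set the velocity is a derivative with respect to the
  whole interval, and continuity of a real function along the path may be checked on subintervals
  where the path is differentiable.\<close>

lemma piecewise_path_pieces:
  assumes "piecewise_C1_path n a b p"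
  obtains S where "finite S" "\<And>t. t \<in> {a<..<b} - S ==> has_path_deriv n p (path_velocity n a b p t) t {a..b}"
    "\<And>F. (\<And>c d t. t \<in> {c..d} ==> {c..d} \<subseteq> {a..b} ==> (\<exists>v. has_path_deriv n p v t {c..d}) ==> continuous (at t within {c..d}) (\<lambda>r. F r)) ==>
      continuous_on {a..b} (F :: real => real)"
proof -
  obtain e N where t: "e 0 = a" "e N = b" "\<And>j. j < N ==> e j < e (Suc j)" "\<And>j. j < N ==> C1_path_on n {e j..e (Suc j)} p"
    and im: "\<And>t. t \<in> {a..b} ==> p t \<in> immersions n"
    using assms unfolding piecewise_C1_path_def by blast
  have ch: "\<forall>j<N. e j < e (Suc j)" using t(3) by blast
  have sub: "{e j..e (Suc j)} \<subseteq> {a..b}" if "j < N" for j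
    using chain_mono[OF ch, of 0 j] chain_mono[OF ch, of "Suc j" N] that t(1,2) by auto
  show ?thesis
  proof (rule that[of "e ` {..N}"])
    show "finite (e ` {..N})" by simp
    fix s assume s: "s \<in> {a<..<b} - e ` {..N}"
    obtain j where j: "j < N" "e j < s" "s < e (Suc j)"
      using chain_piece[OF ch, of s] s t(1,2) by auto
    obtain v where "\<forall>t\<in>{e j..e (Suc j)}. has_path_deriv n p (v t) t {e j..e (Suc j)}"
      using t(4)[OF j(1)] unfolding C1_path_on_def by blast
    then have "has_path_deriv n p (v s) s {e j..e (Suc j)}" using j by simp
    then have v: "has_path_deriv n p (v s) s {a..b}"
      using j s unfolding has_path_deriv_def by (simp add: at_within_Icc_interior)
    have "u = v s" if "has_path_deriv n p u s {a..b}" for u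
      by (rule has_path_deriv_unique[OF that v]) (use s im immersion_sobolev in \<open>auto simp: at_within_Icc_interior\<close>)
    then show "has_path_deriv n p (path_velocity n a b p s) s {a..b}"
      unfolding path_velocity_def using v by (metis (no_types, lifting) theI)
  next
    fix F :: "real => real"
    assume c: "\<And>c d t. t \<in> {c..d} ==> {c..d} \<subseteq> {a..b} ==> (\<exists>v. has_path_deriv n p v t {c..d}) ==> continuous (at t within {c..d}) (\<lambda>r. F r)"
    have "continuous_on {e 0..e N} F"
    proof (rule chain_continuous[OF ch])
      fix j assume j: "j < N"
      show "continuous_on {e j..e (Suc j)} F"
        unfolding continuous_on_eq_continuous_within
        using c[OF _ sub[OF j]] t(4)[OF j] unfolding C1_path_on_def by blast
    qed
    then show "continuous_on {a..b} F" using t by simp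
  qed
qed

lemma piecewise_path_immersion: "piecewise_C1_path n a b c ==> t \<in> {a..b} ==> c t \<in> immersions n"
  by (simp add: piecewise_C1_path_def)

lemma bounded_functional_continuous_path:
  assumes n: "n >= 2" and p: "piecewise_C1_path n a b g" and L: "bounded_functional n T"
  shows "continuous_on {a..b} (\<lambda>t. T (g t))"
proof -
  note im = immersion_sobolev[OF piecewise_path_immersion[OF p]]
  obtain S where S: "\<And>F. (\<And>c d t. t \<in> {c..d} ==> {c..d} \<subseteq> {a..b} ==> (\<exists>v. has_path_deriv n g v t {c..d}) ==> continuous (at t within {c..d}) (\<lambda>r. F r)) ==>
      continuous_on {a..b} (F :: real => real)" using piecewise_path_pieces[OF p] by metis
  show ?thesis
  proof (rule S)
    fix c d t assume t: "t \<in> {c..d}" "{c..d} \<subseteq> {a..b}" "\<exists>v. has_path_deriv n g v t {c..d}"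
    then obtain v where "has_path_deriv n g v t {c..d}" by blast
    from bounded_functional_derivative[OF n L this _ t(1)] im t(2)
    show "continuous (at t within {c..d}) (\<lambda>t. T (g t))" by (blast intro: DERIV_continuous)
  qed
qed

text \<open>The derivative of F is measurable by the fundamental theorem even if the speed of the
  path is not; the speed only has to dominate it off a finite set. Both lower bounds for path
  lengths, through \<open>Psi\<close> and through inner products, come from here.\<close>

lemma path_functional_le:
  assumes p: "piecewise_C1_path n a b c" and T: "a <= T" "T <= b" and C: "0 < C"
    and F: "continuous_on {a..T} F"
    and D: "\<And>t v. t \<in> {a<..<T} ==> has_path_deriv n c v t {a..b} ==>
      \<exists>D. (F has_real_derivative D) (at t) \<and> \<bar>D\<bar> <= C * sqrt (Gm n w (speed (c t)) v)"
  shows "ennreal \<bar>F T - F a\<bar> <= ennreal C * path_len n w a b c"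
proof -
  obtain S where S: "finite S" "\<And>t. t \<in> {a<..<b} - S ==> has_path_deriv n c (path_velocity n a b c t) t {a..b}"
    using piecewise_path_pieces[OF p] by metis
  have d: "(F has_real_derivative deriv F t) (at t)" "\<bar>deriv F t\<bar> <= C * velocity_speed n w a b c t"
    if t: "t \<in> {a<..<T} - S" for t
  proof -
    have "t \<in> {a<..<b} - S" using t T by auto
    from D[OF _ S(2)[OF this]] t obtain d where
      "(F has_real_derivative d) (at t)" "\<bar>d\<bar> <= C * velocity_speed n w a b c t" unfolding velocity_speed_def by auto
    then show "(F has_real_derivative deriv F t) (at t)" "\<bar>deriv F t\<bar> <= C * velocity_speed n w a b c t"
      using DERIV_imp_deriv by auto
  qed
  have hi: "(deriv F has_integral (F T - F a)) {a..T}"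
    by (rule fundamental_theorem_of_calculus_interior_strong[OF S(1) T(1) _ F])
      (use d(1) in \<open>simp add: has_real_derivative_iff_has_vector_derivative\<close>)
  let ?M = "lebesgue_on {a..T}"
  have m: "deriv F \<in> borel_measurable ?M" using hi by (intro integrable_imp_measurable) auto
  have 1: "ennreal \<bar>F T - F a\<bar> <= (\<integral>\<^sup>+t. ennreal \<bar>deriv F t\<bar> \<partial>?M)"
  proof (cases "(\<integral>\<^sup>+t. ennreal \<bar>deriv F t\<bar> \<partial>?M) = \<infinity>")
    case False
    then have i: "integrable ?M (deriv F)"
      using m by (intro integrableI_bounded) (auto simp: less_top)
    have "F T - F a = (LINT t|?M. deriv F t)"
      using lebesgue_integral_eq_integral[OF i] integral_unique[OF hi] by simp
    then have "\<bar>F T - F a\<bar> <= (LINT t|?M. \<bar>deriv F t\<bar>)" using integral_abs_bound[of ?M "deriv F"] by simp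
    then have "ennreal \<bar>F T - F a\<bar> <= ennreal (LINT t|?M. \<bar>deriv F t\<bar>)" by (rule ennreal_leI)
    also have "... = (\<integral>\<^sup>+t. ennreal \<bar>deriv F t\<bar> \<partial>?M)" using i by (intro nn_integral_eq_integral[symmetric]) auto
    finally show ?thesis .
  qed simp
  also have "(\<integral>\<^sup>+t. ennreal \<bar>deriv F t\<bar> \<partial>?M) = (\<integral>\<^sup>+t. ennreal \<bar>deriv F t\<bar> * indicator {a..T} t \<partial>lebesgue)"
    by (rule nn_integral_restrict_space) simp
  also have "... <= (\<integral>\<^sup>+t. ennreal C * (ennreal (velocity_speed n w a b c t) * indicator {a..b} t) \<partial>lebesgue)"
  proof (rule nn_integral_mono_AE)
    have "AE t in lebesgue. t \<notin> S \<union> {a, T}" using S(1) by (intro AE_notin_negligible negligible_finite) simp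
    then show "AE t in lebesgue. ennreal \<bar>deriv F t\<bar> * indicator {a..T} t
      <= ennreal C * (ennreal (velocity_speed n w a b c t) * indicator {a..b} t)"
    proof eventually_elim
      case (elim t)
      show ?case
      proof (cases "t \<in> {a..T}")
        case True
        then have "t \<in> {a<..<T} - S" using elim by auto
        from d(2)[OF this] show ?thesis using True T C by (simp add: ennreal_mult'[symmetric] ennreal_leI)
      qed simp
    qed
  qed
  also have "... <= ennreal C * path_len n w a b c"
    unfolding path_len_indicator by (rule nn_integral_cmult_le[OF C])
  finally show ?thesis .
qed

text \<open>For explicit paths: B is any nonnegative bound along the path whose integral is
  known.\<close>

lemma path_len_le_constant:
  fixes B :: "real => real"
  assumes p: "piecewise_C1_path n a b c" and B: "\<And>t. t \<in> {a..b} ==> 0 <= B t"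
    and le: "\<And>t v. t \<in> {a<..<b} ==> has_path_deriv n c v t {a..b} ==> sqrt (Gm n w (speed (c t)) v) <= B t"
    and hi: "(B has_integral I) {a..b}"
  shows "path_len n w a b c <= ennreal I"
proof -
  obtain S where S: "finite S" "\<And>t. t \<in> {a<..<b} - S ==> has_path_deriv n c (path_velocity n a b c t) t {a..b}"
    using piecewise_path_pieces[OF p] by metis
  have "path_len n w a b c <= (\<integral>\<^sup>+t. ennreal (B t) * indicator {a..b} t \<partial>lebesgue)"
    unfolding path_len_indicator
  proof (rule nn_integral_mono_AE)
    have "AE t in lebesgue. t \<notin> S \<union> {a, b}" using S(1) by (intro AE_notin_negligible negligible_finite) simp
    then show "AE t in lebesgue. ennreal (velocity_speed n w a b c t) * indicator {a..b} t <= ennreal (B t) * indicator {a..b} t"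
    proof eventually_elim
      case (elim t)
      show ?case
      proof (cases "t \<in> {a..b}")
        case True
        then have "t \<in> {a<..<b} - S" using elim by auto
        from le[OF _ S(2)[OF this]] this show ?thesis by (simp add: velocity_speed_def ennreal_leI mult_right_mono)
      qed simp
    qed
  qed
  also have "... = ennreal I"
    using nn_integral_has_integral_lebesgue'[OF B hi] by (simp add: nn_integral_completion)
  finally show ?thesis .
qed

lemma path_len_le_path_len:
  assumes p: "piecewise_C1_path n a b c" and q: "piecewise_C1_path n a b h" and C: "0 < C"
    and le: "\<And>t v. t \<in> {a<..<b} ==> has_path_deriv n c v t {a..b} ==>
      \<exists>u. has_path_deriv n h u t {a..b} \<and> sqrt (Gm n w (speed (h t)) u) <= C * sqrt (Gm n w (speed (c t)) v)"
  shows "path_len n w a b h <= ennreal C * path_len n w a b c"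
proof -
  obtain S where S: "finite S" "\<And>t. t \<in> {a<..<b} - S ==> has_path_deriv n c (path_velocity n a b c t) t {a..b}"
    using piecewise_path_pieces[OF p] by metis
  have "path_len n w a b h <= (\<integral>\<^sup>+t. ennreal C * (ennreal (velocity_speed n w a b c t) * indicator {a..b} t) \<partial>lebesgue)"
    unfolding path_len_indicator
  proof (rule nn_integral_mono_AE)
    have "AE t in lebesgue. t \<notin> S \<union> {a, b}" using S(1) by (intro AE_notin_negligible negligible_finite) simp
    then show "AE t in lebesgue. ennreal (velocity_speed n w a b h t) * indicator {a..b} t
        <= ennreal C * (ennreal (velocity_speed n w a b c t) * indicator {a..b} t)"
    proof eventually_elim
      case (elim t)
      show ?case
      proof (cases "t \<in> {a..b}")
        case True
        then have t: "t \<in> {a<..<b} - S" using elim by auto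
        then obtain u where u: "has_path_deriv n h u t {a..b}"
          "sqrt (Gm n w (speed (h t)) u) <= C * velocity_speed n w a b c t"
          using le[OF _ S(2)[OF t]] unfolding velocity_speed_def by auto
        have "path_velocity n a b h t = u" unfolding path_velocity_def
        proof (rule the_equality[where P = "\<lambda>v. has_path_deriv n h v t {a..b}", OF u(1)])
          fix v assume "has_path_deriv n h v t {a..b}"
          then show "v = u"
            by (rule has_path_deriv_unique[OF _ u(1)])
              (use t immersion_sobolev piecewise_path_immersion[OF q] in \<open>auto simp: at_within_Icc_interior\<close>)
        qed
        then show ?thesis using u(2) True C by (simp add: velocity_speed_def ennreal_mult'[symmetric] ennreal_leI)
      qed simp
    qed
  qed
  also have "... <= ennreal C * path_len n w a b c"
    unfolding path_len_indicator by (rule nn_integral_cmult_le[OF C])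
  finally show ?thesis .
qed

section \<open>Straight paths and upper bounds for the distance\<close>

lemma piecewise_C1_pathI:
  assumes "a < b" "C1_path_on n {a..b} c" "\<And>t. t \<in> {a..b} ==> c t \<in> immersions n"
  shows "piecewise_C1_path n a b c"
  unfolding piecewise_C1_path_def
  using assms by (intro conjI exI[of _ "\<lambda>j. if j = 0 then a else b"] exI[of _ "1::nat"]) auto

lemma sobolev_norm_zero: "sobolev_norm n (\<lambda>x. 0) = 0"
  using sobolev_norm_cmult[OF Hk_zero, of n 0] by simp

lemma affine_path_deriv:
  assumes "q \<in> sobolev n"
  shows "has_path_deriv n (\<lambda>t x. p x + t * q x) q t S"
proof -
  have "\<forall>\<^sub>F r in at t within S. sobolev_norm n (\<lambda>x. ((p x + r * q x) - (p x + t * q x)) / (r - t) - q x) = 0"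
    unfolding eventually_at_filter
  proof (rule always_eventually, intro allI impI)
    fix r :: real assume "r \<noteq> t"
    then have "(\<lambda>x. ((p x + r * q x) - (p x + t * q x)) / (r - t) - q x) = (\<lambda>x. 0)"
      by (simp add: fun_eq_iff field_simps)
    then show "sobolev_norm n (\<lambda>x. ((p x + r * q x) - (p x + t * q x)) / (r - t) - q x) = 0"
      by (simp only: sobolev_norm_zero)
  qed
  then show ?thesis unfolding has_path_deriv_def using assms by (simp add: tendsto_eventually)
qed

lemma affine_path:
  assumes "a < b" "q \<in> sobolev n" "\<And>t. t \<in> {a..b} ==> (\<lambda>x. p x + t * q x) \<in> immersions n"
  shows "piecewise_C1_path n a b (\<lambda>t x. p x + t * q x)"
proof (rule piecewise_C1_pathI[OF assms(1) _ assms(3)])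
  show "C1_path_on n {a..b} (\<lambda>t x. p x + t * q x)"
    unfolding C1_path_on_def
    using affine_path_deriv[OF assms(2)] by (intro exI[of _ "\<lambda>_. q"]) (auto simp: sobolev_norm_zero)
qed auto

lemma velocity_unique:
  assumes p: "piecewise_C1_path n a b c" and t: "t \<in> {a<..<b}"
    and "has_path_deriv n c v t {a..b}" "has_path_deriv n c u t {a..b}"
  shows "v = u"
  by (rule has_path_deriv_unique[OF assms(3,4)])
    (use t immersion_sobolev piecewise_path_immersion[OF p] in \<open>auto simp: at_within_Icc_interior\<close>)

lemma velocity_eqI:
  assumes p: "piecewise_C1_path n a b c" and t: "t \<in> {a<..<b}" and v: "has_path_deriv n c v t {a..b}"
  shows "path_velocity n a b c t = v"
  unfolding path_velocity_def by (rule the_equality[where P = "\<lambda>v. has_path_deriv n c v t {a..b}", OF v])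
    (rule velocity_unique[OF p t _ v])

lemma path_dist_le: "piecewise_C1_path n a b c ==> c a = c1 ==> c b = c2 ==> geodesic_dist n w c1 c2 <= path_len n w a b c"
  unfolding geodesic_dist_def by (rule Inf_lower) blast

lemma dist_less_path:
  assumes "geodesic_dist n w c1 c2 < K"
  obtains a b c where "piecewise_C1_path n a b c" "c a = c1" "c b = c2" "path_len n w a b c < K"
  using assms unfolding geodesic_dist_def Inf_less_iff by blast

lemma affine_dist_le:
  fixes B :: "real => real"
  assumes "a < b" "q \<in> sobolev n" "\<And>t. t \<in> {a..b} ==> (\<lambda>x. p x + t * q x) \<in> immersions n"
    and B: "\<And>t. t \<in> {a..b} ==> 0 <= B t"
    and le: "\<And>t. t \<in> {a<..<b} ==> sqrt (Gm n w (speed (\<lambda>x. p x + t * q x)) q) <= B t"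
    and hi: "(B has_integral I) {a..b}"
  shows "geodesic_dist n w (\<lambda>x. p x + a * q x) (\<lambda>x. p x + b * q x) <= ennreal I"
proof -
  note p = affine_path[OF assms(1-3)]
  have "path_len n w a b (\<lambda>t x. p x + t * q x) <= ennreal I"
  proof (rule path_len_le_constant[OF p B _ hi])
    fix t v assume t: "t \<in> {a<..<b}" and v: "has_path_deriv n (\<lambda>t x. p x + t * q x) v t {a..b}"
    have "v = q" by (rule velocity_unique[OF p t v affine_path_deriv[OF assms(2)]])
    then show "sqrt (Gm n w (speed (\<lambda>x. p x + t * q x)) v) <= B t" using le[OF t] by simp
  qed
  then show ?thesis using path_dist_le[OF p refl refl, of w] by simp
qed

section \<open>Concatenation, shift and reversal of paths\<close>

lemma C1_path_on_cong:
  assumes "C1_path_on n S c" "\<And>t. t \<in> S ==> c t = h t" shows "C1_path_on n S h"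
proof -
  have "has_path_deriv n h v t S" if "has_path_deriv n c v t S" "t \<in> S" for v t
    using that assms(2) unfolding has_path_deriv_iff by simp
  then show ?thesis using assms(1) unfolding C1_path_on_def by blast
qed

lemma has_path_deriv_interior_cong:
  assumes "has_path_deriv n p v t {a..b}" "a < t" "t < b" "\<And>r. r \<in> {a..b} ==> p r = h r" "c < t" "t < d"
  shows "has_path_deriv n h v t {c..d}"
proof -
  have "has_path_deriv n h v t {a..b}" using assms(1-4) unfolding has_path_deriv_iff by simp
  then show ?thesis using assms unfolding has_path_deriv_def by (simp add: at_within_Icc_interior)
qed

text \<open>For functions not known to be measurable one inequality remains, and it is the one that
  the triangle inequality uses.\<close>

lemma nn_integral_split_le:
  assumes "A \<in> sets M"
  shows "(\<integral>\<^sup>+x. f x \<partial>M) <= (\<integral>\<^sup>+x. f x * indicator A x \<partial>M) + (\<integral>\<^sup>+x. f x * indicator (- A) x \<partial>M)"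
proof (rule nn_integral_le_if_minorants)
  fix g assume g: "g \<in> borel_measurable M" "\<And>x. g x <= f x"
  have m: "(\<lambda>x. g x * indicator (- A) x) \<in> borel_measurable M"
  proof -
    have "(\<lambda>x. g x * indicator (space M - A) x) \<in> borel_measurable M" using g(1) assms by measurable
    then show ?thesis by (subst measurable_cong[where g = "\<lambda>x. g x * indicator (space M - A) x"]) (auto split: split_indicator)
  qed
  have "(\<integral>\<^sup>+x. g x \<partial>M) = (\<integral>\<^sup>+x. g x * indicator A x + g x * indicator (- A) x \<partial>M)"
    by (intro nn_integral_cong) (auto split: split_indicator)
  also have "... = (\<integral>\<^sup>+x. g x * indicator A x \<partial>M) + (\<integral>\<^sup>+x. g x * indicator (- A) x \<partial>M)"
    using g(1) assms m by (intro nn_integral_add) auto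
  also have "... <= (\<integral>\<^sup>+x. f x * indicator A x \<partial>M) + (\<integral>\<^sup>+x. f x * indicator (- A) x \<partial>M)"
    using g(2) by (intro add_mono nn_integral_mono mult_right_mono) auto
  finally show "(\<integral>\<^sup>+x. g x \<partial>M) <= (\<integral>\<^sup>+x. f x * indicator A x \<partial>M) + (\<integral>\<^sup>+x. f x * indicator (- A) x \<partial>M)" .
qed

text \<open>\<open>path_velocity\<close> refers to the whole parameter interval. Velocities of the
  joined path and of its parts are identified at interior points off a finite set, where derivatives
  within different intervals agree.\<close>

lemma piecewise_path_concat:
  assumes p1: "piecewise_C1_path n a b g" and p2: "piecewise_C1_path n b c r" and e: "g b = r b"
  defines "h \<equiv> \<lambda>t. if t <= b then g t else r t"
  shows "piecewise_C1_path n a c h" "path_len n w a c h <= path_len n w a b g + path_len n w b c r"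
proof -
  have ab: "a < b" "b < c" using p1 p2 by (auto simp: piecewise_C1_path_def)
  have z1: "g t = h t" if "t \<in> {a..b}" for t using that by (simp add: h_def)
  have z2: "r t = h t" if "t \<in> {b..c}" for t using that e by (auto simp: h_def)
  obtain u1 N1 where 1: "u1 0 = a" "u1 N1 = b" "\<And>j. j < N1 ==> u1 j < u1 (Suc j)"
    "\<And>j. j < N1 ==> C1_path_on n {u1 j..u1 (Suc j)} g"
    using p1 unfolding piecewise_C1_path_def by blast
  obtain u2 N2 where 2: "u2 0 = b" "u2 N2 = c" "\<And>j. j < N2 ==> u2 j < u2 (Suc j)"
    "\<And>j. j < N2 ==> C1_path_on n {u2 j..u2 (Suc j)} r"
    using p2 unfolding piecewise_C1_path_def by blast
  \<comment> \<open>Both subdivisions give the value b at the index N1, so the switch is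
    consistent.\<close>
  define u where "u j = (if j <= N1 then u1 j else u2 (j - N1))" for j
  have t2: "u (N1 + j) = u2 j" for j using 1 2 by (cases j) (auto simp: u_def)
  have ch1: "\<forall>j<N1. u1 j < u1 (Suc j)" and ch2: "\<forall>j<N2. u2 j < u2 (Suc j)" using 1 2 by auto
  have "u j < u (Suc j) \<and> C1_path_on n {u j..u (Suc j)} h" if j: "j < N1 + N2" for j
  proof (cases "j < N1")
    case True
    have "{u1 j..u1 (Suc j)} \<subseteq> {a..b}"
      using chain_mono[OF ch1, of 0 j] chain_mono[OF ch1, of "Suc j" N1] True 1 by auto
    then have "C1_path_on n {u1 j..u1 (Suc j)} h" using C1_path_on_cong[OF 1(4)[OF True]] z1 by blast
    then show ?thesis using True 1(3) by (simp add: u_def)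
  next
    case False
    define i where "i = j - N1"
    have i: "j = N1 + i" "Suc j = N1 + Suc i" "i < N2" using False j by (auto simp: i_def)
    have "{u2 i..u2 (Suc i)} \<subseteq> {b..c}"
      using chain_mono[OF ch2, of 0 i] chain_mono[OF ch2, of "Suc i" N2] i(3) 2 by auto
    then have "C1_path_on n {u2 i..u2 (Suc i)} h" using C1_path_on_cong[OF 2(4)[OF i(3)]] z2 by blast
    moreover have "u j = u2 i" "u (Suc j) = u2 (Suc i)" using t2[of i] t2[of "Suc i"] i by auto
    ultimately show ?thesis using 2(3)[OF i(3)] by simp
  qed
  moreover have "u 0 = a" "u (N1 + N2) = c" using 1 2 t2 by (auto simp: u_def)
  moreover have "h t \<in> immersions n" if "t \<in> {a..c}" for t
    using piecewise_path_immersion[OF p1, of t] piecewise_path_immersion[OF p2, of t] that by (auto simp: h_def)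
  ultimately show p: "piecewise_C1_path n a c h"
    unfolding piecewise_C1_path_def using ab by (intro conjI exI[of _ u] exI[of _ "N1 + N2"]) auto
  obtain S1 where S1: "finite S1" "\<And>t. t \<in> {a<..<b} - S1 ==> has_path_deriv n g (path_velocity n a b g t) t {a..b}"
    using piecewise_path_pieces[OF p1] by metis
  obtain S2 where S2: "finite S2" "\<And>t. t \<in> {b<..<c} - S2 ==> has_path_deriv n r (path_velocity n b c r t) t {b..c}"
    using piecewise_path_pieces[OF p2] by metis
  let ?f = "\<lambda>t. ennreal (velocity_speed n w a c h t) * indicator {a..c} t"
  have ae: "AE t in lebesgue. t \<notin> S1 \<union> S2 \<union> {a, b, c}"
    using S1(1) S2(1) by (intro AE_notin_negligible negligible_finite) simp
  have "path_len n w a c h <= (\<integral>\<^sup>+t. ?f t * indicator {..b} t \<partial>lebesgue) + (\<integral>\<^sup>+t. ?f t * indicator (- {..b}) t \<partial>lebesgue)"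
    unfolding path_len_indicator by (rule nn_integral_split_le) simp
  also have "... <= path_len n w a b g + path_len n w b c r"
  proof (rule add_mono)
    show "(\<integral>\<^sup>+t. ?f t * indicator {..b} t \<partial>lebesgue) <= path_len n w a b g"
      unfolding path_len_indicator
    proof (rule nn_integral_mono_AE)
      show "AE t in lebesgue. ?f t * indicator {..b} t <= ennreal (velocity_speed n w a b g t) * indicator {a..b} t"
        using ae
      proof eventually_elim
        case (elim t)
        show ?case
        proof (cases "t \<in> {a<..<b}")
          case True
          have d: "has_path_deriv n g (path_velocity n a b g t) t {a..b}" using S1(2) True elim by auto
          have "has_path_deriv n h (path_velocity n a b g t) t {a..c}"
            by (rule has_path_deriv_interior_cong[OF d]) (use True ab z1 in auto)
          then have "path_velocity n a c h t = path_velocity n a b g t"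
            using velocity_eqI[OF p, of t] True ab by auto
          moreover have "h t = g t" using z1 True by auto
          ultimately show ?thesis by (auto simp: velocity_speed_def split: split_indicator)
        qed (use elim in \<open>auto split: split_indicator\<close>)
      qed
    qed
    show "(\<integral>\<^sup>+t. ?f t * indicator (- {..b}) t \<partial>lebesgue) <= path_len n w b c r"
      unfolding path_len_indicator
    proof (rule nn_integral_mono_AE)
      show "AE t in lebesgue. ?f t * indicator (- {..b}) t <= ennreal (velocity_speed n w b c r t) * indicator {b..c} t"
        using ae
      proof eventually_elim
        case (elim t)
        show ?case
        proof (cases "t \<in> {b<..<c}")
          case True
          have d: "has_path_deriv n r (path_velocity n b c r t) t {b..c}" using S2(2) True elim by auto
          have "has_path_deriv n h (path_velocity n b c r t) t {a..c}"
            by (rule has_path_deriv_interior_cong[OF d]) (use True ab z2 in auto)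
          then have "path_velocity n a c h t = path_velocity n b c r t"
            using velocity_eqI[OF p, of t] True ab by auto
          moreover have "h t = r t" using z2 True by auto
          ultimately show ?thesis by (auto simp: velocity_speed_def split: split_indicator)
        qed (use elim in \<open>auto split: split_indicator\<close>)
      qed
    qed
  qed
  finally show "path_len n w a c h <= path_len n w a b g + path_len n w b c r" .
qed

text \<open>k = 1 covers shifts and k = -1 reversal. The velocity is multiplied by k, which does not
  change its metric norm.\<close>

lemma has_path_deriv_reparam:
  assumes v: "has_path_deriv n c v (k * t + s) S" and k: "k = 1 \<or> k = -1" and n: "n >= 2"
    and g: "\<And>r. r \<in> S ==> c r \<in> sobolev n" and t: "k * t + s \<in> S"
  shows "has_path_deriv n (\<lambda>t. c (k * t + s)) (\<lambda>x. k * v x) t {t. k * t + s \<in> S}"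
  unfolding has_path_deriv_iff
proof (intro conjI allI impI)
  have vs: "v \<in> sobolev n" using v by (simp add: has_path_deriv_def)
  show "(\<lambda>x. k * v x) \<in> sobolev n" using sobolev_lin(1)[OF n vs vs, of k 0] by simp
  fix e :: real assume "e > 0"
  then obtain d where d: "d > 0" "\<And>r. r \<in> S ==> 0 < dist r (k * t + s) ==> dist r (k * t + s) < d ==>
      sobolev_norm n (\<lambda>y. (c r y - c (k * t + s) y) / (r - (k * t + s)) - v y) < e"
    using v unfolding has_path_deriv_iff by blast
  show "\<exists>d>0. \<forall>r\<in>{t. k * t + s \<in> S}. 0 < dist r t \<and> dist r t < d -->
    sobolev_norm n (\<lambda>y. (c (k * r + s) y - c (k * t + s) y) / (r - t) - k * v y) < e"
  proof (intro exI[of _ d] conjI ballI impI)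
    fix r assume r: "r \<in> {t. k * t + s \<in> S}" "0 < dist r t \<and> dist r t < d"
    let ?q = "\<lambda>y. (c (k * r + s) y - c (k * t + s) y) / ((k * r + s) - (k * t + s)) - v y"
    have di: "dist (k * r + s) (k * t + s) = dist r t" using k by (auto simp: dist_real_def)
    have "(\<lambda>y. (c (k * r + s) y - c (k * t + s) y) / (r - t) - k * v y) = (\<lambda>y. k * ?q y)"
      using k r(2) by (auto simp: fun_eq_iff field_simps)
    moreover have "Hk unit_weight n ?q"
      using r(1) t g by (intro Hk_diff quotient_Hk sobolev_Hk[OF vs]) auto
    ultimately have "sobolev_norm n (\<lambda>y. (c (k * r + s) y - c (k * t + s) y) / (r - t) - k * v y) = sobolev_norm n ?q"
      using k by (auto simp: sobolev_norm_cmult)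
    also have "... < e" using d(2)[of "k * r + s"] r di k by auto
    finally show "sobolev_norm n (\<lambda>y. (c (k * r + s) y - c (k * t + s) y) / (r - t) - k * v y) < e" .
  qed (rule d(1))
qed

lemma C1_path_on_reparam:
  assumes c: "C1_path_on n S p" and k: "k = 1 \<or> k = -1" and n: "n >= 2"
    and g: "\<And>r. r \<in> S ==> p r \<in> sobolev n"
  shows "C1_path_on n {t. k * t + s \<in> S} (\<lambda>t. p (k * t + s))"
proof -
  obtain v where v: "\<And>t. t \<in> S ==> has_path_deriv n p (v t) t S"
    "\<And>t. t \<in> S ==> ((\<lambda>r. sobolev_norm n (\<lambda>y. v r y - v t y)) \<longlongrightarrow> 0) (at t within S)"
    using c unfolding C1_path_on_def by blast
  have vs: "v t \<in> sobolev n" if "t \<in> S" for t using v(1)[OF that] by (simp add: has_path_deriv_def)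
  show ?thesis unfolding C1_path_on_def
  proof (intro exI[of _ "\<lambda>t x. k * v (k * t + s) x"] ballI conjI)
    fix t assume t: "t \<in> {t. k * t + s \<in> S}"
    then show "has_path_deriv n (\<lambda>t. p (k * t + s)) (\<lambda>x. k * v (k * t + s) x) t {t. k * t + s \<in> S}"
      by (intro has_path_deriv_reparam v k n g) auto
    show "((\<lambda>r. sobolev_norm n (\<lambda>y. k * v (k * r + s) y - k * v (k * t + s) y)) \<longlongrightarrow> 0) (at t within {t. k * t + s \<in> S})"
      unfolding Lim_within
    proof (intro allI impI)
      fix e :: real assume "e > 0"
      then obtain d where d: "d > 0" "\<And>r. r \<in> S ==> 0 < dist r (k * t + s) ==> dist r (k * t + s) < d ==>
        sobolev_norm n (\<lambda>y. v r y - v (k * t + s) y) < e"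
        using v(2)[of "k * t + s"] t unfolding Lim_within by (auto simp: sobolev_norm_nonneg)
      show "\<exists>d>0. \<forall>r\<in>{t. k * t + s \<in> S}. 0 < dist r t \<and> dist r t < d -->
        dist (sobolev_norm n (\<lambda>y. k * v (k * r + s) y - k * v (k * t + s) y)) 0 < e"
      proof (intro exI[of _ d] conjI ballI impI)
        fix r assume r: "r \<in> {t. k * t + s \<in> S}" "0 < dist r t \<and> dist r t < d"
        let ?q = "\<lambda>y. v (k * r + s) y - v (k * t + s) y"
        have di: "dist (k * r + s) (k * t + s) = dist r t" using k by (auto simp: dist_real_def)
        have "Hk unit_weight n ?q" using r(1) t vs by (intro Hk_diff sobolev_Hk[of _ n]) auto
        then have "sobolev_norm n (\<lambda>y. k * ?q y) = sobolev_norm n ?q" using k by (auto simp: sobolev_norm_cmult)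
        also have "... < e" using d(2)[of "k * r + s"] r di k by auto
        finally show "dist (sobolev_norm n (\<lambda>y. k * v (k * r + s) y - k * v (k * t + s) y)) 0 < e"
          by (simp add: sobolev_norm_nonneg right_diff_distrib)
      qed (rule d(1))
    qed
  qed
qed

lemma nn_integral_reparam_le:
  assumes k: "k = 1 \<or> k = (-1::real)"
  shows "(\<integral>\<^sup>+x. f (k * x + s) \<partial>lebesgue) <= (\<integral>\<^sup>+x. f x \<partial>lebesgue)"
proof (rule nn_integral_le_if_minorants)
  fix g :: "real => ennreal" assume g: "g \<in> borel_measurable lebesgue" "\<And>x. g x <= f (k * x + s)"
  define h where "h y = g (k * y - k * s)" for y
  have kk: "k * k = 1" using k by auto
  have "(\<integral>\<^sup>+x. g x \<partial>lebesgue) = ennreal \<bar>k\<bar> * (\<integral>\<^sup>+x. g (- k * s + k * x) \<partial>lebesgue)"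
    by (rule nn_integral_real_affine_lebesgue[OF g(1)]) (use k in auto)
  also have "... = (\<integral>\<^sup>+x. h x \<partial>lebesgue)" using k unfolding h_def by (auto simp: add.commute)
  also have "... <= (\<integral>\<^sup>+x. f x \<partial>lebesgue)"
  proof (rule nn_integral_mono)
    fix y
    have "k * (k * y - k * s) + s = y" using kk by (simp add: right_diff_distrib mult.assoc[symmetric])
    then show "h y <= f y" using g(2)[of "k * y - k * s"] by (simp add: h_def)
  qed
  finally show "(\<integral>\<^sup>+x. g x \<partial>lebesgue) <= (\<integral>\<^sup>+x. f x \<partial>lebesgue)" .
qed

lemma path_len_reparam:
  assumes p: "piecewise_C1_path n a b c" and k: "k = 1 \<or> k = -1" and n: "n >= 2"
    and q: "piecewise_C1_path n a' b' (\<lambda>t. c (k * t + s))" and ab: "{a'..b'} = {t. k * t + s \<in> {a..b}}"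
  shows "path_len n w a' b' (\<lambda>t. c (k * t + s)) <= path_len n w a b c"
proof -
  obtain S where S: "finite S" "\<And>t. t \<in> {a<..<b} - S ==> has_path_deriv n c (path_velocity n a b c t) t {a..b}"
    using piecewise_path_pieces[OF p] by metis
  define F where "F = (\<lambda>t. ennreal (velocity_speed n w a b c t) * indicator {a..b} t)"
  have "path_len n w a' b' (\<lambda>t. c (k * t + s)) <= (\<integral>\<^sup>+t. F (k * t + s) \<partial>lebesgue)"
    unfolding path_len_indicator
  proof (rule nn_integral_mono_AE)
    \<comment> \<open>As k is its own inverse, y |-> k (y - s) inverts t |-> k t + s and gives the
      preimages of the exceptional points.\<close>
    let ?N = "(\<lambda>y. k * (y - s)) ` (S \<union> {a, b}) \<union> {a', b'}"
    have "AE t in lebesgue. t \<notin> ?N" using S(1) by (intro AE_notin_negligible negligible_finite) simp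
    then show "AE t in lebesgue. ennreal (velocity_speed n w a' b' (\<lambda>t. c (k * t + s)) t) * indicator {a'..b'} t <= F (k * t + s)"
    proof eventually_elim
      case (elim t)
      show ?case
      proof (cases "t \<in> {a'..b'}")
        case True
        have t: "t \<in> {a'<..<b'}" using True elim by auto
        define y where "y = k * t + s"
        have yt: "t = k * (y - s)" using k by (auto simp: y_def)
        have yab: "y \<in> {a..b}" using True ab by (auto simp: y_def)
        have y: "y \<in> {a<..<b} - S"
        proof -
          have "y \<notin> S \<union> {a, b}" using elim yt by blast
          then show ?thesis using yab by auto
        qed
        note d = S(2)[OF y]
        have vs: "path_velocity n a b c y \<in> sobolev n" using d by (simp add: has_path_deriv_def)
        have im: "c y \<in> immersions n" by (rule piecewise_path_immersion[OF p yab])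
        have "has_path_deriv n (\<lambda>t. c (k * t + s)) (\<lambda>x. k * path_velocity n a b c y x) t {t. k * t + s \<in> {a..b}}"
          by (rule has_path_deriv_reparam[OF _ k n])
            (use d yab immersion_sobolev piecewise_path_immersion[OF p] in \<open>auto simp: y_def\<close>)
        then have "path_velocity n a' b' (\<lambda>t. c (k * t + s)) t = (\<lambda>x. k * path_velocity n a b c y x)"
          unfolding ab[symmetric] by (rule velocity_eqI[OF q t])
        moreover have "Gm n w (speed (c y)) (\<lambda>x. k * path_velocity n a b c y x) = Gm n w (speed (c y)) (path_velocity n a b c y)"
        proof -
          have "Hk (speed (c y)) n (path_velocity n a b c y)"
            using immersion_norm_equivalence[OF n im] sobolev_Hk[OF vs] by metis
          from Gm_cmult[OF immersion_weight[OF im] this] show ?thesis using k by auto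
        qed
        ultimately have "velocity_speed n w a' b' (\<lambda>t. c (k * t + s)) t = velocity_speed n w a b c y"
          by (simp add: velocity_speed_def y_def)
        then show ?thesis using True yab by (simp add: F_def y_def)
      qed simp
    qed
  qed
  also have "... <= (\<integral>\<^sup>+t. F t \<partial>lebesgue)" by (rule nn_integral_reparam_le[OF k])
  finally show ?thesis unfolding F_def path_len_indicator .
qed

lemma piecewise_path_shift:
  assumes p: "piecewise_C1_path n a b g" and n: "n >= 2"
  shows "piecewise_C1_path n (a - s) (b - s) (\<lambda>t. g (1 * t + s))"
    "path_len n w (a - s) (b - s) (\<lambda>t. g (1 * t + s)) <= path_len n w a b g"
proof -
  obtain e N where t: "e 0 = a" "e N = b" "\<And>j. j < N ==> e j < e (Suc j)" "\<And>j. j < N ==> C1_path_on n {e j..e (Suc j)} g"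
    using p unfolding piecewise_C1_path_def by blast
  have ch: "\<forall>j<N. e j < e (Suc j)" using t(3) by blast
  note im = piecewise_path_immersion[OF p]
  have c: "C1_path_on n {e j - s..e (Suc j) - s} (\<lambda>t. g (1 * t + s))" if j: "j < N" for j
  proof -
    have "{e j..e (Suc j)} \<subseteq> {a..b}"
      using chain_mono[OF ch, of 0 j] chain_mono[OF ch, of "Suc j" N] j t(1,2) by auto
    then have "C1_path_on n {u. 1 * u + s \<in> {e j..e (Suc j)}} (\<lambda>t. g (1 * t + s))"
      using im immersion_sobolev by (intro C1_path_on_reparam[OF t(4)[OF j] _ n]) auto
    moreover have "{u. 1 * u + s \<in> {e j..e (Suc j)}} = {e j - s..e (Suc j) - s}" by auto
    ultimately show ?thesis by simp
  qed
  show q: "piecewise_C1_path n (a - s) (b - s) (\<lambda>t. g (1 * t + s))"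
    unfolding piecewise_C1_path_def
  proof (intro conjI exI[of _ "\<lambda>j. e j - s"] exI[of _ N] ballI allI impI)
    show "a - s < b - s" using p by (simp add: piecewise_C1_path_def)
    show "g (1 * u + s) \<in> immersions n" if "u \<in> {a - s..b - s}" for u using im[of "u + s"] that by auto
  qed (use t c in auto)
  show "path_len n w (a - s) (b - s) (\<lambda>t. g (1 * t + s)) <= path_len n w a b g"
    by (rule path_len_reparam[OF p _ n q]) auto
qed

lemma piecewise_path_reverse:
  assumes p: "piecewise_C1_path n a b g" and n: "n >= 2"
  shows "piecewise_C1_path n (- b) (- a) (\<lambda>t. g (-1 * t + 0))"
    "path_len n w (- b) (- a) (\<lambda>t. g (-1 * t + 0)) <= path_len n w a b g"
proof -
  obtain e N where t: "e 0 = a" "e N = b" "\<And>j. j < N ==> e j < e (Suc j)" "\<And>j. j < N ==> C1_path_on n {e j..e (Suc j)} g"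
    using p unfolding piecewise_C1_path_def by blast
  have ch: "\<forall>j<N. e j < e (Suc j)" using t(3) by blast
  note im = piecewise_path_immersion[OF p]
  have c: "- e (N - j) < - e (N - Suc j)" "C1_path_on n {- e (N - j)..- e (N - Suc j)} (\<lambda>t. g (-1 * t + 0))"
    if j: "j < N" for j
  proof -
    define i where "i = N - Suc j"
    have i: "i < N" "N - j = Suc i" "N - Suc j = i" using j by (auto simp: i_def)
    show "- e (N - j) < - e (N - Suc j)" using t(3)[OF i(1)] i by simp
    have "{e i..e (Suc i)} \<subseteq> {a..b}"
      using chain_mono[OF ch, of 0 i] chain_mono[OF ch, of "Suc i" N] i t(1,2) by auto
    then have "C1_path_on n {u. -1 * u + 0 \<in> {e i..e (Suc i)}} (\<lambda>t. g (-1 * t + 0))"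
      using im immersion_sobolev by (intro C1_path_on_reparam[OF t(4)[OF i(1)] _ n]) auto
    moreover have "{u. -1 * u + 0 \<in> {e i..e (Suc i)}} = {- e (Suc i)..- e i}" by auto
    ultimately show "C1_path_on n {- e (N - j)..- e (N - Suc j)} (\<lambda>t. g (-1 * t + 0))" using i by simp
  qed
  show q: "piecewise_C1_path n (- b) (- a) (\<lambda>t. g (-1 * t + 0))"
    unfolding piecewise_C1_path_def
  proof (intro conjI exI[of _ "\<lambda>j. - e (N - j)"] exI[of _ N] ballI allI impI)
    show "- b < - a" using p by (simp add: piecewise_C1_path_def)
    show "g (-1 * u + 0) \<in> immersions n" if "u \<in> {- b..- a}" for u using im[of "- u"] that by auto
  qed (use t c in auto)
  show "path_len n w (- b) (- a) (\<lambda>t. g (-1 * t + 0)) <= path_len n w a b g"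
    by (rule path_len_reparam[OF p _ n q]) auto
qed

lemma dist_commute_le:
  assumes "n >= 2" shows "geodesic_dist n w c2 c1 <= geodesic_dist n w c1 c2"
  unfolding geodesic_dist_def[of n w c1]
proof (rule Inf_greatest)
  fix l assume "l \<in> {path_len n w a b c |a b c. piecewise_C1_path n a b c \<and> c a = c1 \<and> c b = c2}"
  then obtain a b c where l: "l = path_len n w a b c" "piecewise_C1_path n a b c" "c a = c1" "c b = c2" by blast
  note r = piecewise_path_reverse[OF l(2) assms]
  have "geodesic_dist n w c2 c1 <= path_len n w (- b) (- a) (\<lambda>t. c (-1 * t + 0))"
    by (rule path_dist_le[OF r(1)]) (use l in auto)
  also have "... <= l" using r(2) l by simp
  finally show "geodesic_dist n w c2 c1 <= l" .
qed

lemma dist_commute: "n >= 2 ==> geodesic_dist n w c1 c2 = geodesic_dist n w c2 c1"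
  by (intro antisym dist_commute_le)

text \<open>The second path is shifted to start at the final parameter of the first. Nearly minimal
  paths are taken only when both distances are finite, which \<open>ennreal_le_epsilon\<close>
  allows to assume.\<close>

lemma dist_triangle_geodesic:
  assumes n: "n >= 2"
  shows "geodesic_dist n w c1 c3 <= geodesic_dist n w c1 c2 + geodesic_dist n w c2 c3"
proof (rule ennreal_le_epsilon)
  fix e :: real assume fin: "geodesic_dist n w c1 c2 + geodesic_dist n w c2 c3 < top" and e: "e > 0"
  have e2: "ennreal (e/2) > 0" using e by simp
  have "geodesic_dist n w c1 c2 < geodesic_dist n w c1 c2 + ennreal (e/2)"
    using fin e2 by (simp add: ennreal_add_left_cancel_less[of _ 0, simplified] less_top[symmetric])
  then obtain a b c where 1: "piecewise_C1_path n a b c" "c a = c1" "c b = c2"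
    "path_len n w a b c < geodesic_dist n w c1 c2 + ennreal (e/2)" by (rule dist_less_path)
  have "geodesic_dist n w c2 c3 < geodesic_dist n w c2 c3 + ennreal (e/2)"
    using fin e2 by (simp add: ennreal_add_left_cancel_less[of _ 0, simplified] less_top[symmetric])
  then obtain a' b' h where 2: "piecewise_C1_path n a' b' h" "h a' = c2" "h b' = c3"
    "path_len n w a' b' h < geodesic_dist n w c2 c3 + ennreal (e/2)" by (rule dist_less_path)
  note s = piecewise_path_shift[OF 2(1) n, where s = "a' - b"]
  have s1: "piecewise_C1_path n b (b' - (a' - b)) (\<lambda>t. h (1 * t + (a' - b)))" using s(1) by simp
  have e1: "c b = h (1 * b + (a' - b))" using 1 2 by simp
  note cc = piecewise_path_concat[OF 1(1) s1 e1]
  have bb: "b < b' - (a' - b)" "a < b" using s1 1(1) by (auto simp: piecewise_C1_path_def)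
  have "geodesic_dist n w c1 c3 <= path_len n w a b c + path_len n w b (b' - (a' - b)) (\<lambda>t. h (1 * t + (a' - b)))"
    by (rule order_trans[OF path_dist_le[OF cc(1)] cc(2)]) (use 1 2 bb in auto)
  also have "... <= path_len n w a b c + path_len n w a' b' h" using s(2)[where w = w] by (intro add_left_mono) simp
  also have "... <= (geodesic_dist n w c1 c2 + ennreal (e/2)) + (geodesic_dist n w c2 c3 + ennreal (e/2))"
    using 1(4) 2(4) by (intro add_mono) auto
  also have "... = geodesic_dist n w c1 c2 + geodesic_dist n w c2 c3 + (ennreal (e/2) + ennreal (e/2))" by (simp add: ac_simps)
  also have "ennreal (e/2) + ennreal (e/2) = ennreal e" using e by (simp flip: ennreal_plus)
  finally show "geodesic_dist n w c1 c3 <= geodesic_dist n w c1 c2 + geodesic_dist n w c2 c3 + ennreal e" .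
qed

lemma Gm_zero: assumes "weight w" shows "Gm n a w (\<lambda>x. 0) = 0"
  using Gm_cmult[OF assms Hk_zero, of n a 0] by simp

text \<open>A path has a nontrivial parameter interval, so the constant path is taken as a straight
  path with direction 0.\<close>

lemma dist_self:
  assumes n: "n >= 2" and c: "c \<in> immersions n" shows "geodesic_dist n w c c = 0"
proof -
  have z: "(\<lambda>x. 0) \<in> sobolev n"
    using sobolev_lin(1)[OF n immersion_sobolev[OF c] immersion_sobolev[OF c], of 0 0] by simp
  have "geodesic_dist n w (\<lambda>y. c y + 0 * 0) (\<lambda>y. c y + 1 * 0) <= ennreal 0"
    by (rule affine_dist_le[OF _ z, where B = "\<lambda>_. 0"])
      (use c Gm_zero[OF immersion_weight[OF c]] in auto)
  then show ?thesis by simp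
qed

section \<open>Length and local comparison estimates\<close>

lemma path_deriv_norm_continuous:
  assumes v: "has_path_deriv n c v t S" and g: "\<And>r. r \<in> S ==> c r \<in> sobolev n" and t: "t \<in> S"
  shows "((\<lambda>r. sobolev_norm n (\<lambda>x. c r x - c t x)) \<longlongrightarrow> 0) (at t within S)"
proof (rule Lim_null_comparison)
  have vs: "v \<in> sobolev n" and vl: "((\<lambda>r. sobolev_norm n (\<lambda>x. (c r x - c t x) / (r - t) - v x)) \<longlongrightarrow> 0) (at t within S)"
    using v by (auto simp: has_path_deriv_def)
  have "((\<lambda>r. \<bar>r - t\<bar> * (sobolev_norm n (\<lambda>x. (c r x - c t x) / (r - t) - v x) + sobolev_norm n v)) \<longlongrightarrow>
      \<bar>t - t\<bar> * (0 + sobolev_norm n v)) (at t within S)"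
    by (intro tendsto_intros vl)
  then show "((\<lambda>r. \<bar>r - t\<bar> * (sobolev_norm n (\<lambda>x. (c r x - c t x) / (r - t) - v x) + sobolev_norm n v)) \<longlongrightarrow> 0) (at t within S)"
    by simp
  show "\<forall>\<^sub>F r in at t within S. norm (sobolev_norm n (\<lambda>x. c r x - c t x))
      <= \<bar>r - t\<bar> * (sobolev_norm n (\<lambda>x. (c r x - c t x) / (r - t) - v x) + sobolev_norm n v)"
    unfolding eventually_at_filter
  proof (rule always_eventually, intro allI impI)
    fix r assume r: "r \<noteq> t" "r \<in> S"
    let ?q = "\<lambda>x. (c r x - c t x) / (r - t)"
    have q: "Hk unit_weight n ?q" by (rule quotient_Hk[OF g[OF r(2)] g[OF t]])
    have "(\<lambda>x. c r x - c t x) = (\<lambda>x. (r - t) * ((?q x - v x) + v x))" using r(1) by (simp add: fun_eq_iff)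
    moreover have "Hk unit_weight n (\<lambda>x. (?q x - v x) + v x)" using q by simp
    ultimately have "sobolev_norm n (\<lambda>x. c r x - c t x) = \<bar>r - t\<bar> * sobolev_norm n (\<lambda>x. (?q x - v x) + v x)"
      by (simp only: sobolev_norm_cmult)
    also have "... <= \<bar>r - t\<bar> * (sobolev_norm n (\<lambda>x. ?q x - v x) + sobolev_norm n v)"
      by (intro mult_left_mono sobolev_norm_triangle Hk_diff q sobolev_Hk[OF vs]) auto
    finally show "norm (sobolev_norm n (\<lambda>x. c r x - c t x)) <= \<bar>r - t\<bar> * (sobolev_norm n (\<lambda>x. ?q x - v x) + sobolev_norm n v)"
      by (simp add: sobolev_norm_nonneg)
  qed
qed

lemma wtb_unit: "wtb (2*pi) (2*pi) unit_weight"
  using wlen_eq[OF weight_one] by (simp add: wtb_def weight_one)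

text \<open>The embedding of H^1 into the continuous functions, from the supremum bound for the
  weight 1.\<close>

lemma evaluation_functional:
  assumes n: "n >= 1" and x: "x \<in> J" shows "bounded_functional n (\<lambda>f. f x)"
  unfolding bounded_functional_def
proof (intro conjI allI impI exI)
  fix f assume f: "f \<in> sobolev n"
  have h: "H1 f" using Hk_mono[OF sobolev_Hk[OF f] n] by simp
  have ac: "ac f (wd f)" by (rule H1_continuous_ac[OF h ac_continuous[OF sobolev_ac[OF f]]])
  define K where "K = 2 / (2*pi) + 2 * (2*pi)"
  have K: "K >= 0" unfolding K_def by simp
  have "(f x)\<^sup>2 <= K * En unit_weight 1 f" unfolding K_def by (rule sup_le_En[OF wtb_unit h ac _ x]) simp
  also have "... <= K * En unit_weight n f" using En_mono[OF weight_one n] K by (intro mult_left_mono)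
  finally have "sqrt ((f x)\<^sup>2) <= sqrt (K * En unit_weight n f)" by (rule real_sqrt_le_mono)
  then show "\<bar>f x\<bar> <= sqrt (2 / (2*pi) + 2 * (2*pi)) * sobolev_norm n f"
    by (simp add: real_sqrt_mult sobolev_norm_eq[OF sobolev_Hk[OF f]] K_def)
qed simp

lemma bounded_functional_diff:
  assumes "bounded_functional n T" "bounded_functional n Theta"
  shows "bounded_functional n (\<lambda>f. T f - Theta f)"
proof -
  obtain K L where KL: "\<And>f. f \<in> sobolev n ==> \<bar>T f\<bar> <= K * sobolev_norm n f" "\<And>f. f \<in> sobolev n ==> \<bar>Theta f\<bar> <= L * sobolev_norm n f"
    using assms unfolding bounded_functional_def by blast
  have "\<bar>T f - Theta f\<bar> <= (K + L) * sobolev_norm n f" if "f \<in> sobolev n" for f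
    using KL(1)[OF that] KL(2)[OF that] by (simp add: distrib_right)
  then show ?thesis using assms unfolding bounded_functional_def by (auto simp: algebra_simps intro!: exI[of _ "K + L"])
qed

lemma ip_functional:
  assumes n: "n >= 2" and c: "c \<in> immersions n" and h: "Hk (speed c) n h"
  shows "bounded_functional n (\<lambda>f. ip (speed c) n f h)"
proof -
  obtain C where C: "C > 0" "\<And>h. Hk unit_weight n h \<longleftrightarrow> Hk (speed c) n h"
    "\<And>h. Hk unit_weight n h ==> En (speed c) n h <= C * En unit_weight n h"
    using immersion_norm_equivalence[OF n c] by metis
  note w = immersion_weight[OF c]
  have "\<bar>ip (speed c) n f h\<bar> <= (sqrt C * sqrt (En (speed c) n h)) * sobolev_norm n f" if f: "f \<in> sobolev n" for f
  proof -
    have "\<bar>ip (speed c) n f h\<bar> <= sqrt (En (speed c) n f) * sqrt (En (speed c) n h)"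
      by (rule ip_abs_le[OF w _ h]) (use C(2) sobolev_Hk[OF f] in blast)
    also have "sqrt (En (speed c) n f) <= sqrt (C * En unit_weight n f)"
      using C(3)[OF sobolev_Hk[OF f]] by simp
    also have "... = sqrt C * sobolev_norm n f" by (simp add: real_sqrt_mult sobolev_norm_eq[OF sobolev_Hk[OF f]])
    finally show ?thesis using En_nonneg[OF w, of n h] by (simp add: mult_ac mult_right_mono)
  qed
  moreover have "ip (speed c) n (\<lambda>x. a * f x + b * g x) h = a * ip (speed c) n f h + b * ip (speed c) n g h"
    if "Hk unit_weight n f" "Hk unit_weight n g" for f g a b
    by (rule ip_lin[OF w _ _ h]) (use C(2) that in blast)+
  ultimately show ?thesis unfolding bounded_functional_def by blast
qed

lemma path_functional_derivative:
  assumes n: "n >= 2" and p: "piecewise_C1_path n a b c" and L: "bounded_functional n T"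
    and t: "t \<in> {a<..<b}" and v: "has_path_deriv n c v t {a..b}"
  shows "((\<lambda>r. T (c r)) has_real_derivative T v) (at t)"
  using bounded_functional_derivative[OF n L v] immersion_sobolev[OF piecewise_path_immersion[OF p]] t
  by (simp add: at_within_Icc_interior)

text \<open>The signed increment between the end points varies continuously along the path and never
  vanishes, its absolute value being the length of the curve.\<close>

lemma path_orient:
  assumes n: "n >= 2" and p: "piecewise_C1_path n a b g" and t: "t \<in> {a..b}"
  shows "orient (g t) = orient (g a)"
proof -
  have ab: "a < b" using p by (simp add: piecewise_C1_path_def)
  note im = piecewise_path_immersion[OF p]
  have L: "bounded_functional n (\<lambda>f. f (2*pi) - f 0)"
    by (intro bounded_functional_diff evaluation_functional) (use n in auto)
  have c: "continuous_on {a..b} (\<lambda>t. g t (2*pi) - g t 0)" by (rule bounded_functional_continuous_path[OF n p L])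
  have nz: "g t (2*pi) - g t 0 \<noteq> 0" if "t \<in> {a..b}" for t
    using immersion_orient(1,3,4)[OF im[OF that]] by auto
  have conn: "connected ((\<lambda>t. g t (2*pi) - g t 0) ` {a..b})" by (intro connected_continuous_image c) simp
  show ?thesis
  proof (rule ccontr)
    assume "orient (g t) \<noteq> orient (g a)"
    then have ne: "sgn (g t (2*pi) - g t 0) \<noteq> sgn (g a (2*pi) - g a 0)" by (simp add: orient_def)
    have a: "a \<in> {a..b}" using ab by simp
    let ?S = "(\<lambda>t. g t (2*pi) - g t 0) ` {a..b}"
    have m: "g t (2*pi) - g t 0 \<in> ?S" "g a (2*pi) - g a 0 \<in> ?S" using t a by blast+
    have "0 \<in> ?S"
    proof (cases "g t (2*pi) - g t 0 > 0")
      case True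
      then have "g a (2*pi) - g a 0 <= 0" using ne by (auto simp: sgn_if split: if_splits)
      then show ?thesis using connectedD_interval[OF conn m(2,1), of 0] True by simp
    next
      case False
      then have "g a (2*pi) - g a 0 >= 0" using ne nz[OF t] by (auto simp: sgn_if split: if_splits)
      then show ?thesis using connectedD_interval[OF conn m(1,2), of 0] False by simp
    qed
    then show False using nz by force
  qed
qed

locale immersion_metric =
  fixes n :: nat and a :: "nat => real"
  assumes n2: "n >= 2" and a_nonneg: "\<And>i. i <= n ==> a i >= 0"
    and a0: "a 0 > 0" and a2: "a 2 > 0" and an: "a n > 0"
begin

abbreviation M :: "(real => real) set" where "M \<equiv> immersions n"
abbreviation d :: "(real => real) => (real => real) => ennreal" where "d \<equiv> geodesic_dist n a"
abbreviation G :: "(real => real) => (real => real) => real" where "G c \<equiv> Gm n a (speed c)"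

lemma Hk_immersion: "c \<in> M ==> Hk unit_weight n h \<longleftrightarrow> Hk (speed c) n h"
  using immersion_norm_equivalence[OF n2] by metis

lemma sobolev_Hk_immersion: "c \<in> M ==> h \<in> sobolev n ==> Hk (speed c) n h"
  using Hk_immersion sobolev_Hk by blast

lemma G_nonneg: "c \<in> M ==> 0 <= G c h"
  by (rule Gm_nonneg[OF a_nonneg immersion_weight])

section \<open>Variation of the length along a path\<close>

text \<open>The end point increment of \<open>v\<close> is at most the length times the supremum of
  the arc length derivative of \<open>v\<close>. The arc in \<open>derivative_sup_le\<close> has
  length r = min l 1; as r <= 1, both terms can share the factor 1 / r^3, whose square root is the
  singular factor here.\<close>

lemma length_variation_le:
  assumes c: "c \<in> M" and v: "v \<in> sobolev n"
  defines "r \<equiv> min (clen c) 1"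
  shows "\<bar>v (2*pi) - v 0\<bar> <= clen c * (sqrt (72 / a 0 + 2 / a 2) / (r * sqrt r)) * sqrt (G c v)"
proof -
  define w where "w = speed c"
  have w: "weight w" unfolding w_def by (rule immersion_weight[OF c])
  have l: "clen c = wlen w" "wlen w > 0" using wlen_pos[OF w] by (auto simp: clen_def w_def)
  have d: "0 < r" "r <= wlen w" "r <= 1" using l by (auto simp: r_def)
  obtain k where k: "n = Suc (Suc k)" using n2 by (metis add_2_eq_Suc le_Suc_ex)
  have h: "H1 v" "H1 (ad w v)" using sobolev_Hk_immersion[OF c v] unfolding k w_def by auto
  obtain g1 where g1: "ac g1 (wd (ad w v))" "AE x in LI. ad w v x = g1 x" using H1_ac[OF h(2)] .
  define K where "K = 72 / a 0 + 2 / a 2"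
  have K: "K >= 0" using a0 a2 by (simp add: K_def)
  have G: "0 <= Gm n a w v" by (rule Gm_nonneg[OF a_nonneg w])
  define B where "B = sqrt K / (r * sqrt r) * sqrt (Gm n a w v)"
  have B: "\<bar>g1 x\<bar> <= B" if x: "x \<in> J" for x
  proof -
    have "a 0 * X w ((ad w ^^ 0) v) <= Gm n a w v" "a 2 * X w ((ad w ^^ 2) v) <= Gm n a w v"
      by (rule Gm_term_le; use a_nonneg w n2 in simp)+
    then have X: "X w v <= Gm n a w v / a 0" "X w (ad w (ad w v)) <= Gm n a w v / a 2"
      using a0 a2 by (simp_all add: field_simps eval_nat_numeral)
    have "(g1 x)\<^sup>2 <= 72 / r^3 * X w v + 2 * r * X w (ad w (ad w v))"
      by (rule derivative_sup_le[OF w h g1 d(1,2) x])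
    also have "... <= 72 / r^3 * (Gm n a w v / a 0) + 2 * r * (Gm n a w v / a 2)"
      using X d by (intro add_mono mult_left_mono) auto
    also have "2 * r * (Gm n a w v / a 2) <= 2 / r^3 * (Gm n a w v / a 2)"
    proof -
      have "r * r^3 <= 1" using d power_le_one[of r 4] by (simp add: power4_eq_xxxx power3_eq_cube)
      then have "r <= 1 / r^3" using d by (simp add: field_simps)
      then have "2 * r <= 2 / r^3" by simp
      then show ?thesis using G a2 by (intro mult_right_mono) auto
    qed
    also have "72 / r^3 * (Gm n a w v / a 0) + 2 / r^3 * (Gm n a w v / a 2) = K / r^3 * Gm n a w v"
      unfolding K_def using a0 a2 d by (simp add: field_simps)
    finally have "(g1 x)\<^sup>2 <= K / r^3 * Gm n a w v" by simp
    moreover have "B\<^sup>2 = K / r^3 * Gm n a w v"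
    proof -
      have "B\<^sup>2 = K / (r\<^sup>2 * r) * Gm n a w v"
        using K G d by (simp add: B_def power_mult_distrib power_divide)
      then show ?thesis by (simp add: power2_eq_square power3_eq_cube)
    qed
    ultimately have "\<bar>g1 x\<bar> <= \<bar>B\<bar>" by (simp add: abs_le_square_iff)
    moreover have "B >= 0" unfolding B_def using K G d by simp
    ultimately show ?thesis by simp
  qed
  have "AE x in LI. wd v x = g1 x * w x"
  proof -
    have "AE x in LI. ad w v x * w x = wd v x" by (rule AE_LI_I) (rule ad_times_weight[OF w])
    with g1(2) show ?thesis by eventually_elim simp
  qed
  then have "ac v (\<lambda>x. g1 x * w x)"
    by (rule ac_cong_AE[OF H1_continuous_ac[OF h(1) ac_continuous[OF sobolev_ac[OF v]]]]) simp
  from ac_increment[OF this, of 0 "2*pi"] have "v (2*pi) - v 0 = integral J (\<lambda>x. g1 x * w x)" by simp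
  also have "\<bar>...\<bar> <= integral J (\<lambda>x. B * w x)"
  proof -
    have "norm (integral J (\<lambda>x. g1 x * w x)) <= integral J (\<lambda>x. B * w x)"
    proof (rule integral_norm_bound_integral)
      have "continuous_on J w" using w by (simp add: weight_def)
      then show "(\<lambda>x. g1 x * w x) integrable_on J" "(\<lambda>x. B * w x) integrable_on J"
        by (auto intro!: integrable_continuous_real continuous_intros ac_continuous[OF g1(1)])
      show "norm (g1 x * w x) <= B * w x" if "x \<in> J" for x
        using B[OF that] weight_nonneg[OF w that] by (simp add: abs_mult mult_right_mono)
    qed
    then show ?thesis by simp
  qed
  also have "... = B * wlen w" by (simp add: wlen_eq[OF w])
  finally show ?thesis by (simp add: B_def l(1) K_def w_def mult_ac)
qed

definition Psi :: "real => real" where "Psi l = ln (1 + l * sqrt l)"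

text \<open>The factor 3/2 comes from differentiating l^(3/2), the square root from
  \<open>length_variation_le\<close>.\<close>

definition psi_const :: real where "psi_const = 3/2 * sqrt (72 / a 0 + 2 / a 2)"

lemma psi_const_pos: "psi_const > 0"
  using a0 a2 by (simp add: psi_const_def add_pos_pos)

text \<open>\<open>Psi\<close> is chosen such that \<open>Psi' l <= 3/2 min (l\<^bsup>1/2\<^esup>, 1/l)\<close>, which compensates both the degeneration
  of the length estimate for short curves and its growth for long ones.\<close>

lemma Psi_length_lipschitz_path:
  assumes p: "piecewise_C1_path n s t c" and T: "T \<in> {s..t}"
  shows "ennreal \<bar>Psi (clen (c T)) - Psi (clen (c s))\<bar> <= ennreal psi_const * path_len n a s t c"
proof -
  define b where "b = orient (c s)"
  have st: "s < t" using p by (simp add: piecewise_C1_path_def)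
  note im = piecewise_path_immersion[OF p]
  have b: "b = 1 \<or> b = -1" using immersion_orient(1)[OF im[of s]] st by (simp add: b_def)
  have L: "bounded_functional n (\<lambda>f. f (2*pi) - f 0)"
    by (intro bounded_functional_diff evaluation_functional) (use n2 in auto)
  have cl: "clen (c r) = b * (c r (2*pi) - c r 0)" "clen (c r) > 0" if r: "r \<in> {s..t}" for r
    using immersion_orient(3,4)[OF im[OF r]] path_orient[OF n2 p r] b by (auto simp: b_def)
  define F where "F r = Psi (b * (c r (2*pi) - c r 0))" for r
  have "ennreal \<bar>F T - F s\<bar> <= ennreal psi_const * path_len n a s t c"
  proof (rule path_functional_le[OF p _ _ psi_const_pos])
    show "s <= T" "T <= t" using T by auto
    define u where "u r = b * (c r (2*pi) - c r 0)" for r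
    have "continuous_on {s..T} (\<lambda>r. c r (2*pi) - c r 0)"
      by (rule continuous_on_subset[OF bounded_functional_continuous_path[OF n2 p L]]) (use T in auto)
    then have uc: "continuous_on {s..T} u" unfolding u_def by (intro continuous_on_mult_left)
    have u0: "1 + u r * sqrt (u r) \<noteq> 0" if "r \<in> {s..T}" for r
    proof -
      have "r \<in> {s..t}" using that T by auto
      from cl[OF this] have "u r > 0" by (simp add: u_def)
      then have "0 < 1 + u r * sqrt (u r)" by (simp add: add_pos_nonneg)
      then show ?thesis by simp
    qed
    show "continuous_on {s..T} F"
      unfolding F_def Psi_def u_def[symmetric] using u0 by (intro continuous_intros uc) auto
    fix r v assume r: "r \<in> {s<..<T}" and v: "has_path_deriv n c v r {s..t}"
    have rt: "r \<in> {s<..<t}" "r \<in> {s..t}" using r T by auto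
    have vs: "v \<in> sobolev n" using v by (simp add: has_path_deriv_def)
    define l where "l = clen (c r)"
    have l: "l = b * (c r (2*pi) - c r 0)" "l > 0" using cl[OF rt(2)] by (auto simp: l_def)
    have p1: "0 < 1 + l * sqrt l" using l(2) by (simp add: add_pos_nonneg)
    have dl: "((\<lambda>r. b * (c r (2*pi) - c r 0)) has_real_derivative b * (v (2*pi) - v 0)) (at r)"
      by (rule DERIV_cmult[OF path_functional_derivative[OF n2 p L rt(1) v]])
    have dP: "(Psi has_real_derivative (3/2 * sqrt l / (1 + l * sqrt l))) (at l)"
    proof -
      have "((\<lambda>l. l * sqrt l) has_real_derivative 3/2 * sqrt l) (at l)"
        using l(2) by (auto intro!: derivative_eq_intros simp: field_simps real_sqrt_divide)
      from DERIV_add[OF DERIV_const[of 1] this]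
      have "((\<lambda>l. 1 + l * sqrt l) has_real_derivative 3/2 * sqrt l) (at l)" by simp
      from DERIV_chain2[OF DERIV_ln_divide[OF p1] this] show ?thesis
        unfolding Psi_def[abs_def] by (rule DERIV_cong) simp
    qed
    have D: "(F has_real_derivative (3/2 * sqrt l / (1 + l * sqrt l)) * (b * (v (2*pi) - v 0))) (at r)"
      unfolding F_def[abs_def] by (rule DERIV_chain2[OF dP[unfolded l(1)] dl, folded l(1)])
    have "\<bar>(3/2 * sqrt l / (1 + l * sqrt l)) * (b * (v (2*pi) - v 0))\<bar> = 3/2 * sqrt l / (1 + l * sqrt l) * \<bar>v (2*pi) - v 0\<bar>"
      using b l(2) p1 by (auto simp: abs_mult)
    also have "... <= 3/2 * sqrt l / (1 + l * sqrt l) * (l * (sqrt (72 / a 0 + 2 / a 2) / (min l 1 * sqrt (min l 1))) * sqrt (G (c r) v))"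
      using length_variation_le[OF im[OF rt(2)] vs] l(2) p1 unfolding l_def[symmetric] by (intro mult_left_mono) auto
    also have "... = (sqrt l / (1 + l * sqrt l) * l / (min l 1 * sqrt (min l 1))) * (psi_const * sqrt (G (c r) v))"
    proof -
      have "3/2 * A / B * (l * (S / D) * T) = (A / B * l / D) * (3/2 * S * T)" for A B S D T :: real by simp
      then show ?thesis unfolding psi_const_def .
    qed
    also have "... <= 1 * (psi_const * sqrt (G (c r) v))"
    proof (rule mult_right_mono)
      \<comment> \<open>For l <= 1 the factors l sqrt l cancel and 1 / (1 + l sqrt l) remains; for l
        > 1 the quotient is l sqrt l / (1 + l sqrt l).\<close>
      show "sqrt l / (1 + l * sqrt l) * l / (min l 1 * sqrt (min l 1)) <= 1"
      proof (cases "l <= 1")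
        case True
        have "sqrt l / B * l / (l * sqrt l) = 1 / B" for B :: real using l(2) by simp
        then show ?thesis using True l(2) p1 by (simp add: min_def divide_le_eq)
      next
        case False
        then show ?thesis using l(2) p1 by (simp add: min_def divide_le_eq mult.commute)
      qed
      show "0 <= psi_const * sqrt (G (c r) v)" using psi_const_pos G_nonneg[OF im[OF rt(2)]] by simp
    qed
    finally show "\<exists>D. (F has_real_derivative D) (at r) \<and> \<bar>D\<bar> <= psi_const * sqrt (G (c r) v)"
      using D by auto
  qed
  then show ?thesis using cl(1)[OF T] cl(1)[of s] st by (simp add: F_def)
qed

lemma Psi_length_lipschitz:
  "ennreal \<bar>Psi (clen c2) - Psi (clen c1)\<bar> <= ennreal psi_const * d c1 c2"
proof -
  have "ennreal (\<bar>Psi (clen c2) - Psi (clen c1)\<bar> / psi_const) <= d c1 c2"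
    unfolding geodesic_dist_def
  proof (rule Inf_greatest)
    fix l assume "l \<in> {path_len n a s t c |s t c. piecewise_C1_path n s t c \<and> c s = c1 \<and> c t = c2}"
    then obtain s t c where l: "l = path_len n a s t c" "piecewise_C1_path n s t c" "c s = c1" "c t = c2" by blast
    have st: "t \<in> {s..t}" using l(2) by (simp add: piecewise_C1_path_def)
    have "ennreal (1 / psi_const) * ennreal \<bar>Psi (clen c2) - Psi (clen c1)\<bar> <= ennreal (1 / psi_const) * (ennreal psi_const * l)"
      using Psi_length_lipschitz_path[OF l(2) st] l by (intro mult_left_mono) auto
    also have "... = l" using psi_const_pos by (simp add: mult.assoc[symmetric] flip: ennreal_mult)
    finally show "ennreal (\<bar>Psi (clen c2) - Psi (clen c1)\<bar> / psi_const) <= l"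
      using psi_const_pos by (simp flip: ennreal_mult)
  qed
  then have "ennreal psi_const * ennreal (\<bar>Psi (clen c2) - Psi (clen c1)\<bar> / psi_const) <= ennreal psi_const * d c1 c2"
    by (intro mult_left_mono) auto
  then show ?thesis using psi_const_pos by (simp flip: ennreal_mult)
qed

lemma Psi_mono: "0 <= x ==> x <= y ==> Psi x <= Psi y"
  unfolding Psi_def by (subst ln_le_cancel_iff) (auto intro!: add_pos_nonneg mult_mono)

lemma Psi_strict_mono: "0 <= x ==> x < y ==> Psi x < Psi y"
  unfolding Psi_def by (subst ln_less_cancel_iff) (auto intro!: add_pos_nonneg mult_strict_mono')

lemma dist_finite_orient:
  assumes "d c1 c2 < top" shows "orient c1 = orient c2"
proof -
  obtain s t c where l: "piecewise_C1_path n s t c" "c s = c1" "c t = c2" using dist_less_path[OF assms] by metis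
  then show ?thesis using path_orient[OF n2 l(1), of t] by (auto simp: piecewise_C1_path_def)
qed

section \<open>Uniform local comparison of distance and norm\<close>

text \<open>The radius \<open>j\<close> is available before the centre \<open>c0\<close> is chosen.
  Around \<open>c0\<close> the norm belonging to \<open>speed c0\<close> serves as a flat norm,
  equivalent to the metric on a ball of radius R. A short path cannot leave that ball, which bounds
  the norm by the distance; a straight segment stays in it by convexity, which bounds the distance
  by the norm.\<close>

lemma local_estimate:
  assumes lo: "0 < lo"
  shows "\<exists>j>0. \<exists>C>0. \<forall>c0\<in>M. lo <= clen c0 --> clen c0 <= hi -->
    (\<forall>c\<in>sobolev n. sqrt (En (speed c0) n (\<lambda>x. c x - c0 x)) <= j --> c \<in> M) \<and>
    (\<forall>c1\<in>M. \<forall>c2\<in>M. sqrt (En (speed c0) n (\<lambda>x. c1 x - c0 x)) <= j --> d c1 c2 < ennreal j -->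
      ennreal (sqrt (En (speed c0) n (\<lambda>x. c2 x - c1 x))) <= ennreal C * d c1 c2) \<and>
    (\<forall>c1\<in>sobolev n. \<forall>c2\<in>sobolev n. sqrt (En (speed c0) n (\<lambda>x. c1 x - c0 x)) <= j -->
      sqrt (En (speed c0) n (\<lambda>x. c2 x - c0 x)) <= j --> d c1 c2 <= ennreal (C * sqrt (En (speed c0) n (\<lambda>x. c2 x - c1 x))))"
proof -
  obtain r C1 where r: "r > 0" and C1: "C1 > 0" and loc: "\<And>c0 c. c0 \<in> M ==> lo <= clen c0 ==> clen c0 <= hi ==> c \<in> sobolev n ==>
    En (speed c0) n (\<lambda>x. c x - c0 x) <= r ==> c \<in> M \<and>
      (\<forall>h. Hk unit_weight n h --> En (speed c) n h <= C1 * En (speed c0) n h \<and> En (speed c0) n h <= C1 * En (speed c) n h)"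
    using immersion_local_equivalence[OF n2 lo, of hi] by blast
  have lo': "0 < lo / C1" using lo C1 by simp
  obtain C2 where C2: "C2 > 0" "\<And>w h. wtb (lo / C1) (C1 * hi) w ==> Hk w n h ==> En w n h <= C2 * Gm n a w h"
    using En_le_Gm[OF a_nonneg a0 an lo', of "C1 * hi"] by blast
  define A where "A = (\<Sum>i\<le>n. a i)"
  have A: "A > 0" unfolding A_def using a0 a_nonneg by (intro sum_pos2[of _ 0]) auto
  define K where "K = sqrt (C1 * C2)"
  have K: "K > 0" using C1 C2 by (simp add: K_def)
  define B where "B = sqrt (A * C1)"
  have B: "B > 0" using A C1 by (simp add: B_def)
  define R where "R = sqrt r"
  have R: "R > 0" using r by (simp add: R_def)
  have ball: "c \<in> M" "\<And>h. h \<in> sobolev n ==> sqrt (En (speed c0) n h) <= K * sqrt (G c h)"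
    "\<And>h. h \<in> sobolev n ==> sqrt (G c h) <= B * sqrt (En (speed c0) n h)"
    if c0: "c0 \<in> M" "lo <= clen c0" "clen c0 <= hi" and c: "c \<in> sobolev n" "sqrt (En (speed c0) n (\<lambda>x. c x - c0 x)) <= R" for c0 c
  proof -
    have "En (speed c0) n (\<lambda>x. c x - c0 x) <= r" using c(2) by (simp add: R_def)
    note l = loc[OF c0 c(1) this]
    show cM: "c \<in> M" using l by blast
    have eq: "En (speed c) n h <= C1 * En (speed c0) n h" "En (speed c0) n h <= C1 * En (speed c) n h" if "Hk unit_weight n h" for h
      using l that by blast+
    have "wtb (lo / C1) (C1 * hi) (speed c)"
    proof -
      \<comment> \<open>Applied to the constant 1, the equivalence of norms compares the lengths of
        c and c0.\<close>
      note e = eq[OF Hk_const[of unit_weight n 1], unfolded En_const[OF immersion_weight[OF cM]] En_const[OF immersion_weight[OF c0(1)]]]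
      have "clen c <= C1 * clen c0" "clen c0 <= C1 * clen c" using e by (auto simp: clen_def)
      moreover have "C1 * clen c0 <= C1 * hi" using c0 C1 by simp
      ultimately have "clen c <= C1 * hi" "lo <= C1 * clen c" using c0 by linarith+
      then show ?thesis using lo' C1 immersion_weight[OF cM] by (auto simp: wtb_def clen_def[symmetric] field_simps)
    qed
    note G1 = C2(2)[OF this]
    fix h assume h: "h \<in> sobolev n"
    have "En (speed c0) n h <= C1 * En (speed c) n h" by (rule eq(2)[OF sobolev_Hk[OF h]])
    also have "... <= C1 * (C2 * G c h)" using G1[OF sobolev_Hk_immersion[OF cM h]] C1 by simp
    finally have "sqrt (En (speed c0) n h) <= sqrt ((C1 * C2) * G c h)" by (simp add: mult.assoc)
    then show "sqrt (En (speed c0) n h) <= K * sqrt (G c h)" by (simp add: K_def real_sqrt_mult)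
    have "G c h <= A * En (speed c) n h" unfolding A_def by (rule Gm_le_En[OF a_nonneg immersion_weight[OF cM]])
    also have "... <= A * (C1 * En (speed c0) n h)" using eq(1)[OF sobolev_Hk[OF h]] A by simp
    finally have "sqrt (G c h) <= sqrt ((A * C1) * En (speed c0) n h)" by (simp add: mult.assoc)
    then show "sqrt (G c h) <= B * sqrt (En (speed c0) n h)" by (simp add: B_def real_sqrt_mult)
  qed
  \<comment> \<open>A path that starts within R / 2 of the centre and is shorter than j moves by
    less than K * j <= R / 2.\<close>
  define j where "j = min (R / 2) (R / (2 * K))"
  have j: "j > 0" "j <= R / 2" "K * j <= R / 2"
  proof -
    show "j > 0" "j <= R / 2" using R K by (auto simp: j_def)
    have "K * j <= K * (R / (2 * K))" using K by (intro mult_left_mono) (auto simp: j_def)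
    also have "... = R / 2" using K by simp
    finally show "K * j <= R / 2" .
  qed
  have main: "(\<forall>c\<in>sobolev n. sqrt (En (speed c0) n (\<lambda>x. c x - c0 x)) <= j --> c \<in> M) \<and>
    (\<forall>c1\<in>M. \<forall>c2\<in>M. sqrt (En (speed c0) n (\<lambda>x. c1 x - c0 x)) <= j --> d c1 c2 < ennreal j -->
      ennreal (sqrt (En (speed c0) n (\<lambda>x. c2 x - c1 x))) <= ennreal (K + B) * d c1 c2) \<and>
    (\<forall>c1\<in>sobolev n. \<forall>c2\<in>sobolev n. sqrt (En (speed c0) n (\<lambda>x. c1 x - c0 x)) <= j -->
      sqrt (En (speed c0) n (\<lambda>x. c2 x - c0 x)) <= j --> d c1 c2 <= ennreal ((K + B) * sqrt (En (speed c0) n (\<lambda>x. c2 x - c1 x))))"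
    if c0: "c0 \<in> M" "lo <= clen c0" "clen c0 <= hi" for c0
  proof (intro conjI ballI impI)
    let ?w = "speed c0"
    let ?nm = "\<lambda>h. sqrt (En ?w n h)"
    have w: "weight ?w" by (rule immersion_weight[OF c0(1)])
    note H = sobolev_Hk_immersion[OF c0(1)]
    note H0 = H[OF immersion_sobolev[OF c0(1)]]
    note bl = ball[OF c0]
    show "c \<in> M" if "c \<in> sobolev n" "?nm (\<lambda>x. c x - c0 x) <= j" for c
      using bl(1)[OF that(1)] that(2) j(2) R by simp
    \<comment> \<open>The displacement h is paired with itself: along the path the inner product
      with the fixed h is a scalar function whose derivative is at most \<open>K * N\<close> times
      the speed, and its total change is the square of N.\<close>
    have seg: "ennreal (?nm (\<lambda>x. b T x - b s x)) <= ennreal K * path_len n a s t b"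
      if p: "piecewise_C1_path n s t b" and T: "s <= T" "T <= t" and in_ball: "\<And>r. r \<in> {s<..<T} ==> ?nm (\<lambda>x. b r x - c0 x) <= R" for b s t T
    proof -
      note im = immersion_sobolev[OF piecewise_path_immersion[OF p]]
      have sT: "s \<in> {s..t}" "T \<in> {s..t}" using T p by (auto simp: piecewise_C1_path_def)
      define h where "h = (\<lambda>x. b T x - b s x)"
      have h: "Hk ?w n h" unfolding h_def by (intro Hk_diff H im sT)
      define N where "N = ?nm h"
      show ?thesis
      proof (cases "N = 0")
        case False
        have N: "N > 0" using False En_nonneg[OF w, of n h] by (simp add: N_def less_le)
        have "ennreal \<bar>ip ?w n (b T) h - ip ?w n (b s) h\<bar> <= ennreal (K * N) * path_len n a s t b"
        proof (rule path_functional_le[OF p T])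
          show "0 < K * N" using K N by simp
          show "continuous_on {s..T} (\<lambda>r. ip ?w n (b r) h)"
            by (rule continuous_on_subset[OF bounded_functional_continuous_path[OF n2 p ip_functional[OF n2 c0(1) h]]]) (use T in auto)
          fix r v assume r: "r \<in> {s<..<T}" and v: "has_path_deriv n b v r {s..t}"
          have rt: "r \<in> {s<..<t}" "r \<in> {s..t}" using r T by auto
          have vs: "v \<in> sobolev n" using v by (simp add: has_path_deriv_def)
          have "\<bar>ip ?w n v h\<bar> <= ?nm v * N" unfolding N_def by (rule ip_abs_le[OF w H[OF vs] h])
          also have "... <= (K * sqrt (G (b r) v)) * N"
            using bl(2)[OF im[OF rt(2)] in_ball[OF r] vs] N by (intro mult_right_mono) auto
          finally show "\<exists>D. ((\<lambda>r. ip ?w n (b r) h) has_real_derivative D) (at r) \<and> \<bar>D\<bar> <= K * N * sqrt (G (b r) v)"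
            using path_functional_derivative[OF n2 p ip_functional[OF n2 c0(1) h] rt(1) v]
            by (intro exI[of _ "ip ?w n v h"]) (simp add: mult_ac)
        qed
        also have "ip ?w n (b T) h - ip ?w n (b s) h = En ?w n h"
        proof -
          have "ip ?w n (\<lambda>x. 1 * b T x + (-1) * b s x) h = 1 * ip ?w n (b T) h + (-1) * ip ?w n (b s) h"
            by (intro ip_lin w H im sT h)
          then show ?thesis unfolding En_ip[of ?w n h] by (simp add: h_def)
        qed
        also have "\<bar>En ?w n h\<bar> = N * N" using En_nonneg[OF w, of n h] by (simp add: N_def)
        finally have "ennreal (1 / N) * ennreal (N * N) <= ennreal (1 / N) * (ennreal (K * N) * path_len n a s t b)"
          by (intro mult_left_mono) auto
        then have "ennreal N <= ennreal K * path_len n a s t b"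
          using N K by (simp add: mult.assoc[symmetric] flip: ennreal_mult)
        then show ?thesis by (simp add: N_def h_def)
      qed (simp add: N_def h_def)
    qed
    have short: "ennreal (?nm (\<lambda>x. b t x - b s x)) <= ennreal K * path_len n a s t b"
      if p: "piecewise_C1_path n s t b" and st: "?nm (\<lambda>x. b s x - c0 x) <= j" and len: "path_len n a s t b < ennreal j" for b s t
    proof -
      have lt: "s < t" using p by (simp add: piecewise_C1_path_def)
      note im = immersion_sobolev[OF piecewise_path_immersion[OF p]]
      define P where "P r = ?nm (\<lambda>x. b r x - c0 x)" for r
      have P_diff: "\<bar>P r - P r'\<bar> <= ?nm (\<lambda>x. b r x - b r' x)" if "r \<in> {s..t}" "r' \<in> {s..t}" for r r'
      proof -
        have tri: "P u <= ?nm (\<lambda>x. b u x - b u' x) + P u'" if "u \<in> {s..t}" "u' \<in> {s..t}" for u u'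
        proof -
          have "?nm (\<lambda>x. (b u x - b u' x) + (b u' x - c0 x)) <= ?nm (\<lambda>x. b u x - b u' x) + P u'"
            unfolding P_def using that by (intro En_triangle w Hk_diff H im H0) auto
          then show ?thesis by (simp add: P_def)
        qed
        have "?nm (\<lambda>x. b r' x - b r x) = ?nm (\<lambda>x. b r x - b r' x)"
          using En_cmult[OF w Hk_diff[OF H[OF im[OF that(1)]] H[OF im[OF that(2)]]], of "-1"] by simp
        then show ?thesis using tri[OF that] tri[OF that(2,1)] by linarith
      qed
      obtain Ce where Ce: "Ce > 0" "\<And>h. Hk unit_weight n h ==> En ?w n h <= Ce * En unit_weight n h"
        using immersion_norm_equivalence[OF n2 c0(1)] by metis
      obtain S where S: "\<And>Ph. (\<And>c d r. r \<in> {c..d} ==> {c..d} \<subseteq> {s..t} ==> (\<exists>v. has_path_deriv n b v r {c..d}) ==> continuous (at r within {c..d}) (\<lambda>r. Ph r)) ==>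
        continuous_on {s..t} (Ph :: real => real)" using piecewise_path_pieces[OF p] by metis
      have Pc: "continuous_on {s..t} P"
      proof (rule S)
        fix c d r assume r: "r \<in> {c..d}" "{c..d} \<subseteq> {s..t}" "\<exists>v. has_path_deriv n b v r {c..d}"
        then obtain v where v: "has_path_deriv n b v r {c..d}" by blast
        have nc: "((\<lambda>u. sobolev_norm n (\<lambda>z. b u z - b r z)) \<longlongrightarrow> 0) (at r within {c..d})"
          by (rule path_deriv_norm_continuous[OF v _ r(1)]) (use im r(2) in blast)
        have "((\<lambda>u. P u - P r) \<longlongrightarrow> 0) (at r within {c..d})"
        proof (rule Lim_null_comparison)
          show "((\<lambda>u. sqrt Ce * sobolev_norm n (\<lambda>z. b u z - b r z)) \<longlongrightarrow> 0) (at r within {c..d})"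
            by (rule tendsto_mult_right_zero[OF nc])
          show "\<forall>\<^sub>F u in at r within {c..d}. norm (P u - P r) <= sqrt Ce * sobolev_norm n (\<lambda>z. b u z - b r z)"
            unfolding eventually_at_filter
          proof (rule always_eventually, intro allI impI)
            fix u assume u: "u \<in> {c..d}"
            have ur: "u \<in> {s..t}" "r \<in> {s..t}" using u r by auto
            have hk: "Hk unit_weight n (\<lambda>z. b u z - b r z)" by (intro Hk_diff sobolev_Hk im ur)
            have "norm (P u - P r) <= ?nm (\<lambda>x. b u x - b r x)" using P_diff[OF ur] by simp
            also have "... <= sqrt (Ce * En unit_weight n (\<lambda>x. b u x - b r x))" using Ce(2)[OF hk] by simp
            also have "... = sqrt Ce * sobolev_norm n (\<lambda>z. b u z - b r z)"
              by (simp add: real_sqrt_mult sobolev_norm_eq[OF hk])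
            finally show "norm (P u - P r) <= sqrt Ce * sobolev_norm n (\<lambda>z. b u z - b r z)" .
          qed
        qed
        then show "continuous (at r within {c..d}) P" unfolding continuous_within by (rule LIM_zero_cancel)
      qed
      have "P r < R" if r: "r \<in> {s..t}" for r
      proof (rule ccontr)
        assume "\<not> P r < R"
        \<comment> \<open>First exit time: Z is the compact set of times outside the open ball, and
          \<open>seg\<close> up to its least element gives the contradiction.\<close>
        define Z where "Z = {s..t} \<inter> P -` {R..}"
        have "closed Z" unfolding Z_def by (rule continuous_closed_preimage[OF Pc]) auto
        moreover have "Z \<subseteq> {s..t}" by (auto simp: Z_def)
        ultimately have "compact Z" using compact_Icc bounded_subset[of "{s..t}" Z] compact_eq_bounded_closed by (metis bounded_closed_interval)
        moreover have "r \<in> Z" using r \<open>\<not> P r < R\<close> by (simp add: Z_def)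
        ultimately obtain T where T: "T \<in> Z" "\<And>u. u \<in> Z ==> T <= u"
          using compact_attains_inf[of Z] by blast
        have Tst: "s <= T" "T <= t" "P T >= R" using T(1) by (auto simp: Z_def)
        have "ennreal (?nm (\<lambda>x. b T x - b s x)) <= ennreal K * path_len n a s t b"
        proof (rule seg[OF p Tst(1,2)])
          fix u assume u: "u \<in> {s<..<T}"
          then have "u \<notin> Z" using T(2)[of u] by force
          then show "?nm (\<lambda>x. b u x - c0 x) <= R" using u Tst by (auto simp: Z_def P_def)
        qed
        also have "... < ennreal K * ennreal j"
          using len K by (intro ennreal_mult_strict_left_mono) auto
        also have "... = ennreal (K * j)" using K j by (simp add: ennreal_mult)
        finally have "?nm (\<lambda>x. b T x - b s x) < K * j" using En_nonneg[OF w] by (simp add: ennreal_less_iff)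
        moreover have "P T <= ?nm (\<lambda>x. b T x - b s x) + P s" using P_diff[of T s] Tst lt by auto
        moreover have "P s <= R / 2" using st j(2) by (simp add: P_def)
        ultimately show False using Tst(3) j(3) by linarith
      qed
      then show ?thesis using seg[OF p _ order_refl] lt by (auto simp: P_def less_imp_le)
    qed
    fix c1 c2 assume c12: "c1 \<in> M" "c2 \<in> M" "?nm (\<lambda>x. c1 x - c0 x) <= j" "d c1 c2 < ennreal j"
    define y where "y = ?nm (\<lambda>x. c2 x - c1 x)"
    have "ennreal y <= ennreal K * d c1 c2"
    proof (rule ccontr)
      assume "\<not> ?thesis"
      then have lt: "ennreal K * d c1 c2 < ennreal y" by simp
      obtain f where f: "d c1 c2 = ennreal f" "f >= 0" using c12(4) by (cases "d c1 c2") auto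
      have "K * f < y" using lt f K by (simp add: ennreal_mult[symmetric] ennreal_less_iff)
      then have "f < y / K" using K by (simp add: field_simps)
      then have "d c1 c2 < min (ennreal j) (ennreal (y / K))" using f c12(4) by (simp add: ennreal_less_iff)
      then obtain s t b where g: "piecewise_C1_path n s t b" "b s = c1" "b t = c2" "path_len n a s t b < min (ennreal j) (ennreal (y / K))"
        by (rule dist_less_path)
      have "ennreal y <= ennreal K * path_len n a s t b"
        using short[OF g(1)] g c12(3) by (simp add: y_def)
      also have "... < ennreal K * ennreal (y / K)" using g(4) K by (intro ennreal_mult_strict_left_mono) auto
      also have "... = ennreal y" using K by (simp flip: ennreal_mult')
      finally show False by simp
    qed
    also have "... <= ennreal (K + B) * d c1 c2" using B by (intro mult_right_mono ennreal_leI) auto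
    finally show "ennreal (?nm (\<lambda>x. c2 x - c1 x)) <= ennreal (K + B) * d c1 c2" by (simp add: y_def)
  next
    let ?w = "speed c0"
    let ?nm = "\<lambda>h. sqrt (En ?w n h)"
    have w: "weight ?w" by (rule immersion_weight[OF c0(1)])
    note H = sobolev_Hk_immersion[OF c0(1)]
    note H0 = H[OF immersion_sobolev[OF c0(1)]]
    note bl = ball[OF c0]
    fix c1 c2 assume c12: "c1 \<in> sobolev n" "c2 \<in> sobolev n" "?nm (\<lambda>x. c1 x - c0 x) <= j" "?nm (\<lambda>x. c2 x - c0 x) <= j"
    define q where "q = (\<lambda>x. 1 * c2 x + (-1) * c1 x)"
    have q: "q \<in> sobolev n" unfolding q_def by (rule sobolev_lin(1)[OF n2 c12(2,1)])
    have s1: "(\<lambda>z. c1 z + t * q z) \<in> sobolev n" for t using sobolev_lin(1)[OF n2 c12(1) q, of 1 t] by simp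
    \<comment> \<open>Convexity of the ball: the segment from c1 to c2 stays in it.\<close>
    have s2: "?nm (\<lambda>x. (c1 x + t * q x) - c0 x) <= R" if t: "t \<in> {0..1}" for t
    proof -
      have h: "Hk ?w n (\<lambda>x. c1 x - c0 x)" "Hk ?w n (\<lambda>x. c2 x - c0 x)" by (intro Hk_diff H c12 H0)+
      have "(\<lambda>x. (c1 x + t * q x) - c0 x) = (\<lambda>x. (1 - t) * (c1 x - c0 x) + t * (c2 x - c0 x))"
        by (auto simp: q_def algebra_simps)
      then have "?nm (\<lambda>x. (c1 x + t * q x) - c0 x) <= ?nm (\<lambda>x. (1 - t) * (c1 x - c0 x)) + ?nm (\<lambda>x. t * (c2 x - c0 x))"
        using En_triangle[OF w Hk_cmult[OF h(1)] Hk_cmult[OF h(2)]] by simp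
      also have "... = (1 - t) * ?nm (\<lambda>x. c1 x - c0 x) + t * ?nm (\<lambda>x. c2 x - c0 x)"
        using t by (simp add: En_cmult[OF w h(1)] En_cmult[OF w h(2)] real_sqrt_mult)
      also have "... <= (1 - t) * j + t * j" using t c12 by (intro add_mono mult_left_mono) auto
      also have "... = j" by (simp add: algebra_simps)
      finally show ?thesis using j(2) R by simp
    qed
    have "d (\<lambda>z. c1 z + 0 * q z) (\<lambda>z. c1 z + 1 * q z) <= ennreal (B * ?nm q)"
    proof (rule affine_dist_le[OF _ q, where B = "\<lambda>_. B * ?nm q"])
      show "(\<lambda>z. c1 z + t * q z) \<in> M" if "t \<in> {0..1}" for t by (rule bl(1)[OF s1 s2[OF that]])
      show "sqrt (Gm n a (speed (\<lambda>z. c1 z + t * q z)) q) <= B * ?nm q" if "t \<in> {0<..<1}" for t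
        using bl(3)[OF s1 s2 q, of t] that by simp
      show "((\<lambda>_. B * ?nm q) has_integral B * ?nm q) {0..1::real}"
        using has_integral_const_real[of "B * ?nm q" 0 1] by simp
    qed (use B En_nonneg[OF w] in auto)
    also have "(\<lambda>z. c1 z + 1 * q z) = c2" by (simp add: q_def)
    finally have "d c1 c2 <= ennreal (B * ?nm (\<lambda>x. c2 x - c1 x))" by (simp add: q_def)
    also have "... <= ennreal ((K + B) * ?nm (\<lambda>x. c2 x - c1 x))"
      using K En_nonneg[OF w] by (intro ennreal_leI mult_right_mono) auto
    finally show "d c1 c2 <= ennreal ((K + B) * ?nm (\<lambda>x. c2 x - c1 x))" .
  qed
  show ?thesis
    by (rule exI[of _ j], rule conjI[OF j(1)], rule exI[of _ "K + B"], rule conjI) (use K B main in auto)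
qed

end

section \<open>Diffeomorphisms as normalised immersions\<close>

text \<open>An affine map of the target line, with the translation written through
  \<open>oneJ\<close> so that the result again vanishes outside \<open>J\<close>.\<close>

definition aff :: "real => real => (real => real) => real => real" where
  "aff s b f x = s * f x + b * oneJ x"

lemma aff_sobolev:
  assumes "n >= 2" "f \<in> sobolev n"
  shows "aff s b f \<in> sobolev n" "x \<in> J ==> cderiv (aff s b f) x = s * cderiv f x"
  using sobolev_lin(1)[OF assms oneJ_sobolev, of s b] sobolev_lin(2)[OF assms oneJ_sobolev, of x s b] cderiv_oneJ[of x]
  by (auto simp: aff_def[abs_def])

lemma aff_immersion:
  assumes "n >= 2" "c \<in> immersions n" "s > 0"
  shows "aff s b c \<in> immersions n" "x \<in> J ==> speed (aff s b c) x = s * speed c x"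
    "clen (aff s b c) = s * clen c" "orient (aff s b c) = orient c"
proof -
  note S = aff_sobolev[OF assms(1) immersion_sobolev[OF assms(2)], where s = s and b = b]
  show i: "aff s b c \<in> immersions n"
    using assms by (intro immersionI S(1)) (auto simp: S(2) immersions_def)
  show "x \<in> J ==> speed (aff s b c) x = s * speed c x" using S(2) assms(3) by (simp add: speed_def abs_mult)
  have e: "aff s b c (2*pi) - aff s b c 0 = s * (c (2*pi) - c 0)" by (simp add: aff_def oneJ_def algebra_simps)
  show "orient (aff s b c) = orient c" using assms(3) unfolding orient_def e by (simp add: sgn_mult)
  show "clen (aff s b c) = s * clen c"
    using assms(3) unfolding clen_eq[OF i] clen_eq[OF assms(2)] e by (simp add: abs_mult)
qed

lemma aff_aff: "aff s b (aff s' b' f) = aff (s * s') (s * b' + b) f"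
  by (auto simp: aff_def fun_eq_iff algebra_simps)

text \<open>The end point of \<open>J\<close> at which an immersion of this orientation takes its
  least value.\<close>

definition basept :: "(real => real) => real" where "basept c = (if orient c = 1 then 0 else 2*pi)"

lemma basept_J: "basept c \<in> J"
  by (simp add: basept_def)

lemma immersion_increment_pos:
  assumes c: "c \<in> immersions n" and "0 <= x" "x < y" "y <= 2*pi"
  shows "0 < orient c * (c y - c x)"
proof -
  note w = immersion_weight[OF c]
  obtain m where m: "0 < m" "\<And>x. x \<in> J ==> m <= speed c x" using weight_bounds[OF w] by metis
  have o: "orient c * orient c = 1" using immersion_orient(1)[OF c] by auto
  have "orient c * (c y - c x) = orient c * integral {x..y} (cderiv c)"
    using ac_increment[OF sobolev_ac[OF immersion_sobolev[OF c]], of x y] assms by simp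
  also have "... = integral {x..y} (\<lambda>t. orient c * cderiv c t)" by simp
  also have "... = integral {x..y} (speed c)"
    using assms immersion_orient(2)[OF c] o
    by (intro Henstock_Kurzweil_Integration.integral_cong) (auto simp: mult.assoc[symmetric])
  finally have e: "orient c * (c y - c x) = integral {x..y} (speed c)" .
  have "0 < integral {x..y} (\<lambda>_. m)" using m assms by simp
  also have "... <= integral {x..y} (speed c)"
    using m assms L2_integrable_on[OF weight_L2[OF w], of x y] by (intro integral_le) auto
  finally show ?thesis using e by simp
qed

lemma immersion_base_range:
  assumes c: "c \<in> immersions n" and x: "x \<in> J"
  shows "0 <= c x - c (basept c)" "c x - c (basept c) <= clen c"
proof -
  have m: "0 <= orient c * (c v - c u)" if "0 <= u" "u <= v" "v <= 2*pi" for u v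
    using immersion_increment_pos[OF c that(1) _ that(3)] that by (cases "u = v") (auto simp: less_imp_le)
  have e: "c (2*pi) - c 0 = orient c * clen c" by (rule immersion_orient(3)[OF c])
  show "0 <= c x - c (basept c)" "c x - c (basept c) <= clen c"
    using immersion_orient(1)[OF c] m[of 0 x] m[of x "2*pi"] e x by (auto simp: basept_def)
qed

text \<open>Replaces bijectivity by two scalar equations that can be carried to H^n limits.
  Monotonicity gives injectivity, and the intermediate value theorem together with the end point
  values gives surjectivity.\<close>

lemma Diff_iff:
  "f \<in> Diff n \<longleftrightarrow> f \<in> immersions n \<and> clen f = 2*pi \<and> f (basept f) = 0"
proof
  assume D: "f \<in> Diff n"
  then have im: "f \<in> immersions n" by (auto simp: Diff_def immersions_def)
  have b: "f ` J = J" using D by (simp add: Diff_def bij_betw_def)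
  have r: "f x \<in> J" if "x \<in> J" for x using b that by blast
  obtain y where y: "y \<in> J" "f y = 0" using b by (metis atLeastAtMost_iff image_iff order_refl pi_ge_zero zero_le_mult_iff zero_le_numeral)
  obtain z where z: "z \<in> J" "f z = 2*pi" using b by (metis atLeastAtMost_iff image_iff order_refl pi_ge_zero zero_le_mult_iff zero_le_numeral)
  have 0: "f (basept f) = 0"
    using immersion_base_range(1)[OF im y(1)] r[OF basept_J[of f]] y(2) by simp
  have "2*pi <= clen f" using immersion_base_range(2)[OF im z(1)] z(2) 0 by simp
  moreover have "clen f <= 2*pi"
    using clen_eq[OF im] r[of 0] r[of "2*pi"] by auto
  ultimately show "f \<in> immersions n \<and> clen f = 2*pi \<and> f (basept f) = 0" using im 0 by simp
next
  assume a: "f \<in> immersions n \<and> clen f = 2*pi \<and> f (basept f) = 0"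
  then have im: "f \<in> immersions n" by simp
  have c: "continuous_on J f" by (rule ac_continuous[OF sobolev_ac[OF immersion_sobolev[OF im]]])
  have inj: "inj_on f J"
  proof (rule linorder_inj_onI')
    fix x y assume "x \<in> J" "y \<in> J" "x < y"
    then have "0 < orient f * (f y - f x)" by (intro immersion_increment_pos[OF im]) auto
    then show "f x \<noteq> f y" by auto
  qed
  have sub: "f ` J \<subseteq> J" using immersion_base_range[OF im] a by auto
  have e: "f (2*pi) - f 0 = orient f * (2*pi)" using immersion_orient(3)[OF im] a by simp
  have ends: "(f 0 = 0 \<and> f (2*pi) = 2*pi) \<or> (f 0 = 2*pi \<and> f (2*pi) = 0)"
    using immersion_orient(1)[OF im] a e by (auto simp: basept_def)
  have "J \<subseteq> f ` J"
  proof
    fix y assume y: "y \<in> J"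
    from ends show "y \<in> f ` J"
    proof
      assume "f 0 = 0 \<and> f (2*pi) = 2*pi"
      then show ?thesis using IVT'[of f 0 y "2*pi"] y c by force
    next
      assume "f 0 = 2*pi \<and> f (2*pi) = 0"
      then show ?thesis using IVT2'[of f "2*pi" y 0] y c by force
    qed
  qed
  then have "bij_betw f J J" using inj sub by (auto simp: bij_betw_def)
  then show "f \<in> Diff n" using im by (auto simp: Diff_def immersions_def)
qed

definition nrm :: "(real => real) => real => real" where
  "nrm c = aff (2*pi / clen c) (- (2*pi / clen c) * c (basept c)) c"

lemma nrm_Diff:
  assumes n: "n >= 2" and c: "c \<in> immersions n"
  shows "nrm c \<in> Diff n" "orient (nrm c) = orient c" "aff (clen c / (2*pi)) (c (basept c)) (nrm c) = c"
proof -
  have l: "clen c > 0" by (rule immersion_orient(4)[OF c])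
  then have s: "2*pi / clen c > 0" by simp
  note A = aff_immersion[OF n c s, where b = "- (2*pi / clen c) * c (basept c)", folded nrm_def]
  show o: "orient (nrm c) = orient c" by (rule A(4))
  have "basept (nrm c) = basept c" by (simp add: basept_def o)
  moreover have "nrm c (basept c) = 0" using basept_J[of c] by (simp add: nrm_def aff_def oneJ_def)
  ultimately show "nrm c \<in> Diff n" using A(1,3) l unfolding Diff_iff by simp
  have "aff (clen c / (2*pi)) (c (basept c)) (nrm c) = aff 1 0 c" using l by (simp add: nrm_def aff_aff)
  also have "... = c" by (simp add: aff_def fun_eq_iff)
  finally show "aff (clen c / (2*pi)) (c (basept c)) (nrm c) = c" .
qed

lemma Diff_immersion: "f \<in> Diff n ==> f \<in> immersions n"
  by (simp add: Diff_iff)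

lemma nrm_shrunk:
  assumes n: "n >= 2" and f: "f \<in> Diff n" and s: "s > 0"
  shows "nrm (aff s 0 f) = f"
proof -
  note A = aff_immersion[OF n Diff_immersion[OF f] s, where b = 0]
  have "basept (aff s 0 f) = basept f" by (simp add: basept_def A(4))
  then have "aff s 0 f (basept (aff s 0 f)) = 0" using f by (simp add: Diff_iff aff_def)
  then have "nrm (aff s 0 f) = aff 1 0 f"
    unfolding nrm_def A(3) using f s by (simp add: Diff_iff aff_aff)
  then show ?thesis by (simp add: aff_def fun_eq_iff)
qed

lemma Diff_abs_le: "f \<in> Diff n ==> x \<in> J ==> \<bar>f x\<bar> <= 2*pi"
  using immersion_base_range[of f n x] by (auto simp: Diff_iff)

lemma ad_scaled_weight:
  assumes s: "s > 0" and w: "\<And>x. x \<in> J ==> w' x = s * w x" and f: "Hk w k f"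
  shows "AE x in LI. (ad w' ^^ k) f x = inverse s ^ k * (ad w ^^ k) f x"
  using f
proof (induction k)
  case (Suc k)
  define h where "h = (ad w ^^ k) f"
  have h: "H1 h" using Suc.prems unfolding Hk_iff h_def by simp
  have "AE x in LI. (ad w' ^^ k) f x = inverse s ^ k * h x + 0 * h x"
    using Suc.IH[OF Hk_Suc_imp[OF Suc.prems]] by (simp add: h_def)
  from ad_cong_AE[OF this, of w'] have e: "(ad w' ^^ Suc k) f = ad w' (\<lambda>x. inverse s ^ k * h x + 0 * h x)" by simp
  have e': "(ad w ^^ Suc k) f = ad w h" by (simp add: h_def)
  have "AE x in LI. w' x = s * w x" by (rule AE_LI_I) (rule w)
  with H1_lin(2)[OF h h, of "inverse s ^ k" 0] show ?case unfolding e e'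
    by eventually_elim (simp add: ad_def inverse_eq_divide)
qed simp

lemma X_scaled_weight: "(\<And>x. x \<in> J ==> w' x = s * w x) ==> X w' f = s * X w f"
proof -
  assume a: "\<And>x. x \<in> J ==> w' x = s * w x"
  have "X w' f = (LINT x|LI. s * ((f x)\<^sup>2 * w x))" unfolding X_def
    by (intro Bochner_Integration.integral_cong) (auto simp: a)
  then show ?thesis by (simp add: X_def)
qed

lemma funpow_ad_const:
  assumes "j >= 1" shows "AE x in LI. (ad w ^^ j) (\<lambda>x. k) x = 0"
proof -
  obtain i where j: "j = Suc i" using assms by (cases j) auto
  have z: "AE x in LI. (ad w ^^ i) (\<lambda>x. 0) x = 0"
  proof (induction i)
    case (Suc i)
    have "ad w ((ad w ^^ i) (\<lambda>x. 0)) = ad w (\<lambda>x. 0)" by (rule ad_cong_AE[OF Suc])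
    then show ?case using ad_const[of w 0] by simp
  qed simp
  have "AE x in LI. (ad w ^^ i) (ad w (\<lambda>x. k)) x = (ad w ^^ i) (\<lambda>x. 0) x"
    by (rule funpow_ad_cong_AE[OF ad_const])
  with z show ?thesis unfolding j funpow_Suc_right o_apply by eventually_elim simp
qed

lemma X_zero_AE: "weight w ==> AE x in LI. f x = 0 ==> X w f = 0"
  using X_cong_AE[of w "\<lambda>x. 0" f] AE_eq_sym[of f "\<lambda>x. 0" LI] by (simp add: X_def)

text \<open>A constant first arc length derivative kills all orders from 2 on, so two coefficients
  of the metric remain.\<close>

lemma Gm_const_deriv:
  assumes w: "weight w" and n: "n >= 1" and k: "AE x in LI. ad w h x = b"
  shows "Gm n a w h = a 0 * X w h + a 1 * (b\<^sup>2 * wlen w)"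
proof -
  obtain m where m: "n = Suc m" using n by (cases n) auto
  have t: "X w ((ad w ^^ Suc i) h) = (if i = 0 then b\<^sup>2 * wlen w else 0)" for i
  proof (cases "i = 0")
    case True
    have "X w (ad w h) = X w (\<lambda>x. b)" by (rule X_cong_AE[OF w L2_const AE_eq_sym[OF k], symmetric])
    then show ?thesis using True by (simp add: X_def wlen_def)
  next
    case False
    have "AE x in LI. (ad w ^^ i) (ad w h) x = (ad w ^^ i) (\<lambda>x. b) x" by (rule funpow_ad_cong_AE[OF k])
    with funpow_ad_const[of i w b] False have "AE x in LI. (ad w ^^ i) (ad w h) x = 0" by auto
    from X_zero_AE[OF w this] False show ?thesis unfolding funpow_Suc_right o_apply by simp
  qed
  have "Gm n a w h = a 0 * X w h + (\<Sum>i\<le>m. a (Suc i) * X w ((ad w ^^ Suc i) h))"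
    unfolding Gm_def m by (subst sum.atMost_Suc_shift) simp
  also have "(\<Sum>i\<le>m. a (Suc i) * X w ((ad w ^^ Suc i) h)) = (\<Sum>i\<le>m. if i = 0 then a 1 * (b\<^sup>2 * wlen w) else 0)"
    by (intro sum.cong refl) (simp only: t, simp)
  also have "... = a 1 * (b\<^sup>2 * wlen w)" by simp
  finally show ?thesis .
qed

context immersion_metric
begin

section \<open>The cost of shrinking and translating\<close>

text \<open>Its square bounds r * G along r phi for 0 < r <= 1: the first term comes from |phi| <= 2
  pi on a curve of length 2 pi r, the second from the arc length derivative +-1/r.\<close>

definition shrink_const :: real where "shrink_const = sqrt (a 0 * (2*pi)^3 + a 1 * (2*pi))"

lemma shrink_const_nonneg: "0 <= shrink_const"
  unfolding shrink_const_def using a0 a_nonneg[of 1] n2 by simp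

text \<open>Along r phi the speed is at most \<open>shrink_const / sqrt r\<close>; its integral
  stays bounded when the lower limit s tends to 0.\<close>

lemma dist_scale_le:
  assumes f: "f \<in> Diff n" and s: "0 < s" "s < t" "t <= 1"
  shows "d (aff s b f) (aff t b f) <= ennreal (2 * shrink_const * sqrt t)"
proof -
  note im = Diff_immersion[OF f]
  have pq: "(\<lambda>y. b * oneJ y + r * f y) = aff r b f" for r by (auto simp: aff_def)
  have "d (\<lambda>y. b * oneJ y + s * f y) (\<lambda>y. b * oneJ y + t * f y) <= ennreal (2 * shrink_const * sqrt t - 2 * shrink_const * sqrt s)"
  proof (rule affine_dist_le[OF s(2) immersion_sobolev[OF im], where B = "\<lambda>r. shrink_const / sqrt r"])
    show "(\<lambda>y. b * oneJ y + r * f y) \<in> M" if "r \<in> {s..t}" for r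
      unfolding pq by (rule aff_immersion(1)[OF n2 im]) (use that s in auto)
    show "0 <= shrink_const / sqrt r" if "r \<in> {s..t}" for r using shrink_const_nonneg that s by simp
    show "((\<lambda>r. shrink_const / sqrt r) has_integral 2 * shrink_const * sqrt t - 2 * shrink_const * sqrt s) {s..t}"
    proof (rule fundamental_theorem_of_calculus)
      show "s <= t" using s by simp
      fix r assume "r \<in> {s..t}"
      then have "r > 0" using s by simp
      then have "((\<lambda>r. 2 * shrink_const * sqrt r) has_real_derivative shrink_const / sqrt r) (at r)"
        by (auto intro!: derivative_eq_intros simp: field_simps)
      then show "((\<lambda>r. 2 * shrink_const * sqrt r) has_vector_derivative shrink_const / sqrt r) (at r within {s..t})"
        by (simp add: has_real_derivative_iff_has_vector_derivative[symmetric] has_field_derivative_at_within)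
    qed
    fix r assume r: "r \<in> {s<..<t}"
    have r0: "0 < r" "r <= 1" using r s by auto
    note A = aff_immersion[OF n2 im r0(1), where b = b]
    define w where "w = speed (aff r b f)"
    have w: "weight w" unfolding w_def by (rule immersion_weight[OF A(1)])
    have wl: "wlen w = r * (2*pi)" using A(3) f by (simp add: w_def clen_def[symmetric] Diff_iff)
    have "AE x in LI. ad w f x = orient f / r"
    proof -
      have "AE x in LI. w x = r * speed f x" by (rule AE_LI_I) (use A(2) in \<open>simp add: w_def\<close>)
      with immersion_ad_self[OF im] show ?thesis
      proof eventually_elim
        case (elim x)
        have "ad w f x = ad (speed f) f x / r" using elim(2) by (simp add: ad_def)
        then show ?case using elim(1) by simp
      qed
    qed
    then have "Gm n a w f = a 0 * X w f + a 1 * ((orient f / r)\<^sup>2 * wlen w)"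
      using n2 by (intro Gm_const_deriv[OF w]) auto
    also have "(orient f / r)\<^sup>2 * wlen w = 2*pi / r"
      using immersion_orient(1)[OF im] r0 wl by (auto simp: power2_eq_square field_simps)
    also have "X w f <= (2*pi)\<^sup>2 * wlen w"
    proof (rule X_one_le[OF w ac_self_L2[OF sobolev_ac[OF immersion_sobolev[OF im]]]])
      show "AE x in LI. (f x)\<^sup>2 <= (2*pi)\<^sup>2"
      proof (rule AE_LI_I)
        fix x assume "x \<in> J"
        from power_mono[OF Diff_abs_le[OF f this], of 2] show "(f x)\<^sup>2 <= (2*pi)\<^sup>2" by simp
      qed
    qed simp
    also have "(2*pi)\<^sup>2 * wlen w = (2*pi)^3 * r" using wl by (simp add: power2_eq_square power3_eq_cube)
    also have "(2*pi)^3 * r <= (2*pi)^3 / r"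
    proof -
      have "r * r <= 1" using r0 by (simp add: mult_le_one)
      then have "r <= 1 / r" using r0 by (simp add: field_simps)
      then have "(2*pi)^3 * r <= (2*pi)^3 * (1 / r)" by (intro mult_left_mono) auto
      then show ?thesis by simp
    qed
    finally have "Gm n a w f <= a 0 * ((2*pi)^3 / r) + a 1 * (2*pi / r)" using a0 by simp
    also have "... = (a 0 * (2*pi)^3 + a 1 * (2*pi)) / r" by (simp add: add_divide_distrib)
    finally have "sqrt (Gm n a w f) <= sqrt ((a 0 * (2*pi)^3 + a 1 * (2*pi)) / r)" by simp
    also have "... = shrink_const / sqrt r" by (simp add: shrink_const_def real_sqrt_divide)
    finally show "sqrt (Gm n a (speed (\<lambda>y. b * oneJ y + r * f y)) f) <= shrink_const / sqrt r"
      unfolding pq w_def .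
  qed
  also have "... <= ennreal (2 * shrink_const * sqrt t)" using shrink_const_nonneg s by (intro ennreal_leI) simp
  finally show ?thesis unfolding pq .
qed

text \<open>A translation has vanishing arc length derivatives, so the term of order 0 alone counts.
  It is proportional to the length of the curve, and the cost tends to 0 with s.\<close>

lemma dist_translate_le:
  assumes f: "f \<in> Diff n" and s: "0 < s"
  shows "d (aff s b f) (aff s b' f) <= ennreal (\<bar>b' - b\<bar> * sqrt (a 0 * (2*pi) * s))"
proof -
  note im = Diff_immersion[OF f]
  define q where "q = aff 0 (b' - b) f"
  have q: "q \<in> sobolev n" unfolding q_def by (rule aff_sobolev(1)[OF n2 immersion_sobolev[OF im]])
  have pq: "(\<lambda>y. aff s b f y + r * q y) = aff s (b + r * (b' - b)) f" for r
    by (auto simp: aff_def q_def algebra_simps)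
  have "d (\<lambda>y. aff s b f y + 0 * q y) (\<lambda>y. aff s b f y + 1 * q y) <= ennreal (\<bar>b' - b\<bar> * sqrt (a 0 * (2*pi) * s))"
  proof (rule affine_dist_le[OF _ q, where B = "\<lambda>_. \<bar>b' - b\<bar> * sqrt (a 0 * (2*pi) * s)"])
    show "(\<lambda>y. aff s b f y + r * q y) \<in> M" for r unfolding pq by (rule aff_immersion(1)[OF n2 im s])
    show "((\<lambda>_. \<bar>b' - b\<bar> * sqrt (a 0 * (2*pi) * s)) has_integral \<bar>b' - b\<bar> * sqrt (a 0 * (2*pi) * s)) {0..1::real}"
      using has_integral_const_real[of "\<bar>b' - b\<bar> * sqrt (a 0 * (2*pi) * s)" 0 1] by simp
    fix r :: real
    define w where "w = speed (aff s (b + r * (b' - b)) f)"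
    note A = aff_immersion[OF n2 im s, where b = "b + r * (b' - b)"]
    have w: "weight w" unfolding w_def by (rule immersion_weight[OF A(1)])
    have wl: "wlen w = s * (2*pi)" using A(3) f by (simp add: w_def clen_def[symmetric] Diff_iff)
    have qe: "AE x in LI. q x = b' - b" by (rule AE_LI_I) (simp add: q_def aff_def oneJ_def)
    have "AE x in LI. ad w q x = 0" unfolding ad_cong_AE[OF qe] by (rule ad_const)
    then have "Gm n a w q = a 0 * X w q + a 1 * (0\<^sup>2 * wlen w)"
      using n2 by (intro Gm_const_deriv[OF w]) auto
    also have "X w q = X w (\<lambda>x. b' - b)" by (rule X_cong_AE[OF w L2_const AE_eq_sym[OF qe], symmetric])
    also have "... = (b' - b)\<^sup>2 * wlen w" by (simp add: X_def wlen_def)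
    finally have "Gm n a w q = (b' - b)\<^sup>2 * (a 0 * (2*pi) * s)" using wl by (simp add: mult_ac)
    then have "sqrt (Gm n a w q) = \<bar>b' - b\<bar> * sqrt (a 0 * (2*pi) * s)" by (simp only: real_sqrt_mult real_sqrt_abs)
    then show "sqrt (Gm n a (speed (\<lambda>y. aff s b f y + r * q y)) q) <= \<bar>b' - b\<bar> * sqrt (a 0 * (2*pi) * s)"
      unfolding pq w_def by simp
  qed (use a0 s in auto)
  then show ?thesis unfolding pq by simp
qed

text \<open>Translations are almost free for short curves: shrink, translate, and expand again.\<close>

lemma dist_aff_le:
  assumes f: "f \<in> Diff n" and s: "0 < s" "s <= 1" "0 < t" "t <= 1"
  shows "d (aff s b f) (aff t b' f) <= ennreal (2 * shrink_const * (sqrt s + sqrt t))"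
proof (rule ennreal_le_epsilon)
  fix e :: real assume e: "e > 0"
  define K where "K = \<bar>b' - b\<bar> * sqrt (a 0 * (2*pi)) + 1"
  have K: "K > 0" using a0 by (simp add: K_def add_nonneg_pos)
  \<comment> \<open>A scale below s and t at which translating from b to b' costs at most e.\<close>
  define r where "r = min (min (s / 2) (t / 2)) ((e / K)\<^sup>2)"
  have r: "0 < r" "r < s" "r < t" "r <= (e / K)\<^sup>2" using s e K by (auto simp: r_def)
  have "sqrt r <= e / K" using r(4) e K by (intro real_le_lsqrt) (auto simp: r(1) less_imp_le)
  have k: "\<bar>b' - b\<bar> * sqrt (a 0 * (2*pi) * r) <= e"
  proof -
    have "\<bar>b' - b\<bar> * sqrt (a 0 * (2*pi) * r) = (K - 1) * sqrt r" by (simp add: K_def real_sqrt_mult)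
    also have "... <= K * sqrt r" using r by (intro mult_right_mono) auto
    also have "... <= K * (e / K)" using \<open>sqrt r <= e / K\<close> K by (intro mult_left_mono) auto
    also have "... = e" using K by simp
    finally show ?thesis .
  qed
  have "d (aff s b f) (aff t b' f) <= d (aff s b f) (aff r b f) + d (aff r b f) (aff t b' f)"
    by (rule dist_triangle_geodesic[OF n2])
  also have "... <= d (aff s b f) (aff r b f) + (d (aff r b f) (aff r b' f) + d (aff r b' f) (aff t b' f))"
    by (intro add_left_mono dist_triangle_geodesic[OF n2])
  also have "... <= ennreal (2 * shrink_const * sqrt s) + (ennreal e + ennreal (2 * shrink_const * sqrt t))"
  proof (intro add_mono)
    show "d (aff s b f) (aff r b f) <= ennreal (2 * shrink_const * sqrt s)"
      unfolding dist_commute[OF n2, of a "aff s b f"] by (rule dist_scale_le[OF f r(1,2) s(2)])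
    show "d (aff r b f) (aff r b' f) <= ennreal e"
      by (rule order_trans[OF dist_translate_le[OF f r(1)]]) (rule ennreal_leI[OF k])
    show "d (aff r b' f) (aff t b' f) <= ennreal (2 * shrink_const * sqrt t)"
      by (rule dist_scale_le[OF f r(1,3) s(4)])
  qed
  also have "... = ennreal (2 * shrink_const * (sqrt s + sqrt t)) + ennreal e"
    using shrink_const_nonneg s e by (simp add: distrib_left add_ac flip: ennreal_plus)
  finally show "d (aff s b f) (aff t b' f) <= ennreal (2 * shrink_const * (sqrt s + sqrt t)) + ennreal e" .
qed

section \<open>The effect of normalisation on velocities and paths\<close>

text \<open>The powers of 2 pi bound orders 0 and 1 of a normalised velocity by its order 2, whence
  the division by \<open>a 2\<close>; the summand 1 accounts for the orders from 2 on.\<close>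

definition proj_const :: real where
  "proj_const = sqrt ((a 0 * (2*pi)^4 + a 1 * (2*pi)\<^sup>2) / a 2 + 1)"

lemma proj_const_pos: "proj_const > 0"
  unfolding proj_const_def using a0 a2 a_nonneg[of 1] n2 by (simp add: add_nonneg_pos)

text \<open>\<open>u\<close> is the normalised velocity, and \<open>m\<close> is the correction of
  its first arc length derivative that keeps the length equal to 2 pi. Orders 0 and 1 are estimated
  by order 2 on the normalised curve; order 2 and the higher ones are compared directly with those
  of \<open>v\<close>.\<close>

lemma normalised_G_le:
  assumes w: "weight w" and w': "weight w'" and s: "s >= 1" "\<And>x. x \<in> J ==> w' x = s * w x" "wlen w' = 2*pi"
    and u: "u \<in> sobolev n" "Hk w' n u" "u 0 = 0" "u (2*pi) = 0" and v: "Hk w n v"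
    and uv: "AE x in LI. ad w' u x = ad w v x - m"
  shows "Gm n a w' u <= proj_const\<^sup>2 * Gm n a w v"
proof -
  obtain k where k: "n = Suc (Suc k)" using n2 by (metis add_2_eq_Suc le_Suc_ex)
  have hu: "H1 u" "H1 (ad w' u)" "ad w' (ad w' u) \<in> L2" using u(2) unfolding k by (auto dest: Hk_L2)
  define Y where "Y i = X w' ((ad w' ^^ i) u)" for i
  have Yn: "0 <= Y i" for i unfolding Y_def by (rule X_nonneg[OF w'])
  have Y2: "Y 2 = X w' (ad w' (ad w' u))" by (simp add: Y_def eval_nat_numeral)
  obtain g where g: "ac g (wd (ad w' u))" "AE x in LI. ad w' u x = g x" using H1_ac[OF hu(2)] .
  have acu: "ac u (wd u)" by (rule H1_continuous_ac[OF hu(1) ac_continuous[OF sobolev_ac[OF u(1)]]])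
  have gw: "AE x in LI. wd u x = g x * w' x"
  proof -
    have "AE x in LI. ad w' u x * w' x = wd u x" by (rule AE_LI_I) (rule ad_times_weight[OF w'])
    with g(2) show ?thesis by eventually_elim simp
  qed
  have wc: "continuous_on J w'" using w' by (simp add: weight_def)
  \<comment> \<open>The arc length derivative of u has mean 0, so its values are bounded by its
    oscillation.\<close>
  have gi: "integral J (\<lambda>x. g x * w' x) = 0"
  proof -
    have "ac u (\<lambda>x. g x * w' x)" by (rule ac_cong_AE[OF acu gw]) simp
    from ac_increment[OF this, of 0 "2*pi"] show ?thesis using u(3,4) by simp
  qed
  have gb: "(g x)\<^sup>2 <= 2*pi * Y 2" if x: "x \<in> J" for x
  proof -
    have osc: "\<bar>g x - g y\<bar> <= sqrt (2*pi * Y 2)" if y: "y \<in> J" for y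
    proof -
      have "(g x - g y)\<^sup>2 <= 2*pi * Y 2"
        using osc_le[OF w' hu(2) g(1) x y] s(3) by (simp add: Y2)
      then show ?thesis using real_sqrt_le_mono by fastforce
    qed
    have "g x * (2*pi) = integral J (\<lambda>y. g x * w' y) - integral J (\<lambda>y. g y * w' y)"
      using gi wlen_eq[OF w'] s(3) by simp
    also have "... = integral J (\<lambda>y. (g x - g y) * w' y)"
      using wc ac_continuous[OF g(1)]
      by (subst Henstock_Kurzweil_Integration.integral_diff[symmetric])
        (auto intro!: integrable_continuous_real continuous_intros simp: left_diff_distrib)
    also have "\<bar>...\<bar> <= integral J (\<lambda>y. sqrt (2*pi * Y 2) * w' y)"
    proof -
      have "norm (integral J (\<lambda>y. (g x - g y) * w' y)) <= integral J (\<lambda>y. sqrt (2*pi * Y 2) * w' y)"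
      proof (rule integral_norm_bound_integral)
        show "(\<lambda>y. (g x - g y) * w' y) integrable_on J" "(\<lambda>y. sqrt (2*pi * Y 2) * w' y) integrable_on J"
          using wc ac_continuous[OF g(1)] by (auto intro!: integrable_continuous_real continuous_intros)
        show "norm ((g x - g y) * w' y) <= sqrt (2*pi * Y 2) * w' y" if "y \<in> J" for y
          using osc[OF that] weight_nonneg[OF w' that] by (simp add: abs_mult mult_right_mono)
      qed
      then show ?thesis by simp
    qed
    also have "... = sqrt (2*pi * Y 2) * (2*pi)" using wlen_eq[OF w'] s(3) by simp
    finally have "\<bar>g x\<bar> <= sqrt (2*pi * Y 2)" by (simp add: abs_mult)
    then have "\<bar>g x\<bar>\<^sup>2 <= (sqrt (2*pi * Y 2))\<^sup>2" by (intro power_mono) auto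
    then show ?thesis using Yn[of 2] by simp
  qed
  have Y1: "Y 1 <= (2*pi)\<^sup>2 * Y 2"
  proof -
    have "AE x in LI. (g x)\<^sup>2 <= 2*pi * Y 2" by (rule AE_LI_I) (rule gb)
    with g(2) have "AE x in LI. (ad w' u x)\<^sup>2 <= 2*pi * Y 2" by eventually_elim simp
    from X_one_le[OF w' H1_L2[OF hu(2)] this] Yn[of 2] s(3) show ?thesis
      by (simp add: Y_def power2_eq_square mult_ac)
  qed
  have Y0: "Y 0 <= (2*pi)^4 * Y 2"
  proof -
    have "AE x in LI. (u x)\<^sup>2 <= 2*pi * Y 1"
    proof (rule AE_LI_I)
      fix x assume x: "x \<in> J"
      show "(u x)\<^sup>2 <= 2*pi * Y 1"
        using osc_le[OF w' hu(1) acu x, where y = 0] s(3) u(3) by (simp add: Y_def)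
    qed
    from X_one_le[OF w' H1_L2[OF hu(1)] this] Yn[of 1] s(3) have "Y 0 <= (2*pi)\<^sup>2 * Y 1"
      by (simp add: Y_def power2_eq_square mult_ac)
    also have "... <= (2*pi)\<^sup>2 * ((2*pi)\<^sup>2 * Y 2)" using Y1 by (intro mult_left_mono) auto
    finally show ?thesis by (simp add: power2_eq_square power4_eq_xxxx mult.assoc)
  qed
  \<comment> \<open>The constant m disappears after one more derivative. The remaining j = i + 1
    derivatives contribute s^(-2 j) and the arc length contributes s, together at most 1.\<close>
  have high: "Y (Suc (Suc i)) <= X w ((ad w ^^ Suc (Suc i)) v)" if i: "i <= k" for i
  proof -
    let ?j = "Suc i"
    have Hv: "Hk w (Suc k) (ad w v)" using v unfolding k by simp
    have Hj: "Hk w ?j (ad w v)" using Hk_mono[OF Hv, of ?j] i by simp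
    have Hd: "Hk w ?j (\<lambda>x. ad w v x - m)" by (rule Hk_diff[OF Hj Hk_const])
    have s0: "s > 0" using s(1) by simp
    have 1: "AE x in LI. (ad w' ^^ ?j) (ad w' u) x = (ad w' ^^ ?j) (\<lambda>x. ad w v x - m) x"
      by (rule funpow_ad_cong_AE[OF uv])
    have 2: "AE x in LI. (ad w' ^^ ?j) (\<lambda>x. ad w v x - m) x = inverse s ^ ?j * (ad w ^^ ?j) (\<lambda>x. ad w v x - m) x"
      by (rule ad_scaled_weight[OF s0 s(2) Hd])
    have 3: "AE x in LI. (ad w ^^ ?j) (\<lambda>x. ad w v x - m) x = (ad w ^^ ?j) (ad w v) x - (ad w ^^ ?j) (\<lambda>x. m) x"
      by (rule funpow_ad_diff[OF Hj Hk_const order_refl])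
    have 4: "AE x in LI. (ad w ^^ ?j) (\<lambda>x. m) x = 0" by (rule funpow_ad_const) simp
    have e: "AE x in LI. (ad w' ^^ Suc ?j) u x = inverse s ^ ?j * (ad w ^^ Suc ?j) v x"
      unfolding funpow_Suc_right[of ?j] o_apply using 1 2 3 4 by eventually_elim simp
    have "Suc ?j <= n" using i k by simp
    then have L: "(ad w' ^^ Suc ?j) u \<in> L2" using u(2) unfolding Hk_iff by blast
    have "Y (Suc ?j) = X w' (\<lambda>x. inverse s ^ ?j * (ad w ^^ Suc ?j) v x)"
      unfolding Y_def by (rule X_cong_AE[OF w' L e])
    also have "... = (inverse s ^ ?j)\<^sup>2 * (s * X w ((ad w ^^ Suc ?j) v))"
      by (simp only: X_cmult X_scaled_weight[OF s(2)])
    also have "... = ((inverse s ^ ?j)\<^sup>2 * s) * X w ((ad w ^^ Suc ?j) v)" by simp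
    also have "... <= 1 * X w ((ad w ^^ Suc ?j) v)"
    proof (rule mult_right_mono[OF _ X_nonneg[OF w]])
      have "inverse s ^ ?j <= inverse s"
        using s(1) power_le_one[of "inverse s" i] by (simp add: inverse_le_1_iff mult_left_le)
      then have "(inverse s ^ ?j)\<^sup>2 <= (inverse s)\<^sup>2" using s(1) by (intro power_mono) auto
      then have "(inverse s ^ ?j)\<^sup>2 * s <= (inverse s)\<^sup>2 * s" using s(1) by (intro mult_right_mono) auto
      also have "... = inverse s" using s0 by (simp add: power2_eq_square)
      also have "... <= 1" using s(1) by (simp add: inverse_le_1_iff)
      finally show "(inverse s ^ ?j)\<^sup>2 * s <= 1" .
    qed
    finally show ?thesis by simp
  qed
  define T where "T = (\<Sum>i\<le>k. a (Suc (Suc i)) * X w ((ad w ^^ Suc (Suc i)) v))"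
  have split: "(\<Sum>i\<le>n. f i) = f 0 + f 1 + (\<Sum>i\<le>k. f (Suc (Suc i)))" for f :: "nat => real"
    unfolding k sum.atMost_Suc_shift[of f "Suc k"] sum.atMost_Suc_shift[of "\<lambda>i. f (Suc i)" k] by simp
  have hiT: "(\<Sum>i\<le>k. a (Suc (Suc i)) * Y (Suc (Suc i))) <= T"
    unfolding T_def using high a_nonneg k by (intro sum_mono mult_left_mono) auto
  have TG: "T <= Gm n a w v"
    unfolding Gm_def split T_def using a_nonneg[of 0] a_nonneg[of 1] n2 X_nonneg[OF w]
    by (simp add: add_nonneg_nonneg mult_nonneg_nonneg)
  have Y2T: "a 2 * Y 2 <= T"
  proof -
    have "a 2 * Y 2 <= a (Suc (Suc 0)) * X w ((ad w ^^ Suc (Suc 0)) v)"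
      using high[of 0] a2 by (simp add: eval_nat_numeral)
    also have "... <= T" unfolding T_def using a_nonneg k X_nonneg[OF w]
      by (intro member_le_sum[where f = "\<lambda>i. a (Suc (Suc i)) * X w ((ad w ^^ Suc (Suc i)) v)"]) (auto intro!: mult_nonneg_nonneg)
    finally show ?thesis .
  qed
  define P where "P = a 0 * (2*pi)^4 + a 1 * (2*pi)\<^sup>2"
  have P0: "0 <= P" unfolding P_def using a_nonneg[of 0] a_nonneg[of 1] n2 by simp
  have "Gm n a w' u = a 0 * Y 0 + a 1 * Y 1 + (\<Sum>i\<le>k. a (Suc (Suc i)) * Y (Suc (Suc i)))"
    unfolding Gm_def split Y_def by simp
  also have "... <= a 0 * ((2*pi)^4 * Y 2) + a 1 * ((2*pi)\<^sup>2 * Y 2) + T"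
    using Y0 Y1 hiT a_nonneg[of 0] a_nonneg[of 1] n2 by (intro add_mono mult_left_mono) auto
  also have "... = P / a 2 * (a 2 * Y 2) + T"
  proof -
    have "P / a 2 * (a 2 * Y 2) = P * Y 2" using a2 by simp
    then show ?thesis by (simp add: P_def distrib_right mult.assoc)
  qed
  also have "... <= P / a 2 * T + T" using Y2T P0 a2 by (intro add_mono mult_left_mono) auto
  also have "... = (P / a 2 + 1) * T" by (simp add: distrib_right)
  also have "... <= (P / a 2 + 1) * Gm n a w v" using TG P0 a2 by (intro mult_left_mono) auto
  also have "P / a 2 + 1 = proj_const\<^sup>2" using P0 a2 by (simp add: proj_const_def P_def)
  finally show ?thesis .
qed

end

text \<open>Shaped for the difference quotient of an affine image of a path, which has four terms:
  the error of the quotient of the path, the increment of the scale, and the errors of the quotients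
  of the scale and of the translation.\<close>

lemma sobolev_norm_lin4:
  assumes f: "Hk unit_weight n f" and g: "Hk unit_weight n g" and h: "Hk unit_weight n h" and k: "Hk unit_weight n k"
  shows "sobolev_norm n (\<lambda>x. A * f x + B * g x + C * h x + D * k x)
    <= \<bar>A\<bar> * sobolev_norm n f + \<bar>B\<bar> * sobolev_norm n g + \<bar>C\<bar> * sobolev_norm n h + \<bar>D\<bar> * sobolev_norm n k"
proof -
  have 1: "Hk unit_weight n (\<lambda>x. A * f x + B * g x)" by (rule Hk_lin[OF f g])
  have 2: "Hk unit_weight n (\<lambda>x. A * f x + B * g x + C * h x)" using Hk_lin[OF 1 h, of 1 C] by simp
  have "sobolev_norm n (\<lambda>x. (A * f x + B * g x + C * h x) + D * k x)
      <= sobolev_norm n (\<lambda>x. A * f x + B * g x + C * h x) + sobolev_norm n (\<lambda>x. D * k x)"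
    by (rule sobolev_norm_triangle[OF 2 Hk_cmult[OF k]])
  also have "sobolev_norm n (\<lambda>x. (A * f x + B * g x) + C * h x) <= sobolev_norm n (\<lambda>x. A * f x + B * g x) + sobolev_norm n (\<lambda>x. C * h x)"
    by (rule sobolev_norm_triangle[OF 1 Hk_cmult[OF h]])
  also have "sobolev_norm n (\<lambda>x. A * f x + B * g x) <= sobolev_norm n (\<lambda>x. A * f x) + sobolev_norm n (\<lambda>x. B * g x)"
    by (rule sobolev_norm_triangle[OF Hk_cmult[OF f] Hk_cmult[OF g]])
  finally show ?thesis by (simp add: sobolev_norm_cmult f g h k)
qed

lemma aff_path_deriv:
  assumes n: "n >= 2" and v: "has_path_deriv n b v t S"
    and g: "\<And>r. r \<in> S ==> b r \<in> sobolev n" and t: "t \<in> S"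
    and p: "(p has_real_derivative p') (at t within S)"
    and c: "(c has_real_derivative c') (at t within S)"
  defines "u \<equiv> \<lambda>x. p t * v x + p' * b t x + c' * oneJ x"
  shows "has_path_deriv n (\<lambda>t. aff (p t) (c t) (b t)) u t S"
proof -
  have vs: "v \<in> sobolev n" using v by (simp add: has_path_deriv_def)
  note H1J = sobolev_Hk[OF oneJ_sobolev]
  have pc: "(p \<longlongrightarrow> p t) (at t within S)"
    using DERIV_continuous[OF p] by (simp add: continuous_within)
  show ?thesis
    unfolding has_path_deriv_def
  proof (intro conjI)
    have "(\<lambda>x. 1 * (p t * v x + p' * b t x) + c' * oneJ x) \<in> sobolev n"
      by (intro sobolev_lin(1)[OF n] vs g t oneJ_sobolev)
    then show "u \<in> sobolev n" by (simp add: u_def)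
    show "((\<lambda>r. sobolev_norm n (\<lambda>y. (aff (p r) (c r) (b r) y - aff (p t) (c t) (b t) y) / (r - t) - u y)) \<longlongrightarrow> 0) (at t within S)"
    proof (rule Lim_null_comparison)
      let ?q = "\<lambda>r y. (b r y - b t y) / (r - t) - v y"
      let ?da = "\<lambda>r. (p r - p t) / (r - t) - p'" and ?db = "\<lambda>r. (c r - c t) / (r - t) - c'"
      let ?bd = "\<lambda>r. \<bar>p r\<bar> * sobolev_norm n (?q r) + \<bar>p r - p t\<bar> * sobolev_norm n (v)
        + \<bar>?da r\<bar> * sobolev_norm n (b t) + \<bar>?db r\<bar> * sobolev_norm n oneJ"
      have "(?bd \<longlongrightarrow> \<bar>p t\<bar> * 0 + \<bar>p t - p t\<bar> * sobolev_norm n (v) + \<bar>0\<bar> * sobolev_norm n (b t) + \<bar>0\<bar> * sobolev_norm n oneJ) (at t within S)"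
      proof (intro tendsto_intros pc)
        show "((\<lambda>r. sobolev_norm n (?q r)) \<longlongrightarrow> 0) (at t within S)" using v by (simp add: has_path_deriv_def)
        show "(?da \<longlongrightarrow> 0) (at t within S)" "(?db \<longlongrightarrow> 0) (at t within S)"
          using p c unfolding has_field_derivative_iff by (auto simp: LIM_zero)
      qed
      then show "(?bd \<longlongrightarrow> 0) (at t within S)" by simp
      show "\<forall>\<^sub>F r in at t within S. norm (sobolev_norm n (\<lambda>y. (aff (p r) (c r) (b r) y - aff (p t) (c t) (b t) y) / (r - t) - u y)) <= ?bd r"
        unfolding eventually_at_filter
      proof (rule always_eventually, intro allI impI)
        fix r assume r: "r \<noteq> t" "r \<in> S"
        have "(\<lambda>y. (aff (p r) (c r) (b r) y - aff (p t) (c t) (b t) y) / (r - t) - u y) =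
          (\<lambda>y. p r * ?q r y + (p r - p t) * v y + ?da r * b t y + ?db r * oneJ y)"
        proof
          fix y
          define i where "i = 1 / (r - t)"
          have "(aff (p r) (c r) (b r) y - aff (p t) (c t) (b t) y) * i - u y =
            p r * ((b r y - b t y) * i - v y) + (p r - p t) * v y + ((p r - p t) * i - p') * b t y + ((c r - c t) * i - c') * oneJ y"
            unfolding aff_def u_def by (simp add: algebra_simps)
          then show "(aff (p r) (c r) (b r) y - aff (p t) (c t) (b t) y) / (r - t) - u y =
            p r * ?q r y + (p r - p t) * v y + ?da r * b t y + ?db r * oneJ y" by (simp add: i_def)
        qed
        moreover have "Hk unit_weight n (?q r)"
          by (intro Hk_diff quotient_Hk[OF g[OF r(2)] g[OF t]] sobolev_Hk[OF vs])
        ultimately show "norm (sobolev_norm n (\<lambda>y. (aff (p r) (c r) (b r) y - aff (p t) (c t) (b t) y) / (r - t) - u y)) <= ?bd r"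
          using sobolev_norm_lin4[OF _ sobolev_Hk[OF vs] sobolev_Hk[OF g[OF t]] H1J]
          by (simp add: sobolev_norm_nonneg)
      qed
    qed
  qed
qed

lemma C1_path_on_aff:
  assumes n: "n >= 2" and v: "\<And>t. t \<in> S ==> has_path_deriv n c (v t) t S"
    and vc: "\<And>t. t \<in> S ==> ((\<lambda>r. sobolev_norm n (\<lambda>y. v r y - v t y)) \<longlongrightarrow> 0) (at t within S)"
    and g: "\<And>t. t \<in> S ==> c t \<in> sobolev n"
    and p: "\<And>t. t \<in> S ==> (p has_real_derivative p' t) (at t within S)" "continuous_on S p'"
    and q: "\<And>t. t \<in> S ==> (q has_real_derivative q' t) (at t within S)" "continuous_on S q'"
  shows "C1_path_on n S (\<lambda>t. aff (p t) (q t) (c t))"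
proof -
  define u where "u t x = p t * v t x + p' t * c t x + q' t * oneJ x" for t x
  have vs: "v t \<in> sobolev n" if "t \<in> S" for t using v[OF that] by (simp add: has_path_deriv_def)
  note H1J = sobolev_Hk[OF oneJ_sobolev]
  have pc: "(p \<longlongrightarrow> p t) (at t within S)" if "t \<in> S" for t
    using DERIV_continuous[OF p(1)[OF that]] by (simp add: continuous_within)
  have p'c: "(p' \<longlongrightarrow> p' t) (at t within S)" "(q' \<longlongrightarrow> q' t) (at t within S)" if "t \<in> S" for t
    using p(2) q(2) that by (auto simp: continuous_on_def)
  have deriv: "has_path_deriv n (\<lambda>t. aff (p t) (q t) (c t)) (u t) t S" if t: "t \<in> S" for t
    unfolding u_def[abs_def] by (rule aff_path_deriv[OF n v[OF t] g t p(1)[OF t] q(1)[OF t]])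
  have cont: "((\<lambda>r. sobolev_norm n (\<lambda>y. u r y - u t y)) \<longlongrightarrow> 0) (at t within S)" if t: "t \<in> S" for t
  proof (rule Lim_null_comparison)
    let ?bd = "\<lambda>r. (\<bar>p r\<bar> * sobolev_norm n (\<lambda>y. v r y - v t y) + \<bar>p r - p t\<bar> * sobolev_norm n (v t)
        + \<bar>p' r\<bar> * sobolev_norm n (\<lambda>y. c r y - c t y) + \<bar>1\<bar> * (\<bar>p' r - p' t\<bar> * sobolev_norm n (c t) + \<bar>q' r - q' t\<bar> * sobolev_norm n oneJ + \<bar>0\<bar> * 0 + \<bar>0\<bar> * 0))"
    have "(?bd \<longlongrightarrow> (\<bar>p t\<bar> * 0 + \<bar>p t - p t\<bar> * sobolev_norm n (v t)
        + \<bar>p' t\<bar> * 0 + \<bar>1\<bar> * (\<bar>p' t - p' t\<bar> * sobolev_norm n (c t) + \<bar>q' t - q' t\<bar> * sobolev_norm n oneJ + \<bar>0\<bar> * 0 + \<bar>0\<bar> * 0))) (at t within S)"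
      by (intro tendsto_intros pc p'c vc t path_deriv_norm_continuous[OF v[OF t] g t])
    then show "(?bd \<longlongrightarrow> 0) (at t within S)" by simp
    show "\<forall>\<^sub>F r in at t within S. norm (sobolev_norm n (\<lambda>y. u r y - u t y)) <= ?bd r"
      unfolding eventually_at_filter
    proof (rule always_eventually, intro allI impI)
      fix r assume r: "r \<in> S"
      \<comment> \<open>The increment of the velocity has five terms; the last two are grouped and
        estimated by a second use of \<open>sobolev_norm_lin4\<close>, padded with zeros.\<close>
      let ?k = "\<lambda>y. (p' r - p' t) * c t y + (q' r - q' t) * oneJ y + 0 * 0 + 0 * 0"
      have e: "(\<lambda>y. u r y - u t y) =
          (\<lambda>y. p r * (v r y - v t y) + (p r - p t) * v t y + p' r * (c r y - c t y) + 1 * ?k y)"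
        by (auto simp: u_def algebra_simps)
      have hk: "Hk unit_weight n ?k" using Hk_lin[OF sobolev_Hk[OF g[OF t]] H1J, of "p' r - p' t" "q' r - q' t"] by simp
      have "sobolev_norm n (\<lambda>y. u r y - u t y) <= \<bar>p r\<bar> * sobolev_norm n (\<lambda>y. v r y - v t y) + \<bar>p r - p t\<bar> * sobolev_norm n (v t)
        + \<bar>p' r\<bar> * sobolev_norm n (\<lambda>y. c r y - c t y) + \<bar>1\<bar> * sobolev_norm n ?k"
        unfolding e by (intro sobolev_norm_lin4 Hk_diff sobolev_Hk[of _ n] vs g t r hk)
      also have "sobolev_norm n ?k <= \<bar>p' r - p' t\<bar> * sobolev_norm n (c t) + \<bar>q' r - q' t\<bar> * sobolev_norm n oneJ + \<bar>0\<bar> * 0 + \<bar>0\<bar> * 0"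
        using sobolev_norm_lin4[OF sobolev_Hk[OF g[OF t]] H1J Hk_zero Hk_zero, of "p' r - p' t" "q' r - q' t" 0 0] by simp
      finally show "norm (sobolev_norm n (\<lambda>y. u r y - u t y)) <= ?bd r"
        by (simp add: sobolev_norm_nonneg)
    qed
  qed
  show "C1_path_on n S (\<lambda>t. aff (p t) (q t) (c t))"
    unfolding C1_path_on_def using deriv cont by (intro exI[of _ u]) blast
qed

lemma bounded_functional_norm_continuous:
  assumes n: "n >= 2" and L: "bounded_functional n T" and v: "\<And>t. t \<in> S ==> v t \<in> sobolev n"
    and vc: "\<And>t. t \<in> S ==> ((\<lambda>r. sobolev_norm n (\<lambda>y. v r y - v t y)) \<longlongrightarrow> 0) (at t within S)"
  shows "continuous_on S (\<lambda>t. T (v t))"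
  unfolding continuous_on_def
proof
  fix t assume t: "t \<in> S"
  obtain K where K: "\<And>f. f \<in> sobolev n ==> \<bar>T f\<bar> <= K * sobolev_norm n f"
    using L unfolding bounded_functional_def by blast
  have "((\<lambda>r. T (v r) - T (v t)) \<longlongrightarrow> 0) (at t within S)"
  proof (rule Lim_null_comparison)
    show "((\<lambda>r. K * sobolev_norm n (\<lambda>y. v r y - v t y)) \<longlongrightarrow> 0) (at t within S)"
      by (rule tendsto_mult_right_zero[OF vc[OF t]])
    show "\<forall>\<^sub>F r in at t within S. norm (T (v r) - T (v t)) <= K * sobolev_norm n (\<lambda>y. v r y - v t y)"
      unfolding eventually_at_filter
    proof (rule always_eventually, intro allI impI)
      fix r assume r: "r \<in> S"
      have "T (\<lambda>x. 1 * v r x + (-1) * v t x) = 1 * T (v r) + (-1) * T (v t)"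
        using L sobolev_Hk[OF v[OF r]] sobolev_Hk[OF v[OF t]] unfolding bounded_functional_def by blast
      moreover have "(\<lambda>x. 1 * v r x + (-1) * v t x) \<in> sobolev n" by (rule sobolev_lin(1)[OF n v[OF r] v[OF t]])
      ultimately show "norm (T (v r) - T (v t)) <= K * sobolev_norm n (\<lambda>y. v r y - v t y)"
        using K[of "\<lambda>x. 1 * v r x + (-1) * v t x"] by simp
    qed
  qed
  then show "((\<lambda>t. T (v t)) \<longlongrightarrow> T (v t)) (at t within S)" by (rule LIM_zero_cancel)
qed

lemma piecewise_path_map_pieces:
  assumes p: "piecewise_C1_path n a b g"
    and "\<And>c d. {c..d} \<subseteq> {a..b} ==> C1_path_on n {c..d} g ==> C1_path_on n {c..d} h"
    and "\<And>t. t \<in> {a..b} ==> h t \<in> immersions n"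
  shows "piecewise_C1_path n a b h"
proof -
  obtain u N where t: "u 0 = a" "u N = b" "\<And>j. j < N ==> u j < u (Suc j)" "\<And>j. j < N ==> C1_path_on n {u j..u (Suc j)} g"
    using p unfolding piecewise_C1_path_def by blast
  have ch: "\<forall>j<N. u j < u (Suc j)" using t(3) by blast
  have "C1_path_on n {u j..u (Suc j)} h" if j: "j < N" for j
  proof (rule assms(2)[OF _ t(4)[OF j]])
    show "{u j..u (Suc j)} \<subseteq> {a..b}"
      using chain_mono[OF ch, of 0 j] chain_mono[OF ch, of "Suc j" N] j t(1,2) by auto
  qed
  then show ?thesis using p t assms(3) unfolding piecewise_C1_path_def by blast
qed

context immersion_metric
begin

text \<open>The scale is 2 pi / L and the translation subtracts the value at the fixed end point y.
  L and the value at y are bounded functionals, so both coefficients are C^1 on every piece and the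
  normalised path is admissible. Length at most 2 pi means a scale of at least 1, as
  \<open>normalised_G_le\<close> requires.\<close>

lemma normalised_path:
  assumes p: "piecewise_C1_path n s t i" and short: "\<And>r. r \<in> {s..t} ==> clen (i r) <= 2*pi"
  shows "piecewise_C1_path n s t (\<lambda>r. nrm (i r))"
    "path_len n a s t (\<lambda>r. nrm (i r)) <= ennreal proj_const * path_len n a s t i"
proof -
  note im = piecewise_path_immersion[OF p]
  have st: "s < t" using p by (simp add: piecewise_C1_path_def)
  define j where "j = orient (i s)"
  define y where "y = basept (i s)"
  have j: "j = 1 \<or> j = -1" using immersion_orient(1)[OF im[of s]] st by (simp add: j_def)
  have y: "y = (if j = 1 then 0 else 2*pi)" "y \<in> J" by (auto simp: y_def basept_def j_def)
  define L where "L f = j * (f (2*pi) - f 0)" for f :: "real => real"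
  have BE: "bounded_functional n (\<lambda>f. f y)" by (rule evaluation_functional[OF _ y(2)]) (use n2 in auto)
  have BD: "bounded_functional n (\<lambda>f. f (2*pi) - f 0)"
    by (intro bounded_functional_diff evaluation_functional) (use n2 in auto)
  have or: "orient (i r) = j" if "r \<in> {s..t}" for r unfolding j_def by (rule path_orient[OF n2 p that])
  have bp: "basept (i r) = y" if "r \<in> {s..t}" for r using or[OF that] by (simp add: basept_def y(1))
  have cl: "clen (i r) = L (i r)" "L (i r) > 0" if r: "r \<in> {s..t}" for r
    using immersion_orient(3,4)[OF im[OF r]] or[OF r] j by (auto simp: L_def)
  define b where "b r = 2*pi / L (i r)" for r
  define h where "h r = - b r * i r y" for r
  \<comment> \<open>\<open>A'\<close> and \<open>B'\<close> are the derivatives of \<open>b\<close>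
    and \<open>h\<close> in the direction of a velocity v.\<close>
  define A' where "A' r v = - (2*pi) * L v / (L (i r))\<^sup>2" for r v
  define B' where "B' r v = - (A' r v * i r y + b r * v y)" for r v
  have eq: "nrm (i r) = aff (b r) (h r) (i r)" if r: "r \<in> {s..t}" for r
    using cl(1)[OF r] bp[OF r] by (simp add: nrm_def b_def h_def)
  have D: "(b has_real_derivative A' r v) (at r within S)" "(h has_real_derivative B' r v) (at r within S)"
    if S: "S \<subseteq> {s..t}" "r \<in> S" and v: "has_path_deriv n i v r S" for r v S
  proof -
    have g: "i u \<in> sobolev n" if "u \<in> S" for u using im immersion_sobolev that S by blast
    have l: "((\<lambda>r. L (i r)) has_real_derivative L v) (at r within S)"
      unfolding L_def by (rule DERIV_cmult[OF bounded_functional_derivative[OF n2 BD v g S(2)]])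
    have e: "((\<lambda>r. i r y) has_real_derivative v y) (at r within S)"
      by (rule bounded_functional_derivative[OF n2 BE v g S(2)])
    have l0: "L (i r) \<noteq> 0" using cl(2)[of r] S by auto
    show a: "(b has_real_derivative A' r v) (at r within S)"
      unfolding b_def[abs_def] A'_def using l l0
      by (auto intro!: derivative_eq_intros simp: power2_eq_square)
    show "(h has_real_derivative B' r v) (at r within S)"
      unfolding h_def[abs_def] B'_def using DERIV_mult[OF DERIV_minus[OF a] e]
      by (simp add: algebra_simps)
  qed
  have piece: "C1_path_on n {c..e} (\<lambda>r. nrm (i r))"
    if ce: "{c..e} \<subseteq> {s..t}" and C: "C1_path_on n {c..e} i" for c e
  proof -
    obtain v where v: "\<And>r. r \<in> {c..e} ==> has_path_deriv n i (v r) r {c..e}"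
      "\<And>r. r \<in> {c..e} ==> ((\<lambda>u. sobolev_norm n (\<lambda>z. v u z - v r z)) \<longlongrightarrow> 0) (at r within {c..e})"
      using C unfolding C1_path_on_def by blast
    have vs: "v r \<in> sobolev n" if "r \<in> {c..e}" for r using v(1)[OF that] by (simp add: has_path_deriv_def)
    have g: "i u \<in> sobolev n" if "u \<in> {c..e}" for u using im immersion_sobolev that ce by blast
    have Lv: "continuous_on {c..e} (\<lambda>r. L (v r))" unfolding L_def
      by (intro continuous_on_mult_left bounded_functional_norm_continuous[OF n2 BD vs v(2)])
    have yv: "continuous_on {c..e} (\<lambda>r. v r y)" by (rule bounded_functional_norm_continuous[OF n2 BE vs v(2)])
    have Lg: "continuous_on {c..e} (\<lambda>r. L (i r))" unfolding L_def
      by (intro continuous_on_mult_left continuous_on_subset[OF bounded_functional_continuous_path[OF n2 p BD] ce])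
    have yg: "continuous_on {c..e} (\<lambda>r. i r y)"
      by (intro continuous_on_subset[OF bounded_functional_continuous_path[OF n2 p BE] ce])
    have l0: "L (i r) \<noteq> 0" if "r \<in> {c..e}" for r using cl(2)[of r] that ce by auto
    have A'c: "continuous_on {c..e} (\<lambda>r. A' r (v r))" unfolding A'_def
      using l0 by (intro continuous_intros Lv Lg) auto
    have bc: "continuous_on {c..e} b" unfolding b_def using l0 by (intro continuous_intros Lg) auto
    have B'c: "continuous_on {c..e} (\<lambda>r. B' r (v r))" unfolding B'_def
      by (intro continuous_intros A'c yg bc yv)
    have "C1_path_on n {c..e} (\<lambda>r. aff (b r) (h r) (i r))"
      by (rule C1_path_on_aff[OF n2 v g D(1)[OF ce _ v(1)] A'c D(2)[OF ce _ v(1)] B'c])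
    then show ?thesis
      by (rule C1_path_on_cong) (use eq ce in auto)
  qed
  show q: "piecewise_C1_path n s t (\<lambda>r. nrm (i r))"
    by (rule piecewise_path_map_pieces[OF p]) (use piece nrm_Diff(1)[OF n2 im] Diff_immersion in auto)
  show "path_len n a s t (\<lambda>r. nrm (i r)) <= ennreal proj_const * path_len n a s t i"
  proof (rule path_len_le_path_len[OF p q proj_const_pos])
    fix r v assume r: "r \<in> {s<..<t}" and v: "has_path_deriv n i v r {s..t}"
    have rt: "r \<in> {s..t}" using r by auto
    have vs: "v \<in> sobolev n" using v by (simp add: has_path_deriv_def)
    note imr = im[OF rt]
    define u where "u = (\<lambda>x. b r * v x + A' r v * i r x + B' r v * oneJ x)"
    have u: "has_path_deriv n (\<lambda>r. nrm (i r)) u r {s..t}"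
    proof -
      have "has_path_deriv n (\<lambda>r. aff (b r) (h r) (i r)) u r {s..t}"
        unfolding u_def by (rule aff_path_deriv[OF n2 v immersion_sobolev[OF im] rt D[OF order_refl rt v]])
      then show ?thesis unfolding has_path_deriv_iff using eq rt by simp
    qed
    define w where "w = speed (i r)"
    define w' where "w' = speed (nrm (i r))"
    define k where "k = - (A' r v / b r) * j"
    have w: "weight w" unfolding w_def by (rule immersion_weight[OF imr])
    note D' = nrm_Diff(1)[OF n2 imr]
    note imD = Diff_immersion[OF D']
    have w': "weight w'" unfolding w'_def by (rule immersion_weight[OF imD])
    have b1: "b r >= 1" using cl[OF rt] short[OF rt] by (simp add: b_def)
    have b0: "b r > 0" using b1 by simp
    have us: "u \<in> sobolev n" using u by (simp add: has_path_deriv_def)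
    have ww: "w' x = b r * w x" if "x \<in> J" for x
      unfolding w_def w'_def eq[OF rt] by (rule aff_immersion(2)[OF n2 imr b0 that])
    have len: "wlen w' = 2*pi" using D' by (simp add: Diff_iff clen_def w'_def)
    have Hv: "Hk w n v" unfolding w_def by (rule sobolev_Hk_immersion[OF imr vs])
    have Hg: "Hk w n (i r)" unfolding w_def by (rule sobolev_Hk_immersion[OF imr immersion_sobolev[OF imr]])
    have Ho: "Hk w n oneJ" unfolding w_def by (rule sobolev_Hk_immersion[OF imr oneJ_sobolev])
    have Hu: "Hk w n u" unfolding w_def by (rule sobolev_Hk_immersion[OF imr us])
    have Hu': "Hk w' n u" unfolding w'_def by (rule sobolev_Hk_immersion[OF imD us])
    have n1: "1 <= n" using n2 by simp
    \<comment> \<open>Target and arc length are both scaled by \<open>b r\<close>, which cancels in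
      first order. The change of the scale contributes the constant k, because the arc length
      derivative of \<open>i r\<close> is the constant j; translations contribute nothing.\<close>
    have uv: "AE x in LI. ad w' u x = ad w v x - k"
    proof -
      have 1: "AE x in LI. (ad w' ^^ 1) u x = inverse (b r) ^ 1 * (ad w ^^ 1) u x"
        by (rule ad_scaled_weight[OF b0 ww Hk_mono[OF Hu n1]])
      have 2: "AE x in LI. (ad w ^^ 1) (\<lambda>x. 1 * (b r * v x + A' r v * i r x) + B' r v * oneJ x) x =
          1 * (ad w ^^ 1) (\<lambda>x. b r * v x + A' r v * i r x) x + B' r v * (ad w ^^ 1) oneJ x"
        by (rule funpow_ad_lin[OF Hk_lin[OF Hv Hg] Ho n1])
      have 3: "AE x in LI. (ad w ^^ 1) (\<lambda>x. b r * v x + A' r v * i r x) x = b r * (ad w ^^ 1) v x + A' r v * (ad w ^^ 1) (i r) x"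
        by (rule funpow_ad_lin[OF Hv Hg n1])
      have "AE x in LI. oneJ x = 1" by (rule AE_LI_I) (simp add: oneJ_def)
      then have "ad w oneJ = ad w (\<lambda>x. 1)" by (rule ad_cong_AE)
      then have 4: "AE x in LI. ad w oneJ x = 0" using ad_const[of w 1] by simp
      have 5: "AE x in LI. ad w (i r) x = j" using immersion_ad_self[OF imr] or[OF rt] by (simp add: w_def)
      have ue: "u = (\<lambda>x. 1 * (b r * v x + A' r v * i r x) + B' r v * oneJ x)" by (simp add: u_def)
      show ?thesis
        using 1 2[folded ue] 3 4 5
      proof eventually_elim
        case (elim x)
        then have "ad w' u x = inverse (b r) * (b r * ad w v x + A' r v * j)" by simp
        also have "... = ad w v x - k" using b0 by (simp add: k_def field_simps)
        finally show ?case .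
      qed
    qed
    have uy: "u y = 0" using y(2) by (simp add: u_def B'_def oneJ_def)
    \<comment> \<open>All normalised curves have length 2 pi, so u takes equal values at both ends;
      at y the value is 0 because the normalised curves all vanish there.\<close>
    have "u (2*pi) - u 0 = b r * (v (2*pi) - v 0) + A' r v * (i r (2*pi) - i r 0)"
      by (simp add: u_def oneJ_def algebra_simps)
    also have "... = j * (b r * L v + A' r v * L (i r))"
      using j by (auto simp: L_def algebra_simps)
    also have "b r * L v + A' r v * L (i r) = 0"
      using cl(2)[OF rt] by (simp add: b_def A'_def power2_eq_square)
    finally have "u (2*pi) = u 0" by simp
    with uy y(1) have ub: "u 0 = 0" "u (2*pi) = 0" by (auto split: if_splits)
    have "Gm n a w' u <= proj_const\<^sup>2 * Gm n a w v"
      by (rule normalised_G_le[OF w w' b1 ww len us Hu' ub Hv uv])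
    then have "sqrt (Gm n a w' u) <= sqrt (proj_const\<^sup>2 * Gm n a w v)" by (rule real_sqrt_le_mono)
    also have "... = proj_const * sqrt (Gm n a w v)" using proj_const_pos by (simp add: real_sqrt_mult)
    finally show "\<exists>u. has_path_deriv n (\<lambda>r. nrm (i r)) u r {s..t} \<and> sqrt (G (nrm (i r)) u) <= proj_const * sqrt (G (i r) v)"
      using u unfolding w_def w'_def by blast
  qed
qed

text \<open>An estimate known only for paths shorter than \<open>h\<close> passes to the infimum,
  since the almost minimal paths can be taken that short when the distance is below
  \<open>h\<close>.\<close>

lemma dist_lipschitz_from_paths:
  assumes C: "C > 0" and d: "d c1 c2 < ennreal h"
    and le: "\<And>s t c. piecewise_C1_path n s t c ==> c s = c1 ==> c t = c2 ==> path_len n a s t c < ennreal h ==>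
      x <= ennreal C * path_len n a s t c"
  shows "x <= ennreal C * d c1 c2"
proof (rule ccontr)
  assume no: "\<not> x <= ennreal C * d c1 c2"
  define y where "y = ennreal (1 / C) * x"
  have Cy: "ennreal C * y = x" unfolding y_def mult.assoc[symmetric] using C by (simp add: ennreal_mult'[symmetric])
  have "d c1 c2 < y"
  proof (rule ccontr)
    assume "\<not> d c1 c2 < y"
    then have "ennreal C * y <= ennreal C * d c1 c2" by (intro mult_left_mono) auto
    with no Cy show False by simp
  qed
  with d have "d c1 c2 < min y (ennreal h)" by simp
  then obtain s t c where g: "piecewise_C1_path n s t c" "c s = c1" "c t = c2" "path_len n a s t c < min y (ennreal h)"
    by (rule dist_less_path)
  have "ennreal (1 / C) * x <= ennreal (1 / C) * (ennreal C * path_len n a s t c)"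
    using le[OF g(1-3)] g(4) by (intro mult_left_mono) auto
  also have "... = path_len n a s t c" unfolding mult.assoc[symmetric] using C by (simp add: ennreal_mult'[symmetric])
  finally show False using g(4) unfolding y_def min_less_iff_conj by (meson leD)
qed

text \<open>A path shorter than h that starts at a curve of length at most h never passes a curve
  longer than 2 pi, by the Lipschitz bound for \<open>Psi\<close> of the length; so
  \<open>normalised_path\<close> applies to it.\<close>

lemma normalisation_lipschitz:
  "\<exists>h>0. \<forall>c1\<in>M. \<forall>c2\<in>M. clen c1 <= h --> d c1 c2 < ennreal h -->
    d (nrm c1) (nrm c2) <= ennreal proj_const * d c1 c2"
proof -
  \<comment> \<open>Chosen for \<open>Psi h + psi_const * h <= Psi (2*pi)\<close>, using Psi h <= h
    for h <= 1.\<close>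
  define h where "h = min 1 (Psi (2*pi) / (1 + psi_const))"
  have P: "Psi (2*pi) > 0" unfolding Psi_def by (rule ln_gt_zero) simp
  have h: "h > 0" "h <= 1" using P psi_const_pos by (auto simp: h_def)
  have "h <= Psi (2*pi) / (1 + psi_const)" by (simp add: h_def)
  then have "h * (1 + psi_const) <= Psi (2*pi)"
    using psi_const_pos by (simp add: pos_le_divide_eq)
  moreover have "Psi h <= h"
  proof -
    have "Psi h <= h * sqrt h" unfolding Psi_def using h by (intro ln_add_one_self_le_self) simp
    also have "... <= h * 1" using h by (intro mult_left_mono) auto
    finally show ?thesis by simp
  qed
  ultimately have small: "Psi h + psi_const * h <= Psi (2*pi)" by (simp add: algebra_simps)
  have "d (nrm c1) (nrm c2) <= ennreal proj_const * d c1 c2"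
    if c: "clen c1 <= h" "d c1 c2 < ennreal h" for c1 c2
  proof (rule dist_lipschitz_from_paths[OF proj_const_pos c(2)])
    fix s t g assume p: "piecewise_C1_path n s t g" and e: "g s = c1" "g t = c2" and l: "path_len n a s t g < ennreal h"
    have short: "clen (g r) <= 2*pi" if r: "r \<in> {s..t}" for r
    proof (rule ccontr)
      assume "\<not> clen (g r) <= 2*pi"
      then have 1: "Psi (2*pi) < Psi (clen (g r))" by (intro Psi_strict_mono) auto
      have "g s \<in> M" using piecewise_path_immersion[OF p, of s] r by auto
      then have "clen (g s) > 0" by (rule immersion_orient(4))
      then have 2: "Psi (clen (g s)) <= Psi h" using c(1) e by (intro Psi_mono) auto
      have "ennreal \<bar>Psi (clen (g r)) - Psi (clen (g s))\<bar> <= ennreal psi_const * path_len n a s t g"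
        by (rule Psi_length_lipschitz_path[OF p r])
      also have "... <= ennreal psi_const * ennreal h" using l by (intro mult_left_mono) auto
      also have "... = ennreal (psi_const * h)" using psi_const_pos by (simp add: ennreal_mult')
      finally have "\<bar>Psi (clen (g r)) - Psi (clen (g s))\<bar> <= psi_const * h"
        using psi_const_pos h by (simp add: ennreal_le_iff)
      with 1 2 small show False by linarith
    qed
    have "d (nrm c1) (nrm c2) <= path_len n a s t (\<lambda>r. nrm (g r))"
      by (rule path_dist_le[OF normalised_path(1)[OF p short]]) (use e in auto)
    also have "... <= ennreal proj_const * path_len n a s t g" by (rule normalised_path(2)[OF p short])
    finally show "d (nrm c1) (nrm c2) <= ennreal proj_const * path_len n a s t g" .
  qed
  with h(1) show ?thesis by blast
qed

end

section \<open>Cauchy sequences of immersions\<close>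

lemma ennreal_pos_below:
  fixes e :: ennreal assumes "0 < e" shows "\<exists>r>0. ennreal r < e"
proof (cases e)
  case (real r)
  then show ?thesis using assms by (intro exI[of _ "r / 2"]) (simp add: ennreal_lessI)
next
  case top
  then show ?thesis by (intro exI[of _ 1]) simp
qed

context immersion_metric
begin

section \<open>Comparison with the Sobolev norm, and convergence at positive length\<close>

lemma dist_triangle3: "d c1 c4 <= d c1 c2 + (d c2 c3 + d c3 c4)"
proof -
  have "d c1 c4 <= d c1 c2 + d c2 c4" "d c2 c4 <= d c2 c3 + d c3 c4" by (rule dist_triangle_geodesic[OF n2])+
  then show ?thesis by (meson add_left_mono order_trans)
qed

lemma Hk_diff_sobolev: "f \<in> sobolev n ==> g \<in> sobolev n ==> Hk unit_weight n (\<lambda>x. f x - g x)"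
  by (intro Hk_diff sobolev_Hk[of _ n])

text \<open>\<open>local_estimate\<close> at one fixed centre, with the norm of
  \<open>speed c0\<close> replaced by that of H^n; the factor k pays for the change of norm.\<close>

lemma local_comparison:
  assumes c0: "c0 \<in> M"
  obtains r C where "r > 0" "C > 0"
    "\<And>c. c \<in> M ==> d c0 c < ennreal r ==> ennreal (sobolev_norm n (\<lambda>x. c x - c0 x)) <= ennreal C * d c0 c"
    "\<And>c. c \<in> sobolev n ==> sobolev_norm n (\<lambda>x. c x - c0 x) <= r ==>
      d c0 c <= ennreal (C * sobolev_norm n (\<lambda>x. c x - c0 x))"
proof -
  note w = immersion_weight[OF c0]
  have lo: "0 < clen c0" by (rule immersion_orient(4)[OF c0])
  obtain r C where r: "r > 0" and C: "C > 0" and L: "\<forall>c0'\<in>M. clen c0 <= clen c0' --> clen c0' <= clen c0 -->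
    (\<forall>c\<in>sobolev n. sqrt (En (speed c0') n (\<lambda>x. c x - c0' x)) <= r --> c \<in> M) \<and>
    (\<forall>c1\<in>M. \<forall>c2\<in>M. sqrt (En (speed c0') n (\<lambda>x. c1 x - c0' x)) <= r --> d c1 c2 < ennreal r -->
      ennreal (sqrt (En (speed c0') n (\<lambda>x. c2 x - c1 x))) <= ennreal C * d c1 c2) \<and>
    (\<forall>c1\<in>sobolev n. \<forall>c2\<in>sobolev n. sqrt (En (speed c0') n (\<lambda>x. c1 x - c0' x)) <= r -->
      sqrt (En (speed c0') n (\<lambda>x. c2 x - c0' x)) <= r --> d c1 c2 <= ennreal (C * sqrt (En (speed c0') n (\<lambda>x. c2 x - c1 x))))"
    using local_estimate[OF lo, of "clen c0"] by blast
  have s0: "sqrt (En (speed c0) n (\<lambda>x. c0 x - c0 x)) <= r" using r En_zero[OF w] by simp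
  obtain K where K: "K > 0" "\<And>h. Hk unit_weight n h ==> En (speed c0) n h <= K * En unit_weight n h"
    "\<And>h. Hk unit_weight n h ==> En unit_weight n h <= K * En (speed c0) n h"
    using immersion_norm_equivalence[OF n2 c0] by metis
  define k where "k = max 1 (sqrt K)"
  have k: "k >= 1" "sqrt K <= k" by (auto simp: k_def)
  have K1: "sqrt (En (speed c0) n h) <= k * sobolev_norm n h" if h: "Hk unit_weight n h" for h
  proof -
    have "sqrt (En (speed c0) n h) <= sqrt K * sobolev_norm n h"
      using real_sqrt_le_mono[OF K(2)[OF h]] by (simp add: real_sqrt_mult sobolev_norm_eq[OF h])
    also have "... <= k * sobolev_norm n h" using k(2) by (intro mult_right_mono sobolev_norm_nonneg)
    finally show ?thesis .
  qed
  have K2: "sobolev_norm n h <= k * sqrt (En (speed c0) n h)" if h: "Hk unit_weight n h" for h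
  proof -
    have "sobolev_norm n h <= sqrt K * sqrt (En (speed c0) n h)"
      using real_sqrt_le_mono[OF K(3)[OF h]] by (simp add: real_sqrt_mult sobolev_norm_eq[OF h])
    also have "... <= k * sqrt (En (speed c0) n h)" using k(2) En_nonneg[OF w] by (intro mult_right_mono) auto
    finally show ?thesis .
  qed
  note s = immersion_sobolev[OF c0]
  show thesis
  proof (rule that[of "r / k" "C * k"])
    show "r / k > 0" "C * k > 0" using r C k by auto
    have rk: "r / k <= r" using r k by (simp add: divide_le_eq)
    show "ennreal (sobolev_norm n (\<lambda>x. c x - c0 x)) <= ennreal (C * k) * d c0 c" if c: "c \<in> M" "d c0 c < ennreal (r / k)" for c
    proof -
      have "d c0 c < ennreal r" using c(2) rk by (meson ennreal_leI less_le_trans)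
      then have E: "ennreal (sqrt (En (speed c0) n (\<lambda>x. c x - c0 x))) <= ennreal C * d c0 c"
        using L c0 c(1) s0 by blast
      have "ennreal (sobolev_norm n (\<lambda>x. c x - c0 x)) <= ennreal (k * sqrt (En (speed c0) n (\<lambda>x. c x - c0 x)))"
        by (intro ennreal_leI K2 Hk_diff_sobolev immersion_sobolev[OF c(1)] s)
      also have "... = ennreal k * ennreal (sqrt (En (speed c0) n (\<lambda>x. c x - c0 x)))" using k(1) by (simp add: ennreal_mult')
      also have "... <= ennreal k * (ennreal C * d c0 c)" using E by (intro mult_left_mono) auto
      also have "... = ennreal (C * k) * d c0 c" using C k(1) by (simp add: ennreal_mult' mult_ac)
      finally show ?thesis .
    qed
    show "d c0 c <= ennreal (C * k * sobolev_norm n (\<lambda>x. c x - c0 x))"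
      if c: "c \<in> sobolev n" "sobolev_norm n (\<lambda>x. c x - c0 x) <= r / k" for c
    proof -
      note E = K1[OF Hk_diff_sobolev[OF c(1) s]]
      have "k * sobolev_norm n (\<lambda>x. c x - c0 x) <= r" using c(2) k(1) by (simp add: pos_le_divide_eq mult.commute)
      with E have "sqrt (En (speed c0) n (\<lambda>x. c x - c0 x)) <= r" by simp
      then have "d c0 c <= ennreal (C * sqrt (En (speed c0) n (\<lambda>x. c x - c0 x)))" using L c0 s c(1) s0 by blast
      also have "... <= ennreal (C * (k * sobolev_norm n (\<lambda>x. c x - c0 x)))" using E C by (intro ennreal_leI mult_left_mono) auto
      finally show ?thesis by (simp add: mult.assoc)
    qed
  qed
qed

lemma dist_zero_imp_eq:
  assumes c: "c0 \<in> M" "c \<in> M" and 0: "d c0 c = 0" shows "c = c0"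
proof -
  obtain r C where L: "r > 0" "C > 0"
    "\<And>c. c \<in> M ==> d c0 c < ennreal r ==> ennreal (sobolev_norm n (\<lambda>x. c x - c0 x)) <= ennreal C * d c0 c"
    using local_comparison[OF c(1)] by metis
  have "sobolev_norm n (\<lambda>x. c x - c0 x) = 0" using L(3)[OF c(2)] L(1) 0 sobolev_norm_nonneg by (simp add: ennreal_eq_0_iff antisym)
  then show ?thesis by (rule sobolev_norm_zero_imp_eq[OF immersion_sobolev[OF c(2)] immersion_sobolev[OF c(1)]])
qed

text \<open>The radius p is valid at every member of the sequence, so a late member is taken as
  centre and the tail lies in its ball, where distance and norm are comparable. The limit in
  \<open>sobolev\<close> lies in the ball too and hence is an immersion.\<close>

lemma cauchy_converges:
  assumes x: "x \<in> ecauchy M d" and lo: "0 < lo" and len: "\<And>k. lo <= clen (x k)" "\<And>k. clen (x k) <= hi"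
  obtains F where "F \<in> M" "(\<lambda>k. d (x k) F) \<longlonglongrightarrow> 0" "(\<lambda>k. sobolev_norm n (\<lambda>y. x k y - F y)) \<longlonglongrightarrow> 0"
proof -
  have xM: "x k \<in> M" for k using x by (simp add: ecauchy_def)
  have cauchy: "\<exists>N. \<forall>i\<ge>N. \<forall>j\<ge>N. d (x i) (x j) < e" if "e > 0" for e using x that by (auto simp: ecauchy_def)
  note xs = immersion_sobolev[OF xM]
  obtain p C where p: "p > 0" and C: "C > 0" and L: "\<forall>c0\<in>M. lo <= clen c0 --> clen c0 <= hi -->
    (\<forall>c\<in>sobolev n. sqrt (En (speed c0) n (\<lambda>x. c x - c0 x)) <= p --> c \<in> M) \<and>
    (\<forall>c1\<in>M. \<forall>c2\<in>M. sqrt (En (speed c0) n (\<lambda>x. c1 x - c0 x)) <= p --> d c1 c2 < ennreal p -->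
      ennreal (sqrt (En (speed c0) n (\<lambda>x. c2 x - c1 x))) <= ennreal C * d c1 c2) \<and>
    (\<forall>c1\<in>sobolev n. \<forall>c2\<in>sobolev n. sqrt (En (speed c0) n (\<lambda>x. c1 x - c0 x)) <= p -->
      sqrt (En (speed c0) n (\<lambda>x. c2 x - c0 x)) <= p --> d c1 c2 <= ennreal (C * sqrt (En (speed c0) n (\<lambda>x. c2 x - c1 x))))"
    using local_estimate[OF lo, of hi] by blast
  \<comment> \<open>The tail then stays within p / 2 of the centre, which leaves room for the
    limit.\<close>
  define e where "e = min p (p / (2 * C))"
  have e: "e > 0" "e <= p" "C * e <= p / 2"
  proof -
    show "e > 0" "e <= p" using p C by (auto simp: e_def)
    have "C * e <= C * (p / (2 * C))" using C by (intro mult_left_mono) (auto simp: e_def)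
    then show "C * e <= p / 2" using C by simp
  qed
  obtain N where N: "\<forall>i\<ge>N. \<forall>j\<ge>N. d (x i) (x j) < ennreal e" using cauchy[of "ennreal e"] e(1) by auto
  define c0 where "c0 = x N"
  have c0: "c0 \<in> M" and w: "weight (speed c0)" using xM immersion_weight[OF xM] by (auto simp: c0_def)
  have l0: "lo <= clen c0" "clen c0 <= hi" using len by (auto simp: c0_def)
  define E where "E f g = sqrt (En (speed c0) n (\<lambda>y. f y - g y))" for f g
  have LM: "c \<in> M" if "c \<in> sobolev n" "E c c0 <= p" for c
    using L c0 l0 that unfolding E_def by blast
  have Llow: "ennreal (E c2 c1) <= ennreal C * d c1 c2" if "c1 \<in> M" "c2 \<in> M" "E c1 c0 <= p" "d c1 c2 < ennreal p" for c1 c2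
    using L c0 l0 that unfolding E_def by blast
  have Lup: "d c1 c2 <= ennreal (C * E c2 c1)" if "c1 \<in> sobolev n" "c2 \<in> sobolev n" "E c1 c0 <= p" "E c2 c0 <= p" for c1 c2
    using L c0 l0 that unfolding E_def by blast
  have E0: "E c0 c0 = 0" unfolding E_def using En_zero[OF w] by simp
  have close: "E c2 c1 <= C * r" if "c1 \<in> M" "c2 \<in> M" "E c1 c0 <= p" "d c1 c2 < ennreal r" "r > 0" "r <= p" for c1 c2 r
  proof -
    have lt: "d c1 c2 < ennreal p" using that(4,6) by (meson ennreal_leI less_le_trans)
    have "ennreal (E c2 c1) <= ennreal C * d c1 c2" by (rule Llow[OF that(1-3) lt])
    also have "... <= ennreal C * ennreal r" using that(4) by (intro mult_left_mono) auto
    also have "... = ennreal (C * r)" using C that(5) by (simp add: ennreal_mult')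
    finally show ?thesis using C that(5) by (simp add: ennreal_le_iff)
  qed
  have near: "E (x i) c0 <= p / 2" if i: "i >= N" for i
    using close[OF c0 xM[of i], of e] E0 p e N i by (auto simp: c0_def)
  obtain K where K: "K > 0" "\<And>h. Hk unit_weight n h ==> En (speed c0) n h <= K * En unit_weight n h"
    "\<And>h. Hk unit_weight n h ==> En unit_weight n h <= K * En (speed c0) n h"
    using immersion_norm_equivalence[OF n2 c0] by metis
  have Cau: "\<exists>N. \<forall>i\<ge>N. \<forall>j\<ge>N. En unit_weight n (\<lambda>y. x i y - x j y) < b" if b: "b > 0" for b
  proof -
    define r where "r = min p (sqrt (b / (2 * K)) / C)"
    have r: "r > 0" "r <= p" "C * r <= sqrt (b / (2 * K))"
    proof -
      show "r > 0" "r <= p" using p C K(1) b by (auto simp: r_def)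
      have "C * r <= C * (sqrt (b / (2 * K)) / C)" using C by (intro mult_left_mono) (auto simp: r_def)
      then show "C * r <= sqrt (b / (2 * K))" using C by simp
    qed
    obtain N' where N': "\<forall>i\<ge>N'. \<forall>j\<ge>N'. d (x i) (x j) < ennreal r" using cauchy[of "ennreal r"] r(1) by auto
    have "En unit_weight n (\<lambda>y. x i y - x j y) < b" if ij: "i >= max N N'" "j >= max N N'" for i j
    proof -
      have "E (x i) (x j) <= C * r"
        using close[OF xM[of j] xM[of i] _ _ r(1,2)] near[of j] N' ij p by auto
      with r(3) have "E (x i) (x j) <= sqrt (b / (2 * K))" by simp
      then have "En (speed c0) n (\<lambda>y. x i y - x j y) <= b / (2 * K)" by (simp add: E_def)
      then have "K * En (speed c0) n (\<lambda>y. x i y - x j y) <= K * (b / (2 * K))" using K(1) by (intro mult_left_mono) auto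
      also have "... = b / 2" using K(1) by simp
      finally show ?thesis using K(3)[OF Hk_diff_sobolev[OF xs[of i] xs[of j]]] b by simp
    qed
    then show ?thesis by blast
  qed
  obtain F where F: "F \<in> sobolev n" and lim: "(\<lambda>k. En unit_weight n (\<lambda>y. x k y - F y)) \<longlonglongrightarrow> 0"
    using sobolev_complete[OF n2 xs Cau] by metis
  have Hd: "Hk unit_weight n (\<lambda>y. x k y - F y)" for k by (rule Hk_diff_sobolev[OF xs F])
  have limE: "(\<lambda>k. E (x k) F) \<longlonglongrightarrow> 0"
  proof -
    have "(\<lambda>k. En (speed c0) n (\<lambda>y. x k y - F y)) \<longlonglongrightarrow> 0"
    proof (rule tendsto_sandwich[OF _ _ tendsto_const])
      show "(\<lambda>k. K * En unit_weight n (\<lambda>y. x k y - F y)) \<longlonglongrightarrow> 0" by (rule tendsto_mult_right_zero[OF lim])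
      show "\<forall>\<^sub>F k in sequentially. En (speed c0) n (\<lambda>y. x k y - F y) <= K * En unit_weight n (\<lambda>y. x k y - F y)"
        by (intro always_eventually allI K(2) Hd)
      show "\<forall>\<^sub>F k in sequentially. 0 <= En (speed c0) n (\<lambda>y. x k y - F y)"
        by (intro always_eventually allI En_nonneg w)
    qed
    from tendsto_real_sqrt[OF this] show ?thesis by (simp add: E_def)
  qed
  have E_comm: "E f g = E g f" if "f \<in> sobolev n" "g \<in> sobolev n" for f g
    using En_cmult[OF w sobolev_Hk_immersion[OF c0 sobolev_lin(1)[OF n2 that, of 1 "-1"]], of "-1"] by (simp add: E_def)
  have EFc: "E F c0 <= p"
  proof -
    have "\<forall>\<^sub>F k in sequentially. E (x k) F < p / 2" by (rule order_tendstoD(2)[OF limE]) (use p in simp)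
    then obtain k where k: "k >= N" "E (x k) F < p / 2" unfolding eventually_sequentially by (meson linear order_refl)
    have h: "Hk (speed c0) n (\<lambda>y. f y - g y)" if "f \<in> sobolev n" "g \<in> sobolev n" for f g
      using Hk_diff_sobolev[OF that] Hk_immersion[OF c0] by blast
    have "E F c0 <= E F (x k) + E (x k) c0"
      using En_triangle[OF w h[OF F xs[of k]] h[OF xs[of k] immersion_sobolev[OF c0]]] by (simp add: E_def)
    then show ?thesis using k near[OF k(1)] E_comm[OF F xs[of k]] by simp
  qed
  show thesis
  proof
    show "F \<in> M" by (rule LM[OF F EFc])
    show "(\<lambda>k. sobolev_norm n (\<lambda>y. x k y - F y)) \<longlonglongrightarrow> 0"
      using tendsto_real_sqrt[OF lim] by (simp add: sobolev_norm_eq[OF Hd])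
    show "(\<lambda>k. d (x k) F) \<longlonglongrightarrow> 0"
    proof (rule tendsto_sandwich[OF _ _ tendsto_const])
      show "\<forall>\<^sub>F k in sequentially. d (x k) F <= ennreal (C * E (x k) F)"
        unfolding eventually_sequentially
      proof (intro exI[of _ N] allI impI)
        fix k assume k: "k >= N"
        have "E (x k) c0 <= p" using near[OF k] p by simp
        then show "d (x k) F <= ennreal (C * E (x k) F)" using Lup[OF xs[of k] F] EFc E_comm[OF F xs[of k]] by simp
      qed
      show "(\<lambda>k. ennreal (C * E (x k) F)) \<longlonglongrightarrow> 0"
        using tendsto_ennrealI[OF tendsto_mult_right_zero[OF limE, of C]] by simp
    qed auto
  qed
qed

section \<open>Shrinking sequences and the alternative for Cauchy sequences\<close>

text \<open>The scale s is fixed first, so small that every change of scale or translation below it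
  costs at most e / 3; then g is taken so close to f that s f and s g are within e / 3. The
  comparison goes from s1 f up to s f, across to s g and down to s2 g, for any two scales and
  translations.\<close>

lemma shrunk_close:
  assumes f: "f \<in> Diff n" and e: "e > 0"
  shows "\<exists>r>0. \<forall>g\<in>Diff n. \<forall>s1 s2 b1 b2. sobolev_norm n (\<lambda>x. g x - f x) < r -->
    0 < s1 --> s1 <= r --> 0 < s2 --> s2 <= r --> d (aff s1 b1 f) (aff s2 b2 g) <= ennreal e"
proof -
  define Q where "Q = 12 * (shrink_const + 1)"
  have Q: "Q > 0" using shrink_const_nonneg by (simp add: Q_def)
  define s where "s = min 1 ((e / Q)\<^sup>2)"
  have s: "0 < s" "s <= 1" using e Q by (auto simp: s_def)
  have "sqrt s <= e / Q" using e Q s by (intro real_le_lsqrt) (auto simp: s_def)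
  then have sq: "sqrt s * Q <= e" using Q by (simp add: pos_le_divide_eq)
  have small: "d (aff s1 b1 g) (aff s2 b2 g) <= ennreal (e / 3)"
    if g: "g \<in> Diff n" and "0 < s1" "s1 <= s" "0 < s2" "s2 <= s" for g s1 s2 b1 b2
  proof -
    have "d (aff s1 b1 g) (aff s2 b2 g) <= ennreal (2 * shrink_const * (sqrt s1 + sqrt s2))"
      by (rule dist_aff_le[OF g]) (use that s in auto)
    also have "2 * shrink_const * (sqrt s1 + sqrt s2) <= 2 * shrink_const * (sqrt s + sqrt s)"
      using that shrink_const_nonneg by (intro mult_left_mono add_mono) auto
    also have "... <= e / 3"
    proof -
      have "sqrt s * Q = 12 * shrink_const * sqrt s + 12 * sqrt s" by (simp add: Q_def algebra_simps)
      then have "12 * (shrink_const * sqrt s) + 12 * sqrt s <= e" using sq by simp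
      moreover have "0 <= sqrt s" using s by simp
      moreover have "2 * shrink_const * (sqrt s + sqrt s) = 4 * (shrink_const * sqrt s)" by simp
      ultimately show ?thesis by linarith
    qed
    finally show ?thesis by (simp add: ennreal_leI)
  qed
  note im = Diff_immersion[OF f]
  define c0 where "c0 = aff s 0 f"
  have c0: "c0 \<in> M" unfolding c0_def by (rule aff_immersion(1)[OF n2 im s(1)])
  obtain p C where p: "p > 0" and C: "C > 0" and L: "\<And>c. c \<in> sobolev n ==> sobolev_norm n (\<lambda>x. c x - c0 x) <= p ==>
      d c0 c <= ennreal (C * sobolev_norm n (\<lambda>x. c x - c0 x))"
    using local_comparison[OF c0] by metis
  define r where "r = min s (min p (e / (3 * C)))"
  have r: "r > 0" "r <= s" "r <= p" "C * r <= e / 3"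
  proof -
    show "r > 0" "r <= s" "r <= p" using s p C e by (auto simp: r_def)
    have "C * r <= C * (e / (3 * C))" using C by (intro mult_left_mono) (auto simp: r_def)
    then show "C * r <= e / 3" using C by simp
  qed
  show ?thesis
  proof (intro exI[of _ r] conjI ballI allI impI r(1))
    fix g s1 s2 b1 b2 assume g: "g \<in> Diff n" and nm: "sobolev_norm n (\<lambda>x. g x - f x) < r"
      and s12: "0 < s1" "s1 <= r" "0 < s2" "s2 <= r"
    note im' = Diff_immersion[OF g]
    define c where "c = aff s 0 g"
    have c: "c \<in> sobolev n" unfolding c_def by (rule aff_sobolev(1)[OF n2 immersion_sobolev[OF im']])
    have "(\<lambda>x. c x - c0 x) = (\<lambda>x. s * (g x - f x))" by (auto simp: c_def c0_def aff_def algebra_simps)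
    then have "sobolev_norm n (\<lambda>x. c x - c0 x) = s * sobolev_norm n (\<lambda>x. g x - f x)"
      using sobolev_norm_cmult[OF Hk_diff_sobolev[OF immersion_sobolev[OF im'] immersion_sobolev[OF im]], of s] s(1) by simp
    also have "... <= 1 * sobolev_norm n (\<lambda>x. g x - f x)" using s(2) by (intro mult_right_mono sobolev_norm_nonneg)
    finally have cc: "sobolev_norm n (\<lambda>x. c x - c0 x) <= r" using nm by simp
    have "d c0 c <= ennreal (C * sobolev_norm n (\<lambda>x. c x - c0 x))" by (rule L[OF c]) (use cc r(3) in simp)
    also have "C * sobolev_norm n (\<lambda>x. c x - c0 x) <= C * r" using cc C by (intro mult_left_mono) auto
    also note r(4)
    finally have mid: "d c0 c <= ennreal (e / 3)" by (simp add: ennreal_leI)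
    have "d (aff s1 b1 f) (aff s2 b2 g) <= d (aff s1 b1 f) c0 + (d c0 c + d c (aff s2 b2 g))"
      by (rule dist_triangle3)
    also have "... <= ennreal (e / 3) + (ennreal (e / 3) + ennreal (e / 3))"
      by (intro add_mono mid) (unfold c0_def c_def, (rule small[OF f] small[OF g], use s12 r(2) s in auto)+)
    also have "... = ennreal e" using e by (simp add: ennreal_plus[symmetric] del: ennreal_plus)
    finally show "d (aff s1 b1 f) (aff s2 b2 g) <= ennreal e" .
  qed
qed

abbreviation shrunk :: "(real => real) => nat => real => real" where
  "shrunk f k \<equiv> aff (1 / real (Suc k)) 0 f"

lemma small_scale: "r > 0 ==> \<exists>N. \<forall>k\<ge>N. 1 / real (Suc k) <= r"
proof -
  assume "r > 0"
  then have "\<forall>\<^sub>F k in sequentially. 1 / real (Suc k) < r"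
    using lim_1_over_n[where 'a = real, THEN LIMSEQ_Suc] by (simp add: order_tendsto_iff)
  then show ?thesis unfolding eventually_sequentially by (meson less_imp_le)
qed

lemma shrunk_immersion: "f \<in> Diff n ==> shrunk f k \<in> M"
  by (rule aff_immersion(1)[OF n2 Diff_immersion]) auto

lemma shrunk_clen: "f \<in> Diff n ==> clen (shrunk f k) = 2 * pi / real (Suc k)"
  using aff_immersion(3)[OF n2 Diff_immersion, of f "1 / real (Suc k)" 0] by (simp add: Diff_iff)

lemma shrunk_cauchy:
  assumes f: "f \<in> Diff n" shows "shrunk f \<in> ecauchy M d"
  unfolding ecauchy_def
proof (intro CollectI conjI allI impI)
  fix e :: ennreal assume e: "0 < e"
  then obtain e' where e': "0 < e'" "ennreal e' < e" using ennreal_pos_below by blast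
  obtain r where r0: "r > 0" "\<forall>g\<in>Diff n. \<forall>s1 s2 b1 b2. sobolev_norm n (\<lambda>x. g x - f x) < r -->
    0 < s1 --> s1 <= r --> 0 < s2 --> s2 <= r --> d (aff s1 b1 f) (aff s2 b2 g) <= ennreal e'"
    using shrunk_close[OF f e'(1)] by blast
  note r = r0[rule_format]
  obtain N where N: "\<forall>k\<ge>N. 1 / real (Suc k) <= r" using small_scale[OF r(1)] by blast
  have "sobolev_norm n (\<lambda>x. f x - f x) < r" using r(1) sobolev_norm_zero by simp
  then have "d (shrunk f i) (shrunk f j) <= ennreal e'" if "i >= N" "j >= N" for i j
    using r(2)[OF f] N that by simp
  with e'(2) show "\<exists>N. \<forall>i\<ge>N. \<forall>j\<ge>N. d (shrunk f i) (shrunk f j) < e" by (meson le_less_trans)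
qed (rule shrunk_immersion[OF f])

lemma tendsto_Psi_clen:
  assumes "(\<lambda>k. d (x k) c) \<longlonglongrightarrow> 0"
  shows "(\<lambda>k. Psi (clen (x k))) \<longlonglongrightarrow> Psi (clen c)"
proof -
  have "(\<lambda>k. ennreal \<bar>Psi (clen c) - Psi (clen (x k))\<bar>) \<longlonglongrightarrow> 0"
  proof (rule tendsto_sandwich[OF _ _ tendsto_const])
    show "\<forall>\<^sub>F k in sequentially. ennreal \<bar>Psi (clen c) - Psi (clen (x k))\<bar> <= ennreal psi_const * d (x k) c"
      by (intro always_eventually allI Psi_length_lipschitz)
    show "(\<lambda>k. ennreal psi_const * d (x k) c) \<longlonglongrightarrow> 0" using ennreal_tendsto_cmult[OF _ assms, of "ennreal psi_const"] by simp
  qed auto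
  then have "(\<lambda>k. ennreal \<bar>Psi (clen c) - Psi (clen (x k))\<bar>) \<longlonglongrightarrow> ennreal 0" by simp
  from tendsto_ennrealD[OF this] have "(\<lambda>k. \<bar>Psi (clen c) - Psi (clen (x k))\<bar>) \<longlonglongrightarrow> 0" by simp
  then have "(\<lambda>k. Psi (clen c) - Psi (clen (x k))) \<longlonglongrightarrow> 0" by (simp add: tendsto_rabs_zero_iff)
  from tendsto_diff[OF tendsto_const[of "Psi (clen c)"] this] show ?thesis by simp
qed

lemma Psi_upper: "0 <= x ==> Psi x <= x * sqrt x"
  unfolding Psi_def by (rule ln_add_one_self_le_self) simp

text \<open>\<open>Psi\<close> of the length would tend to Psi 0 along the sequence, and by its
  Lipschitz continuity also to the larger value \<open>Psi (clen c)\<close>.\<close>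

lemma shrunk_not_convergent:
  assumes f: "f \<in> Diff n" and c: "c \<in> M" shows "\<not> (\<lambda>k. d (shrunk f k) c) \<longlonglongrightarrow> 0"
proof
  assume "(\<lambda>k. d (shrunk f k) c) \<longlonglongrightarrow> 0"
  from tendsto_Psi_clen[OF this] have 1: "(\<lambda>k. Psi (2 * pi / real (Suc k))) \<longlonglongrightarrow> Psi (clen c)" by (simp only: shrunk_clen[OF f])
  have 0: "(\<lambda>k. 2 * pi / real (Suc k)) \<longlonglongrightarrow> 0"
    using tendsto_mult_right_zero[OF lim_1_over_n[where 'a = real, THEN LIMSEQ_Suc], of "2 * pi"] by simp
  have "(\<lambda>k. Psi (2 * pi / real (Suc k))) \<longlonglongrightarrow> ln (1 + 0 * sqrt 0)"
    unfolding Psi_def by (intro tendsto_intros 0) simp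
  with 1 have "Psi (clen c) = Psi 0" using LIMSEQ_unique[OF 1] by (simp add: Psi_def)
  then show False using Psi_strict_mono[of 0 "clen c"] immersion_orient(4)[OF c] by simp
qed

text \<open>If the shrunk curves are at distance less than h, normalisation recovers p and g and is
  Lipschitz. Otherwise p and g are joined through their shrunk copies at an additional cost of 8 *
  shrink_const, which is at most a multiple of that distance. L does not depend on the scale, so the
  estimate survives its limit 0.\<close>

lemma dist_le_shrunk:
  "\<exists>L\<ge>0. \<exists>r>0. \<forall>p\<in>Diff n. \<forall>g\<in>Diff n. \<forall>s. 0 < s --> s <= r -->
    d p g <= ennreal L * d (aff s 0 p) (aff s 0 g)"
proof -
  obtain h where h: "h > 0" and nl: "\<forall>c1\<in>M. \<forall>c2\<in>M. clen c1 <= h --> d c1 c2 < ennreal h -->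
      d (nrm c1) (nrm c2) <= ennreal proj_const * d c1 c2" using normalisation_lipschitz by blast
  define L where "L = proj_const + (8 * shrink_const / h + 1)"
  have L: "L >= 0" "proj_const <= L" "8 * shrink_const / h + 1 <= L"
    using proj_const_pos shrink_const_nonneg h by (auto simp: L_def add_nonneg_nonneg)
  define r where "r = min 1 (h / (2 * pi))"
  have r: "r > 0" using h by (simp add: r_def)
  have "d p g <= ennreal L * d (aff s 0 p) (aff s 0 g)" if p: "p \<in> Diff n" and g: "g \<in> Diff n" and s: "0 < s" "s <= r" for p g s
  proof (cases "d (aff s 0 p) (aff s 0 g) < ennreal h")
    case True
    have "s * (2 * pi) <= h / (2 * pi) * (2 * pi)" using s(2) by (intro mult_right_mono) (auto simp: r_def)
    then have "clen (aff s 0 p) <= h"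
      using aff_immersion(3)[OF n2 Diff_immersion[OF p] s(1)] p by (simp add: Diff_iff)
    then have "d (nrm (aff s 0 p)) (nrm (aff s 0 g)) <= ennreal proj_const * d (aff s 0 p) (aff s 0 g)"
      using nl True aff_immersion(1)[OF n2 Diff_immersion[OF p] s(1)] aff_immersion(1)[OF n2 Diff_immersion[OF g] s(1)] by blast
    also have "... <= ennreal L * d (aff s 0 p) (aff s 0 g)" using L(2) by (intro mult_right_mono ennreal_leI) auto
    finally show ?thesis using nrm_shrunk[OF n2 p s(1)] nrm_shrunk[OF n2 g s(1)] by simp
  next
    case False
    then have ge: "ennreal h <= d (aff s 0 p) (aff s 0 g)" (is "_ <= ?D") by simp
    have s1: "s <= 1" using s(2) by (simp add: r_def)
    have one: "aff 1 0 f = f" for f by (auto simp: aff_def)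
    have b: "d z (aff s 0 z) <= ennreal (4 * shrink_const)" if z: "z \<in> Diff n" for z
    proof -
      have "d (aff 1 0 z) (aff s 0 z) <= ennreal (2 * shrink_const * (sqrt 1 + sqrt s))"
        by (rule dist_aff_le[OF z]) (use s s1 in auto)
      also have "2 * shrink_const * (sqrt 1 + sqrt s) <= 2 * shrink_const * (1 + 1)"
        using shrink_const_nonneg s1 by (intro mult_left_mono) auto
      finally show ?thesis unfolding one by (simp add: ennreal_leI mult.commute)
    qed
    have "d p g <= d p (aff s 0 p) + (?D + d (aff s 0 g) g)" by (rule dist_triangle3)
    also have "... <= ennreal (4 * shrink_const) + (?D + ennreal (4 * shrink_const))"
      using b[OF p] b[OF g] dist_commute[OF n2, of a g "aff s 0 g"] by (intro add_mono) auto
    also have "... = ennreal (8 * shrink_const / h) * ennreal h + ?D"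
      using shrink_const_nonneg h by (simp add: ennreal_mult[symmetric] ennreal_plus[symmetric] add.left_commute add.commute[of _ ?D] del: ennreal_plus)
    also have "... <= ennreal (8 * shrink_const / h) * ?D + ?D" using ge by (intro add_mono mult_left_mono) auto
    also have "... = ennreal (8 * shrink_const / h + 1) * ?D"
      using shrink_const_nonneg h by (simp add: distrib_right)
    also have "... <= ennreal L * ?D" using L(3) by (intro mult_right_mono ennreal_leI) auto
    finally show ?thesis .
  qed
  with L(1) r show ?thesis by blast
qed

lemma cauchy_shift:
  assumes x: "x \<in> ecauchy M d" shows "(\<lambda>k. x (k + N)) \<in> ecauchy M d"
  unfolding ecauchy_def
proof (intro CollectI conjI allI impI)
  show "x (k + N) \<in> M" for k using x by (simp add: ecauchy_def)
  fix e :: ennreal assume "0 < e"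
  then obtain N' where "\<forall>i\<ge>N'. \<forall>j\<ge>N'. d (x i) (x j) < e" using x unfolding ecauchy_def by blast
  then show "\<exists>N'. \<forall>i\<ge>N'. \<forall>j\<ge>N'. d (x (i + N)) (x (j + N)) < e" by (intro exI[of _ N']) simp
qed

lemma cauchy_alternative:
  assumes x: "x \<in> ecauchy M d"
  shows "(\<exists>c\<in>M. (\<lambda>k. d (x k) c) \<longlonglongrightarrow> 0) \<or> (\<exists>p\<in>Diff n. (\<lambda>k. d (x k) (shrunk p k)) \<longlonglongrightarrow> 0)"
proof -
  have xM: "x k \<in> M" for k using x by (simp add: ecauchy_def)
  have len: "clen (x k) > 0" for k by (rule immersion_orient(4)[OF xM])
  have cauchy: "\<exists>N. \<forall>i\<ge>N. \<forall>j\<ge>N. d (x i) (x j) < e" if "e > 0" for e using x that by (auto simp: ecauchy_def)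
  have "Cauchy (\<lambda>k. Psi (clen (x k)))"
    unfolding Cauchy_altdef2 dist_real_def
  proof (intro allI impI)
    fix e :: real assume e: "e > 0"
    have "ennreal (e / (2 * psi_const)) > 0" using e psi_const_pos by simp
    then obtain N where N: "\<forall>i\<ge>N. \<forall>j\<ge>N. d (x i) (x j) < ennreal (e / (2 * psi_const))" using cauchy by blast
    have "\<bar>Psi (clen (x k)) - Psi (clen (x N))\<bar> < e" if k: "k >= N" for k
    proof -
      have "ennreal \<bar>Psi (clen (x k)) - Psi (clen (x N))\<bar> <= ennreal psi_const * d (x N) (x k)" by (rule Psi_length_lipschitz)
      also have "... <= ennreal psi_const * ennreal (e / (2 * psi_const))" using N k by (intro mult_left_mono) (auto simp: less_imp_le)
      also have "... = ennreal (e / 2)" using psi_const_pos e by (simp add: ennreal_mult[symmetric])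
      finally show ?thesis using e by (simp add: ennreal_le_iff)
    qed
    then show "\<exists>N. \<forall>k\<ge>N. \<bar>Psi (clen (x k)) - Psi (clen (x N))\<bar> < e" by blast
  qed
  then obtain P where P: "(\<lambda>k. Psi (clen (x k))) \<longlonglongrightarrow> P" using Cauchy_convergent convergentD by blast
  have Ppos: "0 < Psi (clen (x k))" for k using Psi_strict_mono[OF order_refl len[of k]] by (simp add: Psi_def)
  have "0 <= P" by (rule LIMSEQ_le_const[OF P]) (use Ppos in \<open>auto intro!: less_imp_le\<close>)
  then consider "P > 0" | "P = 0" by linarith
  then show ?thesis
  proof cases
    case 1
    have "\<forall>\<^sub>F k in sequentially. P / 2 < Psi (clen (x k)) \<and> Psi (clen (x k)) < 2 * P"
      by (intro eventually_conj order_tendstoD[OF P]) (use 1 in auto)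
    then obtain N where N: "\<And>k. k >= N ==> P / 2 < Psi (clen (x k)) \<and> Psi (clen (x k)) < 2 * P" unfolding eventually_sequentially by blast
    \<comment> \<open>Psi l <= l for l <= 1 turns the lower bound for \<open>Psi\<close> into one
      for the length; from above, Psi l >= ln l for l >= 1 does the same.\<close>
    have lo: "min 1 (P / 2) <= clen (x (k + N))" for k
    proof (rule ccontr)
      let ?l = "clen (x (k + N))"
      assume "\<not> min 1 (P / 2) <= ?l"
      then have l: "?l < 1" "?l < P / 2" by auto
      have "Psi ?l <= ?l * sqrt ?l" using Psi_upper len[of "k + N"] by simp
      also have "... <= ?l * 1" using l(1) len[of "k + N"] by (intro mult_left_mono) auto
      finally show False using l(2) N[of "k + N"] by simp
    qed
    have hi: "clen (x (k + N)) <= max 1 (exp (2 * P))" for k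
    proof (rule ccontr)
      let ?l = "clen (x (k + N))"
      assume "\<not> ?l <= max 1 (exp (2 * P))"
      then have l: "?l > 1" "?l > exp (2 * P)" by auto
      have "?l * 1 <= ?l * sqrt ?l" using l(1) by (intro mult_left_mono) auto
      then have "exp (2 * P) <= 1 + ?l * sqrt ?l" using l(2) by simp
      then have "2 * P <= Psi ?l" unfolding Psi_def using ln_mono[of "exp (2 * P)" "1 + ?l * sqrt ?l"] by simp
      then show False using N[of "k + N"] by simp
    qed
    have lp: "0 < min 1 (P / 2)" using 1 by simp
    obtain F where "F \<in> M" "(\<lambda>k. d (x (k + N)) F) \<longlonglongrightarrow> 0"
      using cauchy_converges[OF cauchy_shift[OF x, of N] lp lo hi] by metis
    then show ?thesis using LIMSEQ_offset[of "\<lambda>k. d (x k) _" N 0] by blast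
  next
    case 2
    obtain b where b: "b > 0" and nl: "\<forall>c1\<in>M. \<forall>c2\<in>M. clen c1 <= b --> d c1 c2 < ennreal b -->
      d (nrm c1) (nrm c2) <= ennreal proj_const * d c1 c2" using normalisation_lipschitz by blast
    have len0: "\<exists>N. \<forall>k\<ge>N. clen (x k) < r" if r: "r > 0" for r
    proof -
      have "Psi r > 0" using Psi_strict_mono[OF order_refl r] by (simp add: Psi_def)
      then have "\<forall>\<^sub>F k in sequentially. Psi (clen (x k)) < Psi r" using order_tendstoD(2)[OF P[unfolded 2]] by simp
      then obtain N where N: "\<forall>k\<ge>N. Psi (clen (x k)) < Psi r" unfolding eventually_sequentially by blast
      then show ?thesis using Psi_mono[of r] r by (meson less_imp_le not_le)
    qed
    obtain N where N: "\<forall>k\<ge>N. clen (x k) < b" using len0[OF b] by blast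
    define z where "z k = nrm (x (k + N))" for k
    have zD: "z k \<in> Diff n" for k unfolding z_def by (rule nrm_Diff(1)[OF n2 xM])
    have zC: "z \<in> ecauchy M d"
      unfolding ecauchy_def
    proof (intro CollectI conjI allI impI)
      show "z k \<in> M" for k by (rule Diff_immersion[OF zD])
      fix e :: ennreal assume e: "0 < e"
      have "0 < min (ennreal b) (e / ennreal proj_const)" using b e proj_const_pos by (simp add: ennreal_zero_less_divide)
      then obtain N' where N': "\<forall>i\<ge>N'. \<forall>j\<ge>N'. d (x i) (x j) < min (ennreal b) (e / ennreal proj_const)" using cauchy by blast
      have "d (z i) (z j) < e" if ij: "i >= N'" "j >= N'" for i j
      proof -
        have dl: "d (x (i + N)) (x (j + N)) < min (ennreal b) (e / ennreal proj_const)" using N' ij by simp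
        have "clen (x (i + N)) <= b" using N by (simp add: less_imp_le)
        then have "d (z i) (z j) <= ennreal proj_const * d (x (i + N)) (x (j + N))"
          unfolding z_def using nl xM dl by simp
        also have "... < ennreal proj_const * (e / ennreal proj_const)"
          using dl proj_const_pos by (intro ennreal_mult_strict_left_mono) auto
        also have "... = e" using proj_const_pos by (simp add: ennreal_times_divide mult_divide_eq_ennreal mult.commute)
        finally show ?thesis .
      qed
      then show "\<exists>N. \<forall>i\<ge>N. \<forall>j\<ge>N. d (z i) (z j) < e" by blast
    qed
    have zl: "2 * pi <= clen (z k)" "clen (z k) <= 2 * pi" for k using zD[of k] by (auto simp: Diff_iff)
    have p2: "0 < 2 * pi" by simp
    obtain p where p: "p \<in> M" and l1: "(\<lambda>k. d (z k) p) \<longlonglongrightarrow> 0" and l2: "(\<lambda>k. sobolev_norm n (\<lambda>y. z k y - p y)) \<longlonglongrightarrow> 0"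
      using cauchy_converges[OF zC p2 zl] by metis
    have clz: "clen (z k) = 2 * pi" for k using zD[of k] by (simp add: Diff_iff)
    \<comment> \<open>The length passes to the limit through \<open>Psi\<close>, the value at the
      base point through evaluation. The base points agree eventually, since a finite distance
      forces equal orientation.\<close>
    have pD: "p \<in> Diff n"
      unfolding Diff_iff
    proof (intro conjI)
      have "(\<lambda>k. Psi (2 * pi)) \<longlonglongrightarrow> Psi (clen p)" using tendsto_Psi_clen[OF l1] by (simp add: clz)
      then have "Psi (2 * pi) = Psi (clen p)" by (simp add: LIMSEQ_const_iff)
      then show "clen p = 2 * pi"
        using Psi_strict_mono[of "2 * pi" "clen p"] Psi_strict_mono[of "clen p" "2 * pi"] immersion_orient(4)[OF p] by fastforce
      have "\<forall>\<^sub>F k in sequentially. d (z k) p < top" using l1 by (simp add: order_tendsto_iff)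
      then have ev: "\<forall>\<^sub>F k in sequentially. z k (basept p) = 0"
      proof eventually_elim
        case (elim k)
        then have "basept (z k) = basept p" using dist_finite_orient by (simp add: basept_def)
        then show ?case using zD[of k] by (simp add: Diff_iff)
      qed
      have "bounded_functional n (\<lambda>f. f (basept p))" by (rule evaluation_functional[OF _ basept_J]) (use n2 in auto)
      then obtain K where K: "\<forall>f. f \<in> sobolev n --> \<bar>f (basept p)\<bar> <= K * sobolev_norm n f" unfolding bounded_functional_def by blast
      have "(\<lambda>k. z k (basept p) - p (basept p)) \<longlonglongrightarrow> 0"
      proof (rule Lim_null_comparison)
        show "(\<lambda>k. K * sobolev_norm n (\<lambda>y. z k y - p y)) \<longlonglongrightarrow> 0" by (rule tendsto_mult_right_zero[OF l2])
        have "(\<lambda>y. z k y - p y) \<in> sobolev n" for k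
          using sobolev_lin(1)[OF n2 immersion_sobolev[OF Diff_immersion[OF zD[of k]]] immersion_sobolev[OF p], of 1 "-1"] by simp
        from K[rule_format, OF this]
        have "\<bar>z k (basept p) - p (basept p)\<bar> <= K * sobolev_norm n (\<lambda>y. z k y - p y)" for k .
        then show "\<forall>\<^sub>F k in sequentially. norm (z k (basept p) - p (basept p)) <= K * sobolev_norm n (\<lambda>y. z k y - p y)"
          by (intro always_eventually) simp
      qed
      then have "(\<lambda>k. - p (basept p)) \<longlonglongrightarrow> 0"
        by (rule Lim_transform_eventually) (use ev in eventually_elim, simp)
      then show "p (basept p) = 0" by (simp add: LIMSEQ_const_iff)
    qed (rule p)
    \<comment> \<open>\<open>x k\<close> is an affine image of its normalisation, with scale clen /
      (2 pi) and an uncontrolled translation. \<open>shrunk_close\<close> compares it with p / (k +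
      1) although the two scales are unrelated.\<close>
    have "(\<lambda>k. d (x k) (shrunk p k)) \<longlonglongrightarrow> 0"
      unfolding order_tendsto_iff
    proof (intro conjI allI impI)
      fix e :: ennreal assume "0 < e"
      then obtain e' where e': "0 < e'" "ennreal e' < e" using ennreal_pos_below by blast
      obtain h where h0: "h > 0" "\<forall>g\<in>Diff n. \<forall>s1 s2 b1 b2. sobolev_norm n (\<lambda>x. g x - p x) < h -->
        0 < s1 --> s1 <= h --> 0 < s2 --> s2 <= h --> d (aff s1 b1 p) (aff s2 b2 g) <= ennreal e'"
        using shrunk_close[OF pD e'(1)] by blast
      note h = h0[rule_format]
      obtain N1 where N1: "\<forall>k\<ge>N1. 1 / real (Suc k) <= h" using small_scale[OF h(1)] by blast
      have "h * (2 * pi) > 0" using h(1) by simp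
      then obtain N2 where N2: "\<forall>k\<ge>N2. clen (x k) < h * (2 * pi)" using len0 by blast
      obtain N3 where N3: "\<forall>k\<ge>N3. sobolev_norm n (\<lambda>y. z k y - p y) < h"
        using order_tendstoD(2)[OF l2 h(1)] unfolding eventually_sequentially by blast
      have "d (x k) (shrunk p k) < e" if k: "k >= max (max N1 N2) (N3 + N)" for k
      proof -
        have zk: "z (k - N) = nrm (x k)" using k by (simp add: z_def)
        have "clen (x k) / (2 * pi) <= h" using N2 k by (simp add: divide_le_eq less_imp_le)
        moreover have "N3 <= k - N" using k by linarith
        then have "sobolev_norm n (\<lambda>y. nrm (x k) y - p y) < h" using N3 unfolding zk[symmetric] by blast
        ultimately have "d (shrunk p k) (aff (clen (x k) / (2 * pi)) (x k (basept (x k))) (nrm (x k))) <= ennreal e'"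
          using N1 k len[of k] by (intro h(2) nrm_Diff(1)[OF n2 xM]) auto
        then show ?thesis using e'(2) nrm_Diff(3)[OF n2 xM[of k]] dist_commute[OF n2, of a "x k"] by simp
      qed
      then show "\<forall>\<^sub>F k in sequentially. d (x k) (shrunk p k) < e" unfolding eventually_sequentially by blast
    qed simp
    with pD show ?thesis by blast
  qed
qed

end

section \<open>The completion\<close>

sublocale immersion_metric \<subseteq> E: extended_metric "immersions n" "geodesic_dist n a"
  by unfold_locales (auto simp: dist_self[OF n2] intro: dist_commute[OF n2] dist_triangle_geodesic[OF n2])

context immersion_metric
begin

lemma is_shrinking_limit_iff:
  assumes "f \<in> Diff n" shows "is_shrinking_limit n a f p \<longleftrightarrow> p = E.point (shrunk f)"
proof -
  have "(\<lambda>m. imm_embed n a (\<lambda>x. 1 / real (Suc m) * f x)) = (\<lambda>m. ecompletion_embed M d (shrunk f m))"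
    by (simp add: imm_embed_def aff_def[abs_def])
  then show ?thesis
    unfolding is_shrinking_limit_def imm_completion_def completion_dist_def
    using E.limit_of_embedded_cauchy[OF shrunk_cauchy[OF assms]] by simp
qed

lemma shrinking_limit_eq: "f \<in> Diff n ==> shrinking_limit n a f = E.point (shrunk f)"
  unfolding shrinking_limit_def by (rule the_equality) (simp_all only: is_shrinking_limit_iff)

lemma imm_embed_eq: "imm_embed n a c = E.point (\<lambda>i. c)"
  by (simp add: imm_embed_def E.embed_eq_point)

text \<open>\<open>dist_le_shrunk\<close> holds with the same L at all small scales, so it passes to
  the limit. This is the Lipschitz bound for the inverse; injectivity and continuity of the inverse
  are derived from it as well.\<close>

lemma dist_le_completion_dist:
  "\<exists>L\<ge>0. \<forall>f\<in>Diff n. \<forall>g\<in>Diff n.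
    d f g <= ennreal L * completion_dist n a (shrinking_limit n a f) (shrinking_limit n a g)"
proof -
  obtain L r where L: "L >= 0" and r: "r > 0" and le: "\<forall>f\<in>Diff n. \<forall>g\<in>Diff n. \<forall>s. 0 < s --> s <= r -->
    d f g <= ennreal L * d (aff s 0 f) (aff s 0 g)" using dist_le_shrunk by blast
  obtain N where N: "\<forall>k\<ge>N. 1 / real (Suc k) <= r" using small_scale[OF r] by blast
  have "d f g <= ennreal L * completion_dist n a (shrinking_limit n a f) (shrinking_limit n a g)"
    if f: "f \<in> Diff n" and g: "g \<in> Diff n" for f g
  proof (rule tendsto_lowerbound)
    show "(\<lambda>k. ennreal L * d (shrunk f k) (shrunk g k)) \<longlonglongrightarrow>
        ennreal L * completion_dist n a (shrinking_limit n a f) (shrinking_limit n a g)"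
      unfolding completion_dist_def shrinking_limit_eq[OF f] shrinking_limit_eq[OF g]
      by (intro ennreal_tendsto_cmult E.dist_point shrunk_cauchy f g) simp
    show "\<forall>\<^sub>F k in sequentially. d f g <= ennreal L * d (shrunk f k) (shrunk g k)"
      unfolding eventually_sequentially using N le f g by (intro exI[of _ N]) simp
  qed simp
  with L show ?thesis by blast
qed

lemma shrinking_limit_inj: "inj_on (shrinking_limit n a) (Diff n)"
proof (rule inj_onI)
  fix f g assume f: "f \<in> Diff n" and g: "g \<in> Diff n" and eq: "shrinking_limit n a f = shrinking_limit n a g"
  obtain L where L: "\<forall>f\<in>Diff n. \<forall>g\<in>Diff n.
    d f g <= ennreal L * completion_dist n a (shrinking_limit n a f) (shrinking_limit n a g)"
    using dist_le_completion_dist by blast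
  have "completion_dist n a (shrinking_limit n a f) (shrinking_limit n a g) = 0"
    unfolding eq completion_dist_def shrinking_limit_eq[OF g]
    using E.point_completion[OF shrunk_cauchy[OF g]] by (simp add: E.completion_dist_zero_iff)
  then have "d f g = 0" using L f g by fastforce
  then show "f = g" using dist_zero_imp_eq[OF Diff_immersion[OF f] Diff_immersion[OF g]] by simp
qed

lemma shrinking_limit_not_embedded:
  assumes f: "f \<in> Diff n" and c: "c \<in> M" shows "shrinking_limit n a f \<noteq> imm_embed n a c"
  unfolding shrinking_limit_eq[OF f] imm_embed_eq E.point_eq_iff[OF shrunk_cauchy[OF f] E.ecauchy_const[OF c]]
  by (rule shrunk_not_convergent[OF f c])

lemma imm_embed_inj: "inj_on (imm_embed n a) M"
proof (rule inj_onI)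
  fix c0 c assume c: "c0 \<in> M" "c \<in> M" and eq: "imm_embed n a c0 = imm_embed n a c"
  have "(\<lambda>i::nat. d c0 c) \<longlonglongrightarrow> 0"
    using eq unfolding imm_embed_eq E.point_eq_iff[OF E.ecauchy_const[OF c(1)] E.ecauchy_const[OF c(2)]] .
  then have "d c0 c = 0" by (simp add: LIMSEQ_const_iff)
  then show "c0 = c" using dist_zero_imp_eq[OF c] by simp
qed

lemma completion_eq: "imm_completion n a = imm_embed n a ` M \<union> shrinking_limit n a ` Diff n"
proof (intro equalityI subsetI)
  fix p assume "p \<in> imm_completion n a"
  then obtain x where x: "x \<in> ecauchy M d" "p = E.point x" unfolding imm_completion_def by (rule E.completion_point)
  from cauchy_alternative[OF x(1)] show "p \<in> imm_embed n a ` M \<union> shrinking_limit n a ` Diff n"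
  proof (elim disjE bexE)
    fix c assume c: "c \<in> M" "(\<lambda>k. d (x k) c) \<longlonglongrightarrow> 0"
    then have "p = imm_embed n a c"
      unfolding x(2) imm_embed_eq E.point_eq_iff[OF x(1) E.ecauchy_const[OF c(1)]] by simp
    with c(1) show ?thesis by blast
  next
    fix f assume p: "f \<in> Diff n" "(\<lambda>k. d (x k) (shrunk f k)) \<longlonglongrightarrow> 0"
    then have "p = shrinking_limit n a f"
      unfolding x(2) shrinking_limit_eq[OF p(1)] E.point_eq_iff[OF x(1) shrunk_cauchy[OF p(1)]] by simp
    with p(1) show ?thesis by blast
  qed
next
  fix p assume "p \<in> imm_embed n a ` M \<union> shrinking_limit n a ` Diff n"
  then show "p \<in> imm_completion n a"
    by (auto simp: imm_completion_def imm_embed_eq shrinking_limit_eq simp del: of_nat_Suc intro!: E.point_completion E.ecauchy_const shrunk_cauchy)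
qed

lemma limit_points_eq: "limit_points n a = shrinking_limit n a ` Diff n"
  unfolding limit_points_def completion_eq using shrinking_limit_not_embedded by blast

text \<open>Continuity is \<open>shrunk_close\<close> passed to the limit. For the inverse, the
  completion distance bounds \<open>d f g\<close>, and near f the latter bounds the H^n norm of the
  difference.\<close>

lemma shrinking_limit_homeomorphic:
  "homeomorphic_map (Diff_topology n) (emetric_topology (limit_points n a) (completion_dist n a)) (shrinking_limit n a)"
  unfolding Diff_topology_def
proof (rule homeomorphic_map_emetric_topology)
  show "bij_betw (shrinking_limit n a) (Diff n) (limit_points n a)"
    unfolding limit_points_eq by (rule inj_on_imp_bij_betw[OF shrinking_limit_inj])
next
  fix f and e :: ennreal assume f: "f \<in> Diff n" and "e > 0"
  then obtain e' where e': "0 < e'" "ennreal e' < e" using ennreal_pos_below by blast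
  obtain r where r0: "r > 0" "\<forall>g\<in>Diff n. \<forall>s1 s2 b1 b2. sobolev_norm n (\<lambda>x. g x - f x) < r -->
    0 < s1 --> s1 <= r --> 0 < s2 --> s2 <= r --> d (aff s1 b1 f) (aff s2 b2 g) <= ennreal e'"
    using shrunk_close[OF f e'(1)] by blast
  note r = r0[rule_format]
  obtain N where N: "\<forall>k\<ge>N. 1 / real (Suc k) <= r" using small_scale[OF r(1)] by blast
  have "completion_dist n a (shrinking_limit n a f) (shrinking_limit n a g) < e"
    if g: "g \<in> Diff n" and l: "ennreal (sobolev_norm n (\<lambda>y. f y - g y)) < ennreal r" for g
  proof -
    note s = sobolev_Hk[OF immersion_sobolev[OF Diff_immersion]]
    have nm: "sobolev_norm n (\<lambda>y. g y - f y) < r"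
      using l sobolev_norm_minus_commute[OF s[OF f] s[OF g]] by (simp add: ennreal_less_iff sobolev_norm_nonneg)
    have "completion_dist n a (shrinking_limit n a f) (shrinking_limit n a g) <= ennreal e'"
      unfolding completion_dist_def shrinking_limit_eq[OF f] shrinking_limit_eq[OF g]
    proof (rule tendsto_upperbound[OF E.dist_point[OF shrunk_cauchy[OF f] shrunk_cauchy[OF g]]])
      show "\<forall>\<^sub>F k in sequentially. d (shrunk f k) (shrunk g k) <= ennreal e'"
        unfolding eventually_sequentially using r(2)[OF g nm] N by (intro exI[of _ N]) simp
    qed simp
    then show ?thesis using e'(2) by simp
  qed
  with r(1) show "\<exists>r>0. \<forall>g\<in>Diff n. ennreal (sobolev_norm n (\<lambda>y. f y - g y)) < r -->
      completion_dist n a (shrinking_limit n a f) (shrinking_limit n a g) < e"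
    by (intro exI[of _ "ennreal r"]) auto
next
  fix f and e :: ennreal assume f: "f \<in> Diff n" and "e > 0"
  then obtain e' where e': "0 < e'" "ennreal e' < e" using ennreal_pos_below by blast
  obtain L where L: "L >= 0" "\<forall>f\<in>Diff n. \<forall>g\<in>Diff n.
    d f g <= ennreal L * completion_dist n a (shrinking_limit n a f) (shrinking_limit n a g)"
    using dist_le_completion_dist by blast
  note im = Diff_immersion[OF f]
  obtain p C where p: "p > 0" and C: "C > 0"
    and loc: "\<And>c. c \<in> M ==> d f c < ennreal p ==> ennreal (sobolev_norm n (\<lambda>x. c x - f x)) <= ennreal C * d f c"
    using local_comparison[OF im] by metis
  \<comment> \<open>The first entry brings \<open>d f g\<close> below the radius p of local
    comparison, the second brings the norm to at most e'.\<close>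
  define r where "r = min (p / (2 * (L + 1))) (e' / (C * (L + 1)))"
  have r: "r > 0" using p C L(1) e' by (simp add: r_def)
  have "(L + 1) * r <= (L + 1) * (p / (2 * (L + 1)))" using L(1) by (intro mult_left_mono) (auto simp: r_def)
  moreover have "(L + 1) * (p / (2 * (L + 1))) = p / 2" using L(1) by (simp add: field_simps)
  ultimately have d1: "(L + 1) * r < p" using p by linarith
  have "C * (L + 1) * r <= C * (L + 1) * (e' / (C * (L + 1)))" using L(1) C by (intro mult_left_mono) (auto simp: r_def)
  moreover have "C * (L + 1) * (e' / (C * (L + 1))) = e'" using L(1) C by simp
  ultimately have d2: "C * (L + 1) * r <= e'" by linarith
  have "ennreal (sobolev_norm n (\<lambda>y. f y - g y)) < e"
    if g: "g \<in> Diff n" and l: "completion_dist n a (shrinking_limit n a f) (shrinking_limit n a g) < ennreal r" for g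
  proof -
    have "d f g <= ennreal L * completion_dist n a (shrinking_limit n a f) (shrinking_limit n a g)" using L(2) f g by blast
    also have "... <= ennreal (L + 1) * ennreal r" using l L(1) by (intro mult_mono ennreal_leI) auto
    also have "... = ennreal ((L + 1) * r)" using L(1) by (simp add: ennreal_mult')
    finally have dd: "d f g <= ennreal ((L + 1) * r)" .
    also have "... < ennreal p" using d1 p by (simp add: ennreal_lessI)
    finally have "ennreal (sobolev_norm n (\<lambda>x. g x - f x)) <= ennreal C * d f g" by (rule loc[OF Diff_immersion[OF g]])
    also have "... <= ennreal C * ennreal ((L + 1) * r)" using dd by (intro mult_left_mono) auto
    also have "... = ennreal (C * (L + 1) * r)" using C by (simp add: ennreal_mult' mult.assoc)
    also have "... <= ennreal e'" using d2 by (rule ennreal_leI)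
    finally show ?thesis
      using e'(2) sobolev_norm_minus_commute[OF sobolev_Hk[OF immersion_sobolev[OF im]] sobolev_Hk[OF immersion_sobolev[OF Diff_immersion[OF g]]]]
      by (simp add: le_less_trans)
  qed
  with r show "\<exists>r>0. \<forall>g\<in>Diff n. completion_dist n a (shrinking_limit n a f) (shrinking_limit n a g) < r -->
      ennreal (sobolev_norm n (\<lambda>y. f y - g y)) < e"
    by (intro exI[of _ "ennreal r"]) auto
qed

lemma completion_bijection:
  "bij_betw (case_sum (imm_embed n a) (shrinking_limit n a)) (M <+> Diff n) (imm_completion n a)"
  unfolding bij_betw_def
proof (intro conjI inj_onI)
  fix u v assume u: "u \<in> M <+> Diff n" and v: "v \<in> M <+> Diff n"
    and eq: "case_sum (imm_embed n a) (shrinking_limit n a) u = case_sum (imm_embed n a) (shrinking_limit n a) v"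
  show "u = v"
  proof (cases u; cases v)
    fix c c' assume "u = Inl c" "v = Inl c'"
    then show ?thesis using u v eq inj_onD[OF imm_embed_inj] by auto
  next
    fix c g assume "u = Inl c" "v = Inr g"
    then show ?thesis using u v eq shrinking_limit_not_embedded[of g c] by auto
  next
    fix f c assume "u = Inr f" "v = Inl c"
    then show ?thesis using u v eq shrinking_limit_not_embedded[of f c] by auto
  next
    fix f g assume "u = Inr f" "v = Inr g"
    then show ?thesis using u v eq inj_onD[OF shrinking_limit_inj] by auto
  qed
qed (force simp: completion_eq Plus_def image_Un image_image)

end

theorem theorem1p2:
  fixes n :: nat and a :: "nat \<Rightarrow> real"
  assumes "n \<ge> 2"
    and "\<And>i. i \<le> n \<Longrightarrow> a i \<ge> 0"
    and "a 0 > 0" and "a 2 > 0" and "a n > 0"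
  shows "(\<forall>\<phi>\<in>Diff n. (\<exists>!p. is_shrinking_limit n a \<phi> p) \<and>
                      shrinking_limit n a \<phi> \<in> limit_points n a)
    \<and> homeomorphic_map (Diff_topology n)
        (emetric_topology (limit_points n a) (completion_dist n a))
        (shrinking_limit n a)
    \<and> bij_betw (case_sum (imm_embed n a) (shrinking_limit n a))
        (immersions n <+> Diff n) (imm_completion n a)
    \<and> (\<exists>L\<ge>0. \<forall>p\<in>limit_points n a. \<forall>q\<in>limit_points n a.
          geodesic_dist n a (inv_into (Diff n) (shrinking_limit n a) p)
                            (inv_into (Diff n) (shrinking_limit n a) q)
            \<le> ennreal L * completion_dist n a p q)"
proof -
  interpret immersion_metric n a by unfold_locales (use assms in auto)
  show ?thesis
  proof (intro conjI ballI)
    show "\<exists>!p. is_shrinking_limit n a \<phi> p" if "\<phi> \<in> Diff n" for \<phi>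
      using is_shrinking_limit_iff[OF that] by simp
    show "shrinking_limit n a \<phi> \<in> limit_points n a" if "\<phi> \<in> Diff n" for \<phi>
      unfolding limit_points_eq using that by blast
    obtain L where L: "L \<ge> 0" "\<forall>\<phi>\<in>Diff n. \<forall>\<psi>\<in>Diff n.
      d \<phi> \<psi> \<le> ennreal L * completion_dist n a (shrinking_limit n a \<phi>) (shrinking_limit n a \<psi>)"
      using dist_le_completion_dist by blast
    have "d (inv_into (Diff n) (shrinking_limit n a) p) (inv_into (Diff n) (shrinking_limit n a) q)
        \<le> ennreal L * completion_dist n a p q" if "p \<in> limit_points n a" "q \<in> limit_points n a" for p q
      using that L(2) unfolding limit_points_eq by (auto simp: inv_into_f_f[OF shrinking_limit_inj])
    with L(1) show "\<exists>L\<ge>0. \<forall>p\<in>limit_points n a. \<forall>q\<in>limit_points n a.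
        d (inv_into (Diff n) (shrinking_limit n a) p) (inv_into (Diff n) (shrinking_limit n a) q)
          \<le> ennreal L * completion_dist n a p q" by blast
  qed (rule shrinking_limit_homeomorphic completion_bijection)+
qed

end
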